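(* Let $A$ be a commutative 2-ring, and $U:\mathrm{Cog}(A)\to A$ the forgetful functor. Then the natural transformation $\pi_1(\mathrm{Cog}(A))\to\pi_1(A)$ defined for each small groupoid $G$ by $$\pi_1(\mathrm{Cog}(A))(G)=\mathrm{Hom}_{\mathrm{Com2Ring}}({}^G\mathrm{Set},\mathrm{Cog}(A))\xrightarrow{\;U_*\;}\mathrm{Hom}_{\mathrm{Com2Ring}}({}^G\mathrm{Set},A)=\pi_1(A)(G)$$ gives an equivalence $\pi_1(\mathrm{Cog}(A))\simeq\pi_1(A)$. Likewise, restricting to finite groupoids $G$, it gives an equivalence $\pi_1^f(\mathrm{Cog}(A))\simeq\pi_1^f(A)$.
   Context: Presentable category: a locally small cocomplete category that is the closure under small colimits of a small set of little objects ($x$ is little if, for some cardinal $\kappa$, $\mathrm{Hom}(x,-)$ preserves $\kappa$-directed colimits). A commutative 2-ring is a presentable symmetric monoidal category whose tensor product preserves small colimits in each variable; 1-morphisms are cocontinuous (strong) symmetric monoidal functors and 2-morphisms are monoidal natural transformations; these form the 2-category $\mathrm{Com2Ring}$. ${}^G\mathrm{Set}=\mathrm{Fun}(G,\mathrm{Set})$ is a commutative 2-ring with $\otimes=\times$. $\mathrm{Cog}(A)$ is the category of cocommutative (coassociative, counital) coalgebras in $A$ with the tensor product of coalgebras (which is the categorical product in $\mathrm{Cog}(A)$); it is a commutative 2-ring and $U$ is a 1-morphism of commutative 2-rings. $\pi_1(A)$ is the 2-functor from small groupoids to (locally small) categories $G\mapsto\mathrm{Hom}_{A\text{-Com2Alg}}(\mathrm{Fun}(G,A),A)$,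 identified, via the natural equivalence, with $G\mapsto\mathrm{Hom}_{\mathrm{Com2Ring}}({}^G\mathrm{Set},A)$; $\pi_1^f(A)$ is defined by the same formula on finite groupoids. *)

theory Defs
  imports "HOL-Library.FuncSet" "HOL-Library.Equipollence"
begin

section \<open>Smallness\<close>

text \<open>A type \<open>'u\<close> plays the role of the universe: a set (of any type) is small if it
  has fewer elements than \<open>'u\<close>.  The cardinality of \<open>'u\<close> is required to be infinite, regular and
  a strong limit, which is what a Grothendieck universe provides; the least such cardinality gives
  the universe of hereditarily finite sets, all larger ones are the inaccessible cardinals.\<close>

definition small :: "'u itself \<Rightarrow> 'a set \<Rightarrow> bool" where
  "small U X \<longleftrightarrow> X \<prec> (UNIV :: 'u set)"

definition universe :: "'u itself \<Rightarrow> bool" where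
  "universe U \<longleftrightarrow> infinite (UNIV :: 'u set) \<and>
     (\<forall>X :: 'u set. small U X \<longrightarrow> small U (Pow X)) \<and>
     (\<forall>(I :: 'u set) (X :: 'u \<Rightarrow> 'u set). small U I \<and> (\<forall>i\<in>I. small U (X i)) \<longrightarrow> small U (\<Union>i\<in>I. X i))"


section \<open>Categories, functors, natural transformations\<close>

record ('o, 'm) cat =
  obj :: "'o set"
  arr :: "'m set"
  src :: "'m \<Rightarrow> 'o"
  tgt :: "'m \<Rightarrow> 'o"
  idn :: "'o \<Rightarrow> 'm"
  cmp :: "'m \<Rightarrow> 'm \<Rightarrow> 'm"  (infixl "\<cdot>\<index>" 55)

definition hom :: "('o, 'm, 'z) cat_scheme \<Rightarrow> 'o \<Rightarrow> 'o \<Rightarrow> 'm set" where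
  "hom C a b = {f \<in> arr C. src C f = a \<and> tgt C f = b}"

locale category =
  fixes C :: "('o, 'm, 'z) cat_scheme" (structure)
  assumes src_obj: "f \<in> arr C \<Longrightarrow> src C f \<in> obj C"
    and tgt_obj: "f \<in> arr C \<Longrightarrow> tgt C f \<in> obj C"
    and idn_hom: "a \<in> obj C \<Longrightarrow> idn C a \<in> hom C a a"
    and cmp_hom: "\<lbrakk>f \<in> hom C a b; g \<in> hom C b c\<rbrakk> \<Longrightarrow> g \<cdot> f \<in> hom C a c"
    and cmp_idn: "f \<in> hom C a b \<Longrightarrow> f \<cdot> idn C a = f"
    and idn_cmp: "f \<in> hom C a b \<Longrightarrow> idn C b \<cdot> f = f"
    and cmp_assoc: "\<lbrakk>f \<in> hom C a b; g \<in> hom C b c; h \<in> hom C c d\<rbrakk> \<Longrightarrow> h \<cdot> g \<cdot> f = h \<cdot> (g \<cdot> f)"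

definition inverse_arrows :: "('o, 'm, 'z) cat_scheme \<Rightarrow> 'm \<Rightarrow> 'm \<Rightarrow> bool" where
  "inverse_arrows C f g \<longleftrightarrow> f \<in> arr C \<and> g \<in> hom C (tgt C f) (src C f) \<and>
     g \<cdot>\<^bsub>C\<^esub> f = idn C (src C f) \<and> f \<cdot>\<^bsub>C\<^esub> g = idn C (tgt C f)"

definition iso_arr :: "('o, 'm, 'z) cat_scheme \<Rightarrow> 'm \<Rightarrow> bool" where
  "iso_arr C f \<longleftrightarrow> (\<exists>g. inverse_arrows C f g)"

definition inv_arr :: "('o, 'm, 'z) cat_scheme \<Rightarrow> 'm \<Rightarrow> 'm" where
  "inv_arr C f = (THE g. inverse_arrows C f g)"

definition groupoid :: "('o, 'm, 'z) cat_scheme \<Rightarrow> bool" where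
  "groupoid C \<longleftrightarrow> category C \<and> (\<forall>f\<in>arr C. iso_arr C f)"

text \<open>Functors and natural transformations are extensional (undefined outside the objects and
  arrows of their source), so that equality of records is equality of functors.\<close>

record ('o, 'm, 'p, 'n) func =
  fobj :: "'o \<Rightarrow> 'p"
  farr :: "'m \<Rightarrow> 'n"

definition is_functor ::
  "('o, 'm, 'y) cat_scheme \<Rightarrow> ('p, 'n, 'z) cat_scheme \<Rightarrow> ('o, 'm, 'p, 'n, 'x) func_scheme \<Rightarrow> bool" where
  "is_functor C D F \<longleftrightarrow> category C \<and> category D \<and>
     fobj F \<in> obj C \<rightarrow>\<^sub>E obj D \<and> farr F \<in> arr C \<rightarrow>\<^sub>E arr D \<and>
     (\<forall>f\<in>arr C. farr F f \<in> hom D (fobj F (src C f)) (fobj F (tgt C f))) \<and>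
     (\<forall>a\<in>obj C. farr F (idn C a) = idn D (fobj F a)) \<and>
     (\<forall>f\<in>arr C. \<forall>g\<in>arr C. tgt C f = src C g \<longrightarrow> farr F (g \<cdot>\<^bsub>C\<^esub> f) = farr F g \<cdot>\<^bsub>D\<^esub> farr F f)"

definition id_func :: "('o, 'm, 'z) cat_scheme \<Rightarrow> ('o, 'm, 'o, 'm) func" where
  "id_func C = \<lparr>fobj = \<lambda>x\<in>obj C. x, farr = \<lambda>f\<in>arr C. f\<rparr>"

text \<open>\<open>comp_func C G F\<close> is \<open>G\<close> after \<open>F\<close>, where \<open>C\<close> is the source of \<open>F\<close>; similarly for the other
  operations below that carry the source category as an argument.\<close>

definition comp_func ::
  "('o, 'm, 'z) cat_scheme \<Rightarrow> ('p, 'n, 'q, 'k, 'x) func_scheme \<Rightarrow> ('o, 'm, 'p, 'n, 'y) func_scheme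
    \<Rightarrow> ('o, 'm, 'q, 'k) func" where
  "comp_func C G F = \<lparr>fobj = \<lambda>x\<in>obj C. fobj G (fobj F x), farr = \<lambda>f\<in>arr C. farr G (farr F f)\<rparr>"

definition is_nat ::
  "('o, 'm, 'y) cat_scheme \<Rightarrow> ('p, 'n, 'z) cat_scheme \<Rightarrow> ('o, 'm, 'p, 'n, 'v) func_scheme
    \<Rightarrow> ('o, 'm, 'p, 'n, 'w) func_scheme \<Rightarrow> ('o \<Rightarrow> 'n) \<Rightarrow> bool" where
  "is_nat C D F G t \<longleftrightarrow> is_functor C D F \<and> is_functor C D G \<and> t \<in> extensional (obj C) \<and>
     (\<forall>x\<in>obj C. t x \<in> hom D (fobj F x) (fobj G x)) \<and>
     (\<forall>f\<in>arr C. t (tgt C f) \<cdot>\<^bsub>D\<^esub> farr F f = farr G f \<cdot>\<^bsub>D\<^esub> t (src C f))"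

definition id_nat ::
  "('o, 'm, 'y) cat_scheme \<Rightarrow> ('p, 'n, 'z) cat_scheme \<Rightarrow> ('o, 'm, 'p, 'n, 'v) func_scheme \<Rightarrow> 'o \<Rightarrow> 'n" where
  "id_nat C D F = (\<lambda>x\<in>obj C. idn D (fobj F x))"

definition vcomp ::
  "('o, 'm, 'y) cat_scheme \<Rightarrow> ('p, 'n, 'z) cat_scheme \<Rightarrow> ('o \<Rightarrow> 'n) \<Rightarrow> ('o \<Rightarrow> 'n) \<Rightarrow> 'o \<Rightarrow> 'n" where
  "vcomp C D t s = (\<lambda>x\<in>obj C. t x \<cdot>\<^bsub>D\<^esub> s x)"

text \<open>The horizontal composite of \<open>s : F \<Rightarrow> F'\<close> and \<open>t : G \<Rightarrow> G'\<close>, where \<open>F, F'\<close> start at \<open>C\<close> and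
  \<open>G, G'\<close> end at \<open>E\<close>.\<close>

definition hcomp ::
  "('o, 'm, 'y) cat_scheme \<Rightarrow> ('q, 'k, 'z) cat_scheme \<Rightarrow> ('p, 'n, 'q, 'k, 'v) func_scheme
    \<Rightarrow> ('o, 'm, 'p, 'n, 'w) func_scheme \<Rightarrow> ('p \<Rightarrow> 'k) \<Rightarrow> ('o \<Rightarrow> 'n) \<Rightarrow> 'o \<Rightarrow> 'k" where
  "hcomp C E G F' t s = (\<lambda>x\<in>obj C. t (fobj F' x) \<cdot>\<^bsub>E\<^esub> farr G (s x))"


section \<open>The category of small sets\<close>

type_synonym 'w set_arr = "'w set \<times> ('w \<Rightarrow> 'w) \<times> 'w set"

text \<open>The element type \<open>'w\<close> need not be \<open>'u\<close>; whenever it is at least as large as \<open>'u\<close>, this category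
  contains a copy of every small set.\<close>

definition set_cat :: "'u itself \<Rightarrow> ('w set, 'w set_arr) cat" where
  "set_cat U = \<lparr>
     obj = {X. small U X},
     arr = {(X, h, Y). small U X \<and> small U Y \<and> h \<in> X \<rightarrow>\<^sub>E Y},
     src = (\<lambda>(X, h, Y). X),
     tgt = (\<lambda>(X, h, Y). Y),
     idn = (\<lambda>X. (X, \<lambda>x\<in>X. x, X)),
     cmp = (\<lambda>(_, k, Z) (X, h, _). (X, compose X k h, Z))\<rparr>"


section \<open>Colimits and presentable categories\<close>

definition is_cocone ::
  "('i, 'j, 'x) cat_scheme \<Rightarrow> ('o, 'm, 'y) cat_scheme \<Rightarrow> ('i, 'j, 'o, 'm, 'z) func_scheme
    \<Rightarrow> 'o \<Rightarrow> ('i \<Rightarrow> 'm) \<Rightarrow> bool" where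
  "is_cocone J C D c l \<longleftrightarrow> is_functor J C D \<and> c \<in> obj C \<and> (\<forall>i\<in>obj J. l i \<in> hom C (fobj D i) c) \<and>
     (\<forall>f\<in>arr J. l (tgt J f) \<cdot>\<^bsub>C\<^esub> farr D f = l (src J f))"

definition is_colimit ::
  "('i, 'j, 'x) cat_scheme \<Rightarrow> ('o, 'm, 'y) cat_scheme \<Rightarrow> ('i, 'j, 'o, 'm, 'z) func_scheme
    \<Rightarrow> 'o \<Rightarrow> ('i \<Rightarrow> 'm) \<Rightarrow> bool" where
  "is_colimit J C D c l \<longleftrightarrow> is_cocone J C D c l \<and>
     (\<forall>d k. is_cocone J C D d k \<longrightarrow> (\<exists>!h. h \<in> hom C c d \<and> (\<forall>i\<in>obj J. h \<cdot>\<^bsub>C\<^esub> l i = k i)))"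

text \<open>Every small category is isomorphic to one whose objects and arrows are elements of \<open>'u\<close>.\<close>

definition small_category :: "('u, 'u) cat \<Rightarrow> bool" where
  "small_category J \<longleftrightarrow> category J \<and> small TYPE('u) (obj J) \<and> small TYPE('u) (arr J)"

definition cocomplete :: "'u itself \<Rightarrow> ('o, 'm, 'z) cat_scheme \<Rightarrow> bool" where
  "cocomplete U C \<longleftrightarrow> category C \<and>
     (\<forall>(J :: ('u, 'u) cat) (D :: ('u, 'u, 'o, 'm) func).
        small_category J \<and> is_functor J C D \<longrightarrow> (\<exists>c l. is_colimit J C D c l))"

definition locally_small :: "'u itself \<Rightarrow> ('o, 'm, 'z) cat_scheme \<Rightarrow> bool" where
  "locally_small U C \<longleftrightarrow> category C \<and> (\<forall>a\<in>obj C. \<forall>b\<in>obj C. small U (hom C a b))"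

definition preserves_colimits ::
  "('i, 'j) cat \<Rightarrow> ('o, 'm, 'y) cat_scheme \<Rightarrow> ('p, 'n, 'z) cat_scheme
    \<Rightarrow> ('o, 'm, 'p, 'n, 'x) func_scheme \<Rightarrow> bool" where
  "preserves_colimits J C E F \<longleftrightarrow> (\<forall>(D :: ('i, 'j, 'o, 'm) func) c l. is_colimit J C D c l \<longrightarrow>
     is_colimit J E (comp_func J F D) (fobj F c) (\<lambda>i. farr F (l i)))"

definition cocontinuous ::
  "'u itself \<Rightarrow> ('o, 'm, 'y) cat_scheme \<Rightarrow> ('p, 'n, 'z) cat_scheme
    \<Rightarrow> ('o, 'm, 'p, 'n, 'x) func_scheme \<Rightarrow> bool" where
  "cocontinuous U C E F \<longleftrightarrow> is_functor C E F \<and>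
     (\<forall>J :: ('u, 'u) cat. small_category J \<longrightarrow> preserves_colimits J C E F)"

text \<open>The functor \<open>Hom(x,-)\<close>.  Its values are tagged copies of hom-sets in the type \<open>'m + 'u\<close>, because
  the type \<open>'m\<close> of arrows alone may have too few elements for all small sets.\<close>

definition hom_functor ::
  "'u itself \<Rightarrow> ('o, 'm, 'z) cat_scheme \<Rightarrow> 'o \<Rightarrow> ('o, 'm, ('m + 'u) set, ('m + 'u) set_arr) func" where
  "hom_functor U C x = \<lparr>
     fobj = \<lambda>y\<in>obj C. Inl ` hom C x y,
     farr = \<lambda>f\<in>arr C. (Inl ` hom C x (src C f),
                       \<lambda>p\<in>Inl ` hom C x (src C f). Inl (f \<cdot>\<^bsub>C\<^esub> projl p),
                       Inl ` hom C x (tgt C f))\<rparr>"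

text \<open>Directed posets, regarded as categories; \<open>\<kappa>\<close> is the cardinality of \<open>K\<close>.\<close>

definition directed_poset :: "'u set \<Rightarrow> ('i, 'j) cat \<Rightarrow> bool" where
  "directed_poset K J \<longleftrightarrow> category J \<and>
     (\<forall>f\<in>arr J. \<forall>g\<in>arr J. src J f = src J g \<and> tgt J f = tgt J g \<longrightarrow> f = g) \<and>
     (\<forall>f\<in>arr J. \<forall>g\<in>arr J. src J f = tgt J g \<and> tgt J f = src J g \<longrightarrow> src J f = tgt J f) \<and>
     (\<forall>X \<subseteq> obj J. X \<prec> K \<longrightarrow> (\<exists>u\<in>obj J. \<forall>x\<in>X. hom J x u \<noteq> {}))"

definition little :: "'u itself \<Rightarrow> ('o, 'm, 'z) cat_scheme \<Rightarrow> 'o \<Rightarrow> bool" where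
  "little U C x \<longleftrightarrow> x \<in> obj C \<and>
     (\<exists>K :: 'u set. small U K \<and>
        (\<forall>J :: ('u, 'u) cat. small_category J \<and> directed_poset K J \<longrightarrow>
           preserves_colimits J C (set_cat U) (hom_functor U C x)))"

definition presentable :: "'u itself \<Rightarrow> ('o, 'm, 'z) cat_scheme \<Rightarrow> bool" where
  "presentable U C \<longleftrightarrow> locally_small U C \<and> cocomplete U C \<and>
     (\<exists>S \<subseteq> obj C. small U S \<and> (\<forall>x\<in>S. little U C x) \<and>
        (\<forall>T. S \<subseteq> T \<and> T \<subseteq> obj C \<and>
           (\<forall>(J :: ('u, 'u) cat) (D :: ('u, 'u, 'o, 'm) func) c l.
              small_category J \<and> is_colimit J C D c l \<and> fobj D ` obj J \<subseteq> T \<longrightarrow> c \<in> T)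
           \<longrightarrow> T = obj C))"


section \<open>Symmetric monoidal categories and commutative 2-rings\<close>

record ('o, 'm) smc = "('o, 'm) cat" +
  tob :: "'o \<Rightarrow> 'o \<Rightarrow> 'o"  (infixr "\<odot>\<index>" 65)
  tar :: "'m \<Rightarrow> 'm \<Rightarrow> 'm"  (infixr "\<otimes>\<index>" 65)
  tunit :: "'o"
  associator :: "'o \<Rightarrow> 'o \<Rightarrow> 'o \<Rightarrow> 'm"
  lunitor :: "'o \<Rightarrow> 'm"
  runitor :: "'o \<Rightarrow> 'm"
  braiding :: "'o \<Rightarrow> 'o \<Rightarrow> 'm"

locale symmetric_monoidal = category A for A :: "('o, 'm, 'z) smc_scheme" (structure) +
  assumes tob_obj: "\<lbrakk>a \<in> obj A; b \<in> obj A\<rbrakk> \<Longrightarrow> a \<odot> b \<in> obj A"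
    and tar_hom: "\<lbrakk>f \<in> hom A a a'; g \<in> hom A b b'\<rbrakk> \<Longrightarrow> f \<otimes> g \<in> hom A (a \<odot> b) (a' \<odot> b')"
    and tar_idn: "\<lbrakk>a \<in> obj A; b \<in> obj A\<rbrakk> \<Longrightarrow> idn A a \<otimes> idn A b = idn A (a \<odot> b)"
    and tar_cmp: "\<lbrakk>f \<in> hom A a a'; f' \<in> hom A a' a''; g \<in> hom A b b'; g' \<in> hom A b' b''\<rbrakk>
      \<Longrightarrow> (f' \<cdot> f) \<otimes> (g' \<cdot> g) = (f' \<otimes> g') \<cdot> (f \<otimes> g)"
    and tunit_obj: "tunit A \<in> obj A"
    and associator_hom: "\<lbrakk>a \<in> obj A; b \<in> obj A; c \<in> obj A\<rbrakk>
      \<Longrightarrow> associator A a b c \<in> hom A ((a \<odot> b) \<odot> c) (a \<odot> (b \<odot> c))"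
    and associator_iso: "\<lbrakk>a \<in> obj A; b \<in> obj A; c \<in> obj A\<rbrakk> \<Longrightarrow> iso_arr A (associator A a b c)"
    and associator_nat: "\<lbrakk>f \<in> hom A a a'; g \<in> hom A b b'; h \<in> hom A c c'\<rbrakk>
      \<Longrightarrow> associator A a' b' c' \<cdot> ((f \<otimes> g) \<otimes> h) = (f \<otimes> (g \<otimes> h)) \<cdot> associator A a b c"
    and lunitor_hom: "a \<in> obj A \<Longrightarrow> lunitor A a \<in> hom A (tunit A \<odot> a) a"
    and lunitor_iso: "a \<in> obj A \<Longrightarrow> iso_arr A (lunitor A a)"
    and lunitor_nat: "f \<in> hom A a a' \<Longrightarrow> lunitor A a' \<cdot> (idn A (tunit A) \<otimes> f) = f \<cdot> lunitor A a"
    and runitor_hom: "a \<in> obj A \<Longrightarrow> runitor A a \<in> hom A (a \<odot> tunit A) a"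
    and runitor_iso: "a \<in> obj A \<Longrightarrow> iso_arr A (runitor A a)"
    and runitor_nat: "f \<in> hom A a a' \<Longrightarrow> runitor A a' \<cdot> (f \<otimes> idn A (tunit A)) = f \<cdot> runitor A a"
    and braiding_hom: "\<lbrakk>a \<in> obj A; b \<in> obj A\<rbrakk> \<Longrightarrow> braiding A a b \<in> hom A (a \<odot> b) (b \<odot> a)"
    and braiding_nat: "\<lbrakk>f \<in> hom A a a'; g \<in> hom A b b'\<rbrakk>
      \<Longrightarrow> braiding A a' b' \<cdot> (f \<otimes> g) = (g \<otimes> f) \<cdot> braiding A a b"
    and braiding_sym: "\<lbrakk>a \<in> obj A; b \<in> obj A\<rbrakk> \<Longrightarrow> braiding A b a \<cdot> braiding A a b = idn A (a \<odot> b)"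
    and pentagon: "\<lbrakk>a \<in> obj A; b \<in> obj A; c \<in> obj A; d \<in> obj A\<rbrakk> \<Longrightarrow>
        (idn A a \<otimes> associator A b c d) \<cdot> associator A a (b \<odot> c) d \<cdot> (associator A a b c \<otimes> idn A d)
        = associator A a b (c \<odot> d) \<cdot> associator A (a \<odot> b) c d"
    and triangle: "\<lbrakk>a \<in> obj A; b \<in> obj A\<rbrakk> \<Longrightarrow>
        (idn A a \<otimes> lunitor A b) \<cdot> associator A a (tunit A) b = runitor A a \<otimes> idn A b"
    and hexagon: "\<lbrakk>a \<in> obj A; b \<in> obj A; c \<in> obj A\<rbrakk> \<Longrightarrow>
        associator A b c a \<cdot> braiding A a (b \<odot> c) \<cdot> associator A a b c
        = (idn A b \<otimes> braiding A a c) \<cdot> associator A b a c \<cdot> (braiding A a b \<otimes> idn A c)"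

definition tensor_left :: "('o, 'm, 'z) smc_scheme \<Rightarrow> 'o \<Rightarrow> ('o, 'm, 'o, 'm) func" where
  "tensor_left A a = \<lparr>fobj = \<lambda>x\<in>obj A. a \<odot>\<^bsub>A\<^esub> x, farr = \<lambda>f\<in>arr A. idn A a \<otimes>\<^bsub>A\<^esub> f\<rparr>"

definition tensor_right :: "('o, 'm, 'z) smc_scheme \<Rightarrow> 'o \<Rightarrow> ('o, 'm, 'o, 'm) func" where
  "tensor_right A a = \<lparr>fobj = \<lambda>x\<in>obj A. x \<odot>\<^bsub>A\<^esub> a, farr = \<lambda>f\<in>arr A. f \<otimes>\<^bsub>A\<^esub> idn A a\<rparr>"

definition commutative_2_ring :: "'u itself \<Rightarrow> ('o, 'm, 'z) smc_scheme \<Rightarrow> bool" where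
  "commutative_2_ring U A \<longleftrightarrow> presentable U A \<and> symmetric_monoidal A \<and>
     (\<forall>a\<in>obj A. cocontinuous U A A (tensor_left A a) \<and> cocontinuous U A A (tensor_right A a))"

text \<open>Strong symmetric monoidal functors; the structure maps are
  \<open>mu F (a, b) : F a \<otimes> F b \<rightarrow> F (a \<otimes> b)\<close> and \<open>eta F : I \<rightarrow> F I\<close>.\<close>

record ('o, 'm, 'p, 'n) smfun = "('o, 'm, 'p, 'n) func" +
  mu :: "'o \<times> 'o \<Rightarrow> 'n"
  eta :: "'n"

definition sm_functor ::
  "('o, 'm) smc \<Rightarrow> ('p, 'n) smc \<Rightarrow> ('o, 'm, 'p, 'n) smfun \<Rightarrow> bool" where
  "sm_functor R S F \<longleftrightarrow> is_functor R S F \<and>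
     mu F \<in> extensional (obj R \<times> obj R) \<and>
     (\<forall>a\<in>obj R. \<forall>b\<in>obj R.
        mu F (a, b) \<in> hom S (fobj F a \<odot>\<^bsub>S\<^esub> fobj F b) (fobj F (a \<odot>\<^bsub>R\<^esub> b)) \<and> iso_arr S (mu F (a, b))) \<and>
     eta F \<in> hom S (tunit S) (fobj F (tunit R)) \<and> iso_arr S (eta F) \<and>
     (\<forall>f\<in>arr R. \<forall>g\<in>arr R.
        mu F (tgt R f, tgt R g) \<cdot>\<^bsub>S\<^esub> (farr F f \<otimes>\<^bsub>S\<^esub> farr F g)
        = farr F (f \<otimes>\<^bsub>R\<^esub> g) \<cdot>\<^bsub>S\<^esub> mu F (src R f, src R g)) \<and>
     (\<forall>a\<in>obj R. \<forall>b\<in>obj R. \<forall>c\<in>obj R.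
        farr F (associator R a b c) \<cdot>\<^bsub>S\<^esub> mu F (a \<odot>\<^bsub>R\<^esub> b, c) \<cdot>\<^bsub>S\<^esub> (mu F (a, b) \<otimes>\<^bsub>S\<^esub> idn S (fobj F c))
        = mu F (a, b \<odot>\<^bsub>R\<^esub> c) \<cdot>\<^bsub>S\<^esub> (idn S (fobj F a) \<otimes>\<^bsub>S\<^esub> mu F (b, c))
            \<cdot>\<^bsub>S\<^esub> associator S (fobj F a) (fobj F b) (fobj F c)) \<and>
     (\<forall>a\<in>obj R.
        farr F (lunitor R a) \<cdot>\<^bsub>S\<^esub> mu F (tunit R, a) \<cdot>\<^bsub>S\<^esub> (eta F \<otimes>\<^bsub>S\<^esub> idn S (fobj F a))
        = lunitor S (fobj F a)) \<and>
     (\<forall>a\<in>obj R.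
        farr F (runitor R a) \<cdot>\<^bsub>S\<^esub> mu F (a, tunit R) \<cdot>\<^bsub>S\<^esub> (idn S (fobj F a) \<otimes>\<^bsub>S\<^esub> eta F)
        = runitor S (fobj F a)) \<and>
     (\<forall>a\<in>obj R. \<forall>b\<in>obj R.
        farr F (braiding R a b) \<cdot>\<^bsub>S\<^esub> mu F (a, b) = mu F (b, a) \<cdot>\<^bsub>S\<^esub> braiding S (fobj F a) (fobj F b))"

definition comp_smfun ::
  "('o, 'm) smc \<Rightarrow> ('q, 'k) smc \<Rightarrow> ('p, 'n, 'q, 'k) smfun \<Rightarrow> ('o, 'm, 'p, 'n) smfun
    \<Rightarrow> ('o, 'm, 'q, 'k) smfun" where
  "comp_smfun R T G F = \<lparr>
     fobj = \<lambda>x\<in>obj R. fobj G (fobj F x),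
     farr = \<lambda>f\<in>arr R. farr G (farr F f),
     mu = \<lambda>(a, b)\<in>obj R \<times> obj R. farr G (mu F (a, b)) \<cdot>\<^bsub>T\<^esub> mu G (fobj F a, fobj F b),
     eta = farr G (eta F) \<cdot>\<^bsub>T\<^esub> eta G\<rparr>"

definition is_monoidal_nat ::
  "('o, 'm) smc \<Rightarrow> ('p, 'n) smc \<Rightarrow> ('o, 'm, 'p, 'n) smfun \<Rightarrow> ('o, 'm, 'p, 'n) smfun
    \<Rightarrow> ('o \<Rightarrow> 'n) \<Rightarrow> bool" where
  "is_monoidal_nat R S F G t \<longleftrightarrow> is_nat R S F G t \<and>
     (\<forall>a\<in>obj R. \<forall>b\<in>obj R. t (a \<odot>\<^bsub>R\<^esub> b) \<cdot>\<^bsub>S\<^esub> mu F (a, b) = mu G (a, b) \<cdot>\<^bsub>S\<^esub> (t a \<otimes>\<^bsub>S\<^esub> t b)) \<and>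
     t (tunit R) \<cdot>\<^bsub>S\<^esub> eta F = eta G"

type_synonym ('o, 'm, 'p, 'n) smnat =
  "('o, 'm, 'p, 'n) smfun \<times> ('o \<Rightarrow> 'n) \<times> ('o, 'm, 'p, 'n) smfun"

definition com2ring_hom ::
  "'u itself \<Rightarrow> ('o, 'm) smc \<Rightarrow> ('p, 'n) smc
    \<Rightarrow> (('o, 'm, 'p, 'n) smfun, ('o, 'm, 'p, 'n) smnat) cat" where
  "com2ring_hom U R S =
     (let Ob = {F. sm_functor R S F \<and> cocontinuous U R S F} in \<lparr>
     obj = Ob,
     arr = {(F, t, G). F \<in> Ob \<and> G \<in> Ob \<and> is_monoidal_nat R S F G t},
     src = (\<lambda>(F, t, G). F),
     tgt = (\<lambda>(F, t, G). G),
     idn = (\<lambda>F. (F, id_nat R S F, F)),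
     cmp = (\<lambda>(_, t, H) (F, s, _). (F, vcomp R S t s, H))\<rparr>)"

definition precompose ::
  "'u itself \<Rightarrow> ('o, 'm) smc \<Rightarrow> ('p, 'n) smc \<Rightarrow> ('q, 'k) smc \<Rightarrow> ('o, 'm, 'p, 'n) smfun
    \<Rightarrow> (('p, 'n, 'q, 'k) smfun, ('p, 'n, 'q, 'k) smnat, ('o, 'm, 'q, 'k) smfun, ('o, 'm, 'q, 'k) smnat) func" where
  "precompose U R' R S K = \<lparr>
     fobj = \<lambda>F\<in>obj (com2ring_hom U R S). comp_smfun R' S F K,
     farr = \<lambda>(F, t, G)\<in>arr (com2ring_hom U R S).
              (comp_smfun R' S F K, \<lambda>x\<in>obj R'. t (fobj K x), comp_smfun R' S G K)\<rparr>"

definition postcompose ::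
  "'u itself \<Rightarrow> ('o, 'm) smc \<Rightarrow> ('p, 'n) smc \<Rightarrow> ('q, 'k) smc \<Rightarrow> ('p, 'n, 'q, 'k) smfun
    \<Rightarrow> (('o, 'm, 'p, 'n) smfun, ('o, 'm, 'p, 'n) smnat, ('o, 'm, 'q, 'k) smfun, ('o, 'm, 'q, 'k) smnat) func" where
  "postcompose U R S S' L = \<lparr>
     fobj = \<lambda>F\<in>obj (com2ring_hom U R S). comp_smfun R S' L F,
     farr = \<lambda>(F, t, G)\<in>arr (com2ring_hom U R S).
              (comp_smfun R S' L F, \<lambda>x\<in>obj R. farr L (t x), comp_smfun R S' L G)\<rparr>"


section \<open>Cocommutative coalgebras\<close>

record ('o, 'm) coalg =
  carrier :: "'o"
  comult :: "'m"
  counit :: "'m"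

type_synonym ('o, 'm) coalg_arr = "('o, 'm) coalg \<times> 'm \<times> ('o, 'm) coalg"

definition is_coalg :: "('o, 'm) smc \<Rightarrow> ('o, 'm) coalg \<Rightarrow> bool" where
  "is_coalg A x \<longleftrightarrow> (let c = carrier x; d = comult x; e = counit x in
     c \<in> obj A \<and> d \<in> hom A c (c \<odot>\<^bsub>A\<^esub> c) \<and> e \<in> hom A c (tunit A) \<and>
     associator A c c c \<cdot>\<^bsub>A\<^esub> (d \<otimes>\<^bsub>A\<^esub> idn A c) \<cdot>\<^bsub>A\<^esub> d = (idn A c \<otimes>\<^bsub>A\<^esub> d) \<cdot>\<^bsub>A\<^esub> d \<and>
     lunitor A c \<cdot>\<^bsub>A\<^esub> (e \<otimes>\<^bsub>A\<^esub> idn A c) \<cdot>\<^bsub>A\<^esub> d = idn A c \<and>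
     runitor A c \<cdot>\<^bsub>A\<^esub> (idn A c \<otimes>\<^bsub>A\<^esub> e) \<cdot>\<^bsub>A\<^esub> d = idn A c \<and>
     braiding A c c \<cdot>\<^bsub>A\<^esub> d = d)"

definition is_coalg_arr :: "('o, 'm) smc \<Rightarrow> ('o, 'm) coalg \<Rightarrow> 'm \<Rightarrow> ('o, 'm) coalg \<Rightarrow> bool" where
  "is_coalg_arr A x f y \<longleftrightarrow> is_coalg A x \<and> is_coalg A y \<and> f \<in> hom A (carrier x) (carrier y) \<and>
     (f \<otimes>\<^bsub>A\<^esub> f) \<cdot>\<^bsub>A\<^esub> comult x = comult y \<cdot>\<^bsub>A\<^esub> f \<and> counit y \<cdot>\<^bsub>A\<^esub> f = counit x"

text \<open>The interchange \<open>(a \<otimes> a) \<otimes> (b \<otimes> b) \<rightarrow> (a \<otimes> b) \<otimes> (a \<otimes> b)\<close> of the two middle factors.\<close>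

definition middle_swap :: "('o, 'm) smc \<Rightarrow> 'o \<Rightarrow> 'o \<Rightarrow> 'm" where
  "middle_swap A a b =
     inv_arr A (associator A a b (a \<odot>\<^bsub>A\<^esub> b)) \<cdot>\<^bsub>A\<^esub>
     (idn A a \<otimes>\<^bsub>A\<^esub>
       (associator A b a b \<cdot>\<^bsub>A\<^esub> (braiding A a b \<otimes>\<^bsub>A\<^esub> idn A b) \<cdot>\<^bsub>A\<^esub> inv_arr A (associator A a b b))) \<cdot>\<^bsub>A\<^esub>
     associator A a a (b \<odot>\<^bsub>A\<^esub> b)"

definition tensor_coalg ::
  "('o, 'm) smc \<Rightarrow> ('o, 'm) coalg \<Rightarrow> ('o, 'm) coalg \<Rightarrow> ('o, 'm) coalg" where
  "tensor_coalg A x y = \<lparr>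
     carrier = carrier x \<odot>\<^bsub>A\<^esub> carrier y,
     comult = middle_swap A (carrier x) (carrier y) \<cdot>\<^bsub>A\<^esub> (comult x \<otimes>\<^bsub>A\<^esub> comult y),
     counit = lunitor A (tunit A) \<cdot>\<^bsub>A\<^esub> (counit x \<otimes>\<^bsub>A\<^esub> counit y)\<rparr>"

definition unit_coalg :: "('o, 'm) smc \<Rightarrow> ('o, 'm) coalg" where
  "unit_coalg A = \<lparr>
     carrier = tunit A, comult = inv_arr A (lunitor A (tunit A)), counit = idn A (tunit A)\<rparr>"

definition Cog :: "('o, 'm) smc \<Rightarrow> (('o, 'm) coalg, ('o, 'm) coalg_arr) smc" where
  "Cog A = \<lparr>
     obj = {x. is_coalg A x},
     arr = {(x, f, y). is_coalg_arr A x f y},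
     src = (\<lambda>(x, f, y). x),
     tgt = (\<lambda>(x, f, y). y),
     idn = (\<lambda>x. (x, idn A (carrier x), x)),
     cmp = (\<lambda>(_, g, z) (x, f, _). (x, g \<cdot>\<^bsub>A\<^esub> f, z)),
     tob = tensor_coalg A,
     tar = (\<lambda>(x, f, x') (y, g, y'). (tensor_coalg A x y, f \<otimes>\<^bsub>A\<^esub> g, tensor_coalg A x' y')),
     tunit = unit_coalg A,
     associator = (\<lambda>x y z. (tensor_coalg A (tensor_coalg A x y) z,
        associator A (carrier x) (carrier y) (carrier z),
        tensor_coalg A x (tensor_coalg A y z))),
     lunitor = (\<lambda>x. (tensor_coalg A (unit_coalg A) x, lunitor A (carrier x), x)),
     runitor = (\<lambda>x. (tensor_coalg A x (unit_coalg A), runitor A (carrier x), x)),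
     braiding = (\<lambda>x y.
       (tensor_coalg A x y, braiding A (carrier x) (carrier y), tensor_coalg A y x))\<rparr>"

definition forgetful ::
  "('o, 'm) smc \<Rightarrow> (('o, 'm) coalg, ('o, 'm) coalg_arr, 'o, 'm) smfun" where
  "forgetful A = \<lparr>
     fobj = \<lambda>x\<in>obj (Cog A). carrier x,
     farr = \<lambda>(x, f, y)\<in>arr (Cog A). f,
     mu = \<lambda>(x, y)\<in>obj (Cog A) \<times> obj (Cog A). idn A (carrier x \<odot>\<^bsub>A\<^esub> carrier y),
     eta = idn A (tunit A)\<rparr>"


section \<open>Small sets as a cartesian symmetric monoidal category; functor categories\<close>

text \<open>A chosen injection \<open>'u \<times> 'u \<rightarrow> 'u\<close> (which exists for infinite \<open>'u\<close>) makes \<open>X \<times> Y\<close> a set of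
  elements of \<open>'u\<close>.\<close>

definition pr :: "'u \<Rightarrow> 'u \<Rightarrow> 'u" where
  "pr = curry (SOME p. inj p)"

definition unpr :: "'u \<Rightarrow> 'u \<times> 'u" where
  "unpr = inv (case_prod pr)"

abbreviation "pr1 p \<equiv> fst (unpr p)"
abbreviation "pr2 p \<equiv> snd (unpr p)"

definition set_prod :: "'u set \<Rightarrow> 'u set \<Rightarrow> 'u set" where
  "set_prod X Y = case_prod pr ` (X \<times> Y)"

definition set_one :: "'u set" where
  "set_one = {undefined}"

definition set_arr :: "'u set \<Rightarrow> ('u \<Rightarrow> 'u) \<Rightarrow> 'u set \<Rightarrow> 'u set_arr" where
  "set_arr X h Y = (X, restrict h X, Y)"

definition set_smc :: "('u set, 'u set_arr) smc" where
  "set_smc = (let S = set_cat TYPE('u) in \<lparr>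
     obj = obj S, arr = arr S, src = src S, tgt = tgt S, idn = idn S, cmp = cmp S,
     tob = set_prod,
     tar = (\<lambda>(X, h, X') (Y, k, Y').
       set_arr (set_prod X Y) (\<lambda>p. pr (h (pr1 p)) (k (pr2 p))) (set_prod X' Y')),
     tunit = set_one,
     associator = (\<lambda>X Y Z. set_arr (set_prod (set_prod X Y) Z)
       (\<lambda>p. pr (pr1 (pr1 p)) (pr (pr2 (pr1 p)) (pr2 p))) (set_prod X (set_prod Y Z))),
     lunitor = (\<lambda>X. set_arr (set_prod set_one X) pr2 X),
     runitor = (\<lambda>X. set_arr (set_prod X set_one) pr1 X),
     braiding = (\<lambda>X Y. set_arr (set_prod X Y) (\<lambda>p. pr (pr2 p) (pr1 p)) (set_prod Y X))\<rparr>)"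

type_synonym ('g, 'h, 'o, 'm) fun_arr =
  "('g, 'h, 'o, 'm) func \<times> ('g \<Rightarrow> 'm) \<times> ('g, 'h, 'o, 'm) func"

definition pointwise_tensor ::
  "('g, 'h) cat \<Rightarrow> ('o, 'm) smc \<Rightarrow> ('g, 'h, 'o, 'm) func \<Rightarrow> ('g, 'h, 'o, 'm) func
    \<Rightarrow> ('g, 'h, 'o, 'm) func" where
  "pointwise_tensor G C X Y = \<lparr>
     fobj = \<lambda>x\<in>obj G. fobj X x \<odot>\<^bsub>C\<^esub> fobj Y x,
     farr = \<lambda>f\<in>arr G. farr X f \<otimes>\<^bsub>C\<^esub> farr Y f\<rparr>"

definition constant_unit :: "('g, 'h) cat \<Rightarrow> ('o, 'm) smc \<Rightarrow> ('g, 'h, 'o, 'm) func" where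
  "constant_unit G C = \<lparr>fobj = \<lambda>x\<in>obj G. tunit C, farr = \<lambda>f\<in>arr G. idn C (tunit C)\<rparr>"

definition Fun :: "('g, 'h) cat \<Rightarrow> ('o, 'm) smc \<Rightarrow> (('g, 'h, 'o, 'm) func, ('g, 'h, 'o, 'm) fun_arr) smc" where
  "Fun G C = (let T = pointwise_tensor G C; I = constant_unit G C in \<lparr>
     obj = {X. is_functor G C X},
     arr = {(X, t, Y). is_nat G C X Y t},
     src = (\<lambda>(X, t, Y). X),
     tgt = (\<lambda>(X, t, Y). Y),
     idn = (\<lambda>X. (X, id_nat G C X, X)),
     cmp = (\<lambda>(_, t, Z) (X, s, _). (X, vcomp G C t s, Z)),
     tob = T,
     tar = (\<lambda>(X, s, X') (Y, t, Y'). (T X Y, \<lambda>x\<in>obj G. s x \<otimes>\<^bsub>C\<^esub> t x, T X' Y')),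
     tunit = I,
     associator = (\<lambda>X Y Z. (T (T X Y) Z,
        \<lambda>x\<in>obj G. associator C (fobj X x) (fobj Y x) (fobj Z x), T X (T Y Z))),
     lunitor = (\<lambda>X. (T I X, \<lambda>x\<in>obj G. lunitor C (fobj X x), X)),
     runitor = (\<lambda>X. (T X I, \<lambda>x\<in>obj G. runitor C (fobj X x), X)),
     braiding = (\<lambda>X Y. (T X Y, \<lambda>x\<in>obj G. braiding C (fobj X x) (fobj Y x), T Y X))\<rparr>)"

type_synonym 'u gset = "('u, 'u, 'u set, 'u set_arr) func"
type_synonym 'u gset_arr = "('u, 'u, 'u set, 'u set_arr) fun_arr"

definition GSet :: "('u, 'u) cat \<Rightarrow> ('u gset, 'u gset_arr) smc" where
  "GSet G = Fun G set_smc"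

text \<open>Restriction \<open>f\<^sup>*\<close> along \<open>f : G \<rightarrow> H\<close>; it preserves the pointwise tensor product strictly.\<close>

definition restriction ::
  "('u, 'u) cat \<Rightarrow> ('u, 'u) cat \<Rightarrow> ('u, 'u, 'u, 'u) func
    \<Rightarrow> ('u gset, 'u gset_arr, 'u gset, 'u gset_arr) smfun" where
  "restriction G H f = \<lparr>
     fobj = \<lambda>X\<in>obj (GSet H). comp_func G X f,
     farr = \<lambda>(X, t, Y)\<in>arr (GSet H). (comp_func G X f, \<lambda>g\<in>obj G. t (fobj f g), comp_func G Y f),
     mu = \<lambda>(X, Y)\<in>obj (GSet H) \<times> obj (GSet H). idn (GSet G) (comp_func G X f \<odot>\<^bsub>GSet G\<^esub> comp_func G Y f),
     eta = idn (GSet G) (tunit (GSet G))\<rparr>"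


section \<open>2-functors from groupoids to categories\<close>

definition small_groupoids :: "('u, 'u) cat set" where
  "small_groupoids = {G. groupoid G \<and> small_category G}"

definition finite_groupoids :: "('u, 'u) cat set" where
  "finite_groupoids = {G. groupoid G \<and> finite (obj G) \<and> finite (arr G)}"

record ('u, 'o, 'm) two_functor =
  on0 :: "('u, 'u) cat \<Rightarrow> ('o, 'm) cat"
  on1 :: "('u, 'u) cat \<Rightarrow> ('u, 'u) cat \<Rightarrow> ('u, 'u, 'u, 'u) func \<Rightarrow> ('o, 'm, 'o, 'm) func"
  on2 :: "('u, 'u) cat \<Rightarrow> ('u, 'u) cat \<Rightarrow> ('u, 'u, 'u, 'u) func \<Rightarrow> ('u, 'u, 'u, 'u) func
           \<Rightarrow> ('u \<Rightarrow> 'u) \<Rightarrow> 'o \<Rightarrow> 'm"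

text \<open>\<open>\<G>\<close> stands for the full sub-2-category, on the given set of objects, of the 2-category of
  categories, functors and natural transformations.\<close>

definition is_two_functor :: "('u, 'u) cat set \<Rightarrow> ('u, 'o, 'm) two_functor \<Rightarrow> bool" where
  "is_two_functor \<G> P \<longleftrightarrow>
     (\<forall>G\<in>\<G>. category (on0 P G)) \<and>
     (\<forall>G\<in>\<G>. \<forall>H\<in>\<G>. \<forall>f. is_functor G H f \<longrightarrow> is_functor (on0 P G) (on0 P H) (on1 P G H f)) \<and>
     (\<forall>G\<in>\<G>. on1 P G G (id_func G) = id_func (on0 P G)) \<and>
     (\<forall>G\<in>\<G>. \<forall>H\<in>\<G>. \<forall>K\<in>\<G>. \<forall>f g. is_functor G H f \<and> is_functor H K g \<longrightarrow>
        on1 P G K (comp_func G g f) = comp_func (on0 P G) (on1 P H K g) (on1 P G H f)) \<and>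
     (\<forall>G\<in>\<G>. \<forall>H\<in>\<G>. \<forall>f f' \<alpha>. is_nat G H f f' \<alpha> \<longrightarrow>
        is_nat (on0 P G) (on0 P H) (on1 P G H f) (on1 P G H f') (on2 P G H f f' \<alpha>)) \<and>
     (\<forall>G\<in>\<G>. \<forall>H\<in>\<G>. \<forall>f. is_functor G H f \<longrightarrow>
        on2 P G H f f (id_nat G H f) = id_nat (on0 P G) (on0 P H) (on1 P G H f)) \<and>
     (\<forall>G\<in>\<G>. \<forall>H\<in>\<G>. \<forall>f f' f'' \<alpha> \<beta>. is_nat G H f f' \<alpha> \<and> is_nat G H f' f'' \<beta> \<longrightarrow>
        on2 P G H f f'' (vcomp G H \<beta> \<alpha>)
        = vcomp (on0 P G) (on0 P H) (on2 P G H f' f'' \<beta>) (on2 P G H f f' \<alpha>)) \<and>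
     (\<forall>G\<in>\<G>. \<forall>H\<in>\<G>. \<forall>K\<in>\<G>. \<forall>f f' g g' \<alpha> \<beta>. is_nat G H f f' \<alpha> \<and> is_nat H K g g' \<beta> \<longrightarrow>
        on2 P G K (comp_func G g f) (comp_func G g' f') (hcomp G K g f' \<beta> \<alpha>)
        = hcomp (on0 P G) (on0 P K) (on1 P H K g) (on1 P G H f') (on2 P H K g g' \<beta>) (on2 P G H f f' \<alpha>))"

text \<open>The component of a pseudonatural transformation \<open>t : P \<Rightarrow> Q\<close> at \<open>f : G \<rightarrow> H\<close> is a natural
  isomorphism \<open>Q f \<circ> t G \<Rightarrow> t H \<circ> P f\<close>.\<close>

record ('u, 'o, 'm, 'p, 'n) pseudonat =
  at0 :: "('u, 'u) cat \<Rightarrow> ('o, 'm, 'p, 'n) func"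
  at1 :: "('u, 'u) cat \<Rightarrow> ('u, 'u) cat \<Rightarrow> ('u, 'u, 'u, 'u) func \<Rightarrow> 'o \<Rightarrow> 'n"

definition is_pseudonat ::
  "('u, 'u) cat set \<Rightarrow> ('u, 'o, 'm) two_functor \<Rightarrow> ('u, 'p, 'n) two_functor
    \<Rightarrow> ('u, 'o, 'm, 'p, 'n) pseudonat \<Rightarrow> bool" where
  "is_pseudonat \<G> P Q t \<longleftrightarrow>
     (\<forall>G\<in>\<G>. is_functor (on0 P G) (on0 Q G) (at0 t G)) \<and>
     (\<forall>G\<in>\<G>. \<forall>H\<in>\<G>. \<forall>f. is_functor G H f \<longrightarrow>
        is_nat (on0 P G) (on0 Q H)
          (comp_func (on0 P G) (on1 Q G H f) (at0 t G)) (comp_func (on0 P G) (at0 t H) (on1 P G H f))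
          (at1 t G H f) \<and>
        (\<forall>x\<in>obj (on0 P G). iso_arr (on0 Q H) (at1 t G H f x))) \<and>
     (\<forall>G\<in>\<G>. \<forall>H\<in>\<G>. \<forall>f f' \<alpha>. is_nat G H f f' \<alpha> \<longrightarrow>
        (\<forall>x\<in>obj (on0 P G).
           at1 t G H f' x \<cdot>\<^bsub>on0 Q H\<^esub> on2 Q G H f f' \<alpha> (fobj (at0 t G) x)
           = farr (at0 t H) (on2 P G H f f' \<alpha> x) \<cdot>\<^bsub>on0 Q H\<^esub> at1 t G H f x)) \<and>
     (\<forall>G\<in>\<G>. \<forall>x\<in>obj (on0 P G). at1 t G G (id_func G) x = idn (on0 Q G) (fobj (at0 t G) x)) \<and>
     (\<forall>G\<in>\<G>. \<forall>H\<in>\<G>. \<forall>K\<in>\<G>. \<forall>f g. is_functor G H f \<and> is_functor H K g \<longrightarrow>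
        (\<forall>x\<in>obj (on0 P G).
           at1 t G K (comp_func G g f) x
           = at1 t H K g (fobj (on1 P G H f) x) \<cdot>\<^bsub>on0 Q K\<^esub> farr (on1 Q H K g) (at1 t G H f x)))"

definition id_pseudonat :: "('u, 'o, 'm) two_functor \<Rightarrow> ('u, 'o, 'm, 'o, 'm) pseudonat" where
  "id_pseudonat P = \<lparr>
     at0 = \<lambda>G. id_func (on0 P G),
     at1 = \<lambda>G H f. id_nat (on0 P G) (on0 P H) (on1 P G H f)\<rparr>"

definition comp_pseudonat ::
  "('u, 'o, 'm) two_functor \<Rightarrow> ('u, 'q, 'k) two_functor \<Rightarrow> ('u, 'p, 'n, 'q, 'k) pseudonat
    \<Rightarrow> ('u, 'o, 'm, 'p, 'n) pseudonat \<Rightarrow> ('u, 'o, 'm, 'q, 'k) pseudonat" where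
  "comp_pseudonat P S s t = \<lparr>
     at0 = \<lambda>G. comp_func (on0 P G) (at0 s G) (at0 t G),
     at1 = \<lambda>G H f. \<lambda>x\<in>obj (on0 P G).
       farr (at0 s H) (at1 t G H f x) \<cdot>\<^bsub>on0 S H\<^esub> at1 s G H f (fobj (at0 t G) x)\<rparr>"

definition is_invertible_modification ::
  "('u, 'u) cat set \<Rightarrow> ('u, 'o, 'm) two_functor \<Rightarrow> ('u, 'p, 'n) two_functor
    \<Rightarrow> ('u, 'o, 'm, 'p, 'n) pseudonat \<Rightarrow> ('u, 'o, 'm, 'p, 'n) pseudonat
    \<Rightarrow> (('u, 'u) cat \<Rightarrow> 'o \<Rightarrow> 'n) \<Rightarrow> bool" where
  "is_invertible_modification \<G> P Q s t m \<longleftrightarrow>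
     (\<forall>G\<in>\<G>. is_nat (on0 P G) (on0 Q G) (at0 s G) (at0 t G) (m G) \<and>
        (\<forall>x\<in>obj (on0 P G). iso_arr (on0 Q G) (m G x))) \<and>
     (\<forall>G\<in>\<G>. \<forall>H\<in>\<G>. \<forall>f. is_functor G H f \<longrightarrow>
        (\<forall>x\<in>obj (on0 P G).
           at1 t G H f x \<cdot>\<^bsub>on0 Q H\<^esub> farr (on1 Q G H f) (m G x)
           = m H (fobj (on1 P G H f) x) \<cdot>\<^bsub>on0 Q H\<^esub> at1 s G H f x))"

text \<open>\<open>t\<close> is an equivalence in the 2-category of 2-functors, pseudonatural transformations and
  modifications.\<close>

definition is_equivalence ::
  "('u, 'u) cat set \<Rightarrow> ('u, 'o, 'm) two_functor \<Rightarrow> ('u, 'p, 'n) two_functor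
    \<Rightarrow> ('u, 'o, 'm, 'p, 'n) pseudonat \<Rightarrow> bool" where
  "is_equivalence \<G> P Q t \<longleftrightarrow> is_two_functor \<G> P \<and> is_two_functor \<G> Q \<and> is_pseudonat \<G> P Q t \<and>
     (\<exists>s. is_pseudonat \<G> Q P s \<and>
        (\<exists>m. is_invertible_modification \<G> P P (comp_pseudonat P P s t) (id_pseudonat P) m) \<and>
        (\<exists>m. is_invertible_modification \<G> Q Q (comp_pseudonat Q Q t s) (id_pseudonat Q) m))"


section \<open>The fundamental groupoid 2-functor\<close>

text \<open>On a 2-cell \<open>\<alpha> : f \<Rightarrow> f'\<close> between functors \<open>G \<rightarrow> H\<close>, the component at \<open>F : GSet G \<rightarrow> A\<close> is the
  transformation \<open>F \<circ> f\<^sup>* \<Rightarrow> F \<circ> f'\<^sup>*\<close> obtained by applying \<open>F\<close> to \<open>X \<circ> \<alpha> : X \<circ> f \<Rightarrow> X \<circ> f'\<close>.\<close>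

definition pi1 ::
  "('o, 'm) smc
    \<Rightarrow> ('u, ('u gset, 'u gset_arr, 'o, 'm) smfun, ('u gset, 'u gset_arr, 'o, 'm) smnat) two_functor" where
  "pi1 A = \<lparr>
     on0 = \<lambda>G. com2ring_hom TYPE('u) (GSet G) A,
     on1 = \<lambda>G H f. precompose TYPE('u) (GSet H) (GSet G) A (restriction G H f),
     on2 = \<lambda>G H f f' \<alpha>. \<lambda>F\<in>obj (com2ring_hom TYPE('u) (GSet G) A).
       (comp_smfun (GSet H) A F (restriction G H f),
        \<lambda>X\<in>obj (GSet H). farr F (comp_func G X f, \<lambda>g\<in>obj G. farr X (\<alpha> g), comp_func G X f'),
        comp_smfun (GSet H) A F (restriction G H f'))\<rparr>"

text \<open>Postcomposition with the forgetful functor commutes strictly with precomposition, so the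
  components at 1-cells are identities.\<close>

definition pi1_forgetful ::
  "('o, 'm) smc \<Rightarrow>
    ('u, ('u gset, 'u gset_arr, ('o, 'm) coalg, ('o, 'm) coalg_arr) smfun,
         ('u gset, 'u gset_arr, ('o, 'm) coalg, ('o, 'm) coalg_arr) smnat,
         ('u gset, 'u gset_arr, 'o, 'm) smfun,
         ('u gset, 'u gset_arr, 'o, 'm) smnat) pseudonat" where
  "pi1_forgetful A = (let t = (\<lambda>G. postcompose TYPE('u) (GSet G) (Cog A) A (forgetful A)) in \<lparr>
     at0 = t,
     at1 = \<lambda>G H f. id_nat (on0 (pi1 (Cog A)) G) (on0 (pi1 A) H)
             (comp_func (on0 (pi1 (Cog A)) G) (on1 (pi1 A) G H f) (t G))\<rparr>)"

end

theory Submission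
  imports Defs
begin

text \<open>Why the corollary holds.  In \<open>GSet G\<close> the tensor product is the categorical product, so every
  object \<open>X\<close> is a cocommutative coalgebra, by its diagonal \<open>X \<rightarrow> X \<times> X\<close> and its map \<open>X \<rightarrow> 1\<close>, and every
  map is a map of coalgebras.  A strong monoidal functor \<open>F : GSet G \<rightarrow> A\<close> carries this structure to
  \<open>F X\<close>: the comultiplication is \<open>F X \<rightarrow> F (X \<times> X) \<cong> F X \<otimes> F X\<close>, the counit is \<open>F X \<rightarrow> F 1 \<cong> I\<close>.  This lifts
  \<open>F\<close> to a monoidal functor into \<open>Cog A\<close> (\<open>lift_sm_functor\<close>) whose composite with \<open>U\<close> is \<open>F\<close> itself.  The
  point of the construction is that the structure isomorphisms \<open>F X \<otimes> F Y \<cong> F (X \<times> Y)\<close> are coalgebra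
  maps, which says that \<open>F\<close> respects the interchange of the middle factors of a fourfold product
  (\<open>m_swap\<close>).

  Conversely let \<open>H : GSet G \<rightarrow> Cog A\<close> be monoidal.  Its value \<open>H X\<close> has a comultiplication of its own and
  one that comes from the diagonal of \<open>X\<close>.  They have the same counit, and the second is a map of
  coalgebras for the first, so the Eckmann-Hilton argument identifies them (\<open>lift_obj_unique\<close>).  Hence
  \<open>H\<close> is the lift of \<open>U \<circ> H\<close>, an equality and not only an isomorphism (\<open>lift_forgetful\<close>).  A monoidal
  transformation respects the data from which the lifted structures are built, so all its components
  are coalgebra maps (\<open>monoidal_nat_coalg_arr\<close>).

  Cocontinuity is the same on both sides.  The colimit in \<open>A\<close> of a diagram of coalgebras is again a
  coalgebra, and equations between maps out of it may be tested on the legs; so \<open>U\<close> preserves and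
  reflects colimits (\<open>forgetful_cocontinuous\<close>, \<open>Cog_colimitI\<close>).  Therefore \<open>U\<^sub>*\<close> is an isomorphism of
  categories for every \<open>G\<close>.

  For \<open>f : G \<rightarrow> H\<close>, the functor \<open>f\<^sup>* : GSet H \<rightarrow> GSet G\<close> preserves all the structure strictly, and it is
  cocontinuous because right Kan extension is right adjoint to it (\<open>restriction_cocontinuous\<close>).  So
  \<open>\<pi>\<^sub>1\<close> is a strict 2-functor and \<open>U\<^sub>*\<close> commutes strictly with it; the inverse isomorphisms then do the same
  and form an inverse of \<open>U\<^sub>*\<close> (\<open>strict_equivalence\<close>).  Finite groupoids are among the small ones.\<close>

section \<open>Computing in a category\<close>

lemma in_hom: "f \<in> hom C a b \<longleftrightarrow> f \<in> arr C \<and> src C f = a \<and> tgt C f = b"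
  by (simp add: hom_def)

context category
begin

lemma src_in [simp]: "f \<in> arr C \<Longrightarrow> src C f \<in> obj C"
  by (rule src_obj)

lemma tgt_in [simp]: "f \<in> arr C \<Longrightarrow> tgt C f \<in> obj C"
  by (rule tgt_obj)

lemma idn_simps [simp]:
  assumes "a \<in> obj C"
  shows "idn C a \<in> arr C" "src C (idn C a) = a" "tgt C (idn C a) = a"
  using idn_hom[OF assms] by (simp_all add: in_hom)

lemma cmp_simps [simp]:
  assumes "f \<in> arr C" "g \<in> arr C" "tgt C f = src C g"
  shows "g \<cdot> f \<in> arr C" "src C (g \<cdot> f) = src C f" "tgt C (g \<cdot> f) = tgt C g"
  using cmp_hom[of f "src C f" "tgt C f" g "tgt C g"] assms by (simp_all add: in_hom)

lemma cmp_idn_simp [simp]: "\<lbrakk>f \<in> arr C; src C f = a\<rbrakk> \<Longrightarrow> f \<cdot> idn C a = f"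
  using cmp_idn[of f a "tgt C f"] by (simp add: in_hom)

lemma idn_cmp_simp [simp]: "\<lbrakk>f \<in> arr C; tgt C f = a\<rbrakk> \<Longrightarrow> idn C a \<cdot> f = f"
  using idn_cmp[of f "src C f" a] by (simp add: in_hom)

lemma assoc [simp]:
  "\<lbrakk>f \<in> arr C; g \<in> arr C; h \<in> arr C; tgt C f = src C g; tgt C g = src C h\<rbrakk> \<Longrightarrow> h \<cdot> g \<cdot> f = h \<cdot> (g \<cdot> f)"
  using cmp_assoc[of f "src C f" "tgt C f" g "tgt C g" h "tgt C h"] by (simp add: in_hom)

text \<open>Compositions are kept bracketed to the right.  The following rules let an equation between
  composites act on the head of a longer composite.\<close>

lemma push2:
  assumes "g \<cdot> f = k" "f \<in> arr C" "g \<in> arr C" "tgt C f = src C g" "x \<in> arr C" "tgt C x = src C f"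
  shows "g \<cdot> (f \<cdot> x) = k \<cdot> x"
  using assms by (metis assoc)

lemma push3:
  assumes "h \<cdot> (g \<cdot> f) = k" "f \<in> arr C" "g \<in> arr C" "h \<in> arr C" "tgt C f = src C g" "tgt C g = src C h"
    "x \<in> arr C" "tgt C x = src C f"
  shows "h \<cdot> (g \<cdot> (f \<cdot> x)) = k \<cdot> x"
  using assms by (metis assoc cmp_simps)

lemma inverse_unique:
  assumes "inverse_arrows C f g" "inverse_arrows C f h"
  shows "g = h"
proof -
  have "g = g \<cdot> (f \<cdot> h)" using assms by (simp add: inverse_arrows_def in_hom)
  also have "\<dots> = (g \<cdot> f) \<cdot> h" using assms by (subst assoc) (auto simp: inverse_arrows_def in_hom)
  also have "\<dots> = h" using assms by (simp add: inverse_arrows_def in_hom)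
  finally show ?thesis .
qed

lemma inv_arr_eqI: "inverse_arrows C f g \<Longrightarrow> inv_arr C f = g"
  unfolding inv_arr_def using inverse_unique by blast

lemma inverse_arrows_inv: "iso_arr C f \<Longrightarrow> inverse_arrows C f (inv_arr C f)"
  using inv_arr_eqI by (metis iso_arr_def)

lemma inv_arr_simps [simp]:
  assumes "iso_arr C f"
  shows "inv_arr C f \<in> arr C" "src C (inv_arr C f) = tgt C f" "tgt C (inv_arr C f) = src C f"
    "inv_arr C f \<cdot> f = idn C (src C f)" "f \<cdot> inv_arr C f = idn C (tgt C f)"
  using inverse_arrows_inv[OF assms] by (auto simp: inverse_arrows_def in_hom)

lemma iso_arr_in: "iso_arr C f \<Longrightarrow> f \<in> arr C"
  by (auto simp: iso_arr_def inverse_arrows_def)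

lemma inv_cancel [simp]:
  assumes "iso_arr C f" "x \<in> arr C"
  shows "tgt C x = src C f \<Longrightarrow> inv_arr C f \<cdot> (f \<cdot> x) = x"
    "tgt C x = tgt C f \<Longrightarrow> f \<cdot> (inv_arr C f \<cdot> x) = x"
  using assms iso_arr_in[OF assms(1)] by (simp_all add: push2)

lemma iso_arrI:
  assumes "f \<in> arr C" "g \<in> arr C" "src C g = tgt C f" "tgt C g = src C f"
    "g \<cdot> f = idn C (src C f)" "f \<cdot> g = idn C (tgt C f)"
  shows "iso_arr C f"
  using assms unfolding iso_arr_def inverse_arrows_def in_hom by blast

lemma iso_cancel:
  assumes "iso_arr C j" "f \<in> arr C" "g \<in> arr C" "tgt C f = src C j" "tgt C g = src C j" "j \<cdot> f = j \<cdot> g"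
  shows "f = g"
  using inv_cancel(1)[OF assms(1,2,4)] inv_cancel(1)[OF assms(1,3,5)] assms(6) by metis

lemma iso_idn [simp]: "a \<in> obj C \<Longrightarrow> iso_arr C (idn C a)"
  by (rule iso_arrI[where g = "idn C a"]) simp_all

lemma iso_cmp [simp]:
  assumes "iso_arr C f" "iso_arr C g" "tgt C f = src C g"
  shows "iso_arr C (g \<cdot> f)"
  using assms iso_arr_in[OF assms(1)] iso_arr_in[OF assms(2)]
  by (intro iso_arrI[where g = "inv_arr C f \<cdot> inv_arr C g"]) simp_all

end


section \<open>Cartesian monoidal categories\<close>

text \<open>The tensor product is the categorical product, with chosen projections \<open>p\<close>, \<open>q\<close> that the
  structure isomorphisms respect.  Since maps into a product are determined by their components,
  every identity between structure maps, coherence included, is proved by computing components.\<close>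

locale cartesian = category R for R :: "('o, 'm) smc" (structure) +
  fixes p q :: "'o \<Rightarrow> 'o \<Rightarrow> 'm" and dia bang :: "'o \<Rightarrow> 'm"
  assumes tob_in [simp]: "\<lbrakk>a \<in> obj R; b \<in> obj R\<rbrakk> \<Longrightarrow> a \<odot> b \<in> obj R"
    and unit_in [simp]: "tunit R \<in> obj R"
    and tar_in: "\<lbrakk>f \<in> hom R a a'; g \<in> hom R b b'\<rbrakk> \<Longrightarrow> f \<otimes> g \<in> hom R (a \<odot> b) (a' \<odot> b')"
    and p_hom: "\<lbrakk>a \<in> obj R; b \<in> obj R\<rbrakk> \<Longrightarrow> p a b \<in> hom R (a \<odot> b) a"
    and q_hom: "\<lbrakk>a \<in> obj R; b \<in> obj R\<rbrakk> \<Longrightarrow> q a b \<in> hom R (a \<odot> b) b"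
    and proj_ext: "\<lbrakk>a \<in> obj R; b \<in> obj R; f \<in> hom R c (a \<odot> b); g \<in> hom R c (a \<odot> b);
        p a b \<cdot> f = p a b \<cdot> g; q a b \<cdot> f = q a b \<cdot> g\<rbrakk> \<Longrightarrow> f = g"
    and p_tar: "\<lbrakk>f \<in> hom R a a'; g \<in> hom R b b'\<rbrakk> \<Longrightarrow> p a' b' \<cdot> (f \<otimes> g) = f \<cdot> p a b"
    and q_tar: "\<lbrakk>f \<in> hom R a a'; g \<in> hom R b b'\<rbrakk> \<Longrightarrow> q a' b' \<cdot> (f \<otimes> g) = g \<cdot> q a b"
    and ass_hom: "\<lbrakk>a \<in> obj R; b \<in> obj R; c \<in> obj R\<rbrakk>
        \<Longrightarrow> associator R a b c \<in> hom R ((a \<odot> b) \<odot> c) (a \<odot> (b \<odot> c))"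
    and ass_iso [simp]: "\<lbrakk>a \<in> obj R; b \<in> obj R; c \<in> obj R\<rbrakk> \<Longrightarrow> iso_arr R (associator R a b c)"
    and p_ass: "\<lbrakk>a \<in> obj R; b \<in> obj R; c \<in> obj R\<rbrakk>
        \<Longrightarrow> p a (b \<odot> c) \<cdot> associator R a b c = p a b \<cdot> p (a \<odot> b) c"
    and pq_ass: "\<lbrakk>a \<in> obj R; b \<in> obj R; c \<in> obj R\<rbrakk>
        \<Longrightarrow> p b c \<cdot> (q a (b \<odot> c) \<cdot> associator R a b c) = q a b \<cdot> p (a \<odot> b) c"
    and qq_ass: "\<lbrakk>a \<in> obj R; b \<in> obj R; c \<in> obj R\<rbrakk>
        \<Longrightarrow> q b c \<cdot> (q a (b \<odot> c) \<cdot> associator R a b c) = q (a \<odot> b) c"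
    and lun [simp]: "a \<in> obj R \<Longrightarrow> lunitor R a = q (tunit R) a"
    and run [simp]: "a \<in> obj R \<Longrightarrow> runitor R a = p a (tunit R)"
    and bra_hom: "\<lbrakk>a \<in> obj R; b \<in> obj R\<rbrakk> \<Longrightarrow> braiding R a b \<in> hom R (a \<odot> b) (b \<odot> a)"
    and p_bra: "\<lbrakk>a \<in> obj R; b \<in> obj R\<rbrakk> \<Longrightarrow> p b a \<cdot> braiding R a b = q a b"
    and q_bra: "\<lbrakk>a \<in> obj R; b \<in> obj R\<rbrakk> \<Longrightarrow> q b a \<cdot> braiding R a b = p a b"
    and dia_hom: "a \<in> obj R \<Longrightarrow> dia a \<in> hom R a (a \<odot> a)"
    and p_dia: "a \<in> obj R \<Longrightarrow> p a a \<cdot> dia a = idn R a"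
    and q_dia: "a \<in> obj R \<Longrightarrow> q a a \<cdot> dia a = idn R a"
    and bang_hom: "a \<in> obj R \<Longrightarrow> bang a \<in> hom R a (tunit R)"
    and bang_unique: "f \<in> hom R a (tunit R) \<Longrightarrow> f = bang a"
begin

lemma tar_simps [simp]:
  assumes "f \<in> arr R" "g \<in> arr R"
  shows "f \<otimes> g \<in> arr R" "src R (f \<otimes> g) = src R f \<odot> src R g" "tgt R (f \<otimes> g) = tgt R f \<odot> tgt R g"
  using tar_in[of f "src R f" "tgt R f" g "src R g" "tgt R g"] assms by (simp_all add: in_hom)

lemma structure_simps [simp]:
  assumes "a \<in> obj R" "b \<in> obj R"
  shows "p a b \<in> arr R" "src R (p a b) = a \<odot> b" "tgt R (p a b) = a"
    "q a b \<in> arr R" "src R (q a b) = a \<odot> b" "tgt R (q a b) = b"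
    "braiding R a b \<in> arr R" "src R (braiding R a b) = a \<odot> b" "tgt R (braiding R a b) = b \<odot> a"
  using p_hom[OF assms] q_hom[OF assms] bra_hom[OF assms] by (simp_all add: in_hom)

lemma dia_bang_simps [simp]:
  assumes "a \<in> obj R"
  shows "dia a \<in> arr R" "src R (dia a) = a" "tgt R (dia a) = a \<odot> a"
    "bang a \<in> arr R" "src R (bang a) = a" "tgt R (bang a) = tunit R"
  using dia_hom[OF assms] bang_hom[OF assms] by (simp_all add: in_hom)

lemma ass_simps [simp]:
  assumes "a \<in> obj R" "b \<in> obj R" "c \<in> obj R"
  shows "associator R a b c \<in> arr R" "src R (associator R a b c) = (a \<odot> b) \<odot> c"
    "tgt R (associator R a b c) = a \<odot> (b \<odot> c)"
  using ass_hom[OF assms] by (simp_all add: in_hom)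

lemma proj_tar_simps [simp]:
  assumes "f \<in> arr R" "g \<in> arr R" "tgt R f = a" "tgt R g = b"
  shows "p a b \<cdot> (f \<otimes> g) = f \<cdot> p (src R f) (src R g)"
    "q a b \<cdot> (f \<otimes> g) = g \<cdot> q (src R f) (src R g)"
  using p_tar[of f "src R f" a g "src R g" b] q_tar[of f "src R f" a g "src R g" b] assms
  by (simp_all add: in_hom)

lemma proj_tar_push [simp]:
  assumes "f \<in> arr R" "g \<in> arr R" "tgt R f = a" "tgt R g = b" "x \<in> arr R"
    "tgt R x = src R f \<odot> src R g"
  shows "p a b \<cdot> ((f \<otimes> g) \<cdot> x) = f \<cdot> (p (src R f) (src R g) \<cdot> x)"
    "q a b \<cdot> ((f \<otimes> g) \<cdot> x) = g \<cdot> (q (src R f) (src R g) \<cdot> x)"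
proof -
  have "a \<in> obj R" "b \<in> obj R" using assms by auto
  then show "p a b \<cdot> ((f \<otimes> g) \<cdot> x) = f \<cdot> (p (src R f) (src R g) \<cdot> x)"
    "q a b \<cdot> ((f \<otimes> g) \<cdot> x) = g \<cdot> (q (src R f) (src R g) \<cdot> x)"
    using assms by (simp_all add: push2[OF proj_tar_simps(1)] push2[OF proj_tar_simps(2)])
qed

declare p_bra [simp] q_bra [simp] p_dia [simp] q_dia [simp] p_ass [simp] pq_ass [simp] qq_ass [simp]

lemma structure_push [simp]:
  assumes "a \<in> obj R" "b \<in> obj R" "x \<in> arr R"
  shows "tgt R x = a \<odot> b \<Longrightarrow> p b a \<cdot> (braiding R a b \<cdot> x) = q a b \<cdot> x"
    "tgt R x = a \<odot> b \<Longrightarrow> q b a \<cdot> (braiding R a b \<cdot> x) = p a b \<cdot> x"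
  using assms by (simp_all add: push2[OF p_bra] push2[OF q_bra])

lemma dia_push [simp]:
  assumes "x \<in> arr R" "tgt R x = a"
  shows "p a a \<cdot> (dia a \<cdot> x) = x" "q a a \<cdot> (dia a \<cdot> x) = x"
  using assms tgt_in[OF assms(1)] by (simp_all add: push2[OF p_dia] push2[OF q_dia])

lemma ass_push [simp]:
  assumes "a \<in> obj R" "b \<in> obj R" "c \<in> obj R" "x \<in> arr R" "tgt R x = (a \<odot> b) \<odot> c"
  shows "p a (b \<odot> c) \<cdot> (associator R a b c \<cdot> x) = p a b \<cdot> (p (a \<odot> b) c \<cdot> x)"
    "p b c \<cdot> (q a (b \<odot> c) \<cdot> (associator R a b c \<cdot> x)) = q a b \<cdot> (p (a \<odot> b) c \<cdot> x)"
    "q b c \<cdot> (q a (b \<odot> c) \<cdot> (associator R a b c \<cdot> x)) = q (a \<odot> b) c \<cdot> x"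
  using assms by (simp_all add: push2[OF p_ass] push3[OF pq_ass] push3[OF qq_ass])

lemma inv_ass_push [simp]:
  assumes "a \<in> obj R" "b \<in> obj R" "c \<in> obj R" "y \<in> arr R" "tgt R y = a \<odot> (b \<odot> c)"
  shows "p a b \<cdot> (p (a \<odot> b) c \<cdot> (inv_arr R (associator R a b c) \<cdot> y)) = p a (b \<odot> c) \<cdot> y"
    "q a b \<cdot> (p (a \<odot> b) c \<cdot> (inv_arr R (associator R a b c) \<cdot> y)) = p b c \<cdot> (q a (b \<odot> c) \<cdot> y)"
    "q (a \<odot> b) c \<cdot> (inv_arr R (associator R a b c) \<cdot> y) = q b c \<cdot> (q a (b \<odot> c) \<cdot> y)"
  proof -
  let ?i = "inv_arr R (associator R a b c) \<cdot> y"
  have i: "?i \<in> arr R" "tgt R ?i = (a \<odot> b) \<odot> c" "associator R a b c \<cdot> ?i = y"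
    using assms by simp_all
  show "p a b \<cdot> (p (a \<odot> b) c \<cdot> ?i) = p a (b \<odot> c) \<cdot> y"
    "q a b \<cdot> (p (a \<odot> b) c \<cdot> ?i) = p b c \<cdot> (q a (b \<odot> c) \<cdot> y)"
    "q (a \<odot> b) c \<cdot> ?i = q b c \<cdot> (q a (b \<odot> c) \<cdot> y)"
    using ass_push[OF assms(1-3) i(1,2)] i(3) by simp_all
qed

lemma tob_ext:
  assumes "f \<in> arr R" "g \<in> arr R" "src R f = src R g" "tgt R f = a \<odot> b" "tgt R g = a \<odot> b"
    "a \<in> obj R" "b \<in> obj R" "p a b \<cdot> f = p a b \<cdot> g" "q a b \<cdot> f = q a b \<cdot> g"
  shows "f = g"
  using proj_ext[of a b f "src R f" g] assms by (simp add: in_hom)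

lemma bang_ext:
  assumes "f \<in> arr R" "g \<in> arr R" "src R f = src R g" "tgt R f = tunit R" "tgt R g = tunit R"
  shows "f = g"
  using bang_unique[of f "src R f"] bang_unique[of g "src R f"] assms by (simp add: in_hom)

lemma bang_unit: "bang (tunit R) = idn R (tunit R)"
  by (rule bang_ext) simp_all

lemma bang_natural: "f \<in> arr R \<Longrightarrow> bang (tgt R f) \<cdot> f = bang (src R f)"
  by (rule bang_ext) simp_all

lemma bang_tob: "\<lbrakk>a \<in> obj R; b \<in> obj R\<rbrakk> \<Longrightarrow> bang (a \<odot> b) = lunitor R (tunit R) \<cdot> (bang a \<otimes> bang b)"
  by (rule bang_ext) simp_all

lemma tar_idn_cart: "\<lbrakk>a \<in> obj R; b \<in> obj R\<rbrakk> \<Longrightarrow> idn R a \<otimes> idn R b = idn R (a \<odot> b)"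
  by (rule tob_ext[where a = a and b = b]) simp_all

lemma tar_cmp_cart:
  assumes "f \<in> arr R" "f' \<in> arr R" "tgt R f = src R f'" "g \<in> arr R" "g' \<in> arr R" "tgt R g = src R g'"
  shows "(f' \<cdot> f) \<otimes> (g' \<cdot> g) = (f' \<otimes> g') \<cdot> (f \<otimes> g)"
  by (rule tob_ext[where a = "tgt R f'" and b = "tgt R g'"]) (use assms in simp_all)

text \<open>The next lemmas make every object a cocommutative comonoid, and every map one of comonoids.\<close>

lemma dia_coassoc:
  assumes "a \<in> obj R"
  shows "associator R a a a \<cdot> ((dia a \<otimes> idn R a) \<cdot> dia a) = (idn R a \<otimes> dia a) \<cdot> dia a"
proof (rule tob_ext[where a = a and b = "a \<odot> a"])
  show "q a (a \<odot> a) \<cdot> (associator R a a a \<cdot> ((dia a \<otimes> idn R a) \<cdot> dia a))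
    = q a (a \<odot> a) \<cdot> ((idn R a \<otimes> dia a) \<cdot> dia a)"
    by (rule tob_ext[where a = a and b = a]) (use assms in simp_all)
qed (use assms in simp_all)

lemma dia_cocomm: "a \<in> obj R \<Longrightarrow> braiding R a a \<cdot> dia a = dia a"
  by (rule tob_ext[where a = a and b = a]) simp_all

lemma dia_natural:
  assumes "f \<in> arr R"
  shows "(f \<otimes> f) \<cdot> dia (src R f) = dia (tgt R f) \<cdot> f"
  by (rule tob_ext[where a = "tgt R f" and b = "tgt R f"]) (use assms in simp_all)

lemma swap_simps [simp]:
  assumes "a \<in> obj R" "b \<in> obj R"
  shows "middle_swap R a b \<in> arr R" "src R (middle_swap R a b) = (a \<odot> a) \<odot> (b \<odot> b)"
    "tgt R (middle_swap R a b) = (a \<odot> b) \<odot> (a \<odot> b)"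
  using assms by (simp_all add: middle_swap_def)

text \<open>On elements: \<open>((x, x'), (y, y')) \<mapsto> ((x, y), (x', y'))\<close>.\<close>

lemma swap_proj [simp]:
  assumes "a \<in> obj R" "b \<in> obj R" "x \<in> arr R" "tgt R x = (a \<odot> a) \<odot> (b \<odot> b)"
  shows "p a b \<cdot> (p (a \<odot> b) (a \<odot> b) \<cdot> (middle_swap R a b \<cdot> x)) = p a a \<cdot> (p (a \<odot> a) (b \<odot> b) \<cdot> x)"
    "q a b \<cdot> (p (a \<odot> b) (a \<odot> b) \<cdot> (middle_swap R a b \<cdot> x)) = p b b \<cdot> (q (a \<odot> a) (b \<odot> b) \<cdot> x)"
    "p a b \<cdot> (q (a \<odot> b) (a \<odot> b) \<cdot> (middle_swap R a b \<cdot> x)) = q a a \<cdot> (p (a \<odot> a) (b \<odot> b) \<cdot> x)"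
    "q a b \<cdot> (q (a \<odot> b) (a \<odot> b) \<cdot> (middle_swap R a b \<cdot> x)) = q b b \<cdot> (q (a \<odot> a) (b \<odot> b) \<cdot> x)"
  using assms by (simp_all add: middle_swap_def)

text \<open>Its image under a monoidal functor says that the structure isomorphisms are compatible with the
  comultiplications (\<open>m_arr\<close>).\<close>

lemma dia_tob:
  assumes "a \<in> obj R" "b \<in> obj R"
  shows "middle_swap R a b \<cdot> (dia a \<otimes> dia b) = dia (a \<odot> b)"
proof -
  have "r \<cdot> (middle_swap R a b \<cdot> (dia a \<otimes> dia b)) = r \<cdot> dia (a \<odot> b)"
    if "r = p (a \<odot> b) (a \<odot> b) \<or> r = q (a \<odot> b) (a \<odot> b)" for r
    by (rule tob_ext[where a = a and b = b]) (use that assms in auto)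
  from this[OF disjI1[OF refl]] this[OF disjI2[OF refl]] show ?thesis
    by (rule tob_ext[rotated 7])
      (use assms in simp_all)
qed

text \<open>The interchange moves only the two inner factors, which are the ones that are discarded here.\<close>

lemma outer_swap:
  assumes "a \<in> obj R"
  shows "(p a a \<otimes> q a a) \<cdot> middle_swap R a a = p a a \<otimes> q a a"
  by (rule tob_ext[where a = a and b = a])
    (use assms swap_proj[of a a "idn R ((a \<odot> a) \<odot> (a \<odot> a))"] in simp_all)

end


section \<open>Small sets\<close>

lemma small_lepoll: "\<lbrakk>X \<lesssim> Y; small U Y\<rbrakk> \<Longrightarrow> small U X"
  unfolding small_def by (rule lesspoll_trans1)

lemma small_subset: "\<lbrakk>small U Y; X \<subseteq> Y\<rbrakk> \<Longrightarrow> small U X"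
  using small_lepoll subset_imp_lepoll by blast

lemma small_image: "small U X \<Longrightarrow> small U (f ` X)"
  using small_lepoll image_lepoll by blast

lemma small_inj_on:
  assumes "small U Y" "f ` X \<subseteq> Y" "inj_on f X"
  shows "small U X"
  using small_subset[OF assms(1,2)] assms(3) by (simp add: small_def)

lemma small_obtain_inj:
  fixes X :: "'a set"
  assumes "small TYPE('u) X"
  obtains f :: "'a \<Rightarrow> 'u" where "inj_on f X"
  using lesspoll_imp_lepoll[of X "UNIV :: 'u set"] assms unfolding small_def lepoll_def by blast

lemma finite_small: "\<lbrakk>universe TYPE('u); finite X\<rbrakk> \<Longrightarrow> small TYPE('u) X"
  unfolding small_def universe_def using finite_lesspoll_infinite by blast

lemma inj_pr:
  assumes "universe TYPE('u)"
  shows "inj (case_prod (pr :: 'u \<Rightarrow> 'u \<Rightarrow> 'u))"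
proof -
  have "infinite (UNIV :: 'u set)" using assms by (simp add: universe_def)
  then have "(UNIV :: 'u set) \<times> (UNIV :: 'u set) \<approx> (UNIV :: 'u set)"
    unfolding eqpoll_iff_card_of_ordIso by (rule card_of_Times_same_infinite)
  then have "\<exists>f :: 'u \<times> 'u \<Rightarrow> 'u. inj f" unfolding eqpoll_def bij_betw_def by auto
  then show ?thesis unfolding pr_def using someI_ex[where P = inj] by simp
qed

lemma unpr_pr [simp]: "universe TYPE('u) \<Longrightarrow> unpr (pr (x :: 'u) y) = (x, y)"
  unfolding unpr_def using inv_f_f[OF inj_pr, of "(x, y)"] by simp

lemma small_Pow:
  fixes X :: "'a set"
  assumes "universe TYPE('u)" "small TYPE('u) X"
  shows "small TYPE('u) (Pow X)"
proof -
  obtain f :: "'a \<Rightarrow> 'u" where f: "inj_on f X" using small_obtain_inj[OF assms(2)] .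
  have "small TYPE('u) (Pow (f ` X))"
    using assms small_image[OF assms(2), of f] by (simp add: universe_def)
  moreover have "(`) f ` Pow X \<subseteq> Pow (f ` X)" by blast
  ultimately show ?thesis
    using inj_on_image_Pow[OF f] by (rule small_inj_on)
qed

text \<open>The universe condition speaks of unions of sets of elements of \<open>'u\<close>.  Pairing codes a disjoint
  union over an arbitrary small index set into such a union.\<close>

lemma small_Sigma:
  fixes I :: "'a set" and X :: "'a \<Rightarrow> 'b set"
  assumes U: "universe TYPE('u)" and I: "small TYPE('u) I" and X: "\<And>i. i \<in> I \<Longrightarrow> small TYPE('u) (X i)"
  shows "small TYPE('u) (Sigma I X)"
proof -
  obtain g :: "'a \<Rightarrow> 'u" where g: "inj_on g I" using small_obtain_inj[OF I] .
  have "\<exists>f :: 'b \<Rightarrow> 'u. inj_on f (X i)" if "i \<in> I" for i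
    using small_obtain_inj[OF X[OF that]] by blast
  then obtain f :: "'a \<Rightarrow> 'b \<Rightarrow> 'u" where f: "\<And>i. i \<in> I \<Longrightarrow> inj_on (f i) (X i)" by metis
  define Y where "Y j = (\<lambda>x. pr j (f (inv_into I g j) x)) ` X (inv_into I g j)" for j
  have "small TYPE('u) (\<Union>j \<in> g ` I. Y j)"
  proof -
    have "small TYPE('u) (Y j)" if "j \<in> g ` I" for j
      unfolding Y_def using that by (intro small_image X) (rule inv_into_into)
    then show ?thesis using U small_image[OF I, of g] unfolding universe_def by blast
  qed
  moreover have "(\<lambda>(i, x). pr (g i) (f i x)) ` Sigma I X \<subseteq> (\<Union>j \<in> g ` I. Y j)"
    by (auto simp: Y_def inv_into_f_f[OF g])
  moreover have "inj_on (\<lambda>(i, x). pr (g i) (f i x)) (Sigma I X)"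
  proof (rule inj_onI, clarsimp)
    fix i x j y
    assume h: "i \<in> I" "x \<in> X i" "j \<in> I" "y \<in> X j" "pr (g i) (f i x) = pr (g j) (f j y)"
    then have "(g i, f i x) = (g j, f j y)" using unpr_pr[OF U] by metis
    then show "i = j \<and> x = y" using h g f by (auto dest: inj_onD)
  qed
  ultimately show ?thesis by (rule small_inj_on)
qed

lemma small_Times:
  "\<lbrakk>universe TYPE('u); small TYPE('u) X; small TYPE('u) Y\<rbrakk> \<Longrightarrow> small TYPE('u) (X \<times> Y)"
  by (rule small_Sigma)

text \<open>Functions are coded by their graphs.\<close>

lemma small_PiE:
  assumes "universe TYPE('u)" "small TYPE('u) I" "small TYPE('u) Y"
  shows "small TYPE('u) (I \<rightarrow>\<^sub>E Y)"
proof -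
  have "inj_on (\<lambda>f. (\<lambda>i. (i, f i)) ` I) (I \<rightarrow>\<^sub>E Y)"
  proof (rule inj_onI)
    fix f g assume h: "f \<in> I \<rightarrow>\<^sub>E Y" "g \<in> I \<rightarrow>\<^sub>E Y" "(\<lambda>i. (i, f i)) ` I = (\<lambda>i. (i, g i)) ` I"
    then have "f i = g i" if "i \<in> I" for i using that by auto
    then show "f = g" by (rule PiE_ext[OF h(1,2)])
  qed
  moreover have "(\<lambda>f. (\<lambda>i. (i, f i)) ` I) ` (I \<rightarrow>\<^sub>E Y) \<subseteq> Pow (I \<times> Y)" by auto
  ultimately show ?thesis
    by (rule small_inj_on[OF small_Pow[OF assms(1) small_Times[OF assms]], rotated])
qed


section \<open>The cartesian monoidal category of small sets\<close>

lemma set_smc_simps [simp]: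
  "obj (set_smc :: ('u set, 'u set_arr) smc) = {X. small TYPE('u) X}"
  "src set_smc (set_arr X h Y) = X" "tgt set_smc (set_arr X h Y) = Y"
  "idn set_smc X = set_arr X (\<lambda>x. x) X"
  "tob set_smc = set_prod" "tunit set_smc = set_one"
  "lunitor set_smc X = set_arr (set_prod set_one X) pr2 X"
  "runitor set_smc X = set_arr (set_prod X set_one) pr1 X"
  "associator set_smc X Y Z = set_arr (set_prod (set_prod X Y) Z)
       (\<lambda>p. pr (pr1 (pr1 p)) (pr (pr2 (pr1 p)) (pr2 p))) (set_prod X (set_prod Y Z))"
  "braiding set_smc X Y = set_arr (set_prod X Y) (\<lambda>p. pr (pr2 p) (pr1 p)) (set_prod Y X)"
  by (simp_all add: set_smc_def set_cat_def set_arr_def Let_def)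

lemma set_arr_eq [simp]: "set_arr X h Y = set_arr X' k Y' \<longleftrightarrow> X = X' \<and> Y = Y' \<and> (\<forall>x\<in>X. h x = k x)"
  unfolding set_arr_def by (auto simp: restrict_def fun_eq_iff)

lemma set_arr_in [simp]:
  "set_arr X h Y \<in> arr (set_smc :: ('u set, 'u set_arr) smc)
    \<longleftrightarrow> small TYPE('u) X \<and> small TYPE('u) Y \<and> h \<in> X \<rightarrow> Y"
  by (auto simp: set_smc_def set_cat_def set_arr_def Let_def restrict_def PiE_iff extensional_def)

lemma set_arr_cmp [simp]:
  "h \<in> X \<rightarrow> Y \<Longrightarrow> set_arr Y k Z \<cdot>\<^bsub>set_smc\<^esub> set_arr X h Y = set_arr X (\<lambda>x. k (h x)) Z"
  by (auto simp: set_smc_def set_cat_def set_arr_def Let_def compose_def restrict_def fun_eq_iff)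

text \<open>A normal form for arrows: the function may be given on a larger set, because \<open>set_arr\<close> restricts
  it.\<close>

lemma set_hom_iff:
  "f \<in> hom (set_smc :: ('u set, 'u set_arr) smc) X Y
    \<longleftrightarrow> small TYPE('u) X \<and> small TYPE('u) Y \<and> (\<exists>h \<in> X \<rightarrow> Y. f = set_arr X h Y)"
proof
  assume "f \<in> hom (set_smc :: ('u set, 'u set_arr) smc) X Y"
  then obtain h where h: "f = (X, h, Y)" "small TYPE('u) X" "small TYPE('u) Y" "h \<in> X \<rightarrow>\<^sub>E Y"
    by (auto simp: in_hom set_smc_def set_cat_def Let_def)
  then have "f = set_arr X h Y" "h \<in> X \<rightarrow> Y" unfolding set_arr_def by (auto simp: PiE_restrict)
  with h show "small TYPE('u) X \<and> small TYPE('u) Y \<and> (\<exists>h \<in> X \<rightarrow> Y. f = set_arr X h Y)"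
    by blast
qed (auto simp: in_hom)

lemma mem_set_prod: "p \<in> set_prod X Y \<longleftrightarrow> (\<exists>x\<in>X. \<exists>y\<in>Y. p = pr x y)"
  by (auto simp: set_prod_def)

lemma pr_mem [simp]:
  "universe TYPE('u) \<Longrightarrow> pr (x :: 'u) y \<in> set_prod X Y \<longleftrightarrow> x \<in> X \<and> y \<in> Y"
  unfolding mem_set_prod by (metis unpr_pr prod.inject)

lemma ball_set_prod [simp]: "(\<forall>p \<in> set_prod X Y. P p) \<longleftrightarrow> (\<forall>x\<in>X. \<forall>y\<in>Y. P (pr x y))"
  by (auto simp: set_prod_def)

lemma set_arr_tar [simp]:
  assumes "universe TYPE('u)"
  shows "set_arr (X :: 'u set) h X' \<otimes>\<^bsub>set_smc\<^esub> set_arr Y k Y'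
    = set_arr (set_prod X Y) (\<lambda>p. pr (h (pr1 p)) (k (pr2 p))) (set_prod X' Y')"
  using assms by (auto simp: set_smc_def Let_def set_arr_def mem_set_prod restrict_def fun_eq_iff)

lemma small_set_prod:
  assumes "universe TYPE('u)" "small TYPE('u) (X :: 'u set)" "small TYPE('u) Y"
  shows "small TYPE('u) (set_prod X Y)"
  unfolding set_prod_def using small_image[OF small_Times[OF assms]] .

lemma small_set_one: "universe TYPE('u) \<Longrightarrow> small TYPE('u) (set_one :: 'u set)"
  unfolding set_one_def by (simp add: finite_small)

definition set_p :: "'u set \<Rightarrow> 'u set \<Rightarrow> 'u set_arr" where
  "set_p X Y = set_arr (set_prod X Y) pr1 X"

definition set_q :: "'u set \<Rightarrow> 'u set \<Rightarrow> 'u set_arr" where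
  "set_q X Y = set_arr (set_prod X Y) pr2 Y"

definition set_dia :: "'u set \<Rightarrow> 'u set_arr" where
  "set_dia X = set_arr X (\<lambda>x. pr x x) (set_prod X X)"

definition set_bang :: "'u set \<Rightarrow> 'u set_arr" where
  "set_bang X = set_arr X (\<lambda>_. undefined) set_one"

lemma category_set: "category (set_smc :: ('u set, 'u set_arr) smc)"
proof
  fix f assume "f \<in> arr (set_smc :: ('u set, 'u set_arr) smc)"
  then have "f \<in> hom set_smc (src set_smc f) (tgt set_smc f)" by (simp add: in_hom)
  then show "src set_smc f \<in> obj set_smc" "tgt set_smc f \<in> obj set_smc"
    unfolding set_hom_iff by auto
next
  fix f g h :: "'u set_arr" and X Y Z W :: "'u set"
  show "X \<in> obj set_smc \<Longrightarrow> idn set_smc X \<in> hom set_smc X X" by (auto simp: set_hom_iff)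
  show "f \<in> hom set_smc X Y \<Longrightarrow> f \<cdot>\<^bsub>set_smc\<^esub> idn set_smc X = f"
    "f \<in> hom set_smc X Y \<Longrightarrow> idn set_smc Y \<cdot>\<^bsub>set_smc\<^esub> f = f"
    by (auto simp: set_hom_iff)
  assume "f \<in> hom set_smc X Y" "g \<in> hom set_smc Y Z"
  then obtain h' k where "h' \<in> X \<rightarrow> Y" "f = set_arr X h' Y" "k \<in> Y \<rightarrow> Z" "g = set_arr Y k Z"
    "small TYPE('u) X" "small TYPE('u) Z"
    unfolding set_hom_iff by blast
  then show "g \<cdot>\<^bsub>set_smc\<^esub> f \<in> hom set_smc X Z" by (auto simp: in_hom)
  assume "f \<in> hom set_smc X Y" "g \<in> hom set_smc Y Z" "h \<in> hom set_smc Z W"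
  then show "h \<cdot>\<^bsub>set_smc\<^esub> g \<cdot>\<^bsub>set_smc\<^esub> f = h \<cdot>\<^bsub>set_smc\<^esub> (g \<cdot>\<^bsub>set_smc\<^esub> f)"
    by (auto simp: set_hom_iff Pi_iff)
qed

lemma cartesian_set:
  assumes U: "universe TYPE('u)"
  shows "cartesian (set_smc :: ('u set, 'u set_arr) smc) set_p set_q set_dia set_bang"
proof -
  interpret S: category "set_smc :: ('u set, 'u set_arr) smc" by (rule category_set)
  note [simp] = U small_set_prod[OF U] small_set_one[OF U] unpr_pr[OF U] pr_mem[OF U] set_arr_tar[OF U]
  note defs = set_p_def set_q_def set_dia_def set_bang_def
  show ?thesis
  proof
    fix X Y Z :: "'u set" 
    assume X: "X \<in> obj set_smc"
    show "set_dia X \<in> hom set_smc X (X \<odot>\<^bsub>set_smc\<^esub> X)" "set_bang X \<in> hom set_smc X (tunit set_smc)"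
      "set_p X X \<cdot>\<^bsub>set_smc\<^esub> set_dia X = idn set_smc X" "set_q X X \<cdot>\<^bsub>set_smc\<^esub> set_dia X = idn set_smc X"
      "lunitor set_smc X = set_q (tunit set_smc) X" "runitor set_smc X = set_p X (tunit set_smc)"
      using X by (auto simp: defs in_hom Pi_iff set_one_def small_set_one[OF U, unfolded set_one_def])
    assume Y: "Y \<in> obj set_smc"
    show "X \<odot>\<^bsub>set_smc\<^esub> Y \<in> obj set_smc" "set_p X Y \<in> hom set_smc (X \<odot>\<^bsub>set_smc\<^esub> Y) X"
      "set_q X Y \<in> hom set_smc (X \<odot>\<^bsub>set_smc\<^esub> Y) Y"
      "braiding set_smc X Y \<in> hom set_smc (X \<odot>\<^bsub>set_smc\<^esub> Y) (Y \<odot>\<^bsub>set_smc\<^esub> X)"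
      "set_p Y X \<cdot>\<^bsub>set_smc\<^esub> braiding set_smc X Y = set_q X Y"
      "set_q Y X \<cdot>\<^bsub>set_smc\<^esub> braiding set_smc X Y = set_p X Y"
      using X Y by (auto simp: defs in_hom Pi_iff)
    assume Z: "Z \<in> obj set_smc"
    show "associator set_smc X Y Z
        \<in> hom set_smc ((X \<odot>\<^bsub>set_smc\<^esub> Y) \<odot>\<^bsub>set_smc\<^esub> Z) (X \<odot>\<^bsub>set_smc\<^esub> (Y \<odot>\<^bsub>set_smc\<^esub> Z))"
      "set_p X (Y \<odot>\<^bsub>set_smc\<^esub> Z) \<cdot>\<^bsub>set_smc\<^esub> associator set_smc X Y Z
        = set_p X Y \<cdot>\<^bsub>set_smc\<^esub> set_p (X \<odot>\<^bsub>set_smc\<^esub> Y) Z"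
      "set_p Y Z \<cdot>\<^bsub>set_smc\<^esub> (set_q X (Y \<odot>\<^bsub>set_smc\<^esub> Z) \<cdot>\<^bsub>set_smc\<^esub> associator set_smc X Y Z)
        = set_q X Y \<cdot>\<^bsub>set_smc\<^esub> set_p (X \<odot>\<^bsub>set_smc\<^esub> Y) Z"
      "set_q Y Z \<cdot>\<^bsub>set_smc\<^esub> (set_q X (Y \<odot>\<^bsub>set_smc\<^esub> Z) \<cdot>\<^bsub>set_smc\<^esub> associator set_smc X Y Z)
        = set_q (X \<odot>\<^bsub>set_smc\<^esub> Y) Z"
      using X Y Z by (auto simp: defs in_hom Pi_iff)
    show "iso_arr set_smc (associator set_smc X Y Z)"
      by (rule S.iso_arrI[where g = "set_arr (set_prod X (set_prod Y Z))
            (\<lambda>p. pr (pr (pr1 p) (pr1 (pr2 p))) (pr2 (pr2 p))) (set_prod (set_prod X Y) Z)"])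
        (use X Y Z in \<open>auto simp: Pi_iff\<close>)
  next
    show "tunit set_smc \<in> obj (set_smc :: ('u set, 'u set_arr) smc)" by simp
  next
    fix f X assume "f \<in> hom set_smc X (tunit (set_smc :: ('u set, 'u set_arr) smc))"
    then show "f = set_bang X" by (auto simp: set_hom_iff defs set_one_def)
  next
    fix f g :: "'u set_arr" and X X' Y Y'
    assume "f \<in> hom set_smc X X'" "g \<in> hom set_smc Y Y'"
    then obtain h k where h: "f = set_arr X h X'" "g = set_arr Y k Y'" "h \<in> X \<rightarrow> X'" "k \<in> Y \<rightarrow> Y'"
        "small TYPE('u) X" "small TYPE('u) Y" "small TYPE('u) X'" "small TYPE('u) Y'"
      unfolding set_hom_iff by blast
    then show "f \<otimes>\<^bsub>set_smc\<^esub> g \<in> hom set_smc (X \<odot>\<^bsub>set_smc\<^esub> Y) (X' \<odot>\<^bsub>set_smc\<^esub> Y')"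
      "set_p X' Y' \<cdot>\<^bsub>set_smc\<^esub> (f \<otimes>\<^bsub>set_smc\<^esub> g) = f \<cdot>\<^bsub>set_smc\<^esub> set_p X Y"
      "set_q X' Y' \<cdot>\<^bsub>set_smc\<^esub> (f \<otimes>\<^bsub>set_smc\<^esub> g) = g \<cdot>\<^bsub>set_smc\<^esub> set_q X Y"
      by (auto simp: defs in_hom Pi_iff)
  next
    fix f g :: "'u set_arr" and X Y Z
    assume "f \<in> hom set_smc Z (X \<odot>\<^bsub>set_smc\<^esub> Y)" "g \<in> hom set_smc Z (X \<odot>\<^bsub>set_smc\<^esub> Y)"
    then obtain h k where h: "f = set_arr Z h (set_prod X Y)" "g = set_arr Z k (set_prod X Y)"
        "h \<in> Z \<rightarrow> set_prod X Y" "k \<in> Z \<rightarrow> set_prod X Y"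
      unfolding set_hom_iff set_smc_simps by blast
    assume "set_p X Y \<cdot>\<^bsub>set_smc\<^esub> f = set_p X Y \<cdot>\<^bsub>set_smc\<^esub> g"
      "set_q X Y \<cdot>\<^bsub>set_smc\<^esub> f = set_q X Y \<cdot>\<^bsub>set_smc\<^esub> g"
    then have "pr1 (h z) = pr1 (k z) \<and> pr2 (h z) = pr2 (k z)" if "z \<in> Z" for z
      using h that by (auto simp: defs)
    moreover have "h z = pr (pr1 (h z)) (pr2 (h z)) \<and> k z = pr (pr1 (k z)) (pr2 (k z))" if "z \<in> Z" for z
      using h(3,4) that by (fastforce simp: Pi_iff mem_set_prod)
    ultimately show "f = g" using h(1,2) by (metis set_arr_eq)
  qed
qed


section \<open>Functors and transformations\<close>

lemma restrict_eqI: "\<lbrakk>g \<in> extensional A; \<And>x. x \<in> A \<Longrightarrow> f x = g x\<rbrakk> \<Longrightarrow> restrict f A = g"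
  by (auto simp: restrict_def extensional_def)

lemma functor_cats:
  assumes "is_functor C D F"
  shows "category C" "category D"
  using assms by (auto simp: is_functor_def)

lemma functor_simps:
  assumes "is_functor C D F"
  shows "a \<in> obj C \<Longrightarrow> fobj F a \<in> obj D"
    "f \<in> arr C \<Longrightarrow> farr F f \<in> arr D"
    "f \<in> arr C \<Longrightarrow> src D (farr F f) = fobj F (src C f)"
    "f \<in> arr C \<Longrightarrow> tgt D (farr F f) = fobj F (tgt C f)"
    "a \<in> obj C \<Longrightarrow> farr F (idn C a) = idn D (fobj F a)"
    "\<lbrakk>f \<in> arr C; g \<in> arr C; tgt C f = src C g\<rbrakk> \<Longrightarrow> farr F (g \<cdot>\<^bsub>C\<^esub> f) = farr F g \<cdot>\<^bsub>D\<^esub> farr F f"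
  using assms by (auto simp: is_functor_def in_hom)

lemma functor_extensional:
  assumes "is_functor C D F"
  shows "fobj F \<in> extensional (obj C)" "farr F \<in> extensional (arr C)"
  using assms by (auto simp: is_functor_def PiE_iff)

lemma functorI:
  assumes "category C" "category D" "fobj F \<in> extensional (obj C)" "farr F \<in> extensional (arr C)"
    "\<And>a. a \<in> obj C \<Longrightarrow> fobj F a \<in> obj D"
    "\<And>f. f \<in> arr C \<Longrightarrow> farr F f \<in> hom D (fobj F (src C f)) (fobj F (tgt C f))"
    "\<And>a. a \<in> obj C \<Longrightarrow> farr F (idn C a) = idn D (fobj F a)"
    "\<And>f g. \<lbrakk>f \<in> arr C; g \<in> arr C; tgt C f = src C g\<rbrakk> \<Longrightarrow> farr F (g \<cdot>\<^bsub>C\<^esub> f) = farr F g \<cdot>\<^bsub>D\<^esub> farr F f"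
  shows "is_functor C D F"
  using assms by (auto simp: is_functor_def in_hom PiE_iff)

lemma functor_ext:
  fixes F G :: "('o, 'm, 'p, 'n) func"
  assumes "is_functor C D F" "is_functor C E G" "\<And>a. a \<in> obj C \<Longrightarrow> fobj F a = fobj G a"
    "\<And>f. f \<in> arr C \<Longrightarrow> farr F f = farr G f"
  shows "F = G"
proof -
  have "fobj F = fobj G" "farr F = farr G"
    using functor_extensional[OF assms(1)] functor_extensional[OF assms(2)] assms(3,4)
    by (auto intro: extensionalityI)
  then show ?thesis by simp
qed

lemma nat_simps:
  assumes "is_nat C D F G t"
  shows "x \<in> obj C \<Longrightarrow> t x \<in> arr D" "x \<in> obj C \<Longrightarrow> src D (t x) = fobj F x"
    "x \<in> obj C \<Longrightarrow> tgt D (t x) = fobj G x"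
    "f \<in> arr C \<Longrightarrow> t (tgt C f) \<cdot>\<^bsub>D\<^esub> farr F f = farr G f \<cdot>\<^bsub>D\<^esub> t (src C f)"
  using assms by (auto simp: is_nat_def in_hom)

lemma natD:
  assumes "is_nat C D F G t"
  shows "is_functor C D F" "is_functor C D G" "t \<in> extensional (obj C)"
  using assms by (auto simp: is_nat_def)

lemma nat_cats: "is_nat C D F G t \<Longrightarrow> category C" "is_nat C D F G t \<Longrightarrow> category D"
  using functor_cats natD by blast+

lemma natI:
  assumes "is_functor C D F" "is_functor C D G" "t \<in> extensional (obj C)"
    "\<And>x. x \<in> obj C \<Longrightarrow> t x \<in> hom D (fobj F x) (fobj G x)"
    "\<And>f. f \<in> arr C \<Longrightarrow> t (tgt C f) \<cdot>\<^bsub>D\<^esub> farr F f = farr G f \<cdot>\<^bsub>D\<^esub> t (src C f)"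
  shows "is_nat C D F G t"
  using assms by (simp add: is_nat_def)

lemma id_nat_nat: "is_functor C D F \<Longrightarrow> is_nat C D F F (id_nat C D F)"
proof -
  assume F: "is_functor C D F"
  interpret C: category C by (rule functor_cats[OF F])
  interpret D: category D by (rule functor_cats[OF F])
  show ?thesis using F functor_simps[OF F] by (intro natI) (auto simp: id_nat_def in_hom)
qed

lemma vcomp_nat:
  assumes s: "is_nat C D F G s" and t: "is_nat C D G H t"
  shows "is_nat C D F H (vcomp C D t s)"
proof -
  interpret C: category C by (rule nat_cats[OF s])
  interpret D: category D by (rule nat_cats[OF s])
  note [simp] = functor_simps[OF natD(1)[OF s]] functor_simps[OF natD(1)[OF t]]
    functor_simps[OF natD(2)[OF t]] nat_simps(1-3)[OF s] nat_simps(1-3)[OF t]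
  show ?thesis
  proof (rule natI)
    fix f assume f: "f \<in> arr C"
    have "t (tgt C f) \<cdot>\<^bsub>D\<^esub> (s (tgt C f) \<cdot>\<^bsub>D\<^esub> farr F f) = t (tgt C f) \<cdot>\<^bsub>D\<^esub> (farr G f \<cdot>\<^bsub>D\<^esub> s (src C f))"
      using nat_simps(4)[OF s f] by simp
    also have "\<dots> = farr H f \<cdot>\<^bsub>D\<^esub> (t (src C f) \<cdot>\<^bsub>D\<^esub> s (src C f))"
      using nat_simps(4)[OF t f] f by (simp flip: D.assoc)
    finally show "vcomp C D t s (tgt C f) \<cdot>\<^bsub>D\<^esub> farr F f = farr H f \<cdot>\<^bsub>D\<^esub> vcomp C D t s (src C f)"
      using f by (simp add: vcomp_def)
  qed (use natD[OF s] natD[OF t] in \<open>auto simp: vcomp_def in_hom\<close>)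
qed

lemma comp_functor:
  assumes F: "is_functor C D F" and G: "is_functor D E G"
  shows "is_functor C E (comp_func C G F)"
proof -
  interpret C: category C by (rule functor_cats[OF F])
  show ?thesis
    using functor_cats[OF F] functor_cats[OF G] functor_simps[OF F] functor_simps[OF G]
    by (intro functorI) (auto simp: comp_func_def in_hom)
qed

lemma comp_func_simps [simp]:
  "a \<in> obj C \<Longrightarrow> fobj (comp_func C G F) a = fobj G (fobj F a)"
  "f \<in> arr C \<Longrightarrow> farr (comp_func C G F) f = farr G (farr F f)"
  by (simp_all add: comp_func_def)

lemma id_functor: "category C \<Longrightarrow> is_functor C C (id_func C)"
proof -
  assume "category C"
  then interpret C: category C .
  show ?thesis by (intro functorI) (auto simp: id_func_def in_hom C.category_axioms)
qed

lemma id_func_simps [simp]: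
  "a \<in> obj C \<Longrightarrow> fobj (id_func C) a = a" "f \<in> arr C \<Longrightarrow> farr (id_func C) f = f"
  by (simp_all add: id_func_def)


section \<open>Functor categories\<close>

lemma Fun_simps [simp]:
  "obj (Fun G C) = {X. is_functor G C X}"
  "src (Fun G C) (X, t, Y) = X" "tgt (Fun G C) (X, t, Y) = Y"
  "(X, t, Y) \<in> arr (Fun G C) \<longleftrightarrow> is_nat G C X Y t"
  "idn (Fun G C) X = (X, id_nat G C X, X)"
  "(Y', t, Z) \<cdot>\<^bsub>Fun G C\<^esub> (X, s, Y) = (X, vcomp G C t s, Z)"
  "tob (Fun G C) = pointwise_tensor G C" "tunit (Fun G C) = constant_unit G C"
  "(X, s, X') \<otimes>\<^bsub>Fun G C\<^esub> (Y, t, Y')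
    = (pointwise_tensor G C X Y, \<lambda>x\<in>obj G. s x \<otimes>\<^bsub>C\<^esub> t x, pointwise_tensor G C X' Y')"
  by (simp_all add: Fun_def Let_def)

lemma Fun_arrE:
  assumes "f \<in> arr (Fun G C)"
  obtains X t Y where "f = (X, t, Y)" "is_nat G C X Y t"
  using assms by (auto simp: Fun_def Let_def)

lemma Fun_homE:
  assumes "f \<in> hom (Fun G C) X Y"
  obtains t where "f = (X, t, Y)" "is_nat G C X Y t"
  using assms by (auto simp: Fun_def Let_def in_hom)

lemma Fun_hom [simp]: "(X, t, Y) \<in> hom (Fun G C) X' Y' \<longleftrightarrow> X = X' \<and> Y = Y' \<and> is_nat G C X Y t"
  by (auto simp: in_hom)

lemma category_Fun: "category (Fun G C)"
proof
  fix f assume "f \<in> arr (Fun G C)"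
  then show "src (Fun G C) f \<in> obj (Fun G C)" "tgt (Fun G C) f \<in> obj (Fun G C)"
    by (auto elim!: Fun_arrE dest: natD)
next
  fix X assume "X \<in> obj (Fun G C)"
  then show "idn (Fun G C) X \<in> hom (Fun G C) X X" by (simp add: id_nat_nat)
next
  fix f g h X Y Z W
  assume f: "f \<in> hom (Fun G C) X Y"
  then obtain r where r: "f = (X, r, Y)" "is_nat G C X Y r" by (rule Fun_homE)
  interpret G: category G by (rule nat_cats[OF r(2)])
  interpret C: category C by (rule nat_cats[OF r(2)])
  note [simp] = nat_simps(1-3)[OF r(2)] functor_simps[OF natD(1)[OF r(2)]]
    functor_simps[OF natD(2)[OF r(2)]]
  show "f \<cdot>\<^bsub>Fun G C\<^esub> idn (Fun G C) X = f" "idn (Fun G C) Y \<cdot>\<^bsub>Fun G C\<^esub> f = f"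
    using natD(3)[OF r(2)] by (auto simp: r(1) vcomp_def id_nat_def intro!: restrict_eqI)
  assume "g \<in> hom (Fun G C) Y Z"
  then obtain s where s: "g = (Y, s, Z)" "is_nat G C Y Z s" by (rule Fun_homE)
  then show "g \<cdot>\<^bsub>Fun G C\<^esub> f \<in> hom (Fun G C) X Z" using r by (simp add: vcomp_nat)
  assume "h \<in> hom (Fun G C) Z W"
  then obtain t where t: "h = (Z, t, W)" "is_nat G C Z W t" by (rule Fun_homE)
  show "h \<cdot>\<^bsub>Fun G C\<^esub> g \<cdot>\<^bsub>Fun G C\<^esub> f = h \<cdot>\<^bsub>Fun G C\<^esub> (g \<cdot>\<^bsub>Fun G C\<^esub> f)"
    using nat_simps(1-3)[OF s(2)] nat_simps(1-3)[OF t(2)]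
    by (auto simp: r(1) s(1) t(1) vcomp_def intro!: restrict_ext)
qed

lemma Fun_iso:
  assumes t: "is_nat G C X Y t" and iso: "\<And>x. x \<in> obj G \<Longrightarrow> iso_arr C (t x)"
  shows "iso_arr (Fun G C) (X, t, Y)"
proof -
  interpret G: category G by (rule nat_cats[OF t])
  interpret C: category C by (rule nat_cats[OF t])
  interpret F: category "Fun G C" by (rule category_Fun)
  note [simp] = nat_simps(1-3)[OF t] functor_simps[OF natD(1)[OF t]] functor_simps[OF natD(2)[OF t]] iso
  have i: "is_nat G C Y X (\<lambda>x\<in>obj G. inv_arr C (t x))"
  proof (rule natI)
    fix f assume f: "f \<in> arr G"
    have "inv_arr C (t (tgt G f)) \<cdot>\<^bsub>C\<^esub> (farr Y f \<cdot>\<^bsub>C\<^esub> t (src G f)) \<cdot>\<^bsub>C\<^esub> inv_arr C (t (src G f))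
      = inv_arr C (t (tgt G f)) \<cdot>\<^bsub>C\<^esub> (t (tgt G f) \<cdot>\<^bsub>C\<^esub> farr X f) \<cdot>\<^bsub>C\<^esub> inv_arr C (t (src G f))"
      using nat_simps(4)[OF t f] by simp
    then show "(\<lambda>x\<in>obj G. inv_arr C (t x)) (tgt G f) \<cdot>\<^bsub>C\<^esub> farr Y f
      = farr X f \<cdot>\<^bsub>C\<^esub> (\<lambda>x\<in>obj G. inv_arr C (t x)) (src G f)"
      using f by simp
  qed (use natD[OF t] in \<open>auto simp: in_hom\<close>)
  show ?thesis
    by (rule F.iso_arrI[where g = "(Y, \<lambda>x\<in>obj G. inv_arr C (t x), X)"])
      (use i t in \<open>auto simp: vcomp_def id_nat_def intro!: restrict_ext\<close>)
qed

text \<open>Products of functors are computed pointwise, so the projections, diagonals and maps to the unit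
  of \<open>C\<close> give those of the functor category.\<close>

definition Fun_p ::
  "('g, 'h) cat \<Rightarrow> ('o, 'm) smc \<Rightarrow> ('o \<Rightarrow> 'o \<Rightarrow> 'm) \<Rightarrow> ('g, 'h, 'o, 'm) func \<Rightarrow> ('g, 'h, 'o, 'm) func
    \<Rightarrow> ('g, 'h, 'o, 'm) fun_arr" where
  "Fun_p G C p X Y = (pointwise_tensor G C X Y, \<lambda>x\<in>obj G. p (fobj X x) (fobj Y x), X)"

definition Fun_q ::
  "('g, 'h) cat \<Rightarrow> ('o, 'm) smc \<Rightarrow> ('o \<Rightarrow> 'o \<Rightarrow> 'm) \<Rightarrow> ('g, 'h, 'o, 'm) func \<Rightarrow> ('g, 'h, 'o, 'm) func
    \<Rightarrow> ('g, 'h, 'o, 'm) fun_arr" where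
  "Fun_q G C q X Y = (pointwise_tensor G C X Y, \<lambda>x\<in>obj G. q (fobj X x) (fobj Y x), Y)"

definition Fun_dia ::
  "('g, 'h) cat \<Rightarrow> ('o, 'm) smc \<Rightarrow> ('o \<Rightarrow> 'm) \<Rightarrow> ('g, 'h, 'o, 'm) func \<Rightarrow> ('g, 'h, 'o, 'm) fun_arr" where
  "Fun_dia G C d X = (X, \<lambda>x\<in>obj G. d (fobj X x), pointwise_tensor G C X X)"

definition Fun_bang ::
  "('g, 'h) cat \<Rightarrow> ('o, 'm) smc \<Rightarrow> ('o \<Rightarrow> 'm) \<Rightarrow> ('g, 'h, 'o, 'm) func \<Rightarrow> ('g, 'h, 'o, 'm) fun_arr" where
  "Fun_bang G C e X = (X, \<lambda>x\<in>obj G. e (fobj X x), constant_unit G C)"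

lemma cartesian_Fun:
  assumes "cartesian C p q dia bang" "category G"
  shows "cartesian (Fun G C) (Fun_p G C p) (Fun_q G C q) (Fun_dia G C dia) (Fun_bang G C bang)"
proof -
  interpret C: cartesian C p q dia bang by fact
  interpret G: category G by fact
  interpret F: category "Fun G C" by (rule category_Fun)
  let ?T = "pointwise_tensor G C" and ?I = "constant_unit G C"
  have T: "is_functor G C (?T X Y)" if "is_functor G C X" "is_functor G C Y" for X Y
    using that functor_simps[OF that(1)] functor_simps[OF that(2)]
    by (intro functorI) (auto simp: pointwise_tensor_def in_hom C.tar_idn_cart C.tar_cmp_cart
        C.category_axioms G.category_axioms)
  have I: "is_functor G C ?I"
    by (intro functorI) (auto simp: constant_unit_def in_hom C.category_axioms G.category_axioms)
  have TI [simp]: "x \<in> obj G \<Longrightarrow> fobj (?T X Y) x = fobj X x \<odot>\<^bsub>C\<^esub> fobj Y x"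
      "f \<in> arr G \<Longrightarrow> farr (?T X Y) f = farr X f \<otimes>\<^bsub>C\<^esub> farr Y f"
      "x \<in> obj G \<Longrightarrow> fobj ?I x = tunit C" "f \<in> arr G \<Longrightarrow> farr ?I f = idn C (tunit C)" for x f X Y
    by (simp_all add: pointwise_tensor_def constant_unit_def)
  note defs = Fun_p_def Fun_q_def Fun_dia_def Fun_bang_def
  have lr: "lunitor (Fun G C) X = Fun_q G C q ?I X" "runitor (Fun G C) X = Fun_p G C p X ?I"
    if "is_functor G C X" for X
    using functor_simps[OF that]
    by (auto simp: Fun_def Let_def defs intro!: restrict_ext)
  have ass: "associator (Fun G C) X Y Z = (?T (?T X Y) Z,
      \<lambda>x\<in>obj G. associator C (fobj X x) (fobj Y x) (fobj Z x), ?T X (?T Y Z))" for X Y Z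
    by (simp add: Fun_def Let_def)
  have bra: "braiding (Fun G C) X Y
      = (?T X Y, \<lambda>x\<in>obj G. braiding C (fobj X x) (fobj Y x), ?T Y X)" for X Y
    by (simp add: Fun_def Let_def)
  show ?thesis
  proof
    fix X Y Z 
    assume X: "X \<in> obj (Fun G C)"
    note [simp] = functor_simps[OF X[simplified]]
    have d: "is_nat G C X (?T X X) (\<lambda>x\<in>obj G. dia (fobj X x))"
    proof (rule natI)
      fix f assume "f \<in> arr G"
      then show "(\<lambda>x\<in>obj G. dia (fobj X x)) (tgt G f) \<cdot>\<^bsub>C\<^esub> farr X f
        = farr (?T X X) f \<cdot>\<^bsub>C\<^esub> (\<lambda>x\<in>obj G. dia (fobj X x)) (src G f)"
        using C.dia_natural[of "farr X f"] by simp
    qed (use X T in \<open>auto simp: in_hom\<close>)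
    then show "Fun_dia G C dia X \<in> hom (Fun G C) X (X \<odot>\<^bsub>Fun G C\<^esub> X)" by (simp add: defs)
    show "Fun_p G C p X X \<cdot>\<^bsub>Fun G C\<^esub> Fun_dia G C dia X = idn (Fun G C) X"
      "Fun_q G C q X X \<cdot>\<^bsub>Fun G C\<^esub> Fun_dia G C dia X = idn (Fun G C) X"
      by (auto simp: defs vcomp_def id_nat_def intro!: restrict_ext)
    have "is_nat G C X ?I (\<lambda>x\<in>obj G. bang (fobj X x))"
    proof (rule natI)
      fix f assume "f \<in> arr G"
      then show "(\<lambda>x\<in>obj G. bang (fobj X x)) (tgt G f) \<cdot>\<^bsub>C\<^esub> farr X f
        = farr ?I f \<cdot>\<^bsub>C\<^esub> (\<lambda>x\<in>obj G. bang (fobj X x)) (src G f)"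
        using C.bang_natural[of "farr X f"] by simp
    qed (use X I in \<open>auto simp: in_hom\<close>)
    then show "Fun_bang G C bang X \<in> hom (Fun G C) X (tunit (Fun G C))" by (simp add: defs)
    show "lunitor (Fun G C) X = Fun_q G C q (tunit (Fun G C)) X"
      "runitor (Fun G C) X = Fun_p G C p X (tunit (Fun G C))"
      using X by (simp_all add: lr)
    assume Y: "Y \<in> obj (Fun G C)"
    note [simp] = functor_simps[OF Y[simplified]]
    show "X \<odot>\<^bsub>Fun G C\<^esub> Y \<in> obj (Fun G C)" using X Y by (simp add: T)
    have "is_nat G C (?T X Y) X (\<lambda>x\<in>obj G. p (fobj X x) (fobj Y x))"
      "is_nat G C (?T X Y) Y (\<lambda>x\<in>obj G. q (fobj X x) (fobj Y x))"
      by (rule natI; use X Y T in \<open>auto simp: in_hom\<close>)+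
    then show "Fun_p G C p X Y \<in> hom (Fun G C) (X \<odot>\<^bsub>Fun G C\<^esub> Y) X"
      "Fun_q G C q X Y \<in> hom (Fun G C) (X \<odot>\<^bsub>Fun G C\<^esub> Y) Y"
      by (simp_all add: defs)
    have "is_nat G C (?T X Y) (?T Y X) (\<lambda>x\<in>obj G. braiding C (fobj X x) (fobj Y x))"
    proof (rule natI)
      fix f assume f: "f \<in> arr G"
      show "(\<lambda>x\<in>obj G. braiding C (fobj X x) (fobj Y x)) (tgt G f) \<cdot>\<^bsub>C\<^esub> farr (?T X Y) f
        = farr (?T Y X) f \<cdot>\<^bsub>C\<^esub> (\<lambda>x\<in>obj G. braiding C (fobj X x) (fobj Y x)) (src G f)"
        by (rule C.tob_ext[where a = "fobj Y (tgt G f)" and b = "fobj X (tgt G f)"]) (use f in simp_all)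
    qed (use X Y T in \<open>auto simp: in_hom\<close>)
    then show "braiding (Fun G C) X Y \<in> hom (Fun G C) (X \<odot>\<^bsub>Fun G C\<^esub> Y) (Y \<odot>\<^bsub>Fun G C\<^esub> X)"
      by (simp add: bra)
    show "Fun_p G C p Y X \<cdot>\<^bsub>Fun G C\<^esub> braiding (Fun G C) X Y = Fun_q G C q X Y"
      "Fun_q G C q Y X \<cdot>\<^bsub>Fun G C\<^esub> braiding (Fun G C) X Y = Fun_p G C p X Y"
      by (auto simp: defs bra vcomp_def intro!: restrict_ext)
    assume Z: "Z \<in> obj (Fun G C)"
    note [simp] = functor_simps[OF Z[simplified]]
    have a: "is_nat G C (?T (?T X Y) Z) (?T X (?T Y Z))
        (\<lambda>x\<in>obj G. associator C (fobj X x) (fobj Y x) (fobj Z x))" (is "is_nat G C ?L ?R ?a")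
    proof (rule natI)
      fix f assume f: "f \<in> arr G"
      have "q (fobj X (tgt G f)) (fobj Y (tgt G f) \<odot>\<^bsub>C\<^esub> fobj Z (tgt G f)) \<cdot>\<^bsub>C\<^esub> (?a (tgt G f) \<cdot>\<^bsub>C\<^esub> farr ?L f)
          = q (fobj X (tgt G f)) (fobj Y (tgt G f) \<odot>\<^bsub>C\<^esub> fobj Z (tgt G f)) \<cdot>\<^bsub>C\<^esub> (farr ?R f \<cdot>\<^bsub>C\<^esub> ?a (src G f))"
        by (rule C.tob_ext[where a = "fobj Y (tgt G f)" and b = "fobj Z (tgt G f)"]) (use f in simp_all)
      then show "?a (tgt G f) \<cdot>\<^bsub>C\<^esub> farr ?L f = farr ?R f \<cdot>\<^bsub>C\<^esub> ?a (src G f)"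
        by (rule C.tob_ext[rotated 8]) (use f in simp_all)
    qed (use X Y Z T in \<open>auto simp: in_hom\<close>)
    then show "associator (Fun G C) X Y Z \<in> hom (Fun G C) ((X \<odot>\<^bsub>Fun G C\<^esub> Y) \<odot>\<^bsub>Fun G C\<^esub> Z)
        (X \<odot>\<^bsub>Fun G C\<^esub> (Y \<odot>\<^bsub>Fun G C\<^esub> Z))"
      by (simp add: ass)
    show "Fun_p G C p X (Y \<odot>\<^bsub>Fun G C\<^esub> Z) \<cdot>\<^bsub>Fun G C\<^esub> associator (Fun G C) X Y Z
        = Fun_p G C p X Y \<cdot>\<^bsub>Fun G C\<^esub> Fun_p G C p (X \<odot>\<^bsub>Fun G C\<^esub> Y) Z"
      "Fun_p G C p Y Z \<cdot>\<^bsub>Fun G C\<^esub> (Fun_q G C q X (Y \<odot>\<^bsub>Fun G C\<^esub> Z) \<cdot>\<^bsub>Fun G C\<^esub> associator (Fun G C) X Y Z)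
        = Fun_q G C q X Y \<cdot>\<^bsub>Fun G C\<^esub> Fun_p G C p (X \<odot>\<^bsub>Fun G C\<^esub> Y) Z"
      "Fun_q G C q Y Z \<cdot>\<^bsub>Fun G C\<^esub> (Fun_q G C q X (Y \<odot>\<^bsub>Fun G C\<^esub> Z) \<cdot>\<^bsub>Fun G C\<^esub> associator (Fun G C) X Y Z)
        = Fun_q G C q (X \<odot>\<^bsub>Fun G C\<^esub> Y) Z"
      by (auto simp: defs ass vcomp_def intro!: restrict_ext)
    show "iso_arr (Fun G C) (associator (Fun G C) X Y Z)"
      unfolding ass using a by (rule Fun_iso) simp
  next
    show "tunit (Fun G C) \<in> obj (Fun G C)" using I by simp
  next
    fix f X assume "f \<in> hom (Fun G C) X (tunit (Fun G C))"
    then obtain t where t: "f = (X, t, ?I)" "is_nat G C X ?I t" by (auto elim: Fun_homE)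
    have "t x = bang (fobj X x)" if "x \<in> obj G" for x
      using that nat_simps(1-3)[OF t(2) that] functor_simps(1)[OF natD(1)[OF t(2)]]
      by (intro C.bang_ext) simp_all
    then show "f = Fun_bang G C bang X"
      using natD(3)[OF t(2)] by (auto simp: t(1) defs intro!: restrict_eqI[symmetric])
  next
    fix f g X X' Y Y'
    assume "f \<in> hom (Fun G C) X X'" "g \<in> hom (Fun G C) Y Y'"
    then obtain s t where s: "f = (X, s, X')" "is_nat G C X X' s"
        and t: "g = (Y, t, Y')" "is_nat G C Y Y' t"
      by (auto elim!: Fun_homE)
    note [simp] = nat_simps(1-3)[OF s(2)] nat_simps(1-3)[OF t(2)]
      functor_simps[OF natD(1)[OF s(2)]] functor_simps[OF natD(2)[OF s(2)]]
      functor_simps[OF natD(1)[OF t(2)]] functor_simps[OF natD(2)[OF t(2)]]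
    have "is_nat G C (?T X Y) (?T X' Y') (\<lambda>x\<in>obj G. s x \<otimes>\<^bsub>C\<^esub> t x)"
    proof (rule natI)
      fix f assume f: "f \<in> arr G"
      then show "(\<lambda>x\<in>obj G. s x \<otimes>\<^bsub>C\<^esub> t x) (tgt G f) \<cdot>\<^bsub>C\<^esub> farr (?T X Y) f
        = farr (?T X' Y') f \<cdot>\<^bsub>C\<^esub> (\<lambda>x\<in>obj G. s x \<otimes>\<^bsub>C\<^esub> t x) (src G f)"
        using nat_simps(4)[OF s(2) f] nat_simps(4)[OF t(2) f] by (simp flip: C.tar_cmp_cart)
    qed (use T natD[OF s(2)] natD[OF t(2)] in \<open>auto simp: in_hom\<close>)
    then show "f \<otimes>\<^bsub>Fun G C\<^esub> g \<in> hom (Fun G C) (X \<odot>\<^bsub>Fun G C\<^esub> Y) (X' \<odot>\<^bsub>Fun G C\<^esub> Y')"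
      by (simp add: s(1) t(1))
    show "Fun_p G C p X' Y' \<cdot>\<^bsub>Fun G C\<^esub> (f \<otimes>\<^bsub>Fun G C\<^esub> g) = f \<cdot>\<^bsub>Fun G C\<^esub> Fun_p G C p X Y"
      "Fun_q G C q X' Y' \<cdot>\<^bsub>Fun G C\<^esub> (f \<otimes>\<^bsub>Fun G C\<^esub> g) = g \<cdot>\<^bsub>Fun G C\<^esub> Fun_q G C q X Y"
      by (auto simp: s(1) t(1) defs vcomp_def intro!: restrict_ext)
  next
    fix f g X Y Z
    assume X: "X \<in> obj (Fun G C)" and Y: "Y \<in> obj (Fun G C)"
      and "f \<in> hom (Fun G C) Z (X \<odot>\<^bsub>Fun G C\<^esub> Y)" "g \<in> hom (Fun G C) Z (X \<odot>\<^bsub>Fun G C\<^esub> Y)"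
    then obtain s t where s: "f = (Z, s, ?T X Y)" "is_nat G C Z (?T X Y) s"
        and t: "g = (Z, t, ?T X Y)" "is_nat G C Z (?T X Y) t"
      by (auto elim!: Fun_homE)
    assume e: "Fun_p G C p X Y \<cdot>\<^bsub>Fun G C\<^esub> f = Fun_p G C p X Y \<cdot>\<^bsub>Fun G C\<^esub> g"
      "Fun_q G C q X Y \<cdot>\<^bsub>Fun G C\<^esub> f = Fun_q G C q X Y \<cdot>\<^bsub>Fun G C\<^esub> g"
    have "s x = t x" if x: "x \<in> obj G" for x
    proof (rule C.tob_ext[where a = "fobj X x" and b = "fobj Y x"])
      show "p (fobj X x) (fobj Y x) \<cdot>\<^bsub>C\<^esub> s x = p (fobj X x) (fobj Y x) \<cdot>\<^bsub>C\<^esub> t x"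
        using e(1) x by (auto simp: s(1) t(1) defs vcomp_def dest: fun_cong[where x = x])
      show "q (fobj X x) (fobj Y x) \<cdot>\<^bsub>C\<^esub> s x = q (fobj X x) (fobj Y x) \<cdot>\<^bsub>C\<^esub> t x"
        using e(2) x by (auto simp: s(1) t(1) defs vcomp_def dest: fun_cong[where x = x])
    qed (use x nat_simps(1-3)[OF s(2) x] nat_simps(1-3)[OF t(2) x]
        functor_simps(1)[OF X[simplified]] functor_simps(1)[OF Y[simplified]] in simp_all)
    then show "f = g" using natD(3)[OF s(2)] natD(3)[OF t(2)] by (simp add: s(1) t(1)) (rule extensionalityI)
  qed
qed

lemma cartesian_GSet:
  assumes "universe TYPE('u)" "category (G :: ('u, 'u) cat)"
  obtains p q dia bang where "cartesian (GSet G) p q dia bang"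
  using cartesian_Fun[OF cartesian_set[OF assms(1)] assms(2)] unfolding GSet_def by blast


section \<open>Symmetric monoidal categories and their coalgebras\<close>

text \<open>The part of the monoidal structure of a target that enters the composition of monoidal
  transformations.  The tensor product of two objects may fail to be an object.  In \<open>Cog A\<close> the products
  that occur are isomorphic to values of a monoidal functor, and it is along these isomorphisms that
  they are seen to be coalgebras.\<close>

locale tensor_category = category S for S :: "('o, 'm) smc" (structure) +
  assumes tar_hom_part: "\<lbrakk>f \<in> hom S a a'; g \<in> hom S b b'; a \<odot> b \<in> obj S; a' \<odot> b' \<in> obj S\<rbrakk>
      \<Longrightarrow> f \<otimes> g \<in> hom S (a \<odot> b) (a' \<odot> b')"
    and tar_idn_part: "\<lbrakk>a \<in> obj S; b \<in> obj S\<rbrakk> \<Longrightarrow> idn S a \<otimes> idn S b = idn S (a \<odot> b)"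
    and tar_cmp_part: "\<lbrakk>f \<in> hom S a a'; f' \<in> hom S a' a''; g \<in> hom S b b'; g' \<in> hom S b' b''\<rbrakk>
      \<Longrightarrow> (f' \<cdot> f) \<otimes> (g' \<cdot> g) = (f' \<otimes> g') \<cdot> (f \<otimes> g)"

locale smc = symmetric_monoidal A for A :: "('o, 'm) smc" (structure)
begin

lemma is_tensor_category: "tensor_category A"
  by unfold_locales (auto intro: tar_hom tar_idn tar_cmp)

lemma tensor_simps [simp]:
  assumes "f \<in> arr A" "g \<in> arr A"
  shows "f \<otimes> g \<in> arr A" "src A (f \<otimes> g) = src A f \<odot> src A g" "tgt A (f \<otimes> g) = tgt A f \<odot> tgt A g"
  using tar_hom[of f "src A f" "tgt A f" g "src A g" "tgt A g"] assms by (simp_all add: in_hom)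

declare tob_obj [simp] tunit_obj [simp] tar_idn [simp] associator_iso [simp] lunitor_iso [simp]
  runitor_iso [simp]

lemma structure_arrows [simp]:
  assumes "a \<in> obj A"
  shows "lunitor A a \<in> arr A" "src A (lunitor A a) = tunit A \<odot> a" "tgt A (lunitor A a) = a"
    "runitor A a \<in> arr A" "src A (runitor A a) = a \<odot> tunit A" "tgt A (runitor A a) = a"
  using lunitor_hom[OF assms] runitor_hom[OF assms] by (simp_all add: in_hom)

lemma braiding_simps [simp]:
  assumes "a \<in> obj A" "b \<in> obj A"
  shows "braiding A a b \<in> arr A" "src A (braiding A a b) = a \<odot> b" "tgt A (braiding A a b) = b \<odot> a"
  using braiding_hom[OF assms] by (simp_all add: in_hom)

lemma associator_simps [simp]:
  assumes "a \<in> obj A" "b \<in> obj A" "c \<in> obj A"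
  shows "associator A a b c \<in> arr A" "src A (associator A a b c) = (a \<odot> b) \<odot> c"
    "tgt A (associator A a b c) = a \<odot> (b \<odot> c)"
  using associator_hom[OF assms] by (simp_all add: in_hom)

lemma interchange:
  assumes "f \<in> arr A" "f' \<in> arr A" "tgt A f = src A f'" "g \<in> arr A" "g' \<in> arr A" "tgt A g = src A g'"
  shows "(f' \<otimes> g') \<cdot> (f \<otimes> g) = (f' \<cdot> f) \<otimes> (g' \<cdot> g)"
  using tar_cmp[of f "src A f" "tgt A f" f' "tgt A f'" g "src A g" "tgt A g" g' "tgt A g'"] assms
  by (simp add: in_hom)

lemma interchange_push:
  assumes "f \<in> arr A" "f' \<in> arr A" "tgt A f = src A f'" "g \<in> arr A" "g' \<in> arr A" "tgt A g = src A g'"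
    "x \<in> arr A" "tgt A x = src A f \<odot> src A g"
  shows "(f' \<otimes> g') \<cdot> ((f \<otimes> g) \<cdot> x) = ((f' \<cdot> f) \<otimes> (g' \<cdot> g)) \<cdot> x"
  using assms by (intro push2[OF interchange]) simp_all

lemma tensor_iso [simp]:
  assumes "iso_arr A f" "iso_arr A g"
  shows "iso_arr A (f \<otimes> g)"
  using assms iso_arr_in[OF assms(1)] iso_arr_in[OF assms(2)]
  by (intro iso_arrI[where g = "inv_arr A f \<otimes> inv_arr A g"]) (simp_all add: interchange)

lemma associator_natural:
  assumes "f \<in> arr A" "g \<in> arr A" "h \<in> arr A"
  shows "associator A (tgt A f) (tgt A g) (tgt A h) \<cdot> ((f \<otimes> g) \<otimes> h)
    = (f \<otimes> (g \<otimes> h)) \<cdot> associator A (src A f) (src A g) (src A h)"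
  using associator_nat[of f "src A f" "tgt A f" g "src A g" "tgt A g" h "src A h" "tgt A h"] assms
  by (simp add: in_hom)

lemma inv_associator_natural:
  assumes "f \<in> arr A" "g \<in> arr A" "h \<in> arr A"
  shows "inv_arr A (associator A (tgt A f) (tgt A g) (tgt A h)) \<cdot> (f \<otimes> (g \<otimes> h))
    = ((f \<otimes> g) \<otimes> h) \<cdot> inv_arr A (associator A (src A f) (src A g) (src A h))"
proof (rule iso_cancel[where j = "associator A (tgt A f) (tgt A g) (tgt A h)"])
  have "associator A (tgt A f) (tgt A g) (tgt A h) \<cdot>
      (((f \<otimes> g) \<otimes> h) \<cdot> inv_arr A (associator A (src A f) (src A g) (src A h)))
    = (f \<otimes> (g \<otimes> h)) \<cdot> associator A (src A f) (src A g) (src A h)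
        \<cdot> inv_arr A (associator A (src A f) (src A g) (src A h))"
    using assms by (simp add: push2[OF associator_natural])
  then show "associator A (tgt A f) (tgt A g) (tgt A h) \<cdot>
      (inv_arr A (associator A (tgt A f) (tgt A g) (tgt A h)) \<cdot> (f \<otimes> (g \<otimes> h)))
    = associator A (tgt A f) (tgt A g) (tgt A h) \<cdot>
      (((f \<otimes> g) \<otimes> h) \<cdot> inv_arr A (associator A (src A f) (src A g) (src A h)))"
    using assms by simp
qed (use assms in simp_all)

lemma braiding_natural:
  assumes "f \<in> arr A" "g \<in> arr A"
  shows "braiding A (tgt A f) (tgt A g) \<cdot> (f \<otimes> g) = (g \<otimes> f) \<cdot> braiding A (src A f) (src A g)"
  using braiding_nat[of f "src A f" "tgt A f" g "src A g" "tgt A g"] assms by (simp add: in_hom)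

lemma lunitor_natural:
  "f \<in> arr A \<Longrightarrow> lunitor A (tgt A f) \<cdot> (idn A (tunit A) \<otimes> f) = f \<cdot> lunitor A (src A f)"
  using lunitor_nat[of f "src A f" "tgt A f"] by (simp add: in_hom)

text \<open>The interchange of the middle factors is composed of two associators around this exchange.\<close>

definition inner_swap :: "'o \<Rightarrow> 'o \<Rightarrow> 'm" where
  "inner_swap a b = associator A b a b \<cdot> ((braiding A a b \<otimes> idn A b) \<cdot> inv_arr A (associator A a b b))"

lemma inner_swap_simps [simp]:
  assumes "a \<in> obj A" "b \<in> obj A"
  shows "inner_swap a b \<in> arr A" "src A (inner_swap a b) = a \<odot> (b \<odot> b)"
    "tgt A (inner_swap a b) = b \<odot> (a \<odot> b)"
  using assms by (simp_all add: inner_swap_def)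

lemma inner_swap_natural:
  assumes "f \<in> arr A" "g \<in> arr A"
  shows "inner_swap (tgt A f) (tgt A g) \<cdot> (f \<otimes> (g \<otimes> g)) = (g \<otimes> (f \<otimes> g)) \<cdot> inner_swap (src A f) (src A g)"
proof -
  let ?x = "tgt A f" and ?y = "tgt A g" and ?a = "src A f" and ?b = "src A g"
  have b: "(braiding A ?x ?y \<otimes> idn A ?y) \<cdot> ((f \<otimes> g) \<otimes> g)
      = ((g \<otimes> f) \<otimes> g) \<cdot> (braiding A ?a ?b \<otimes> idn A ?b)"
    using assms by (simp add: interchange braiding_natural)
  have "inner_swap ?x ?y \<cdot> (f \<otimes> (g \<otimes> g)) = associator A ?y ?x ?y \<cdot> ((braiding A ?x ?y \<otimes> idn A ?y)
      \<cdot> (((f \<otimes> g) \<otimes> g) \<cdot> inv_arr A (associator A ?a ?b ?b)))"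
    using assms by (simp add: inner_swap_def inv_associator_natural)
  also have "\<dots> = associator A ?y ?x ?y \<cdot> (((g \<otimes> f) \<otimes> g) \<cdot>
      ((braiding A ?a ?b \<otimes> idn A ?b) \<cdot> inv_arr A (associator A ?a ?b ?b)))"
    using assms by (subst push2[OF b]) simp_all
  also have "\<dots> = (g \<otimes> (f \<otimes> g)) \<cdot> inner_swap ?a ?b"
    using assms by (subst push2[OF associator_natural]) (simp_all add: inner_swap_def)
  finally show ?thesis .
qed

lemma middle_swap_eq:
  assumes "a \<in> obj A" "b \<in> obj A"
  shows "middle_swap A a b = inv_arr A (associator A a b (a \<odot> b)) \<cdot>
    ((idn A a \<otimes> inner_swap a b) \<cdot> associator A a a (b \<odot> b))"
  using assms by (simp add: middle_swap_def inner_swap_def)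

lemma middle_swap_simps [simp]:
  assumes "a \<in> obj A" "b \<in> obj A"
  shows "middle_swap A a b \<in> arr A" "src A (middle_swap A a b) = (a \<odot> a) \<odot> (b \<odot> b)"
    "tgt A (middle_swap A a b) = (a \<odot> b) \<odot> (a \<odot> b)"
  using assms by (simp_all add: middle_swap_eq)

text \<open>Naturality passes through the two outer associators and the exchange between them.  It makes
  tensor products of coalgebra maps coalgebra maps.\<close>

lemma middle_swap_natural:
  assumes "f \<in> arr A" "g \<in> arr A"
  shows "middle_swap A (tgt A f) (tgt A g) \<cdot> ((f \<otimes> f) \<otimes> (g \<otimes> g))
    = ((f \<otimes> g) \<otimes> (f \<otimes> g)) \<cdot> middle_swap A (src A f) (src A g)"
proof -
  let ?x = "tgt A f" and ?y = "tgt A g" and ?a = "src A f" and ?b = "src A g"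
  have "middle_swap A ?x ?y \<cdot> ((f \<otimes> f) \<otimes> (g \<otimes> g))
    = inv_arr A (associator A ?x ?y (?x \<odot> ?y)) \<cdot> ((idn A ?x \<otimes> inner_swap ?x ?y)
        \<cdot> (associator A (tgt A f) (tgt A f) (tgt A (g \<otimes> g)) \<cdot> ((f \<otimes> f) \<otimes> (g \<otimes> g))))"
    using assms by (simp add: middle_swap_eq)
  also have "\<dots> = inv_arr A (associator A ?x ?y (?x \<odot> ?y)) \<cdot>
      ((f \<otimes> (inner_swap ?x ?y \<cdot> (f \<otimes> (g \<otimes> g)))) \<cdot> associator A ?a ?a (?b \<odot> ?b))"
    using assms by (subst associator_natural) (simp_all add: interchange_push)
  also have "\<dots> = inv_arr A (associator A (tgt A f) (tgt A g) (tgt A (f \<otimes> g))) \<cdot>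
      ((f \<otimes> (g \<otimes> (f \<otimes> g))) \<cdot> ((idn A ?a \<otimes> inner_swap ?a ?b) \<cdot> associator A ?a ?a (?b \<odot> ?b)))"
    using assms by (simp add: inner_swap_natural interchange_push)
  also have "\<dots> = ((f \<otimes> g) \<otimes> (f \<otimes> g)) \<cdot> middle_swap A ?a ?b"
    using assms by (subst push2[OF inv_associator_natural]) (simp_all add: middle_swap_eq)
  finally show ?thesis .
qed

end


subsection \<open>Coalgebras\<close>

lemma Cog_simps [simp]:
  "obj (Cog A) = {x. is_coalg A x}"
  "src (Cog A) (x, f, y) = x" "tgt (Cog A) (x, f, y) = y"
  "(x, f, y) \<in> arr (Cog A) \<longleftrightarrow> is_coalg_arr A x f y"
  "idn (Cog A) x = (x, idn A (carrier x), x)"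
  "(y', g, z) \<cdot>\<^bsub>Cog A\<^esub> (x, f, y) = (x, g \<cdot>\<^bsub>A\<^esub> f, z)"
  "tob (Cog A) = tensor_coalg A" "tunit (Cog A) = unit_coalg A"
  "(x, f, x') \<otimes>\<^bsub>Cog A\<^esub> (y, g, y') = (tensor_coalg A x y, f \<otimes>\<^bsub>A\<^esub> g, tensor_coalg A x' y')"
  "associator (Cog A) x y z = (tensor_coalg A (tensor_coalg A x y) z,
        associator A (carrier x) (carrier y) (carrier z), tensor_coalg A x (tensor_coalg A y z))"
  "lunitor (Cog A) x = (tensor_coalg A (unit_coalg A) x, lunitor A (carrier x), x)"
  "runitor (Cog A) x = (tensor_coalg A x (unit_coalg A), runitor A (carrier x), x)"
  "braiding (Cog A) x y = (tensor_coalg A x y, braiding A (carrier x) (carrier y), tensor_coalg A y x)"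
  by (simp_all add: Cog_def)

lemma tensor_coalg_simps [simp]:
  "carrier (tensor_coalg A x y) = carrier x \<odot>\<^bsub>A\<^esub> carrier y"
  "comult (tensor_coalg A x y) = middle_swap A (carrier x) (carrier y) \<cdot>\<^bsub>A\<^esub> (comult x \<otimes>\<^bsub>A\<^esub> comult y)"
  "counit (tensor_coalg A x y) = lunitor A (tunit A) \<cdot>\<^bsub>A\<^esub> (counit x \<otimes>\<^bsub>A\<^esub> counit y)"
  "carrier (unit_coalg A) = tunit A" "comult (unit_coalg A) = inv_arr A (lunitor A (tunit A))"
  "counit (unit_coalg A) = idn A (tunit A)"
  by (simp_all add: tensor_coalg_def unit_coalg_def)

lemma Cog_homE:
  assumes "f \<in> hom (Cog A) x y"
  obtains f' where "f = (x, f', y)" "is_coalg_arr A x f' y"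
  using assms by (auto simp: Cog_def in_hom)

lemma Cog_hom [simp]: "(x, f, y) \<in> hom (Cog A) x' y' \<longleftrightarrow> x = x' \<and> y = y' \<and> is_coalg_arr A x f y"
  by (auto simp: in_hom)

text \<open>The underlying arrow of an arrow of coalgebras.\<close>

abbreviation und :: "('o, 'm) coalg_arr \<Rightarrow> 'm" where
  "und f \<equiv> fst (snd f)"

context smc
begin

lemma coalg_simps:
  assumes "is_coalg A x"
  shows "carrier x \<in> obj A" "comult x \<in> arr A" "src A (comult x) = carrier x"
    "tgt A (comult x) = carrier x \<odot> carrier x" "counit x \<in> arr A" "src A (counit x) = carrier x"
    "tgt A (counit x) = tunit A"
  using assms by (auto simp: is_coalg_def Let_def in_hom)

lemma coalg_laws:
  assumes "is_coalg A x"
  shows "associator A (carrier x) (carrier x) (carrier x) \<cdot> ((comult x \<otimes> idn A (carrier x)) \<cdot> comult x)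
      = (idn A (carrier x) \<otimes> comult x) \<cdot> comult x"
    "lunitor A (carrier x) \<cdot> ((counit x \<otimes> idn A (carrier x)) \<cdot> comult x) = idn A (carrier x)"
    "runitor A (carrier x) \<cdot> ((idn A (carrier x) \<otimes> counit x) \<cdot> comult x) = idn A (carrier x)"
    "braiding A (carrier x) (carrier x) \<cdot> comult x = comult x"
  using assms coalg_simps[OF assms] unfolding is_coalg_def Let_def by simp_all

lemma coalgI:
  assumes "carrier x \<in> obj A" "comult x \<in> hom A (carrier x) (carrier x \<odot> carrier x)"
    "counit x \<in> hom A (carrier x) (tunit A)"
    "associator A (carrier x) (carrier x) (carrier x) \<cdot> ((comult x \<otimes> idn A (carrier x)) \<cdot> comult x)
      = (idn A (carrier x) \<otimes> comult x) \<cdot> comult x"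
    "lunitor A (carrier x) \<cdot> ((counit x \<otimes> idn A (carrier x)) \<cdot> comult x) = idn A (carrier x)"
    "runitor A (carrier x) \<cdot> ((idn A (carrier x) \<otimes> counit x) \<cdot> comult x) = idn A (carrier x)"
    "braiding A (carrier x) (carrier x) \<cdot> comult x = comult x"
  shows "is_coalg A x"
  using assms by (simp add: is_coalg_def Let_def in_hom)

lemma coalg_arr_simps:
  assumes "is_coalg_arr A x f y"
  shows "f \<in> arr A" "src A f = carrier x" "tgt A f = carrier y"
    "(f \<otimes> f) \<cdot> comult x = comult y \<cdot> f" "counit y \<cdot> f = counit x"
  using assms by (auto simp: is_coalg_arr_def in_hom)

lemma coalg_arr_coalgs:
  assumes "is_coalg_arr A x f y"
  shows "is_coalg A x" "is_coalg A y"
  using assms by (auto simp: is_coalg_arr_def)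

lemma category_Cog: "category (Cog A)"
proof
  fix f assume "f \<in> arr (Cog A)"
  then show "src (Cog A) f \<in> obj (Cog A)" "tgt (Cog A) f \<in> obj (Cog A)"
    by (auto simp: Cog_def is_coalg_arr_def)
next
  fix x assume "x \<in> obj (Cog A)"
  then show "idn (Cog A) x \<in> hom (Cog A) x x"
    using coalg_simps[of x] by (simp add: is_coalg_arr_def in_hom)
next
  fix f g h x y z w
  assume f: "f \<in> hom (Cog A) x y"
  then obtain f' where f': "f = (x, f', y)" "is_coalg_arr A x f' y" by (rule Cog_homE)
  note [simp] = coalg_arr_simps[OF f'(2)] coalg_simps[OF coalg_arr_coalgs(1)[OF f'(2)]]
    coalg_simps[OF coalg_arr_coalgs(2)[OF f'(2)]]
  show "f \<cdot>\<^bsub>Cog A\<^esub> idn (Cog A) x = f" "idn (Cog A) y \<cdot>\<^bsub>Cog A\<^esub> f = f"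
    by (simp_all add: f'(1))
  assume g: "g \<in> hom (Cog A) y z"
  then obtain g' where g': "g = (y, g', z)" "is_coalg_arr A y g' z" by (rule Cog_homE)
  note [simp] = coalg_arr_simps[OF g'(2)] coalg_simps[OF coalg_arr_coalgs(2)[OF g'(2)]]
  have "((g' \<cdot> f') \<otimes> (g' \<cdot> f')) \<cdot> comult x = (g' \<otimes> g') \<cdot> ((f' \<otimes> f') \<cdot> comult x)"
    by (subst interchange_push) simp_all
  also have "\<dots> = comult z \<cdot> (g' \<cdot> f')" by (simp add: push2[OF coalg_arr_simps(4)[OF g'(2)]])
  finally have "is_coalg_arr A x (g' \<cdot> f') z"
    using coalg_arr_coalgs[OF f'(2)] coalg_arr_coalgs[OF g'(2)]
    by (simp add: is_coalg_arr_def in_hom push2[OF coalg_arr_simps(5)[OF g'(2)]])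
  then show "g \<cdot>\<^bsub>Cog A\<^esub> f \<in> hom (Cog A) x z" by (simp add: f'(1) g'(1))
  assume "h \<in> hom (Cog A) z w"
  then obtain h' where h': "h = (z, h', w)" "is_coalg_arr A z h' w" by (rule Cog_homE)
  show "h \<cdot>\<^bsub>Cog A\<^esub> g \<cdot>\<^bsub>Cog A\<^esub> f = h \<cdot>\<^bsub>Cog A\<^esub> (g \<cdot>\<^bsub>Cog A\<^esub> f)"
    by (simp add: f'(1) g'(1) h'(1) coalg_arr_simps[OF h'(2)])
qed

lemma tensor_category_Cog: "tensor_category (Cog A)"
proof -
  interpret Cog: category "Cog A" by (rule category_Cog)
  show ?thesis
  proof
    fix f g x x' y y'
    assume "f \<in> hom (Cog A) x x'" "g \<in> hom (Cog A) y y'"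
    then obtain f' g' where f: "f = (x, f', x')" "is_coalg_arr A x f' x'"
        and g: "g = (y, g', y')" "is_coalg_arr A y g' y'"
      by (auto elim!: Cog_homE)
    assume xy: "x \<odot>\<^bsub>Cog A\<^esub> y \<in> obj (Cog A)" "x' \<odot>\<^bsub>Cog A\<^esub> y' \<in> obj (Cog A)"
    note [simp] = coalg_arr_simps[OF f(2)] coalg_simps[OF coalg_arr_coalgs(1)[OF f(2)]]
      coalg_simps[OF coalg_arr_coalgs(2)[OF f(2)]] coalg_arr_simps[OF g(2)]
      coalg_simps[OF coalg_arr_coalgs(1)[OF g(2)]] coalg_simps[OF coalg_arr_coalgs(2)[OF g(2)]]
    have "((f' \<otimes> g') \<otimes> (f' \<otimes> g')) \<cdot> (middle_swap A (carrier x) (carrier y) \<cdot> (comult x \<otimes> comult y))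
        = middle_swap A (carrier x') (carrier y') \<cdot> (((f' \<otimes> f') \<otimes> (g' \<otimes> g')) \<cdot> (comult x \<otimes> comult y))"
      using middle_swap_natural[of f' g'] by (simp flip: assoc)
    also have "\<dots> = middle_swap A (carrier x') (carrier y') \<cdot> ((comult x' \<otimes> comult y') \<cdot> (f' \<otimes> g'))"
      by (simp add: interchange)
    finally show "f \<otimes>\<^bsub>Cog A\<^esub> g \<in> hom (Cog A) (x \<odot>\<^bsub>Cog A\<^esub> y) (x' \<odot>\<^bsub>Cog A\<^esub> y')"
      using xy by (simp add: f(1) g(1) is_coalg_arr_def in_hom interchange)
  next
    fix x y assume "x \<in> obj (Cog A)" "y \<in> obj (Cog A)"
    then show "idn (Cog A) x \<otimes>\<^bsub>Cog A\<^esub> idn (Cog A) y = idn (Cog A) (x \<odot>\<^bsub>Cog A\<^esub> y)"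
      by (simp add: coalg_simps)
  next
    fix f f' g g' x x' x'' y y' y''
    assume "f \<in> hom (Cog A) x x'" "f' \<in> hom (Cog A) x' x''" "g \<in> hom (Cog A) y y'"
      "g' \<in> hom (Cog A) y' y''"
    then show "(f' \<cdot>\<^bsub>Cog A\<^esub> f) \<otimes>\<^bsub>Cog A\<^esub> (g' \<cdot>\<^bsub>Cog A\<^esub> g)
      = (f' \<otimes>\<^bsub>Cog A\<^esub> g') \<cdot>\<^bsub>Cog A\<^esub> (f \<otimes>\<^bsub>Cog A\<^esub> g)"
      by (auto elim!: Cog_homE simp: coalg_arr_simps interchange)
  qed
qed

lemma iso_Cog:
  assumes f: "is_coalg_arr A x f y" and iso: "iso_arr A f"
  shows "iso_arr (Cog A) (x, f, y)"
proof -
  interpret Cog: category "Cog A" by (rule category_Cog)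
  note [simp] = coalg_arr_simps(1-3)[OF f] coalg_simps[OF coalg_arr_coalgs(1)[OF f]]
      coalg_simps[OF coalg_arr_coalgs(2)[OF f]] iso
  let ?g = "inv_arr A f"
  have "(?g \<otimes> ?g) \<cdot> comult y = (?g \<otimes> ?g) \<cdot> (comult y \<cdot> f) \<cdot> ?g" by simp
  also have "\<dots> = (?g \<otimes> ?g) \<cdot> ((f \<otimes> f) \<cdot> comult x) \<cdot> ?g" by (simp only: coalg_arr_simps(4)[OF f])
  also have "\<dots> = comult x \<cdot> ?g" by (simp add: interchange_push)
  finally have "(?g \<otimes> ?g) \<cdot> comult y = comult x \<cdot> ?g" .
  moreover have "counit x \<cdot> ?g = counit y" by (simp flip: coalg_arr_simps(5)[OF f])
  ultimately have g: "is_coalg_arr A y ?g x"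
    using coalg_arr_coalgs[OF f] by (simp add: is_coalg_arr_def in_hom)
  show ?thesis by (rule Cog.iso_arrI[where g = "(y, ?g, x)"]) (use f g in simp_all)
qed

text \<open>Each axiom for \<open>x\<close>, composed with a tensor power of the isomorphism \<open>j\<close>, becomes the axiom for \<open>y\<close>
  composed with \<open>j\<close>.\<close>

lemma transport_coalg:
  assumes y: "is_coalg A y" and iso: "iso_arr A j" and j: "j \<in> hom A (carrier x) (carrier y)"
    and d: "comult x \<in> hom A (carrier x) (carrier x \<odot> carrier x)" "(j \<otimes> j) \<cdot> comult x = comult y \<cdot> j"
    and e: "counit x \<in> hom A (carrier x) (tunit A)" "counit y \<cdot> j = counit x"
  shows "is_coalg_arr A x j y"
proof -
  let ?x = "carrier x" and ?y = "carrier y" and ?d = "comult x"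
  note y' [simp] = coalg_simps[OF y] iso
  have [simp]: "j \<in> arr A" "src A j = ?x" "tgt A j = ?y" using j by (simp_all add: in_hom)
  have [simp]: "?x \<in> obj A" using \<open>j \<in> arr A\<close> src_in by fastforce
  have [simp]: "?d \<in> arr A" "src A ?d = ?x" "tgt A ?d = ?x \<odot> ?x"
    "counit x \<in> arr A" "src A (counit x) = ?x" "tgt A (counit x) = tunit A"
    using d(1) e(1) by (simp_all add: in_hom)
  have x: "is_coalg A x"
  proof (rule coalgI)
    have "(j \<otimes> (j \<otimes> j)) \<cdot> (associator A ?x ?x ?x \<cdot> ((?d \<otimes> idn A ?x) \<cdot> ?d))
      = associator A ?y ?y ?y \<cdot> ((((j \<otimes> j) \<cdot> ?d) \<otimes> j) \<cdot> ?d)"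
      using push2[OF associator_natural[of j j j], of "(?d \<otimes> idn A ?x) \<cdot> ?d"]
      by (simp add: interchange_push)
    also have "\<dots> = associator A ?y ?y ?y \<cdot> ((comult y \<otimes> idn A ?y) \<cdot> ((j \<otimes> j) \<cdot> ?d))"
      by (subst interchange_push) (simp_all add: d(2))
    also have "\<dots> = (idn A ?y \<otimes> comult y) \<cdot> (comult y \<cdot> j)"
      using push3[OF coalg_laws(1)[OF y]] by (simp add: d(2))
    also have "\<dots> = (j \<otimes> ((j \<otimes> j) \<cdot> ?d)) \<cdot> ?d" by (simp add: interchange_push flip: d(2))
    also have "\<dots> = (j \<otimes> (j \<otimes> j)) \<cdot> ((idn A ?x \<otimes> ?d) \<cdot> ?d)" by (simp add: interchange_push)
    finally show "associator A ?x ?x ?x \<cdot> ((?d \<otimes> idn A ?x) \<cdot> ?d) = (idn A ?x \<otimes> ?d) \<cdot> ?d"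
      by (rule iso_cancel[rotated 5]) simp_all
    have "j \<cdot> (lunitor A ?x \<cdot> ((counit x \<otimes> idn A ?x) \<cdot> ?d))
      = lunitor A ?y \<cdot> ((idn A (tunit A) \<otimes> j) \<cdot> ((counit x \<otimes> idn A ?x) \<cdot> ?d))"
      using lunitor_natural[of j] by (simp flip: assoc)
    also have "\<dots> = lunitor A ?y \<cdot> ((counit y \<otimes> idn A ?y) \<cdot> ((j \<otimes> j) \<cdot> ?d))"
      by (simp add: interchange_push flip: e(2))
    also have "\<dots> = j \<cdot> idn A ?x" using push3[OF coalg_laws(2)[OF y]] by (simp add: d(2))
    finally show "lunitor A ?x \<cdot> ((counit x \<otimes> idn A ?x) \<cdot> ?d) = idn A ?x"
      by (rule iso_cancel[rotated 5]) simp_all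
    have "j \<cdot> (runitor A ?x \<cdot> ((idn A ?x \<otimes> counit x) \<cdot> ?d))
      = runitor A ?y \<cdot> ((j \<otimes> idn A (tunit A)) \<cdot> ((idn A ?x \<otimes> counit x) \<cdot> ?d))"
      using runitor_nat[OF j] by (simp flip: assoc)
    also have "\<dots> = runitor A ?y \<cdot> ((idn A ?y \<otimes> counit y) \<cdot> ((j \<otimes> j) \<cdot> ?d))"
      by (simp add: interchange_push flip: e(2))
    also have "\<dots> = j \<cdot> idn A ?x" using push3[OF coalg_laws(3)[OF y]] by (simp add: d(2))
    finally show "runitor A ?x \<cdot> ((idn A ?x \<otimes> counit x) \<cdot> ?d) = idn A ?x"
      by (rule iso_cancel[rotated 5]) simp_all
    have "(j \<otimes> j) \<cdot> (braiding A ?x ?x \<cdot> ?d) = braiding A ?y ?y \<cdot> ((j \<otimes> j) \<cdot> ?d)"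
      using braiding_natural[of j j] by (simp flip: assoc)
    also have "\<dots> = (j \<otimes> j) \<cdot> ?d" using push2[OF coalg_laws(4)[OF y]] by (simp add: d(2))
    finally show "braiding A ?x ?x \<cdot> ?d = ?d" by (rule iso_cancel[rotated 5]) simp_all
  qed (use d e in simp_all)
  with y j d e show ?thesis by (simp add: is_coalg_arr_def)
qed

end


section \<open>Lifting monoidal functors to coalgebras\<close>

lemma sm_functorD:
  assumes "sm_functor R S F"
  shows "is_functor R S F" "mu F \<in> extensional (obj R \<times> obj R)"
    "\<And>a b. \<lbrakk>a \<in> obj R; b \<in> obj R\<rbrakk> \<Longrightarrow> mu F (a, b) \<in> hom S (fobj F a \<odot>\<^bsub>S\<^esub> fobj F b) (fobj F (a \<odot>\<^bsub>R\<^esub> b))"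
    "\<And>a b. \<lbrakk>a \<in> obj R; b \<in> obj R\<rbrakk> \<Longrightarrow> iso_arr S (mu F (a, b))"
    "eta F \<in> hom S (tunit S) (fobj F (tunit R))" "iso_arr S (eta F)"
    "\<And>f g. \<lbrakk>f \<in> arr R; g \<in> arr R\<rbrakk> \<Longrightarrow>
        mu F (tgt R f, tgt R g) \<cdot>\<^bsub>S\<^esub> (farr F f \<otimes>\<^bsub>S\<^esub> farr F g) = farr F (f \<otimes>\<^bsub>R\<^esub> g) \<cdot>\<^bsub>S\<^esub> mu F (src R f, src R g)"
    "\<And>a b c. \<lbrakk>a \<in> obj R; b \<in> obj R; c \<in> obj R\<rbrakk> \<Longrightarrow>
        farr F (associator R a b c) \<cdot>\<^bsub>S\<^esub> mu F (a \<odot>\<^bsub>R\<^esub> b, c) \<cdot>\<^bsub>S\<^esub> (mu F (a, b) \<otimes>\<^bsub>S\<^esub> idn S (fobj F c))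
        = mu F (a, b \<odot>\<^bsub>R\<^esub> c) \<cdot>\<^bsub>S\<^esub> (idn S (fobj F a) \<otimes>\<^bsub>S\<^esub> mu F (b, c))
            \<cdot>\<^bsub>S\<^esub> associator S (fobj F a) (fobj F b) (fobj F c)"
    "\<And>a. a \<in> obj R \<Longrightarrow>
        farr F (lunitor R a) \<cdot>\<^bsub>S\<^esub> mu F (tunit R, a) \<cdot>\<^bsub>S\<^esub> (eta F \<otimes>\<^bsub>S\<^esub> idn S (fobj F a)) = lunitor S (fobj F a)"
    "\<And>a. a \<in> obj R \<Longrightarrow>
        farr F (runitor R a) \<cdot>\<^bsub>S\<^esub> mu F (a, tunit R) \<cdot>\<^bsub>S\<^esub> (idn S (fobj F a) \<otimes>\<^bsub>S\<^esub> eta F) = runitor S (fobj F a)"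
    "\<And>a b. \<lbrakk>a \<in> obj R; b \<in> obj R\<rbrakk> \<Longrightarrow>
        farr F (braiding R a b) \<cdot>\<^bsub>S\<^esub> mu F (a, b) = mu F (b, a) \<cdot>\<^bsub>S\<^esub> braiding S (fobj F a) (fobj F b)"
  using assms unfolding sm_functor_def by simp_all

text \<open>The diagonal and the map to the unit make each object of a cartesian category a coalgebra, and
  a strong monoidal functor \<open>F\<close> carries this structure to \<open>F a\<close>.\<close>

definition lift_obj ::
  "('o \<Rightarrow> 'm) \<Rightarrow> ('o \<Rightarrow> 'm) \<Rightarrow> ('p, 'n) smc \<Rightarrow> ('o, 'm, 'p, 'n) smfun \<Rightarrow> 'o \<Rightarrow> ('p, 'n) coalg" where
  "lift_obj dia bang A F a = \<lparr>
     carrier = fobj F a,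
     comult = inv_arr A (mu F (a, a)) \<cdot>\<^bsub>A\<^esub> farr F (dia a),
     counit = inv_arr A (eta F) \<cdot>\<^bsub>A\<^esub> farr F (bang a)\<rparr>"

definition lift ::
  "('o, 'm) smc \<Rightarrow> ('o \<Rightarrow> 'm) \<Rightarrow> ('o \<Rightarrow> 'm) \<Rightarrow> ('p, 'n) smc \<Rightarrow> ('o, 'm, 'p, 'n) smfun
    \<Rightarrow> ('o, 'm, ('p, 'n) coalg, ('p, 'n) coalg_arr) smfun" where
  "lift R dia bang A F = (let L = lift_obj dia bang A F in \<lparr>
     fobj = \<lambda>a\<in>obj R. L a,
     farr = \<lambda>f\<in>arr R. (L (src R f), farr F f, L (tgt R f)),
     mu = \<lambda>(a, b)\<in>obj R \<times> obj R. (tensor_coalg A (L a) (L b), mu F (a, b), L (a \<odot>\<^bsub>R\<^esub> b)),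
     eta = (unit_coalg A, eta F, L (tunit R))\<rparr>)"

locale monoidal_on_cartesian = R: cartesian R p q dia bang + A: smc A
  for R :: "('o, 'm) smc" and p q dia bang and A :: "('p, 'n) smc" (structure) +
  fixes F :: "('o, 'm, 'p, 'n) smfun"
  assumes F: "sm_functor R A F"
begin

abbreviation m where "m a b \<equiv> mu F (a, b)"

abbreviation "I \<equiv> tunit A"

abbreviation "\<Delta> a \<equiv> comult (lift_obj dia bang A F a)"

abbreviation "\<epsilon> a \<equiv> counit (lift_obj dia bang A F a)"

lemmas F_simps [simp] = functor_simps[OF sm_functorD(1)[OF F]]

lemma m_simps [simp]:
  assumes "a \<in> obj R" "b \<in> obj R"
  shows "m a b \<in> arr A" "src A (m a b) = fobj F a \<odot> fobj F b" "tgt A (m a b) = fobj F (a \<odot>\<^bsub>R\<^esub> b)"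
    "iso_arr A (m a b)"
  using sm_functorD(3,4)[OF F assms] by (simp_all add: in_hom)

lemma n_simps [simp]:
  "eta F \<in> arr A" "src A (eta F) = I" "tgt A (eta F) = fobj F (tunit R)" "iso_arr A (eta F)"
  using sm_functorD(5,6)[OF F] by (simp_all add: in_hom)

lemma m_natural:
  assumes "f \<in> arr R" "g \<in> arr R"
  shows "m (tgt R f) (tgt R g) \<cdot> (farr F f \<otimes> farr F g) = farr F (f \<otimes>\<^bsub>R\<^esub> g) \<cdot> m (src R f) (src R g)"
  by (rule sm_functorD(7)[OF F assms])

lemma m_assoc:
  assumes "a \<in> obj R" "b \<in> obj R" "c \<in> obj R"
  shows "farr F (associator R a b c) \<cdot> (m (a \<odot>\<^bsub>R\<^esub> b) c \<cdot> (m a b \<otimes> idn A (fobj F c)))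
    = m a (b \<odot>\<^bsub>R\<^esub> c) \<cdot> ((idn A (fobj F a) \<otimes> m b c) \<cdot> associator A (fobj F a) (fobj F b) (fobj F c))"
  using sm_functorD(8)[OF F assms] assms by simp

lemma m_unit:
  assumes "a \<in> obj R"
  shows "farr F (lunitor R a) \<cdot> (m (tunit R) a \<cdot> (eta F \<otimes> idn A (fobj F a))) = lunitor A (fobj F a)"
    "farr F (runitor R a) \<cdot> (m a (tunit R) \<cdot> (idn A (fobj F a) \<otimes> eta F)) = runitor A (fobj F a)"
  using sm_functorD(9,10)[OF F assms] assms by simp_all

lemma m_braiding:
  assumes "a \<in> obj R" "b \<in> obj R"
  shows "farr F (braiding R a b) \<cdot> m a b = m b a \<cdot> braiding A (fobj F a) (fobj F b)"
  by (rule sm_functorD(11)[OF F assms])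

lemma F_cancel [simp]:
  assumes "iso_arr R f" "x \<in> arr A"
  shows "tgt A x = fobj F (src R f) \<Longrightarrow> farr F (inv_arr R f) \<cdot> (farr F f \<cdot> x) = x"
    "tgt A x = fobj F (tgt R f) \<Longrightarrow> farr F f \<cdot> (farr F (inv_arr R f) \<cdot> x) = x"
proof -
  have f: "f \<in> arr R" using R.iso_arr_in assms by blast
  have 1: "farr F (inv_arr R f) \<cdot> farr F f = idn A (fobj F (src R f))"
    "farr F f \<cdot> farr F (inv_arr R f) = idn A (fobj F (tgt R f))"
    using F_simps(6)[of f "inv_arr R f"] F_simps(6)[of "inv_arr R f" f] f assms by simp_all
  show "tgt A x = fobj F (src R f) \<Longrightarrow> farr F (inv_arr R f) \<cdot> (farr F f \<cdot> x) = x"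
    "tgt A x = fobj F (tgt R f) \<Longrightarrow> farr F f \<cdot> (farr F (inv_arr R f) \<cdot> x) = x"
    using f assms by (simp_all add: A.push2[OF 1(1)] A.push2[OF 1(2)])
qed

text \<open>The next three lemmas show that \<open>F\<close> respects the interchange of middle factors, by following
  the associators and the braiding out of which it is composed.\<close>

lemma m_inner_swap:
  assumes "a \<in> obj R" "b \<in> obj R"
  defines "s \<equiv> associator R b a b \<cdot>\<^bsub>R\<^esub> ((braiding R a b \<otimes>\<^bsub>R\<^esub> idn R b) \<cdot>\<^bsub>R\<^esub> inv_arr R (associator R a b b))"
  shows "farr F s \<cdot> (m a (b \<odot>\<^bsub>R\<^esub> b) \<cdot> (idn A (fobj F a) \<otimes> m b b))
    = m b (a \<odot>\<^bsub>R\<^esub> b) \<cdot> ((idn A (fobj F b) \<otimes> m a b) \<cdot> A.inner_swap (fobj F a) (fobj F b))"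
proof -
  note [simp] = assms(1,2)
  let ?a = "fobj F a" and ?b = "fobj F b"
  let ?i = "inv_arr A (associator A ?a ?b ?b)"
  have 1: "farr F (inv_arr R (associator R a b b)) \<cdot> (m a (b \<odot>\<^bsub>R\<^esub> b) \<cdot> (idn A ?a \<otimes> m b b))
    = m (a \<odot>\<^bsub>R\<^esub> b) b \<cdot> ((m a b \<otimes> idn A ?b) \<cdot> ?i)"
  proof -
    have "m a (b \<odot>\<^bsub>R\<^esub> b) \<cdot> (idn A ?a \<otimes> m b b)
      = m a (b \<odot>\<^bsub>R\<^esub> b) \<cdot> ((idn A ?a \<otimes> m b b) \<cdot> associator A ?a ?b ?b) \<cdot> ?i" by simp
    also have "\<dots> = farr F (associator R a b b) \<cdot> (m (a \<odot>\<^bsub>R\<^esub> b) b \<cdot> (m a b \<otimes> idn A ?b)) \<cdot> ?i"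
      by (simp only: m_assoc assms(1,2))
    finally show ?thesis by simp
  qed
  have 2: "farr F (braiding R a b \<otimes>\<^bsub>R\<^esub> idn R b) \<cdot> (m (a \<odot>\<^bsub>R\<^esub> b) b \<cdot> (m a b \<otimes> idn A ?b))
    = m (b \<odot>\<^bsub>R\<^esub> a) b \<cdot> ((m b a \<otimes> idn A ?b) \<cdot> (braiding A ?a ?b \<otimes> idn A ?b))"
  proof -
    have "farr F (braiding R a b \<otimes>\<^bsub>R\<^esub> idn R b) \<cdot> m (a \<odot>\<^bsub>R\<^esub> b) b
      = m (b \<odot>\<^bsub>R\<^esub> a) b \<cdot> (farr F (braiding R a b) \<otimes> idn A ?b)"
      using m_natural[of "braiding R a b" "idn R b"] by simp
    then show ?thesis by (simp add: A.push2 A.interchange m_braiding)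
  qed
  have "farr F s \<cdot> (m a (b \<odot>\<^bsub>R\<^esub> b) \<cdot> (idn A ?a \<otimes> m b b)) = farr F (associator R b a b) \<cdot>
      (farr F (braiding R a b \<otimes>\<^bsub>R\<^esub> idn R b) \<cdot> (m (a \<odot>\<^bsub>R\<^esub> b) b \<cdot> ((m a b \<otimes> idn A ?b) \<cdot> ?i)))"
    by (simp add: s_def 1)
  also have "\<dots> = farr F (associator R b a b) \<cdot> (m (b \<odot>\<^bsub>R\<^esub> a) b \<cdot> ((m b a \<otimes> idn A ?b) \<cdot>
      ((braiding A ?a ?b \<otimes> idn A ?b) \<cdot> ?i)))"
    by (subst A.push3[OF 2]) simp_all
  also have "\<dots> = m b (a \<odot>\<^bsub>R\<^esub> b) \<cdot> ((idn A ?b \<otimes> m a b) \<cdot> A.inner_swap ?a ?b)"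
    by (subst A.push3[OF m_assoc]) (simp_all add: A.inner_swap_def)
  finally show ?thesis .
qed

text \<open>The comparison maps for a fourfold product that is bracketed in pairs or to the right: the outer
  associators of the interchange pass from one bracketing to the other.\<close>

lemma m_four:
  assumes "a \<in> obj R" "b \<in> obj R" "c \<in> obj R" "d \<in> obj R"
  shows "farr F (associator R a b (c \<odot>\<^bsub>R\<^esub> d)) \<cdot> (m (a \<odot>\<^bsub>R\<^esub> b) (c \<odot>\<^bsub>R\<^esub> d) \<cdot> (m a b \<otimes> m c d))
    = m a (b \<odot>\<^bsub>R\<^esub> (c \<odot>\<^bsub>R\<^esub> d)) \<cdot> ((idn A (fobj F a) \<otimes> (m b (c \<odot>\<^bsub>R\<^esub> d) \<cdot> (idn A (fobj F b) \<otimes> m c d)))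
        \<cdot> associator A (fobj F a) (fobj F b) (fobj F c \<odot> fobj F d))"
proof -
  note [simp] = assms
  have "farr F (associator R a b (c \<odot>\<^bsub>R\<^esub> d)) \<cdot> (m (a \<odot>\<^bsub>R\<^esub> b) (c \<odot>\<^bsub>R\<^esub> d) \<cdot> (m a b \<otimes> m c d))
    = farr F (associator R a b (c \<odot>\<^bsub>R\<^esub> d)) \<cdot> (m (a \<odot>\<^bsub>R\<^esub> b) (c \<odot>\<^bsub>R\<^esub> d) \<cdot>
        ((m a b \<otimes> idn A (fobj F (c \<odot>\<^bsub>R\<^esub> d))) \<cdot> (idn A (fobj F a \<odot> fobj F b) \<otimes> m c d)))"
    by (simp add: A.interchange)
  also have "\<dots> = m a (b \<odot>\<^bsub>R\<^esub> (c \<odot>\<^bsub>R\<^esub> d)) \<cdot> ((idn A (fobj F a) \<otimes> m b (c \<odot>\<^bsub>R\<^esub> d)) \<cdot>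
      (associator A (fobj F a) (fobj F b) (fobj F (c \<odot>\<^bsub>R\<^esub> d)) \<cdot> (idn A (fobj F a \<odot> fobj F b) \<otimes> m c d)))"
    by (subst A.push3[OF m_assoc]) simp_all
  also have "\<dots> = m a (b \<odot>\<^bsub>R\<^esub> (c \<odot>\<^bsub>R\<^esub> d)) \<cdot> ((idn A (fobj F a) \<otimes> m b (c \<odot>\<^bsub>R\<^esub> d)) \<cdot>
      ((idn A (fobj F a) \<otimes> (idn A (fobj F b) \<otimes> m c d)) \<cdot> associator A (fobj F a) (fobj F b) (fobj F c \<odot> fobj F d)))"
    using A.associator_natural[of "idn A (fobj F a)" "idn A (fobj F b)" "m c d"] by simp
  finally show ?thesis by (simp add: A.interchange_push)
qed

lemma m_swap:
  assumes "a \<in> obj R" "b \<in> obj R"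
  shows "farr F (middle_swap R a b) \<cdot> (m (a \<odot>\<^bsub>R\<^esub> a) (b \<odot>\<^bsub>R\<^esub> b) \<cdot> (m a a \<otimes> m b b))
    = m (a \<odot>\<^bsub>R\<^esub> b) (a \<odot>\<^bsub>R\<^esub> b) \<cdot> ((m a b \<otimes> m a b) \<cdot> middle_swap A (fobj F a) (fobj F b))"
proof -
  note [simp] = assms
  let ?a = "fobj F a" and ?b = "fobj F b"
  define s where "s = associator R b a b \<cdot>\<^bsub>R\<^esub>
    ((braiding R a b \<otimes>\<^bsub>R\<^esub> idn R b) \<cdot>\<^bsub>R\<^esub> inv_arr R (associator R a b b))"
  have [simp]: "s \<in> arr R" "src R s = a \<odot>\<^bsub>R\<^esub> (b \<odot>\<^bsub>R\<^esub> b)" "tgt R s = b \<odot>\<^bsub>R\<^esub> (a \<odot>\<^bsub>R\<^esub> b)"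
    by (simp_all add: s_def)
  let ?N = "m a (b \<odot>\<^bsub>R\<^esub> b) \<cdot> (idn A ?a \<otimes> m b b)" and ?N' = "m b (a \<odot>\<^bsub>R\<^esub> b) \<cdot> (idn A ?b \<otimes> m a b)"
  let ?Q = "m (a \<odot>\<^bsub>R\<^esub> b) (a \<odot>\<^bsub>R\<^esub> b) \<cdot> (m a b \<otimes> m a b)"
  have N: "farr F s \<cdot> ?N = ?N' \<cdot> A.inner_swap ?a ?b"
    using m_inner_swap[of a b] by (simp add: s_def)
  have i: "farr F (inv_arr R (associator R a b (a \<odot>\<^bsub>R\<^esub> b))) \<cdot> (m a (b \<odot>\<^bsub>R\<^esub> (a \<odot>\<^bsub>R\<^esub> b)) \<cdot> (idn A ?a \<otimes> ?N'))
    = ?Q \<cdot> inv_arr A (associator A ?a ?b (?a \<odot> ?b))"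
  proof -
    have "m a (b \<odot>\<^bsub>R\<^esub> (a \<odot>\<^bsub>R\<^esub> b)) \<cdot> (idn A ?a \<otimes> ?N') = m a (b \<odot>\<^bsub>R\<^esub> (a \<odot>\<^bsub>R\<^esub> b)) \<cdot> ((idn A ?a \<otimes> ?N')
        \<cdot> associator A ?a ?b (?a \<odot> ?b)) \<cdot> inv_arr A (associator A ?a ?b (?a \<odot> ?b))" by simp
    also have "\<dots> = farr F (associator R a b (a \<odot>\<^bsub>R\<^esub> b)) \<cdot> ?Q \<cdot> inv_arr A (associator A ?a ?b (?a \<odot> ?b))"
      by (simp only: m_four assms)
    finally show ?thesis by simp
  qed
  have "farr F (middle_swap R a b) \<cdot> (m (a \<odot>\<^bsub>R\<^esub> a) (b \<odot>\<^bsub>R\<^esub> b) \<cdot> (m a a \<otimes> m b b))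
    = farr F (inv_arr R (associator R a b (a \<odot>\<^bsub>R\<^esub> b))) \<cdot> (farr F (idn R a \<otimes>\<^bsub>R\<^esub> s) \<cdot>
        (m a (a \<odot>\<^bsub>R\<^esub> (b \<odot>\<^bsub>R\<^esub> b)) \<cdot> ((idn A ?a \<otimes> ?N) \<cdot> associator A ?a ?a (?b \<odot> ?b))))"
    using m_four[of a a b b] by (simp add: middle_swap_def s_def)
  also have "\<dots> = farr F (inv_arr R (associator R a b (a \<odot>\<^bsub>R\<^esub> b))) \<cdot> (m a (b \<odot>\<^bsub>R\<^esub> (a \<odot>\<^bsub>R\<^esub> b)) \<cdot>
        ((idn A ?a \<otimes> farr F s) \<cdot> ((idn A ?a \<otimes> ?N) \<cdot> associator A ?a ?a (?b \<odot> ?b))))"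
    using A.push2[OF m_natural[of "idn R a" s, symmetric], of "(idn A ?a \<otimes> ?N) \<cdot> associator A ?a ?a (?b \<odot> ?b)"]
    by simp
  also have "\<dots> = farr F (inv_arr R (associator R a b (a \<odot>\<^bsub>R\<^esub> b))) \<cdot> (m a (b \<odot>\<^bsub>R\<^esub> (a \<odot>\<^bsub>R\<^esub> b)) \<cdot>
        ((idn A ?a \<otimes> (?N' \<cdot> A.inner_swap ?a ?b)) \<cdot> associator A ?a ?a (?b \<odot> ?b)))"
    by (subst A.interchange_push) (simp_all only: N, simp_all)
  also have "\<dots> = farr F (inv_arr R (associator R a b (a \<odot>\<^bsub>R\<^esub> b))) \<cdot> (m a (b \<odot>\<^bsub>R\<^esub> (a \<odot>\<^bsub>R\<^esub> b)) \<cdot>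
        ((idn A ?a \<otimes> ?N') \<cdot> ((idn A ?a \<otimes> A.inner_swap ?a ?b) \<cdot> associator A ?a ?a (?b \<odot> ?b))))"
    by (simp add: A.interchange_push)
  also have "\<dots> = ?Q \<cdot> inv_arr A (associator A ?a ?b (?a \<odot> ?b)) \<cdot>
      ((idn A ?a \<otimes> A.inner_swap ?a ?b) \<cdot> associator A ?a ?a (?b \<odot> ?b))"
    by (subst A.push3[OF i]) simp_all
  finally show ?thesis by (simp add: A.middle_swap_eq)
qed

end


context monoidal_on_cartesian
begin

abbreviation "L \<equiv> lift_obj dia bang A F"

lemma lift_carrier [simp]: "carrier (L a) = fobj F a"
  by (simp add: lift_obj_def)

lemma lift_obj_simps [simp]:
  assumes "a \<in> obj R"
  shows "\<Delta> a \<in> arr A" "src A (\<Delta> a) = fobj F a" "tgt A (\<Delta> a) = fobj F a \<odot> fobj F a"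
    "\<epsilon> a \<in> arr A" "src A (\<epsilon> a) = fobj F a" "tgt A (\<epsilon> a) = I"
  using assms by (simp_all add: lift_obj_def)

lemma m_delta: "a \<in> obj R \<Longrightarrow> m a a \<cdot> \<Delta> a = farr F (dia a)"
  by (simp add: lift_obj_def)

lemma n_eps: "a \<in> obj R \<Longrightarrow> eta F \<cdot> \<epsilon> a = farr F (bang a)"
  by (simp add: lift_obj_def)

text \<open>By the unit axioms of \<open>F\<close>, discarding a factor with the lifted counit is the image under \<open>F\<close> of a
  projection.\<close>

lemma eps_proj:
  assumes [simp]: "a \<in> obj R" "b \<in> obj R"
  shows "lunitor A (fobj F b) \<cdot> (\<epsilon> a \<otimes> idn A (fobj F b)) = farr F (q a b) \<cdot> m a b"
    "runitor A (fobj F a) \<cdot> (idn A (fobj F a) \<otimes> \<epsilon> b) = farr F (p a b) \<cdot> m a b"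
proof -
  have "lunitor A (fobj F b) \<cdot> (\<epsilon> a \<otimes> idn A (fobj F b))
    = farr F (lunitor R b) \<cdot> (m (tunit R) b \<cdot> (eta F \<otimes> idn A (fobj F b))) \<cdot> (\<epsilon> a \<otimes> idn A (fobj F b))"
    by (simp only: m_unit assms)
  also have "\<dots> = farr F (lunitor R b) \<cdot> (m (tunit R) b \<cdot> (farr F (bang a) \<otimes> farr F (idn R b)))"
    by (simp add: A.interchange n_eps)
  also have "\<dots> = farr F (lunitor R b) \<cdot> (farr F (bang a \<otimes>\<^bsub>R\<^esub> idn R b) \<cdot> m a b)"
    using m_natural[of "bang a" "idn R b"] by simp
  also have "\<dots> = farr F (q a b) \<cdot> m a b"
    by (subst A.push2[OF F_simps(6)[symmetric]]) simp_all
  finally show "lunitor A (fobj F b) \<cdot> (\<epsilon> a \<otimes> idn A (fobj F b)) = farr F (q a b) \<cdot> m a b" .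
  have "runitor A (fobj F a) \<cdot> (idn A (fobj F a) \<otimes> \<epsilon> b)
    = farr F (runitor R a) \<cdot> (m a (tunit R) \<cdot> (idn A (fobj F a) \<otimes> eta F)) \<cdot> (idn A (fobj F a) \<otimes> \<epsilon> b)"
    by (simp only: m_unit assms)
  also have "\<dots> = farr F (runitor R a) \<cdot> (m a (tunit R) \<cdot> (farr F (idn R a) \<otimes> farr F (bang b)))"
    by (simp add: A.interchange n_eps)
  also have "\<dots> = farr F (runitor R a) \<cdot> (farr F (idn R a \<otimes>\<^bsub>R\<^esub> bang b) \<cdot> m a b)"
    using m_natural[of "idn R a" "bang b"] by simp
  also have "\<dots> = farr F (p a b) \<cdot> m a b"
    by (subst A.push2[OF F_simps(6)[symmetric]]) simp_all
  finally show "runitor A (fobj F a) \<cdot> (idn A (fobj F a) \<otimes> \<epsilon> b) = farr F (p a b) \<cdot> m a b" .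
qed

lemma proj_delta:
  assumes [simp]: "a \<in> obj R"
  shows "farr F (p a a) \<cdot> (m a a \<cdot> \<Delta> a) = idn A (fobj F a)"
    "farr F (q a a) \<cdot> (m a a \<cdot> \<Delta> a) = idn A (fobj F a)"
  using F_simps(6)[of "dia a" "p a a"] F_simps(6)[of "dia a" "q a a"] by (simp_all add: m_delta)

text \<open>Composed with the invertible comparison maps of \<open>F\<close>, each axiom is the image under \<open>F\<close> of the same
  axiom for the diagonal.\<close>

lemma lift_coalg:
  assumes [simp]: "a \<in> obj R"
  shows "is_coalg A (L a)"
proof (rule A.coalgI)
  let ?a = "fobj F a" and ?j = "m a (a \<odot>\<^bsub>R\<^esub> a) \<cdot> (idn A (fobj F a) \<otimes> m a a)"
  have "?j \<cdot> (associator A ?a ?a ?a \<cdot> ((\<Delta> a \<otimes> idn A ?a) \<cdot> \<Delta> a))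
    = farr F (associator R a a a) \<cdot> (m (a \<odot>\<^bsub>R\<^esub> a) a \<cdot> ((m a a \<otimes> idn A ?a) \<cdot> ((\<Delta> a \<otimes> idn A ?a) \<cdot> \<Delta> a)))"
    using A.push3[OF m_assoc[of a a a], of "(\<Delta> a \<otimes> idn A ?a) \<cdot> \<Delta> a"] by simp
  also have "\<dots> = farr F (associator R a a a) \<cdot> (m (a \<odot>\<^bsub>R\<^esub> a) a \<cdot> ((farr F (dia a) \<otimes> farr F (idn R a)) \<cdot> \<Delta> a))"
    by (simp add: A.interchange_push m_delta)
  also have "\<dots> = farr F (associator R a a a) \<cdot> (farr F (dia a \<otimes>\<^bsub>R\<^esub> idn R a) \<cdot> (m a a \<cdot> \<Delta> a))"
    using A.push2[OF m_natural[of "dia a" "idn R a"], of "\<Delta> a"] by simp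
  also have "\<dots> = farr F ((idn R a \<otimes>\<^bsub>R\<^esub> dia a) \<cdot>\<^bsub>R\<^esub> dia a)"
    by (simp add: m_delta flip: R.dia_coassoc)
  also have "\<dots> = farr F (idn R a \<otimes>\<^bsub>R\<^esub> dia a) \<cdot> (m a a \<cdot> \<Delta> a)" by (simp add: m_delta)
  also have "\<dots> = m a (a \<odot>\<^bsub>R\<^esub> a) \<cdot> ((farr F (idn R a) \<otimes> farr F (dia a)) \<cdot> \<Delta> a)"
    using A.push2[OF m_natural[of "idn R a" "dia a"], of "\<Delta> a"] by simp
  also have "\<dots> = ?j \<cdot> ((idn A ?a \<otimes> \<Delta> a) \<cdot> \<Delta> a)"
    by (simp add: A.interchange_push m_delta)
  finally have "?j \<cdot> (associator A ?a ?a ?a \<cdot> ((\<Delta> a \<otimes> idn A ?a) \<cdot> \<Delta> a))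
    = ?j \<cdot> ((idn A ?a \<otimes> \<Delta> a) \<cdot> \<Delta> a)" .
  then show "associator A (carrier (L a)) (carrier (L a)) (carrier (L a)) \<cdot>
      ((\<Delta> a \<otimes> idn A (carrier (L a))) \<cdot> \<Delta> a) = (idn A (carrier (L a)) \<otimes> \<Delta> a) \<cdot> \<Delta> a"
    unfolding lift_carrier by (rule A.iso_cancel[rotated 5]) simp_all
  show "lunitor A (carrier (L a)) \<cdot> ((\<epsilon> a \<otimes> idn A (carrier (L a))) \<cdot> \<Delta> a) = idn A (carrier (L a))"
    "runitor A (carrier (L a)) \<cdot> ((idn A (carrier (L a)) \<otimes> \<epsilon> a) \<cdot> \<Delta> a) = idn A (carrier (L a))"
    by (simp_all add: A.push2[OF eps_proj(1)] A.push2[OF eps_proj(2)] proj_delta)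
  have "m a a \<cdot> (braiding A ?a ?a \<cdot> \<Delta> a) = farr F (braiding R a a) \<cdot> (m a a \<cdot> \<Delta> a)"
    using A.push2[OF m_braiding[of a a], of "\<Delta> a"] by simp
  also have "\<dots> = m a a \<cdot> \<Delta> a"
    using F_simps(6)[of "dia a" "braiding R a a"] by (simp add: m_delta R.dia_cocomm)
  finally show "braiding A (carrier (L a)) (carrier (L a)) \<cdot> \<Delta> a = \<Delta> a"
    unfolding lift_carrier by (rule A.iso_cancel[rotated 5]) simp_all
qed (simp_all add: in_hom)

lemma lift_arr:
  assumes [simp]: "f \<in> arr R"
  shows "is_coalg_arr A (L (src R f)) (farr F f) (L (tgt R f))"
proof -
  let ?a = "src R f" and ?b = "tgt R f"
  have "m ?b ?b \<cdot> ((farr F f \<otimes> farr F f) \<cdot> \<Delta> ?a) = farr F (f \<otimes>\<^bsub>R\<^esub> f) \<cdot> (m ?a ?a \<cdot> \<Delta> ?a)"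
    using A.push2[OF m_natural[of f f], of "\<Delta> ?a"] by simp
  also have "\<dots> = farr F (dia ?b \<cdot>\<^bsub>R\<^esub> f)" by (simp add: m_delta flip: R.dia_natural)
  also have "\<dots> = m ?b ?b \<cdot> (\<Delta> ?b \<cdot> farr F f)"
    using A.push2[OF m_delta[of ?b], of "farr F f"] by simp
  finally have "(farr F f \<otimes> farr F f) \<cdot> \<Delta> ?a = \<Delta> ?b \<cdot> farr F f"
    by (rule A.iso_cancel[rotated 5]) simp_all
  moreover have "eta F \<cdot> (\<epsilon> ?b \<cdot> farr F f) = eta F \<cdot> \<epsilon> ?a"
    using A.push2[OF n_eps[of ?b], of "farr F f"] by (simp add: n_eps flip: R.bang_natural)
  then have "\<epsilon> ?b \<cdot> farr F f = \<epsilon> ?a" by (rule A.iso_cancel[rotated 5]) simp_all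
  ultimately show ?thesis by (simp add: is_coalg_arr_def lift_coalg in_hom)
qed

text \<open>The tensor product of two lifted coalgebras is a coalgebra because \<open>m\<close> identifies it with
  the lifted coalgebra of the product.\<close>

lemma m_arr:
  assumes [simp]: "a \<in> obj R" "b \<in> obj R"
  shows "is_coalg_arr A (tensor_coalg A (L a) (L b)) (m a b) (L (a \<odot>\<^bsub>R\<^esub> b))"
proof (rule A.transport_coalg)
  let ?a = "fobj F a" and ?b = "fobj F b" and ?ab = "a \<odot>\<^bsub>R\<^esub> b"
  have "m ?ab ?ab \<cdot> ((m a b \<otimes> m a b) \<cdot> (middle_swap A ?a ?b \<cdot> (\<Delta> a \<otimes> \<Delta> b)))
    = farr F (middle_swap R a b) \<cdot> (m (a \<odot>\<^bsub>R\<^esub> a) (b \<odot>\<^bsub>R\<^esub> b) \<cdot> ((m a a \<otimes> m b b) \<cdot> (\<Delta> a \<otimes> \<Delta> b)))"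
    using A.push3[OF m_swap[of a b], of "\<Delta> a \<otimes> \<Delta> b"] by simp
  also have "\<dots> = farr F (middle_swap R a b) \<cdot> (farr F (dia a \<otimes>\<^bsub>R\<^esub> dia b) \<cdot> m a b)"
    using m_natural[of "dia a" "dia b"] by (simp add: A.interchange m_delta)
  also have "\<dots> = farr F (dia ?ab) \<cdot> m a b"
    by (subst A.push2[OF F_simps(6)[symmetric]]) (simp_all add: R.dia_tob)
  also have "\<dots> = m ?ab ?ab \<cdot> (\<Delta> ?ab \<cdot> m a b)"
    using A.push2[OF m_delta[of ?ab], of "m a b"] by simp
  finally have "(m a b \<otimes> m a b) \<cdot> (middle_swap A ?a ?b \<cdot> (\<Delta> a \<otimes> \<Delta> b)) = \<Delta> ?ab \<cdot> m a b"
    by (rule A.iso_cancel[rotated 5]) simp_all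
  then show "(m a b \<otimes> m a b) \<cdot> comult (tensor_coalg A (L a) (L b)) = comult (L ?ab) \<cdot> m a b" by simp
  have "eta F \<cdot> (\<epsilon> ?ab \<cdot> m a b) = farr F (lunitor R (tunit R)) \<cdot> (farr F (bang a \<otimes>\<^bsub>R\<^esub> bang b) \<cdot> m a b)"
    using A.push2[OF n_eps[of ?ab], of "m a b"]
      A.push2[OF F_simps(6)[of "bang a \<otimes>\<^bsub>R\<^esub> bang b" "lunitor R (tunit R)", symmetric], of "m a b"]
    by (simp add: R.bang_tob)
  also have "\<dots> = farr F (lunitor R (tunit R)) \<cdot> (m (tunit R) (tunit R) \<cdot> ((eta F \<cdot> \<epsilon> a) \<otimes> (eta F \<cdot> \<epsilon> b)))"
    using m_natural[of "bang a" "bang b"] by (simp add: n_eps)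
  also have "\<dots> = farr F (lunitor R (tunit R)) \<cdot> (m (tunit R) (tunit R) \<cdot>
      ((eta F \<otimes> idn A (fobj F (tunit R))) \<cdot> ((idn A I \<otimes> eta F) \<cdot> (\<epsilon> a \<otimes> \<epsilon> b))))"
    by (simp add: A.interchange)
  also have "\<dots> = lunitor A (fobj F (tunit R)) \<cdot> ((idn A I \<otimes> eta F) \<cdot> (\<epsilon> a \<otimes> \<epsilon> b))"
    by (subst A.push3[OF m_unit(1)]) simp_all
  also have "\<dots> = eta F \<cdot> (lunitor A I \<cdot> (\<epsilon> a \<otimes> \<epsilon> b))"
    using A.push2[OF A.lunitor_natural[of "eta F"], of "\<epsilon> a \<otimes> \<epsilon> b"] by simp
  finally have "\<epsilon> ?ab \<cdot> m a b = lunitor A I \<cdot> (\<epsilon> a \<otimes> \<epsilon> b)"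
    by (rule A.iso_cancel[rotated 5]) simp_all
  then show "counit (L ?ab) \<cdot> m a b = counit (tensor_coalg A (L a) (L b))" by simp
qed (simp_all add: in_hom lift_coalg)

text \<open>The diagonal of the unit is inverse to its unitor, as any two maps into the unit agree.\<close>

lemma n_arr: "is_coalg_arr A (unit_coalg A) (eta F) (L (tunit R))"
proof (rule A.transport_coalg)
  let ?I = "tunit R"
  have "m ?I ?I \<cdot> ((eta F \<otimes> eta F) \<cdot> inv_arr A (lunitor A I))
    = m ?I ?I \<cdot> ((eta F \<otimes> idn A (fobj F ?I)) \<cdot> ((idn A I \<otimes> eta F) \<cdot> inv_arr A (lunitor A I)))"
    by (simp add: A.interchange_push)
  also have "\<dots> = farr F (dia ?I \<cdot>\<^bsub>R\<^esub> lunitor R ?I) \<cdot> \<dots>"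
  proof -
    have "dia ?I \<cdot>\<^bsub>R\<^esub> lunitor R ?I = idn R (?I \<odot>\<^bsub>R\<^esub> ?I)"
      by (rule R.tob_ext[where a = ?I and b = ?I]; simp?; rule R.bang_ext) simp_all
    then show ?thesis by simp
  qed
  also have "\<dots> = farr F (dia ?I) \<cdot> (farr F (lunitor R ?I) \<cdot> (m ?I ?I \<cdot> ((eta F \<otimes> idn A (fobj F ?I)) \<cdot>
      ((idn A I \<otimes> eta F) \<cdot> inv_arr A (lunitor A I)))))"
    by simp
  also have "\<dots> = farr F (dia ?I) \<cdot> (lunitor A (fobj F ?I) \<cdot> ((idn A I \<otimes> eta F) \<cdot> inv_arr A (lunitor A I)))"
    by (subst A.push3[OF m_unit(1)]) simp_all
  also have "\<dots> = farr F (dia ?I) \<cdot> eta F"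
    using A.push2[OF A.lunitor_natural[of "eta F"], of "inv_arr A (lunitor A I)"] by simp
  also have "\<dots> = m ?I ?I \<cdot> (\<Delta> ?I \<cdot> eta F)" using A.push2[OF m_delta[of ?I], of "eta F"] by simp
  finally have "(eta F \<otimes> eta F) \<cdot> inv_arr A (lunitor A I) = \<Delta> ?I \<cdot> eta F"
    by (rule A.iso_cancel[rotated 5]) simp_all
  then show "(eta F \<otimes> eta F) \<cdot> comult (unit_coalg A) = comult (L ?I) \<cdot> eta F" by simp
  have "\<epsilon> ?I \<cdot> eta F = idn A I" by (simp add: lift_obj_def R.bang_unit)
  then show "counit (L ?I) \<cdot> eta F = counit (unit_coalg A)" by simp
qed (simp_all add: in_hom lift_coalg)

abbreviation "LF \<equiv> lift R dia bang A F"

lemma lift_simps [simp]: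
  "a \<in> obj R \<Longrightarrow> fobj (LF) a = L a"
  "f \<in> arr R \<Longrightarrow> farr (LF) f = (L (src R f), farr F f, L (tgt R f))"
  "\<lbrakk>a \<in> obj R; b \<in> obj R\<rbrakk> \<Longrightarrow> mu (LF) (a, b)
    = (tensor_coalg A (L a) (L b), m a b, L (a \<odot>\<^bsub>R\<^esub> b))"
  "eta (LF) = (unit_coalg A, eta F, L (tunit R))"
  by (simp_all add: lift_def Let_def)

lemma lift_functor: "is_functor R (Cog A) (LF)"
proof (rule functorI[OF R.category_axioms A.category_Cog])
  show "fobj (LF) \<in> extensional (obj R)" "farr (LF) \<in> extensional (arr R)"
    by (simp_all add: lift_def Let_def)
qed (simp_all add: lift_coalg lift_arr)

lemma lift_sm_functor: "sm_functor R (Cog A) (LF)"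
  unfolding sm_functor_def
proof (intro conjI ballI)
  show "is_functor R (Cog A) (LF)" by (rule lift_functor)
  show "mu (LF) \<in> extensional (obj R \<times> obj R)"
    by (simp add: lift_def Let_def)
  show "eta (LF) \<in> hom (Cog A) (tunit (Cog A)) (fobj (LF) (tunit R))"
    "iso_arr (Cog A) (eta (LF))"
    by (simp_all add: n_arr A.iso_Cog)
  fix a assume [simp]: "a \<in> obj R"
  show "farr (LF) (lunitor R a) \<cdot>\<^bsub>Cog A\<^esub> mu (LF) (tunit R, a) \<cdot>\<^bsub>Cog A\<^esub>
      (eta (LF) \<otimes>\<^bsub>Cog A\<^esub> idn (Cog A) (fobj (LF) a))
    = lunitor (Cog A) (fobj (LF) a)"
    using m_unit(1)[of a] by simp
  show "farr (LF) (runitor R a) \<cdot>\<^bsub>Cog A\<^esub> mu (LF) (a, tunit R) \<cdot>\<^bsub>Cog A\<^esub>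
      (idn (Cog A) (fobj (LF) a) \<otimes>\<^bsub>Cog A\<^esub> eta (LF))
    = runitor (Cog A) (fobj (LF) a)"
    using m_unit(2)[of a] by simp
  fix b assume [simp]: "b \<in> obj R"
  show "mu (LF) (a, b) \<in> hom (Cog A) (fobj (LF) a \<odot>\<^bsub>Cog A\<^esub>
      fobj (LF) b) (fobj (LF) (a \<odot>\<^bsub>R\<^esub> b))"
    "iso_arr (Cog A) (mu (LF) (a, b))"
    by (simp_all add: m_arr A.iso_Cog)
  show "farr (LF) (braiding R a b) \<cdot>\<^bsub>Cog A\<^esub> mu (LF) (a, b)
    = mu (LF) (b, a) \<cdot>\<^bsub>Cog A\<^esub>
      braiding (Cog A) (fobj (LF) a) (fobj (LF) b)"
    by (simp add: m_braiding)
  fix c assume [simp]: "c \<in> obj R"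
  show "farr (LF) (associator R a b c) \<cdot>\<^bsub>Cog A\<^esub> mu (LF) (a \<odot>\<^bsub>R\<^esub> b, c) \<cdot>\<^bsub>Cog A\<^esub>
      (mu (LF) (a, b) \<otimes>\<^bsub>Cog A\<^esub> idn (Cog A) (fobj (LF) c))
    = mu (LF) (a, b \<odot>\<^bsub>R\<^esub> c) \<cdot>\<^bsub>Cog A\<^esub>
      (idn (Cog A) (fobj (LF) a) \<otimes>\<^bsub>Cog A\<^esub> mu (LF) (b, c)) \<cdot>\<^bsub>Cog A\<^esub>
      associator (Cog A) (fobj (LF) a) (fobj (LF) b) (fobj (LF) c)"
    using m_assoc[of a b c] by simp
next
  fix f g assume [simp]: "f \<in> arr R" "g \<in> arr R"
  show "mu (LF) (tgt R f, tgt R g) \<cdot>\<^bsub>Cog A\<^esub>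
      (farr (LF) f \<otimes>\<^bsub>Cog A\<^esub> farr (LF) g)
    = farr (LF) (f \<otimes>\<^bsub>R\<^esub> g) \<cdot>\<^bsub>Cog A\<^esub> mu (LF) (src R f, src R g)"
    by (simp add: m_natural)
qed

text \<open>The Eckmann-Hilton argument.  Let \<open>D\<close> be another comultiplication on \<open>F a\<close> with the lifted counit,
  such that \<open>F (dia a)\<close> and \<open>m a a\<close> are compatible with one comultiplication on \<open>F (a \<otimes> a)\<close>.  Then \<open>\<Delta> a\<close> is a coalgebra map for \<open>D\<close>, that is,
  \<open>(\<Delta> a \<otimes> \<Delta> a) D = s (D \<otimes> D) (\<Delta> a)\<close> with the interchange \<open>s\<close>.  Discarding the two inner factors, which \<open>s\<close>
  exchanges, leaves \<open>D\<close> on the left and \<open>\<Delta> a\<close> on the right.\<close>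

lemma lift_obj_unique:
  assumes a [simp]: "a \<in> obj R" and x: "is_coalg A x" "carrier x = fobj F a" "counit x = \<epsilon> a"
    and y: "comult y \<cdot> farr F (dia a) = (farr F (dia a) \<otimes> farr F (dia a)) \<cdot> comult x"
      "(m a a \<otimes> m a a) \<cdot> comult (tensor_coalg A x x) = comult y \<cdot> m a a"
      "comult y \<in> hom A (fobj F (a \<odot>\<^bsub>R\<^esub> a)) (fobj F (a \<odot>\<^bsub>R\<^esub> a) \<odot> fobj F (a \<odot>\<^bsub>R\<^esub> a))"
  shows "comult x = \<Delta> a"
proof -
  let ?a = "fobj F a"
  let ?D = "comult x" and ?s = "middle_swap A (fobj F a) (fobj F a)"
  note [simp] = A.coalg_simps[OF x(1), unfolded x(2)]
  have [simp]: "comult y \<in> arr A" "src A (comult y) = fobj F (a \<odot>\<^bsub>R\<^esub> a)"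
    "tgt A (comult y) = fobj F (a \<odot>\<^bsub>R\<^esub> a) \<odot> fobj F (a \<odot>\<^bsub>R\<^esub> a)" using y(3) by (simp_all add: in_hom)
  \<comment> \<open>\<open>P\<close> discards the second factor and \<open>Q\<close> the first; both are left inverse to \<open>D\<close> and to \<open>\<Delta> a\<close> by the
    counit laws.\<close>
  define P where "P = farr F (p a a) \<cdot> m a a"
  define Q where "Q = farr F (q a a) \<cdot> m a a"
  have [simp]: "P \<in> arr A" "src A P = ?a \<odot> ?a" "tgt A P = ?a" "Q \<in> arr A" "src A Q = ?a \<odot> ?a" "tgt A Q = ?a"
    by (simp_all add: P_def Q_def)
  have PQ_delta: "P \<cdot> \<Delta> a = idn A ?a" "Q \<cdot> \<Delta> a = idn A ?a"
    by (simp_all add: P_def Q_def proj_delta)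
  have PQ_D: "P \<cdot> ?D = idn A ?a" "Q \<cdot> ?D = idn A ?a"
    using A.coalg_laws(2,3)[OF x(1)] eps_proj[of a a]
    by (simp_all add: P_def Q_def x(2,3) A.push2[OF eps_proj(1)] A.push2[OF eps_proj(2)])
  have PQ_s: "(P \<otimes> Q) \<cdot> ?s = P \<otimes> Q"
  proof -
    have *: "m a a \<cdot> (P \<otimes> Q) = farr F (p a a \<otimes>\<^bsub>R\<^esub> q a a) \<cdot> (m (a \<odot>\<^bsub>R\<^esub> a) (a \<odot>\<^bsub>R\<^esub> a) \<cdot> (m a a \<otimes> m a a))"
    proof -
      have "m a a \<cdot> (P \<otimes> Q) = m a a \<cdot> ((farr F (p a a) \<otimes> farr F (q a a)) \<cdot> (m a a \<otimes> m a a))"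
        by (simp add: P_def Q_def A.interchange)
      then show ?thesis using A.push2[OF m_natural[of "p a a" "q a a"], of "m a a \<otimes> m a a"] by simp
    qed
    have "m a a \<cdot> ((P \<otimes> Q) \<cdot> ?s) = farr F (p a a \<otimes>\<^bsub>R\<^esub> q a a) \<cdot> (m (a \<odot>\<^bsub>R\<^esub> a) (a \<odot>\<^bsub>R\<^esub> a) \<cdot> ((m a a \<otimes> m a a) \<cdot> ?s))"
      by (subst A.push2[OF *]) simp_all
    also have "\<dots> = farr F (p a a \<otimes>\<^bsub>R\<^esub> q a a) \<cdot> (farr F (middle_swap R a a) \<cdot>
        (m (a \<odot>\<^bsub>R\<^esub> a) (a \<odot>\<^bsub>R\<^esub> a) \<cdot> (m a a \<otimes> m a a)))"
      by (simp add: m_swap)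
    also have "\<dots> = m a a \<cdot> (P \<otimes> Q)"
      by (subst A.push2[OF F_simps(6)[symmetric]]) (simp_all add: R.outer_swap *)
    finally show ?thesis by (rule A.iso_cancel[rotated 5]) simp_all
  qed
  have "(m a a \<otimes> m a a) \<cdot> ((\<Delta> a \<otimes> \<Delta> a) \<cdot> ?D) = comult y \<cdot> (m a a \<cdot> \<Delta> a)"
    using y(1) by (simp add: A.interchange_push m_delta)
  also have "\<dots> = (m a a \<otimes> m a a) \<cdot> (?s \<cdot> ((?D \<otimes> ?D) \<cdot> \<Delta> a))"
    using A.push2[OF y(2)[symmetric], of "\<Delta> a"] by (simp add: x(2))
  finally have e: "(\<Delta> a \<otimes> \<Delta> a) \<cdot> ?D = ?s \<cdot> ((?D \<otimes> ?D) \<cdot> \<Delta> a)"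
    by (rule A.iso_cancel[rotated 5]) simp_all
  have "?D = (P \<otimes> Q) \<cdot> ((\<Delta> a \<otimes> \<Delta> a) \<cdot> ?D)" by (simp add: A.interchange_push PQ_delta)
  also have "\<dots> = (P \<otimes> Q) \<cdot> ((?D \<otimes> ?D) \<cdot> \<Delta> a)" unfolding e by (subst A.push2[OF PQ_s]) simp_all
  also have "\<dots> = \<Delta> a" by (simp add: A.interchange_push PQ_D)
  finally show ?thesis .
qed

end


section \<open>Functors with values in coalgebras\<close>

context smc
begin

lemma forgetful_functor: "is_functor (Cog A) A (forgetful A)"
proof (rule functorI[OF category_Cog category_axioms])
  fix f assume "f \<in> arr (Cog A)"
  then show "farr (forgetful A) f \<in> hom A (fobj (forgetful A) (src (Cog A) f)) (fobj (forgetful A) (tgt (Cog A) f))"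
    by (auto simp: forgetful_def Cog_def is_coalg_arr_def)
next
  fix f g assume h: "f \<in> arr (Cog A)" "g \<in> arr (Cog A)" "tgt (Cog A) f = src (Cog A) g"
  then have "g \<cdot>\<^bsub>Cog A\<^esub> f \<in> arr (Cog A)" using category.cmp_simps(1)[OF category_Cog] by blast
  with h show "farr (forgetful A) (g \<cdot>\<^bsub>Cog A\<^esub> f) = farr (forgetful A) g \<cdot> farr (forgetful A) f"
    by (auto simp: forgetful_def Cog_def)
next
  fix x assume "x \<in> obj (Cog A)"
  moreover then have "idn (Cog A) x \<in> arr (Cog A)" using category.idn_simps(1)[OF category_Cog] by blast
  ultimately show "farr (forgetful A) (idn (Cog A) x) = idn A (fobj (forgetful A) x)"
    by (simp add: forgetful_def)
qed (auto simp: forgetful_def coalg_simps)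

lemma forgetful_apply [simp]:
  "is_coalg A x \<Longrightarrow> fobj (forgetful A) x = carrier x"
  "f \<in> arr (Cog A) \<Longrightarrow> farr (forgetful A) f = und f"
  by (auto simp: forgetful_def Cog_def)

end

lemma und_cmp: "und (g \<cdot>\<^bsub>Cog A\<^esub> f) = und g \<cdot>\<^bsub>A\<^esub> und f"
  by (cases f; cases g) simp

lemma und_tar: "und (f \<otimes>\<^bsub>Cog A\<^esub> g) = und f \<otimes>\<^bsub>A\<^esub> und g"
  by (cases f; cases g) simp

locale coalgebra_valued = R: cartesian R p q dia bang + A: smc A
  for R :: "('o, 'm) smc" and p q dia bang and A :: "('p, 'n) smc" (structure) +
  fixes H :: "('o, 'm, ('p, 'n) coalg, ('p, 'n) coalg_arr) smfun"
  assumes H: "sm_functor R (Cog A) H"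
begin

lemmas H_functor [simp] = functor_simps[OF sm_functorD(1)[OF H]]

lemma H_obj [simp]: "a \<in> obj R \<Longrightarrow> is_coalg A (fobj H a)"
  using H_functor(1)[of a] by simp

lemma H_arr:
  assumes "f \<in> arr R"
  shows "farr H f = (fobj H (src R f), und (farr H f), fobj H (tgt R f))"
    "is_coalg_arr A (fobj H (src R f)) (und (farr H f)) (fobj H (tgt R f))"
proof -
  have "farr H f \<in> hom (Cog A) (fobj H (src R f)) (fobj H (tgt R f))"
    using assms by (simp add: in_hom)
  then obtain h where h: "farr H f = (fobj H (src R f), h, fobj H (tgt R f))"
    "is_coalg_arr A (fobj H (src R f)) h (fobj H (tgt R f))" by (rule Cog_homE)
  show "farr H f = (fobj H (src R f), und (farr H f), fobj H (tgt R f))"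
    "is_coalg_arr A (fobj H (src R f)) (und (farr H f)) (fobj H (tgt R f))"
    unfolding h(1) using h(2) by simp_all
qed

lemma H_mu:
  assumes "a \<in> obj R" "b \<in> obj R"
  shows "mu H (a, b) = (tensor_coalg A (fobj H a) (fobj H b), und (mu H (a, b)), fobj H (a \<odot>\<^bsub>R\<^esub> b))"
    "is_coalg_arr A (tensor_coalg A (fobj H a) (fobj H b)) (und (mu H (a, b))) (fobj H (a \<odot>\<^bsub>R\<^esub> b))"
proof -
  obtain h where h: "mu H (a, b) = (tensor_coalg A (fobj H a) (fobj H b), h, fobj H (a \<odot>\<^bsub>R\<^esub> b))"
    "is_coalg_arr A (tensor_coalg A (fobj H a) (fobj H b)) h (fobj H (a \<odot>\<^bsub>R\<^esub> b))"
    using sm_functorD(3)[OF H assms] by (auto elim: Cog_homE)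
  show "mu H (a, b) = (tensor_coalg A (fobj H a) (fobj H b), und (mu H (a, b)), fobj H (a \<odot>\<^bsub>R\<^esub> b))"
    "is_coalg_arr A (tensor_coalg A (fobj H a) (fobj H b)) (und (mu H (a, b))) (fobj H (a \<odot>\<^bsub>R\<^esub> b))"
    unfolding h(1) using h(2) by simp_all
qed

lemma H_eta:
  "eta H = (unit_coalg A, und (eta H), fobj H (tunit R))"
  "is_coalg_arr A (unit_coalg A) (und (eta H)) (fobj H (tunit R))"
proof -
  obtain h where h: "eta H = (unit_coalg A, h, fobj H (tunit R))"
    "is_coalg_arr A (unit_coalg A) h (fobj H (tunit R))"
    using sm_functorD(5)[OF H] by (auto elim: Cog_homE)
  show "eta H = (unit_coalg A, und (eta H), fobj H (tunit R))"
    "is_coalg_arr A (unit_coalg A) (und (eta H)) (fobj H (tunit R))"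
    unfolding h(1) using h(2) by simp_all
qed

abbreviation "UH \<equiv> comp_smfun R A (forgetful A) H"

lemma H_in_Cog [simp]:
  "\<lbrakk>a \<in> obj R; b \<in> obj R\<rbrakk> \<Longrightarrow> mu H (a, b) \<in> arr (Cog A)" "eta H \<in> arr (Cog A)"
  using sm_functorD(3,5)[OF H] by (simp_all add: in_hom)

lemma UH_simps [simp]:
  "a \<in> obj R \<Longrightarrow> fobj UH a = carrier (fobj H a)"
  "f \<in> arr R \<Longrightarrow> farr UH f = und (farr H f)"
  "\<lbrakk>a \<in> obj R; b \<in> obj R\<rbrakk> \<Longrightarrow> mu UH (a, b) = und (mu H (a, b))"
  "eta UH = und (eta H)"
proof -
  show "\<lbrakk>a \<in> obj R; b \<in> obj R\<rbrakk> \<Longrightarrow> mu UH (a, b) = und (mu H (a, b))"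
    using A.coalg_arr_simps(1-3)[OF H_mu(2)] by (simp add: comp_smfun_def) (simp add: forgetful_def)
  show "eta UH = und (eta H)"
    using A.coalg_arr_simps(1-3)[OF H_eta(2)] by (simp add: comp_smfun_def) (simp add: forgetful_def)
qed (simp_all add: comp_smfun_def)

lemma UH_functor: "is_functor R A UH"
proof (rule functorI[OF R.category_axioms A.category_axioms])
  fix f assume [simp]: "f \<in> arr R"
  show "farr UH f \<in> hom A (fobj UH (src R f)) (fobj UH (tgt R f))"
    using A.coalg_arr_simps[OF H_arr(2)[of f]] by (simp add: in_hom)
next
  fix f g assume "f \<in> arr R" "g \<in> arr R" "tgt R f = src R g"
  then show "farr UH (g \<cdot>\<^bsub>R\<^esub> f) = farr UH g \<cdot> farr UH f" by (simp add: und_cmp)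
next
  show "fobj UH \<in> extensional (obj R)" "farr UH \<in> extensional (arr R)" by (simp_all add: comp_smfun_def)
qed (simp_all add: A.coalg_simps[OF H_obj])

lemma und_iso:
  assumes "iso_arr (Cog A) f"
  shows "iso_arr A (und f)"
proof -
  obtain g where g: "inverse_arrows (Cog A) f g" using assms by (auto simp: iso_arr_def)
  then have "f \<in> arr (Cog A)" "g \<in> arr (Cog A)" by (auto simp: inverse_arrows_def in_hom)
  then obtain x f' y y' g' x' where "f = (x, f', y)" "is_coalg_arr A x f' y"
      "g = (y', g', x')" "is_coalg_arr A y' g' x'"
    by (auto simp: Cog_def)
  then show ?thesis
    using g by (auto simp: inverse_arrows_def A.coalg_arr_simps intro!: A.iso_arrI[where g = g'])
qed

lemma UH_sm_functor: "sm_functor R A UH"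
  unfolding sm_functor_def
proof (intro conjI ballI)
  show "is_functor R A UH" by (rule UH_functor)
  show "mu UH \<in> extensional (obj R \<times> obj R)" by (simp add: comp_smfun_def)
  show "eta UH \<in> hom A (tunit A) (fobj UH (tunit R))" "iso_arr A (eta UH)"
    using A.coalg_arr_simps[OF H_eta(2)] und_iso[OF sm_functorD(6)[OF H]] by (simp_all add: in_hom)
  fix a assume [simp]: "a \<in> obj R"
  show "farr UH (lunitor R a) \<cdot> mu UH (tunit R, a) \<cdot> (eta UH \<otimes> idn A (fobj UH a)) = lunitor A (fobj UH a)"
    using arg_cong[OF sm_functorD(9)[OF H, of a], of und] by (simp add: und_cmp und_tar)
  show "farr UH (runitor R a) \<cdot> mu UH (a, tunit R) \<cdot> (idn A (fobj UH a) \<otimes> eta UH) = runitor A (fobj UH a)"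
    using arg_cong[OF sm_functorD(10)[OF H, of a], of und] by (simp add: und_cmp und_tar)
  fix b assume [simp]: "b \<in> obj R"
  show "mu UH (a, b) \<in> hom A (fobj UH a \<odot> fobj UH b) (fobj UH (a \<odot>\<^bsub>R\<^esub> b))" "iso_arr A (mu UH (a, b))"
    using A.coalg_arr_simps[OF H_mu(2)] und_iso[OF sm_functorD(4)[OF H]] by (simp_all add: in_hom)
  show "farr UH (braiding R a b) \<cdot> mu UH (a, b) = mu UH (b, a) \<cdot> braiding A (fobj UH a) (fobj UH b)"
    using arg_cong[OF sm_functorD(11)[OF H, of a b], of und] by (simp add: und_cmp und_tar)
  fix c assume [simp]: "c \<in> obj R"
  show "farr UH (associator R a b c) \<cdot> mu UH (a \<odot>\<^bsub>R\<^esub> b, c) \<cdot> (mu UH (a, b) \<otimes> idn A (fobj UH c))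
    = mu UH (a, b \<odot>\<^bsub>R\<^esub> c) \<cdot> (idn A (fobj UH a) \<otimes> mu UH (b, c)) \<cdot>
      associator A (fobj UH a) (fobj UH b) (fobj UH c)"
    using arg_cong[OF sm_functorD(8)[OF H, of a b c], of und] by (simp add: und_cmp und_tar del: A.assoc)
next
  fix f g assume [simp]: "f \<in> arr R" "g \<in> arr R"
  show "mu UH (tgt R f, tgt R g) \<cdot> (farr UH f \<otimes> farr UH g) = farr UH (f \<otimes>\<^bsub>R\<^esub> g) \<cdot> mu UH (src R f, src R g)"
    using arg_cong[OF sm_functorD(7)[OF H, of f g], of und] by (simp add: und_cmp und_tar)
qed

text \<open>The counit of \<open>H I\<close> is inverse to \<open>eta H\<close>, because \<open>eta H\<close> is a coalgebra map out of the unit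
  coalgebra.  As \<open>H\<close> sends the map \<open>a \<rightarrow> I\<close> to a coalgebra map, this determines the counit of every \<open>H a\<close>;
  the comultiplication is then determined by the Eckmann-Hilton argument.\<close>

lemma lift_forgetful: "lift R dia bang A UH = H"
proof -
  interpret F: monoidal_on_cartesian R p q dia bang A UH
    by unfold_locales (rule UH_sm_functor)
  have L: "lift_obj dia bang A UH a = fobj H a" if [simp]: "a \<in> obj R" for a
  proof -
    let ?n = "und (eta H)"
    note [simp] = A.coalg_simps[OF H_obj]
    have n: "?n \<in> arr A" "src A ?n = tunit A" "tgt A ?n = carrier (fobj H (tunit R))" "iso_arr A ?n"
      using F.n_simps by simp_all
    have "counit (fobj H (tunit R)) = counit (fobj H (tunit R)) \<cdot> (?n \<cdot> inv_arr A ?n)" using n by simp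
    also have "\<dots> = inv_arr A ?n"
      using A.push2[OF A.coalg_arr_simps(5)[OF H_eta(2)], of "inv_arr A ?n"] n by simp
    finally have "counit (fobj H (tunit R)) = inv_arr A ?n" .
    then have c: "counit (fobj H a) = F.\<epsilon> a"
      using A.coalg_arr_simps(5)[OF H_arr(2)[of "bang a"]] by (simp add: lift_obj_def)
    have "comult (fobj H a) = F.\<Delta> a"
      using A.coalg_arr_simps(4)[OF H_arr(2)[of "dia a"]] A.coalg_arr_simps(4)[OF H_mu(2)[of a a]] c
      by (intro F.lift_obj_unique[where y = "fobj H (a \<odot>\<^bsub>R\<^esub> a)"]) (simp_all add: in_hom)
    with c show ?thesis by (simp add: lift_obj_def)
  qed
  have "fobj (lift R dia bang A UH) = fobj H"
    using functor_extensional(1)[OF sm_functorD(1)[OF H]] L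
    by (auto simp: lift_def Let_def intro!: restrict_eqI)
  moreover have "farr (lift R dia bang A UH) = farr H"
    using functor_extensional(2)[OF sm_functorD(1)[OF H]] L H_arr(1)
    by (auto simp: lift_def Let_def intro!: restrict_eqI simp del: prod.case)
  moreover have "mu (lift R dia bang A UH) = mu H"
    using sm_functorD(2)[OF H] L H_mu(1) by (auto simp: lift_def Let_def intro!: restrict_eqI)
  moreover have "eta (lift R dia bang A UH) = eta H"
    using L H_eta(1) by (simp add: lift_def Let_def)
  ultimately show ?thesis by simp
qed

end

lemma (in monoidal_on_cartesian) forgetful_lift: "comp_smfun R A (forgetful A) (LF) = F"
proof -
  interpret H: coalgebra_valued R p q dia bang A "LF"
    by unfold_locales (rule lift_sm_functor)
  have "fobj H.UH = fobj F"
    using functor_extensional(1)[OF sm_functorD(1)[OF F]]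
    by (intro extensionalityI[where A = "obj R"]) (simp_all, simp add: comp_smfun_def)
  moreover have "farr H.UH = farr F"
    using functor_extensional(2)[OF sm_functorD(1)[OF F]]
    by (intro extensionalityI[where A = "arr R"]) (simp_all, simp add: comp_smfun_def)
  moreover have "mu H.UH = mu F"
    using sm_functorD(2)[OF F]
    by (intro extensionalityI[where A = "obj R \<times> obj R"]) (auto, simp add: comp_smfun_def)
  moreover have "eta H.UH = eta F" by simp
  ultimately show ?thesis by simp
qed


section \<open>Colimits of coalgebras\<close>

lemma colimitD:
  assumes "is_colimit J C D c l"
  shows "is_cocone J C D c l"
    "\<And>d k. is_cocone J C D d k \<Longrightarrow> \<exists>h. h \<in> hom C c d \<and> (\<forall>i\<in>obj J. h \<cdot>\<^bsub>C\<^esub> l i = k i)"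
  using assms unfolding is_colimit_def by blast+

lemma coconeD:
  assumes "is_cocone J C D c l"
  shows "is_functor J C D" "c \<in> obj C" "i \<in> obj J \<Longrightarrow> l i \<in> arr C" "i \<in> obj J \<Longrightarrow> src C (l i) = fobj D i"
    "i \<in> obj J \<Longrightarrow> tgt C (l i) = c" "f \<in> arr J \<Longrightarrow> l (tgt J f) \<cdot>\<^bsub>C\<^esub> farr D f = l (src J f)"
  using assms by (auto simp: is_cocone_def in_hom)

lemma coconeI:
  assumes "is_functor J C D" "c \<in> obj C" "\<And>i. i \<in> obj J \<Longrightarrow> l i \<in> hom C (fobj D i) c"
    "\<And>f. f \<in> arr J \<Longrightarrow> l (tgt J f) \<cdot>\<^bsub>C\<^esub> farr D f = l (src J f)"
  shows "is_cocone J C D c l"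
  using assms by (simp add: is_cocone_def)

lemma colimit_ext:
  assumes c: "is_colimit J C D c l" and f: "f \<in> arr C" "g \<in> arr C" "src C f = c" "src C g = c" "tgt C f = tgt C g"
    and eq: "\<And>i. i \<in> obj J \<Longrightarrow> f \<cdot>\<^bsub>C\<^esub> l i = g \<cdot>\<^bsub>C\<^esub> l i"
  shows "f = g"
proof -
  note k = coconeD[OF colimitD(1)[OF c]]
  interpret C: category C using functor_cats k(1) by blast
  interpret J: category J using functor_cats k(1) by blast
  have "is_cocone J C D (tgt C f) (\<lambda>i. f \<cdot>\<^bsub>C\<^esub> l i)"
    using k f functor_simps[OF k(1)] by (intro coconeI) (auto simp: in_hom)
  then have "\<exists>!h. h \<in> hom C c (tgt C f) \<and> (\<forall>i\<in>obj J. h \<cdot>\<^bsub>C\<^esub> l i = f \<cdot>\<^bsub>C\<^esub> l i)"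
    using c unfolding is_colimit_def by blast
  moreover have "f \<in> hom C c (tgt C f)" "g \<in> hom C c (tgt C f)" using f by (auto simp: in_hom)
  ultimately show ?thesis using eq by metis
qed

lemma colimitI:
  assumes "is_cocone J C D c l"
    and "\<And>d k. is_cocone J C D d k \<Longrightarrow> \<exists>h. h \<in> hom C c d \<and> (\<forall>i\<in>obj J. h \<cdot>\<^bsub>C\<^esub> l i = k i)"
    and "\<And>f g d. \<lbrakk>f \<in> hom C c d; g \<in> hom C c d; \<And>i. i \<in> obj J \<Longrightarrow> f \<cdot>\<^bsub>C\<^esub> l i = g \<cdot>\<^bsub>C\<^esub> l i\<rbrakk> \<Longrightarrow> f = g"
  shows "is_colimit J C D c l"
  unfolding is_colimit_def
proof (intro conjI allI impI)
  fix d k assume "is_cocone J C D d k"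
  then obtain h where h: "h \<in> hom C c d" "\<forall>i\<in>obj J. h \<cdot>\<^bsub>C\<^esub> l i = k i" using assms(2) by blast
  then show "\<exists>!h. h \<in> hom C c d \<and> (\<forall>i\<in>obj J. h \<cdot>\<^bsub>C\<^esub> l i = k i)"
    by (intro ex1I[of _ h]) (auto intro: assms(3))
qed (rule assms(1))

lemma colimit_cong:
  assumes "is_colimit J C D c l" "\<And>i. i \<in> obj J \<Longrightarrow> l i = l' i"
  shows "is_colimit J C D c l'"
proof -
  have J: "category J" using coconeD(1)[OF colimitD(1)[OF assms(1)]] functor_cats by blast
  have "is_cocone J C D c l'"
    using colimitD(1)[OF assms(1)] assms(2) category.src_in[OF J] category.tgt_in[OF J]
    by (simp add: is_cocone_def)
  moreover have "(\<forall>i\<in>obj J. h \<cdot>\<^bsub>C\<^esub> l i = k i) \<longleftrightarrow> (\<forall>i\<in>obj J. h \<cdot>\<^bsub>C\<^esub> l' i = k i)" for h k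
    using assms(2) by simp
  ultimately show ?thesis using assms(1) unfolding is_colimit_def by simp
qed

lemma functor_cocone:
  assumes "is_functor C E F" "is_cocone J C D c l"
  shows "is_cocone J E (comp_func J F D) (fobj F c) (\<lambda>i. farr F (l i))"
proof -
  note k = coconeD[OF assms(2)] and F = functor_simps[OF assms(1)] and D = functor_simps[OF coconeD(1)[OF assms(2)]]
  interpret J: category J using functor_cats k(1) by blast
  show ?thesis
  proof (rule coconeI)
    fix f assume f: "f \<in> arr J"
    have "farr F (l (tgt J f) \<cdot>\<^bsub>C\<^esub> farr D f) = farr F (l (tgt J f)) \<cdot>\<^bsub>E\<^esub> farr F (farr D f)"
      using f k D by (intro F(6)) simp_all
    then show "farr F (l (tgt J f)) \<cdot>\<^bsub>E\<^esub> farr (comp_func J F D) f = farr F (l (src J f))"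
      using f k by simp
  qed (use k F assms comp_functor in \<open>auto simp: in_hom\<close>)
qed

context smc
begin

text \<open>A map out of an underlying colimit is a coalgebra map if its restrictions are, because the
  legs of the colimit are jointly epic.\<close>

lemma colimit_map_coalg:
  assumes col: "is_colimit J A D c l"
    and x: "is_coalg A x" "carrier x = c" and y: "is_coalg A y" and h: "h \<in> hom A c (carrier y)"
    and l: "\<And>i. i \<in> obj J \<Longrightarrow> is_coalg_arr A (E i) (l i) x"
    and hl: "\<And>i. i \<in> obj J \<Longrightarrow> is_coalg_arr A (E i) (h \<cdot> l i) y"
  shows "is_coalg_arr A x h y"
proof -
  note [simp] = coalg_simps[OF x(1)] coalg_simps[OF y] x(2)
  have [simp]: "h \<in> arr A" "src A h = c" "tgt A h = carrier y" using h by (simp_all add: in_hom)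
  have "(h \<otimes> h) \<cdot> comult x = comult y \<cdot> h"
  proof (rule colimit_ext[OF col])
    fix i assume i: "i \<in> obj J"
    note [simp] = coalg_arr_simps(1-3)[OF l[OF i]] coalg_simps[OF coalg_arr_coalgs(1)[OF l[OF i]]]
    have "(h \<otimes> h) \<cdot> comult x \<cdot> l i = (h \<otimes> h) \<cdot> ((l i \<otimes> l i) \<cdot> comult (E i))"
      using coalg_arr_simps(4)[OF l[OF i]] by simp
    also have "\<dots> = comult y \<cdot> h \<cdot> l i"
      using coalg_arr_simps(4)[OF hl[OF i]] by (simp add: interchange_push)
    finally show "(h \<otimes> h) \<cdot> comult x \<cdot> l i = comult y \<cdot> h \<cdot> l i" .
  qed simp_all
  moreover have "counit y \<cdot> h = counit x"
  proof (rule colimit_ext[OF col])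
    fix i assume i: "i \<in> obj J"
    note [simp] = coalg_arr_simps(1-3)[OF l[OF i]]
    show "counit y \<cdot> h \<cdot> l i = counit x \<cdot> l i"
      using coalg_arr_simps(5)[OF l[OF i]] coalg_arr_simps(5)[OF hl[OF i]] by simp
  qed simp_all
  ultimately show ?thesis using x y h by (simp add: is_coalg_arr_def)
qed

lemma Cog_leg:
  assumes "is_cocone J (Cog A) D x l" "i \<in> obj J"
  shows "l i = (fobj D i, und (l i), x)" "is_coalg_arr A (fobj D i) (und (l i)) x"
proof -
  have "l i \<in> hom (Cog A) (fobj D i) x" using assms by (auto simp: is_cocone_def)
  then show "l i = (fobj D i, und (l i), x)" "is_coalg_arr A (fobj D i) (und (l i)) x"
    by (auto elim: Cog_homE)
qed

text \<open>The forgetful functor reflects colimits: a map that the universal property in \<open>A\<close> provides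
  is a coalgebra map by \<open>colimit_map_coalg\<close>.\<close>

lemma Cog_colimitI:
  assumes cc: "is_cocone J (Cog A) D x l"
    and col: "is_colimit J A (comp_func J (forgetful A) D) (carrier x) (\<lambda>i. und (l i))"
  shows "is_colimit J (Cog A) D x l"
proof (rule colimitI[OF cc])
  have x: "is_coalg A x" using coconeD(2)[OF cc] by simp
  note J = category.src_in[OF functor_cats(1)[OF coconeD(1)[OF cc]]]
    category.tgt_in[OF functor_cats(1)[OF coconeD(1)[OF cc]]]
  {
    fix y k assume k: "is_cocone J (Cog A) D y k"
    then have y: "is_coalg A y" using coconeD(2)[OF k] by simp
    have "is_cocone J A (comp_func J (forgetful A) D) (carrier y) (\<lambda>i. farr (forgetful A) (k i))"
      using functor_cocone[OF forgetful_functor k] y by simp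
    from colimitD(2)[OF col this] obtain h where h: "h \<in> hom A (carrier x) (carrier y)"
      "\<forall>i\<in>obj J. h \<cdot> und (l i) = farr (forgetful A) (k i)"
      by blast
    have hk: "h \<cdot> und (l i) = und (k i)" if "i \<in> obj J" for i
      using h(2) that coconeD(3)[OF k that] by simp
    have "is_coalg_arr A x h y"
      by (rule colimit_map_coalg[OF col x refl y h(1), where E = "fobj D"])
        (simp_all add: hk Cog_leg(2)[OF cc] Cog_leg(2)[OF k])
    then have "(x, h, y) \<in> hom (Cog A) x y" by simp
    moreover have "(x, h, y) \<cdot>\<^bsub>Cog A\<^esub> l i = k i" if i: "i \<in> obj J" for i
      using Cog_leg(1)[OF cc i] Cog_leg(1)[OF k i] hk[OF i] Cog_simps(6)[of A x h y "fobj D i" "und (l i)" x] by metis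
    ultimately show "\<exists>h. h \<in> hom (Cog A) x y \<and> (\<forall>i\<in>obj J. h \<cdot>\<^bsub>Cog A\<^esub> l i = k i)" by blast
  }
  fix f g y assume "f \<in> hom (Cog A) x y" "g \<in> hom (Cog A) x y"
  then obtain f' g' where f: "f = (x, f', y)" "is_coalg_arr A x f' y" and g: "g = (x, g', y)" "is_coalg_arr A x g' y"
    by (auto elim!: Cog_homE)
  assume eq: "\<And>i. i \<in> obj J \<Longrightarrow> f \<cdot>\<^bsub>Cog A\<^esub> l i = g \<cdot>\<^bsub>Cog A\<^esub> l i"
  have "f' \<cdot> und (l i) = g' \<cdot> und (l i)" if i: "i \<in> obj J" for i
    using eq[OF i] Cog_leg(1)[OF cc i] Cog_simps(6)[of A x _ y "fobj D i" "und (l i)" x]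
    unfolding f(1) g(1) by (metis fst_conv snd_conv)
  then have "f' = g'"
    by (rule colimit_ext[OF col, rotated 5]) (simp_all add: coalg_arr_simps[OF f(2)] coalg_arr_simps[OF g(2)])
  then show "f = g" by (simp add: f g)
qed

end


context smc
begin

text \<open>The colimit in \<open>A\<close> of a diagram of coalgebras carries a coalgebra structure, all of whose axioms
  may be tested on the jointly epic legs.  With this structure it is a cocone in \<open>Cog A\<close>.\<close>

lemma colimit_coalg:
  assumes D: "is_functor J (Cog A) D" and col: "is_colimit J A (comp_func J (forgetful A) D) c l"
  obtains x where "carrier x = c" "is_cocone J (Cog A) D x (\<lambda>i. (fobj D i, l i, x))"
proof -
  note cc = coconeD[OF colimitD(1)[OF col]]
  interpret J: category J using functor_cats[OF D] by blast
  note Ds [simp] = functor_simps[OF D]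
  have Di: "is_coalg A (fobj D i)" if "i \<in> obj J" for i using Ds(1)[OF that] by simp
  note Dc [simp] = coalg_simps[OF Di]
  have Df: "is_coalg_arr A (fobj D (src J f)) (und (farr D f)) (fobj D (tgt J f))"
      "farr D f = (fobj D (src J f), und (farr D f), fobj D (tgt J f))" if "f \<in> arr J" for f
  proof -
    have "farr D f \<in> hom (Cog A) (fobj D (src J f)) (fobj D (tgt J f))" using that by (simp add: in_hom)
    then show "is_coalg_arr A (fobj D (src J f)) (und (farr D f)) (fobj D (tgt J f))"
      "farr D f = (fobj D (src J f), und (farr D f), fobj D (tgt J f))"
      by (auto elim: Cog_homE)
  qed
  have [simp]: "c \<in> obj A" by (rule cc(2))
  have l [simp]: "l i \<in> arr A" "src A (l i) = carrier (fobj D i)" "tgt A (l i) = c" if "i \<in> obj J" for i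
    using cc that Di[OF that] by simp_all
  have lf: "l (tgt J f) \<cdot> und (farr D f) = l (src J f)" if "f \<in> arr J" for f
    using cc(6)[of f] that by simp
  have "is_cocone J A (comp_func J (forgetful A) D) (c \<odot> c) (\<lambda>i. (l i \<otimes> l i) \<cdot> comult (fobj D i))"
  proof (rule coconeI[OF cc(1)])
    fix f assume f: "f \<in> arr J"
    note [simp] = coalg_arr_simps(1-3)[OF Df(1)[OF f]]
    have "(l (tgt J f) \<otimes> l (tgt J f)) \<cdot> comult (fobj D (tgt J f)) \<cdot> und (farr D f)
      = (l (tgt J f) \<otimes> l (tgt J f)) \<cdot> ((und (farr D f) \<otimes> und (farr D f)) \<cdot> comult (fobj D (src J f)))"
      using f coalg_arr_simps(4)[OF Df(1)[OF f]] by simp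
    also have "\<dots> = (l (src J f) \<otimes> l (src J f)) \<cdot> comult (fobj D (src J f))"
      using f by (simp add: interchange_push lf)
    finally show "(l (tgt J f) \<otimes> l (tgt J f)) \<cdot> comult (fobj D (tgt J f)) \<cdot> farr (comp_func J (forgetful A) D) f
      = (l (src J f) \<otimes> l (src J f)) \<cdot> comult (fobj D (src J f))"
      using f by simp
  qed (simp_all add: in_hom Di)
  from colimitD(2)[OF col this] obtain d where "d \<in> hom A c (c \<odot> c)"
    and d: "\<And>i. i \<in> obj J \<Longrightarrow> d \<cdot> l i = (l i \<otimes> l i) \<cdot> comult (fobj D i)" by blast
  then have [simp]: "d \<in> arr A" "src A d = c" "tgt A d = c \<odot> c" by (simp_all add: in_hom)
  have "is_cocone J A (comp_func J (forgetful A) D) (tunit A) (\<lambda>i. counit (fobj D i))"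
    by (rule coconeI[OF cc(1)]) (simp_all add: in_hom Di coalg_arr_simps(5)[OF Df(1)])
  from colimitD(2)[OF col this] obtain e where "e \<in> hom A c (tunit A)"
    and e: "\<And>i. i \<in> obj J \<Longrightarrow> e \<cdot> l i = counit (fobj D i)" by blast
  then have [simp]: "e \<in> arr A" "src A e = c" "tgt A e = tunit A" by (simp_all add: in_hom)
  define x where "x = \<lparr>carrier = c, comult = d, counit = e\<rparr>"
  have x [simp]: "carrier x = c" "comult x = d" "counit x = e" by (simp_all add: x_def)
  have "is_coalg A x"
  proof (rule coalgI)
    show "associator A (carrier x) (carrier x) (carrier x) \<cdot> ((comult x \<otimes> idn A (carrier x)) \<cdot> comult x)
      = (idn A (carrier x) \<otimes> comult x) \<cdot> comult x"
    proof (rule colimit_ext[OF col])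
      fix i assume i [simp]: "i \<in> obj J"
      let ?y = "fobj D i"
      let ?c = "carrier ?y" and ?d = "comult ?y"
      have "associator A c c c \<cdot> ((d \<otimes> idn A c) \<cdot> (d \<cdot> l i)) = associator A c c c \<cdot> (((d \<cdot> l i) \<otimes> l i) \<cdot> ?d)"
        by (simp add: d interchange_push)
      also have "\<dots> = associator A c c c \<cdot> (((l i \<otimes> l i) \<otimes> l i) \<cdot> ((?d \<otimes> idn A ?c) \<cdot> ?d))"
        by (simp add: d interchange_push)
      also have "\<dots> = (l i \<otimes> (l i \<otimes> l i)) \<cdot> ((idn A ?c \<otimes> ?d) \<cdot> ?d)"
        using push2[OF associator_natural[of "l i" "l i" "l i"], of "(?d \<otimes> idn A ?c) \<cdot> ?d"]
        by (simp add: coalg_laws(1)[OF Di[OF i]])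
      also have "\<dots> = (l i \<otimes> (d \<cdot> l i)) \<cdot> ?d" by (simp add: interchange_push d)
      also have "\<dots> = (idn A c \<otimes> d) \<cdot> (d \<cdot> l i)" by (simp add: d) (simp add: interchange_push d)
      finally show "associator A (carrier x) (carrier x) (carrier x) \<cdot> ((comult x \<otimes> idn A (carrier x)) \<cdot> comult x) \<cdot> l i
        = (idn A (carrier x) \<otimes> comult x) \<cdot> comult x \<cdot> l i" by simp
    qed simp_all
    show "lunitor A (carrier x) \<cdot> ((counit x \<otimes> idn A (carrier x)) \<cdot> comult x) = idn A (carrier x)"
    proof (rule colimit_ext[OF col])
      fix i assume i [simp]: "i \<in> obj J"
      let ?y = "fobj D i"
      have "lunitor A c \<cdot> ((e \<otimes> idn A c) \<cdot> (d \<cdot> l i)) = lunitor A c \<cdot> ((idn A (tunit A) \<otimes> l i) \<cdot>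
          ((counit ?y \<otimes> idn A (carrier ?y)) \<cdot> comult ?y))"
        by (simp add: d) (simp add: interchange_push e)
      also have "\<dots> = l i"
        using push2[OF lunitor_natural[of "l i"], of "(counit ?y \<otimes> idn A (carrier ?y)) \<cdot> comult ?y"]
        by (simp add: coalg_laws(2)[OF Di[OF i]])
      finally show "lunitor A (carrier x) \<cdot> ((counit x \<otimes> idn A (carrier x)) \<cdot> comult x) \<cdot> l i
        = idn A (carrier x) \<cdot> l i" by simp
    qed simp_all
    show "runitor A (carrier x) \<cdot> ((idn A (carrier x) \<otimes> counit x) \<cdot> comult x) = idn A (carrier x)"
    proof (rule colimit_ext[OF col])
      fix i assume i [simp]: "i \<in> obj J"
      let ?y = "fobj D i"
      have "runitor A c \<cdot> ((idn A c \<otimes> e) \<cdot> (d \<cdot> l i)) = runitor A c \<cdot> ((l i \<otimes> idn A (tunit A)) \<cdot>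
          ((idn A (carrier ?y) \<otimes> counit ?y) \<cdot> comult ?y))"
        by (simp add: d) (simp add: interchange_push e)
      also have "\<dots> = l i"
        using push2[OF runitor_nat[of "l i" "carrier ?y" c], of "(idn A (carrier ?y) \<otimes> counit ?y) \<cdot> comult ?y"]
        by (simp add: coalg_laws(3)[OF Di[OF i]] in_hom)
      finally show "runitor A (carrier x) \<cdot> ((idn A (carrier x) \<otimes> counit x) \<cdot> comult x) \<cdot> l i
        = idn A (carrier x) \<cdot> l i" by simp
    qed simp_all
    show "braiding A (carrier x) (carrier x) \<cdot> comult x = comult x"
    proof (rule colimit_ext[OF col])
      fix i assume i [simp]: "i \<in> obj J"
      let ?y = "fobj D i"
      show "braiding A (carrier x) (carrier x) \<cdot> comult x \<cdot> l i = comult x \<cdot> l i"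
        using push2[OF braiding_natural[of "l i" "l i"], of "comult ?y"]
        by (simp add: d coalg_laws(4)[OF Di[OF i]])
    qed simp_all
  qed (simp_all add: in_hom)
  then have arr: "is_coalg_arr A (fobj D i) (l i) x" if "i \<in> obj J" for i
    using that d[OF that] e[OF that] by (simp add: is_coalg_arr_def Di in_hom)
  have "is_cocone J (Cog A) D x (\<lambda>i. (fobj D i, l i, x))"
  proof (rule coconeI[OF D])
    fix f assume f: "f \<in> arr J"
    show "(fobj D (tgt J f), l (tgt J f), x) \<cdot>\<^bsub>Cog A\<^esub> farr D f = (fobj D (src J f), l (src J f), x)"
      by (subst Df(2)[OF f]) (simp add: lf f)
  qed (use \<open>is_coalg A x\<close> arr in simp_all)
  with that x show thesis by blast
qed

text \<open>Let \<open>x\<close> be a colimit in \<open>Cog A\<close> and \<open>y\<close> the coalgebra on the colimit in \<open>A\<close>.  The universal properties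
  give coalgebra maps \<open>h' : x \<rightarrow> y\<close> and \<open>g : y \<rightarrow> x\<close>, and \<open>g h'\<close> is the identity because it fixes the legs.  So the
  underlying object of \<open>x\<close> inherits the universal property in \<open>A\<close> from \<open>y\<close>.\<close>

lemma forgetful_cocontinuous:
  fixes U :: "'u itself"
  assumes "cocomplete U A"
  shows "cocontinuous U (Cog A) A (forgetful A)"
  unfolding cocontinuous_def preserves_colimits_def
proof (intro conjI allI impI)
  show "is_functor (Cog A) A (forgetful A)" by (rule forgetful_functor)
  interpret Cog: category "Cog A" by (rule category_Cog)
  fix J :: "('u, 'u) cat" and D :: "('u, 'u, ('o, 'm) coalg, ('o, 'm) coalg_arr) func" and x l
  assume J: "small_category J" and col: "is_colimit J (Cog A) D x l"
  note cc = colimitD(1)[OF col]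
  let ?D = "comp_func J (forgetful A) D"
  have "is_functor J A ?D" by (rule comp_functor[OF coconeD(1)[OF cc] forgetful_functor])
  then obtain c k where k: "is_colimit J A ?D c k" using assms J unfolding cocomplete_def by blast
  note kc = coconeD[OF colimitD(1)[OF k]]
  obtain y where y: "carrier y = c" "is_cocone J (Cog A) D y (\<lambda>i. (fobj D i, k i, y))"
    using colimit_coalg[OF coconeD(1)[OF cc] k] .
  have x: "is_coalg A x" using coconeD(2)[OF cc] by simp
  obtain h where h: "h \<in> hom (Cog A) x y" "\<And>i. i \<in> obj J \<Longrightarrow> h \<cdot>\<^bsub>Cog A\<^esub> l i = (fobj D i, k i, y)"
    using colimitD(2)[OF col y(2)] by blast
  obtain h' where h': "h = (x, h', y)" "is_coalg_arr A x h' y" using h(1) by (rule Cog_homE)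
  have hl: "h' \<cdot> und (l i) = k i" if i: "i \<in> obj J" for i
    using h(2)[OF i] Cog_leg(1)[OF cc i] Cog_simps(6)[of A x h' y "fobj D i" "und (l i)" x]
    unfolding h'(1) by (metis fst_conv snd_conv)
  have lc: "is_cocone J A ?D (carrier x) (\<lambda>i. farr (forgetful A) (l i))"
    using functor_cocone[OF forgetful_functor cc] x by simp
  from colimitD(2)[OF k this] obtain g where g: "g \<in> hom A c (carrier x)"
    and "\<And>i. i \<in> obj J \<Longrightarrow> g \<cdot> k i = farr (forgetful A) (l i)" by blast
  then have gk: "g \<cdot> k i = und (l i)" if "i \<in> obj J" for i using coconeD(3)[OF cc that] that by simp
  have "is_coalg_arr A y g x"
    by (rule colimit_map_coalg[OF k _ y(1) x g, where E = "fobj D"])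
      (use coconeD(2)[OF y(2)] Cog_leg(2)[OF y(2)] Cog_leg(2)[OF cc] gk in simp_all)
  then have g': "(y, g, x) \<in> arr (Cog A)" by simp
  have gh: "(y, g, x) \<cdot>\<^bsub>Cog A\<^esub> (x, h', y) = idn (Cog A) x"
  proof (rule colimit_ext[OF col])
    fix i assume i: "i \<in> obj J"
    have "(y, g, x) \<cdot>\<^bsub>Cog A\<^esub> (x, h', y) \<cdot>\<^bsub>Cog A\<^esub> l i = (y, g, x) \<cdot>\<^bsub>Cog A\<^esub> (fobj D i, k i, y)"
      using h(2)[OF i] h(1) g' i coconeD[OF cc] unfolding h'(1) by (simp add: in_hom del: Cog_simps(6))
    also have "\<dots> = (fobj D i, und (l i), x)" by (simp add: gk[OF i])
    also have "\<dots> = idn (Cog A) x \<cdot>\<^bsub>Cog A\<^esub> l i"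
      using i coconeD[OF cc] Cog_leg(1)[OF cc i] by (simp del: Cog_simps)
    finally show "(y, g, x) \<cdot>\<^bsub>Cog A\<^esub> (x, h', y) \<cdot>\<^bsub>Cog A\<^esub> l i = idn (Cog A) x \<cdot>\<^bsub>Cog A\<^esub> l i" .
  qed (use g' h'(2) x Cog.idn_simps[of x] Cog.cmp_simps[of "(x, h', y)" "(y, g, x)"] in \<open>simp_all del: Cog_simps(6)\<close>)
  then have gh: "g \<cdot> h' = idn A (carrier x)" by simp
  note [simp] = coalg_arr_simps(1-3)[OF h'(2)] y(1)
  have [simp]: "g \<in> arr A" "src A g = c" "tgt A g = carrier x" using g by (simp_all add: in_hom)
  have lu: "farr (forgetful A) (l i) = und (l i)" if "i \<in> obj J" for i
    using coconeD(3)[OF cc that] by simp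
  note und_l [simp] = coalg_arr_simps(1-3)[OF Cog_leg(2)[OF cc]]
  have "is_colimit J A ?D (carrier x) (\<lambda>i. farr (forgetful A) (l i))"
  proof (rule colimitI[OF lc])
    fix d r assume "is_cocone J A ?D d r"
    then obtain u where u: "u \<in> hom A c d" "\<And>i. i \<in> obj J \<Longrightarrow> u \<cdot> k i = r i"
      using colimitD(2)[OF k] by blast
    have "u \<cdot> h' \<cdot> farr (forgetful A) (l i) = r i" if "i \<in> obj J" for i
      using u that by (simp add: lu hl in_hom)
    moreover have "u \<cdot> h' \<in> hom A (carrier x) d" using u by (simp add: in_hom)
    ultimately show "\<exists>h. h \<in> hom A (carrier x) d \<and> (\<forall>i\<in>obj J. h \<cdot> farr (forgetful A) (l i) = r i)"
      by blast
  next
    fix u v d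
    assume uv: "u \<in> hom A (carrier x) d" "v \<in> hom A (carrier x) d"
      and eq: "\<And>i. i \<in> obj J \<Longrightarrow> u \<cdot> farr (forgetful A) (l i) = v \<cdot> farr (forgetful A) (l i)"
    have "u \<cdot> g = v \<cdot> g"
      by (rule colimit_ext[OF k]) (use uv eq kc in \<open>simp_all add: in_hom gk lu\<close>)
    then have "u \<cdot> g \<cdot> h' = v \<cdot> g \<cdot> h'" by simp
    then show "u = v" using uv by (simp add: gh in_hom)
  qed
  with x show "is_colimit J A ?D (fobj (forgetful A) x) (\<lambda>i. farr (forgetful A) (l i))" by simp
qed

end


section \<open>Categories of monoidal functors\<close>

lemma cocontinuous_comp:
  fixes C :: "('o, 'm, 'y) cat_scheme" and U :: "'u itself"
  assumes F: "cocontinuous U C E F" and G: "cocontinuous U E K G" and H: "is_functor C K H"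
    and eq: "\<And>a. a \<in> obj C \<Longrightarrow> fobj G (fobj F a) = fobj H a" "\<And>f. f \<in> arr C \<Longrightarrow> farr G (farr F f) = farr H f"
  shows "cocontinuous U C K H"
  unfolding cocontinuous_def preserves_colimits_def
proof (intro conjI allI impI)
  fix J :: "('u, 'u) cat" and D :: "('u, 'u, 'o, 'm) func" and c l
  assume J: "small_category J" and l: "is_colimit J C D c l"
  note cc = coconeD[OF colimitD(1)[OF l]]
  note D = functor_simps[OF cc(1)]
  have "is_colimit J E (comp_func J F D) (fobj F c) (\<lambda>i. farr F (l i))"
    using F J l unfolding cocontinuous_def preserves_colimits_def by blast
  then have k: "is_colimit J K (comp_func J G (comp_func J F D)) (fobj G (fobj F c)) (\<lambda>i. farr G (farr F (l i)))"
    using G J unfolding cocontinuous_def preserves_colimits_def by blast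
  have "comp_func J G (comp_func J F D) = comp_func J H D"
    using D eq by (auto simp: comp_func_def intro!: restrict_ext)
  then show "is_colimit J K (comp_func J H D) (fobj H c) (\<lambda>i. farr H (l i))"
    using colimit_cong[OF k] cc(2,3) eq by simp
qed (rule H)

lemma (in coalgebra_valued) UH_cocontinuous:
  fixes U :: "'u itself"
  assumes "cocomplete U A" "cocontinuous U R (Cog A) H"
  shows "cocontinuous U R A UH"
  by (rule cocontinuous_comp[OF assms(2) A.forgetful_cocontinuous[OF assms(1)] UH_functor]) simp_all

lemma (in monoidal_on_cartesian) lift_cocontinuous:
  fixes U :: "'u itself"
  assumes "cocontinuous U R A F"
  shows "cocontinuous U R (Cog A) (LF)"
  unfolding cocontinuous_def preserves_colimits_def
proof (intro conjI allI impI)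
  show "is_functor R (Cog A) (LF)" by (rule lift_functor)
  fix J :: "('u, 'u) cat" and D :: "('u, 'u, 'o, 'm) func" and c l
  assume J: "small_category J" and col: "is_colimit J R D c l"
  note cc = coconeD[OF colimitD(1)[OF col]]
  have k: "is_colimit J A (comp_func J F D) (fobj F c) (\<lambda>i. farr F (l i))"
    using assms J col unfolding cocontinuous_def preserves_colimits_def by blast
  show "is_colimit J (Cog A) (comp_func J (LF) D) (fobj (LF) c)
      (\<lambda>i. farr (LF) (l i))"
  proof (rule A.Cog_colimitI)
    show "is_cocone J (Cog A) (comp_func J (LF) D) (fobj (LF) c)
      (\<lambda>i. farr (LF) (l i))"
      by (rule functor_cocone[OF lift_functor colimitD(1)[OF col]])
    have "farr (forgetful A) (farr (LF) f) = farr F f" if "f \<in> arr R" for f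
      using that lift_arr[OF that] by simp
    then have "comp_func J (forgetful A) (comp_func J (LF) D) = comp_func J F D"
      using functor_simps[OF cc(1)] lift_coalg
      by (auto simp: comp_func_def simp del: lift_simps(2) intro!: restrict_ext)
    moreover have "carrier (fobj (LF) c) = fobj F c" using cc(2) by simp
    ultimately show "is_colimit J A (comp_func J (forgetful A) (comp_func J (LF) D))
        (carrier (fobj (LF) c)) (\<lambda>i. und (farr (LF) (l i)))"
      using colimit_cong[OF k] cc(3) by simp
  qed
qed


lemma com2ring_simps [simp]:
  "obj (com2ring_hom U R S) = {F. sm_functor R S F \<and> cocontinuous U R S F}"
  "src (com2ring_hom U R S) (F, t, G) = F" "tgt (com2ring_hom U R S) (F, t, G) = G"
  "(F, t, G) \<in> arr (com2ring_hom U R S) \<longleftrightarrow> F \<in> obj (com2ring_hom U R S) \<and> G \<in> obj (com2ring_hom U R S) \<and>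
    is_monoidal_nat R S F G t"
  "idn (com2ring_hom U R S) F = (F, id_nat R S F, F)"
  "(G', t, H) \<cdot>\<^bsub>com2ring_hom U R S\<^esub> (F, s, G) = (F, vcomp R S t s, H)"
  by (simp_all add: com2ring_hom_def Let_def)

lemma com2ring_arrE:
  assumes "f \<in> arr (com2ring_hom U R S)"
  obtains F t G where "f = (F, t, G)" "sm_functor R S F" "cocontinuous U R S F"
    "sm_functor R S G" "cocontinuous U R S G" "is_monoidal_nat R S F G t"
  using assms by (auto simp: com2ring_hom_def Let_def)

lemma com2ring_homE:
  assumes "f \<in> hom (com2ring_hom U R S) F G"
  obtains t where "f = (F, t, G)" "sm_functor R S F" "cocontinuous U R S F"
    "sm_functor R S G" "cocontinuous U R S G" "is_monoidal_nat R S F G t"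
  using assms by (auto simp: com2ring_hom_def Let_def in_hom)

lemma monoidal_natD:
  assumes "is_monoidal_nat R S F G t"
  shows "is_nat R S F G t"
    "\<And>a b. \<lbrakk>a \<in> obj R; b \<in> obj R\<rbrakk> \<Longrightarrow> t (a \<odot>\<^bsub>R\<^esub> b) \<cdot>\<^bsub>S\<^esub> mu F (a, b) = mu G (a, b) \<cdot>\<^bsub>S\<^esub> (t a \<otimes>\<^bsub>S\<^esub> t b)"
    "t (tunit R) \<cdot>\<^bsub>S\<^esub> eta F = eta G"
  using assms unfolding is_monoidal_nat_def by blast+

context tensor_category
begin

lemma tensor_part_simps [simp]:
  assumes "f \<in> arr S" "g \<in> arr S" "src S f \<odot> src S g \<in> obj S" "tgt S f \<odot> tgt S g \<in> obj S"
  shows "f \<otimes> g \<in> arr S" "src S (f \<otimes> g) = src S f \<odot> src S g" "tgt S (f \<otimes> g) = tgt S f \<odot> tgt S g"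
  using tar_hom_part[of f "src S f" "tgt S f" g "src S g" "tgt S g"] assms by (simp_all add: in_hom)

lemma interchange_part:
  assumes "f \<in> arr S" "f' \<in> arr S" "tgt S f = src S f'" "g \<in> arr S" "g' \<in> arr S" "tgt S g = src S g'"
  shows "(f' \<otimes> g') \<cdot> (f \<otimes> g) = (f' \<cdot> f) \<otimes> (g' \<cdot> g)"
  using tar_cmp_part[of f "src S f" "tgt S f" f' "tgt S f'" g "src S g" "tgt S g" g' "tgt S g'"] assms
  by (simp add: in_hom)

lemma sm_functor_simps:
  assumes "sm_functor R S F" "a \<in> obj R" "b \<in> obj R"
  shows "mu F (a, b) \<in> arr S" "src S (mu F (a, b)) = fobj F a \<odot> fobj F b"
    "tgt S (mu F (a, b)) = fobj F (a \<odot>\<^bsub>R\<^esub> b)" "fobj F a \<odot> fobj F b \<in> obj S"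
  using sm_functorD(3)[OF assms] src_obj[of "mu F (a, b)"] by (auto simp: in_hom)

lemma sm_functor_eta:
  assumes "sm_functor R S F"
  shows "eta F \<in> arr S" "src S (eta F) = tunit S" "tgt S (eta F) = fobj F (tunit R)"
  using sm_functorD(5)[OF assms] by (auto simp: in_hom)

lemma id_monoidal_nat:
  assumes F: "sm_functor R S F" and R: "cartesian R p q dia bang"
  shows "is_monoidal_nat R S F F (id_nat R S F)"
proof -
  interpret R: cartesian R p q dia bang by (rule R)
  note [simp] = sm_functor_simps[OF F] sm_functor_eta[OF F] functor_simps[OF sm_functorD(1)[OF F]]
  show ?thesis
    using id_nat_nat[OF sm_functorD(1)[OF F]]
    by (auto simp: is_monoidal_nat_def id_nat_def tar_idn_part)
qed

lemma vcomp_monoidal_nat: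
  assumes s: "is_monoidal_nat R S F G s" and t: "is_monoidal_nat R S G H t"
    and F: "sm_functor R S F" and G: "sm_functor R S G" and H: "sm_functor R S H"
    and R: "cartesian R p q dia bang"
  shows "is_monoidal_nat R S F H (vcomp R S t s)"
  unfolding is_monoidal_nat_def
proof (intro conjI ballI)
  interpret R: cartesian R p q dia bang by (rule R)
  note [simp] = sm_functor_simps[OF F] sm_functor_simps[OF G] sm_functor_simps[OF H]
    nat_simps(1-3)[OF monoidal_natD(1)[OF s]] nat_simps(1-3)[OF monoidal_natD(1)[OF t]]
  show "is_nat R S F H (vcomp R S t s)"
    by (rule vcomp_nat[OF monoidal_natD(1)[OF s] monoidal_natD(1)[OF t]])
  show "vcomp R S t s (tunit R) \<cdot> eta F = eta H"
    using monoidal_natD(3)[OF s] monoidal_natD(3)[OF t] sm_functor_eta[OF F]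
    by (simp add: vcomp_def)
  fix a b assume ab [simp]: "a \<in> obj R" "b \<in> obj R"
  have "t (a \<odot>\<^bsub>R\<^esub> b) \<cdot> (s (a \<odot>\<^bsub>R\<^esub> b) \<cdot> mu F (a, b)) = t (a \<odot>\<^bsub>R\<^esub> b) \<cdot> (mu G (a, b) \<cdot> (s a \<otimes> s b))"
    by (simp add: monoidal_natD(2)[OF s])
  also have "\<dots> = mu H (a, b) \<cdot> ((t a \<otimes> t b) \<cdot> (s a \<otimes> s b))"
    by (simp add: push2[OF monoidal_natD(2)[OF t]])
  finally show "vcomp R S t s (a \<odot>\<^bsub>R\<^esub> b) \<cdot> mu F (a, b)
    = mu H (a, b) \<cdot> (vcomp R S t s a \<otimes> vcomp R S t s b)"
    by (simp add: vcomp_def interchange_part)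
qed

lemma category_com2ring:
  assumes R: "cartesian R p q dia bang"
  shows "category (com2ring_hom U R S)"
proof
  fix f assume "f \<in> arr (com2ring_hom U R S)"
  then show "src (com2ring_hom U R S) f \<in> obj (com2ring_hom U R S)"
    "tgt (com2ring_hom U R S) f \<in> obj (com2ring_hom U R S)"
    by (auto elim: com2ring_arrE)
next
  fix F assume "F \<in> obj (com2ring_hom U R S)"
  then show "idn (com2ring_hom U R S) F \<in> hom (com2ring_hom U R S) F F"
    using id_monoidal_nat[OF _ R] by (simp add: in_hom)
next
  fix f g h F G H K
  assume f: "f \<in> hom (com2ring_hom U R S) F G"
  then obtain r where r: "f = (F, r, G)" "is_monoidal_nat R S F G r" and F: "sm_functor R S F"
      "cocontinuous U R S F" and G: "sm_functor R S G"
    by (rule com2ring_homE)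
  note rn = monoidal_natD(1)[OF r(2)]
  note [simp] = nat_simps(1-3)[OF rn] functor_simps[OF natD(1)[OF rn]] functor_simps[OF natD(2)[OF rn]]
  show "f \<cdot>\<^bsub>com2ring_hom U R S\<^esub> idn (com2ring_hom U R S) F = f"
    "idn (com2ring_hom U R S) G \<cdot>\<^bsub>com2ring_hom U R S\<^esub> f = f"
    using natD(3)[OF rn] by (auto simp: r(1) vcomp_def id_nat_def intro!: restrict_eqI)
  assume "g \<in> hom (com2ring_hom U R S) G H"
  then obtain s where s: "g = (G, s, H)" "is_monoidal_nat R S G H s" and H: "sm_functor R S H"
      "cocontinuous U R S H"
    by (rule com2ring_homE)
  show "g \<cdot>\<^bsub>com2ring_hom U R S\<^esub> f \<in> hom (com2ring_hom U R S) F H"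
    using vcomp_monoidal_nat[OF r(2) s(2) F(1) G H(1) R] F H by (simp add: r(1) s(1) in_hom)
  assume "h \<in> hom (com2ring_hom U R S) H K"
  then obtain t where t: "h = (H, t, K)" "is_monoidal_nat R S H K t"
    by (rule com2ring_homE)
  show "h \<cdot>\<^bsub>com2ring_hom U R S\<^esub> g \<cdot>\<^bsub>com2ring_hom U R S\<^esub> f
    = h \<cdot>\<^bsub>com2ring_hom U R S\<^esub> (g \<cdot>\<^bsub>com2ring_hom U R S\<^esub> f)"
    using nat_simps(1-3)[OF monoidal_natD(1)[OF s(2)]] nat_simps(1-3)[OF monoidal_natD(1)[OF t(2)]]
    by (auto simp: r(1) s(1) t(1) vcomp_def intro!: restrict_ext)
qed

end


section \<open>The forgetful functor is an isomorphism on categories of monoidal functors\<close>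

text \<open>Components of monoidal transformations are coalgebra maps for the lifted structures, because
  these structures are defined from data that the transformation respects.\<close>

lemma monoidal_nat_coalg_arr:
  assumes R: "cartesian R p q dia bang" and A: "smc A" and F: "sm_functor R A F" and G: "sm_functor R A G"
    and t: "is_monoidal_nat R A F G t" and a [simp]: "a \<in> obj R"
  shows "is_coalg_arr A (lift_obj dia bang A F a) (t a) (lift_obj dia bang A G a)"
proof -
  interpret A: smc A by (rule A)
  interpret F: monoidal_on_cartesian R p q dia bang A F
    using R A F by (simp add: monoidal_on_cartesian_def monoidal_on_cartesian_axioms_def)
  interpret G: monoidal_on_cartesian R p q dia bang A G
    using R A G by (simp add: monoidal_on_cartesian_def monoidal_on_cartesian_axioms_def)
  note tn = monoidal_natD(1)[OF t]
  note [simp] = nat_simps(1-3)[OF tn]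
  have "G.m a a \<cdot>\<^bsub>A\<^esub> ((t a \<otimes>\<^bsub>A\<^esub> t a) \<cdot>\<^bsub>A\<^esub> F.\<Delta> a) = t (a \<odot>\<^bsub>R\<^esub> a) \<cdot>\<^bsub>A\<^esub> (F.m a a \<cdot>\<^bsub>A\<^esub> F.\<Delta> a)"
    using A.push2[OF monoidal_natD(2)[OF t a a], of "F.\<Delta> a"] by simp
  also have "\<dots> = G.m a a \<cdot>\<^bsub>A\<^esub> (G.\<Delta> a \<cdot>\<^bsub>A\<^esub> t a)"
    using nat_simps(4)[OF tn, of "dia a"] A.push2[OF G.m_delta[OF a], of "t a"] by (simp add: F.m_delta)
  finally have "(t a \<otimes>\<^bsub>A\<^esub> t a) \<cdot>\<^bsub>A\<^esub> F.\<Delta> a = G.\<Delta> a \<cdot>\<^bsub>A\<^esub> t a"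
    by (rule A.iso_cancel[rotated 5]) simp_all
  moreover have "eta G \<cdot>\<^bsub>A\<^esub> (G.\<epsilon> a \<cdot>\<^bsub>A\<^esub> t a) = t (tunit R) \<cdot>\<^bsub>A\<^esub> (eta F \<cdot>\<^bsub>A\<^esub> F.\<epsilon> a)"
    using nat_simps(4)[OF tn, of "bang a"] A.push2[OF G.n_eps[OF a], of "t a"] by (simp add: F.n_eps)
  then have "eta G \<cdot>\<^bsub>A\<^esub> (G.\<epsilon> a \<cdot>\<^bsub>A\<^esub> t a) = eta G \<cdot>\<^bsub>A\<^esub> F.\<epsilon> a"
    using A.push2[OF monoidal_natD(3)[OF t], of "F.\<epsilon> a"] by simp
  then have "G.\<epsilon> a \<cdot>\<^bsub>A\<^esub> t a = F.\<epsilon> a" by (rule A.iso_cancel[rotated 5]) simp_all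
  ultimately show ?thesis by (simp add: is_coalg_arr_def F.lift_coalg G.lift_coalg in_hom)
qed

text \<open>The inverse of composition with the forgetful functor, on functors and on transformations.\<close>

definition lift_hom ::
  "'u itself \<Rightarrow> ('o, 'm) smc \<Rightarrow> ('o \<Rightarrow> 'm) \<Rightarrow> ('o \<Rightarrow> 'm) \<Rightarrow> ('p, 'n) smc
    \<Rightarrow> (('o, 'm, 'p, 'n) smfun, ('o, 'm, 'p, 'n) smnat,
        ('o, 'm, ('p, 'n) coalg, ('p, 'n) coalg_arr) smfun,
        ('o, 'm, ('p, 'n) coalg, ('p, 'n) coalg_arr) smnat) func" where
  "lift_hom U R dia bang A = \<lparr>
     fobj = \<lambda>F\<in>obj (com2ring_hom U R A). lift R dia bang A F,
     farr = \<lambda>(F, t, G)\<in>arr (com2ring_hom U R A).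
       (lift R dia bang A F,
        \<lambda>a\<in>obj R. (lift_obj dia bang A F a, t a, lift_obj dia bang A G a),
        lift R dia bang A G)\<rparr>"

locale coalgebra_comparison = R: cartesian R p q dia bang + A: smc A
  for R :: "('o, 'm) smc" and p q dia bang and A :: "('p, 'n) smc" (structure) +
  fixes U :: "'u itself"
  assumes cocomp: "cocomplete U A"
begin

abbreviation "P \<equiv> com2ring_hom U R (Cog A)"

abbreviation "Q \<equiv> com2ring_hom U R A"

abbreviation "T \<equiv> postcompose U R (Cog A) A (forgetful A)"

abbreviation "V \<equiv> lift_hom U R dia bang A"

lemma on_cartesian: "sm_functor R A F \<Longrightarrow> monoidal_on_cartesian R p q dia bang A F"
  by unfold_locales

lemma into_coalgebras: "sm_functor R (Cog A) H \<Longrightarrow> coalgebra_valued R p q dia bang A H"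
  by unfold_locales

lemma category_P: "category P"
  by (rule tensor_category.category_com2ring[OF A.tensor_category_Cog R.cartesian_axioms])

lemma category_Q: "category Q"
  by (rule tensor_category.category_com2ring[OF A.is_tensor_category R.cartesian_axioms])

lemma T_obj: "H \<in> obj P \<Longrightarrow> fobj T H = comp_smfun R A (forgetful A) H"
  by (simp add: postcompose_def)

lemma T_arr: "(H, t, K) \<in> arr P \<Longrightarrow> farr T (H, t, K)
  = (comp_smfun R A (forgetful A) H, \<lambda>a\<in>obj R. und (t a), comp_smfun R A (forgetful A) K)"
proof -
  assume "(H, t, K) \<in> arr P"
  moreover from this have "is_nat R (Cog A) H K t" by (auto dest: monoidal_natD)
  ultimately show ?thesis
    by (auto simp: postcompose_def nat_simps intro!: restrict_ext)
qed

lemma V_obj: "F \<in> obj Q \<Longrightarrow> fobj V F = lift R dia bang A F"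
  by (simp add: lift_hom_def)

lemma V_arr: "(F, t, G) \<in> arr Q \<Longrightarrow> farr V (F, t, G) = (lift R dia bang A F,
    \<lambda>a\<in>obj R. (lift_obj dia bang A F a, t a, lift_obj dia bang A G a), lift R dia bang A G)"
  by (simp add: lift_hom_def)

lemma T_functor: "is_functor P Q T"
proof (rule functorI[OF category_P category_Q])
  fix H assume H: "H \<in> obj P"
  interpret H: coalgebra_valued R p q dia bang A H by (rule into_coalgebras) (use H in simp)
  show "fobj T H \<in> obj Q"
    using H H.UH_sm_functor H.UH_cocontinuous[OF cocomp] by (simp add: T_obj del: comp_smfun_def)
  show "farr T (idn P H) = idn Q (fobj T H)"
    using category.idn_simps(1)[OF category_P H] H.UH_functor H
    by (auto simp: T_arr T_obj id_nat_def intro!: restrict_ext)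
next
  fix f assume f: "f \<in> arr P"
  then obtain H t K where f': "f = (H, t, K)" and H: "sm_functor R (Cog A) H" "cocontinuous U R (Cog A) H"
    and K: "sm_functor R (Cog A) K" "cocontinuous U R (Cog A) K" and t: "is_monoidal_nat R (Cog A) H K t"
    by (rule com2ring_arrE)
  interpret H: coalgebra_valued R p q dia bang A H by (rule into_coalgebras[OF H(1)])
  interpret K: coalgebra_valued R p q dia bang A K by (rule into_coalgebras[OF K(1)])
  note tn = monoidal_natD(1)[OF t]
  have ta: "is_coalg_arr A (fobj H a) (und (t a)) (fobj K a)" if "a \<in> obj R" for a
  proof -
    have "t a \<in> hom (Cog A) (fobj H a) (fobj K a)" using nat_simps(1-3)[OF tn that] by (simp add: in_hom)
    then show ?thesis by (auto elim: Cog_homE)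
  qed
  have "is_monoidal_nat R A H.UH K.UH (\<lambda>a\<in>obj R. und (t a))"
    unfolding is_monoidal_nat_def
  proof (intro conjI ballI)
    show "is_nat R A H.UH K.UH (\<lambda>a\<in>obj R. und (t a))"
    proof (rule natI[OF H.UH_functor K.UH_functor])
      fix a assume a: "a \<in> obj R"
      then show "(\<lambda>a\<in>obj R. und (t a)) a \<in> hom A (fobj H.UH a) (fobj K.UH a)"
        using A.coalg_arr_simps(1-3)[OF ta[OF a]] by (simp add: in_hom)
    next
      fix f assume "f \<in> arr R"
      then show "(\<lambda>a\<in>obj R. und (t a)) (tgt R f) \<cdot> farr H.UH f = farr K.UH f \<cdot> (\<lambda>a\<in>obj R. und (t a)) (src R f)"
        using arg_cong[OF nat_simps(4)[OF tn, of f], of und] by (simp add: und_cmp)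
    qed simp
    show "(\<lambda>a\<in>obj R. und (t a)) (tunit R) \<cdot> eta H.UH = eta K.UH"
      using arg_cong[OF monoidal_natD(3)[OF t], of und] by (simp add: und_cmp)
    fix a b assume "a \<in> obj R" "b \<in> obj R"
    then show "(\<lambda>a\<in>obj R. und (t a)) (a \<odot>\<^bsub>R\<^esub> b) \<cdot> mu H.UH (a, b)
      = mu K.UH (a, b) \<cdot> ((\<lambda>a\<in>obj R. und (t a)) a \<otimes> (\<lambda>a\<in>obj R. und (t a)) b)"
      using arg_cong[OF monoidal_natD(2)[OF t, of a b], of und] by (simp add: und_cmp und_tar)
  qed
  then show "farr T f \<in> hom Q (fobj T (src P f)) (fobj T (tgt P f))"
    using f H K H.UH_sm_functor H.UH_cocontinuous[OF cocomp] K.UH_sm_functor K.UH_cocontinuous[OF cocomp]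
    by (simp add: f' T_arr T_obj in_hom)
next
  fix f g assume fg: "f \<in> arr P" "g \<in> arr P" "tgt P f = src P g"
  then have gf: "g \<cdot>\<^bsub>P\<^esub> f \<in> arr P" using category.cmp_simps(1)[OF category_P] by blast
  from fg obtain H s K t L where "f = (H, s, K)" "g = (K, t, L)"
    by (auto elim!: com2ring_arrE)
  with fg gf show "farr T (g \<cdot>\<^bsub>P\<^esub> f) = farr T g \<cdot>\<^bsub>Q\<^esub> farr T f"
    by (auto simp: T_arr vcomp_def und_cmp simp del: com2ring_simps(4) intro!: restrict_ext)
qed (simp_all add: postcompose_def)

lemma V_functor: "is_functor Q P V"
proof (rule functorI[OF category_Q category_P])
  fix F assume F: "F \<in> obj Q"
  interpret F: monoidal_on_cartesian R p q dia bang A F by (rule on_cartesian) (use F in simp)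
  show "fobj V F \<in> obj P"
    using F F.lift_sm_functor F.lift_cocontinuous[of U] by (simp add: V_obj)
  show "farr V (idn Q F) = idn P (fobj V F)"
    using category.idn_simps(1)[OF category_Q F] F
    by (auto simp: V_arr V_obj id_nat_def intro!: restrict_ext)
next
  fix f assume f: "f \<in> arr Q"
  then obtain F t G where f': "f = (F, t, G)" and F: "sm_functor R A F" "cocontinuous U R A F"
    and G: "sm_functor R A G" "cocontinuous U R A G" and t: "is_monoidal_nat R A F G t"
    by (rule com2ring_arrE)
  interpret F: monoidal_on_cartesian R p q dia bang A F by (rule on_cartesian[OF F(1)])
  interpret G: monoidal_on_cartesian R p q dia bang A G by (rule on_cartesian[OF G(1)])
  note ta = monoidal_nat_coalg_arr[OF R.cartesian_axioms A.smc_axioms F(1) G(1) t]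
  note tn = monoidal_natD(1)[OF t]
  let ?t = "\<lambda>a\<in>obj R. (F.L a, t a, G.L a)"
  have "is_monoidal_nat R (Cog A) (lift R dia bang A F) (lift R dia bang A G) ?t"
    unfolding is_monoidal_nat_def
  proof (intro conjI ballI)
    show "is_nat R (Cog A) (lift R dia bang A F) (lift R dia bang A G) ?t"
      using nat_simps(4)[OF tn] by (intro natI[OF F.lift_functor G.lift_functor]) (simp_all add: ta)
    show "?t (tunit R) \<cdot>\<^bsub>Cog A\<^esub> eta (lift R dia bang A F) = eta (lift R dia bang A G)"
      using monoidal_natD(3)[OF t] by simp
    fix a b assume "a \<in> obj R" "b \<in> obj R"
    then show "?t (a \<odot>\<^bsub>R\<^esub> b) \<cdot>\<^bsub>Cog A\<^esub> mu (lift R dia bang A F) (a, b)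
      = mu (lift R dia bang A G) (a, b) \<cdot>\<^bsub>Cog A\<^esub> (?t a \<otimes>\<^bsub>Cog A\<^esub> ?t b)"
      using monoidal_natD(2)[OF t, of a b] by simp
  qed
  then show "farr V f \<in> hom P (fobj V (src Q f)) (fobj V (tgt Q f))"
    using f F G F.lift_sm_functor F.lift_cocontinuous[of U] G.lift_sm_functor G.lift_cocontinuous[of U]
    by (simp add: f' V_arr V_obj in_hom)
next
  fix f g assume fg: "f \<in> arr Q" "g \<in> arr Q" "tgt Q f = src Q g"
  then have gf: "g \<cdot>\<^bsub>Q\<^esub> f \<in> arr Q" using category.cmp_simps(1)[OF category_Q] by blast
  from fg obtain F s G t H where "f = (F, s, G)" "g = (G, t, H)"
    by (auto elim!: com2ring_arrE)
  with fg gf show "farr V (g \<cdot>\<^bsub>Q\<^esub> f) = farr V g \<cdot>\<^bsub>P\<^esub> farr V f"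
    by (auto simp: V_arr vcomp_def simp del: com2ring_simps(4) intro!: restrict_ext)
qed (simp_all add: lift_hom_def)

lemma V_T: "comp_func P V T = id_func P"
proof (rule functor_ext[OF comp_functor[OF T_functor V_functor] id_functor[OF category_P]])
  fix H assume H: "H \<in> obj P"
  interpret H: coalgebra_valued R p q dia bang A H by (rule into_coalgebras) (use H in simp)
  show "fobj (comp_func P V T) H = fobj (id_func P) H"
    using H functor_simps(1)[OF T_functor H] by (simp add: T_obj V_obj H.lift_forgetful del: com2ring_simps)
next
  fix f assume f: "f \<in> arr P"
  then obtain H t K where f': "f = (H, t, K)" and H: "sm_functor R (Cog A) H"
    and K: "sm_functor R (Cog A) K" and t: "is_monoidal_nat R (Cog A) H K t"
    by (rule com2ring_arrE)
  interpret H: coalgebra_valued R p q dia bang A H by (rule into_coalgebras[OF H])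
  interpret K: coalgebra_valued R p q dia bang A K by (rule into_coalgebras[OF K])
  note tn = monoidal_natD(1)[OF t]
  have L: "lift_obj dia bang A H.UH a = fobj H a" "lift_obj dia bang A K.UH a = fobj K a"
    if "a \<in> obj R" for a
    using that H.lift_forgetful K.lift_forgetful
      monoidal_on_cartesian.lift_simps(1)[OF on_cartesian[OF H.UH_sm_functor] that]
      monoidal_on_cartesian.lift_simps(1)[OF on_cartesian[OF K.UH_sm_functor] that] by simp_all
  have "(fobj H a, und (t a), fobj K a) = t a" if "a \<in> obj R" for a
  proof -
    have "t a \<in> hom (Cog A) (fobj H a) (fobj K a)" using nat_simps(1-3)[OF tn that] by (simp add: in_hom)
    then show ?thesis by (auto elim: Cog_homE)
  qed
  then have "(\<lambda>a\<in>obj R. (fobj H a, und (t a), fobj K a)) = t"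
    using natD(3)[OF tn] by (auto intro: restrict_eqI)
  moreover have "farr V (farr T f) = (H, \<lambda>a\<in>obj R. (fobj H a, und (t a), fobj K a), K)"
    using functor_simps(2)[OF T_functor f] f
    by (auto simp: f' T_arr V_arr H.lift_forgetful K.lift_forgetful L simp del: com2ring_simps intro!: restrict_ext)
  ultimately show "farr (comp_func P V T) f = farr (id_func P) f" using f by (simp add: f')
qed

lemma T_V: "comp_func Q T V = id_func Q"
proof (rule functor_ext[OF comp_functor[OF V_functor T_functor] id_functor[OF category_Q]])
  fix F assume F: "F \<in> obj Q"
  interpret F: monoidal_on_cartesian R p q dia bang A F by (rule on_cartesian) (use F in simp)
  show "fobj (comp_func Q T V) F = fobj (id_func Q) F"
    using F functor_simps(1)[OF V_functor F] by (simp add: T_obj V_obj F.forgetful_lift del: com2ring_simps)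
next
  fix f assume f: "f \<in> arr Q"
  then obtain F t G where f': "f = (F, t, G)" and F: "sm_functor R A F"
    and G: "sm_functor R A G" and t: "is_monoidal_nat R A F G t"
    by (rule com2ring_arrE)
  interpret F: monoidal_on_cartesian R p q dia bang A F by (rule on_cartesian[OF F])
  interpret G: monoidal_on_cartesian R p q dia bang A G by (rule on_cartesian[OF G])
  have "(\<lambda>a\<in>obj R. t a) = t"
    using natD(3)[OF monoidal_natD(1)[OF t]] by (auto intro: restrict_eqI)
  moreover have "farr T (farr V f) = (F, \<lambda>a\<in>obj R. t a, G)"
    using functor_simps(2)[OF V_functor f] f
    by (auto simp: f' T_arr V_arr F.forgetful_lift G.forgetful_lift simp del: com2ring_simps intro!: restrict_ext)
  ultimately show "farr (comp_func Q T V) f = farr (id_func Q) f" using f by (simp add: f')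
qed

end


section \<open>Restriction of functors has a right adjoint\<close>

text \<open>Cocones over the image of a diagram transpose to cocones over the diagram itself.  The right
  adjoint is given by its values and the universal arrows.\<close>

lemma left_adjoint_cocontinuous:
  fixes C :: "('o, 'm, 'y) cat_scheme" and U :: "'u itself"
  assumes L: "is_functor C E L"
    and univ: "\<And>d. d \<in> obj E \<Longrightarrow> \<exists>r \<in> obj C. \<exists>e \<in> hom E (fobj L r) d. \<forall>c \<in> obj C. \<forall>g \<in> hom E (fobj L c) d.
      \<exists>!h. h \<in> hom C c r \<and> e \<cdot>\<^bsub>E\<^esub> farr L h = g"
  shows "cocontinuous U C E L"
  unfolding cocontinuous_def preserves_colimits_def
proof (intro conjI allI impI)
  show "is_functor C E L" by (rule L)
  interpret C: category C using functor_cats[OF L] by blast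
  interpret E: category E using functor_cats[OF L] by blast
  note Ls = functor_simps[OF L]
  fix J :: "('u, 'u) cat" and D :: "('u, 'u, 'o, 'm) func" and c l
  assume col: "is_colimit J C D c l"
  note cc = coconeD[OF colimitD(1)[OF col]]
  note Ds = functor_simps[OF cc(1)]
  interpret J: category J using functor_cats[OF cc(1)] by blast
  have unique: "h = h'"
    if r: "e \<in> hom E (fobj L r) d" and c: "c \<in> obj C" and h: "h \<in> hom C c r" "h' \<in> hom C c r"
      and eq: "e \<cdot>\<^bsub>E\<^esub> farr L h = e \<cdot>\<^bsub>E\<^esub> farr L h'"
      and u: "\<And>c g. \<lbrakk>c \<in> obj C; g \<in> hom E (fobj L c) d\<rbrakk> \<Longrightarrow> \<exists>!h. h \<in> hom C c r \<and> e \<cdot>\<^bsub>E\<^esub> farr L h = g"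
    for e r d c h h'
  proof -
    have "e \<cdot>\<^bsub>E\<^esub> farr L h' \<in> hom E (fobj L c) d" using r h Ls by (simp add: in_hom)
    from u[OF c this] show ?thesis using h eq by auto
  qed
  show "is_colimit J E (comp_func J L D) (fobj L c) (\<lambda>i. farr L (l i))"
  proof (rule colimitI[OF functor_cocone[OF L colimitD(1)[OF col]]])
    fix d k assume k: "is_cocone J E (comp_func J L D) d k"
    note kc = coconeD[OF k]
    from univ[OF kc(2)] obtain r e where r: "r \<in> obj C" "e \<in> hom E (fobj L r) d"
      and u: "\<And>c g. \<lbrakk>c \<in> obj C; g \<in> hom E (fobj L c) d\<rbrakk> \<Longrightarrow> \<exists>!h. h \<in> hom C c r \<and> e \<cdot>\<^bsub>E\<^esub> farr L h = g" by blast
    have "\<exists>h. h \<in> hom C (fobj D i) r \<and> e \<cdot>\<^bsub>E\<^esub> farr L h = k i" if "i \<in> obj J" for i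
      using u[of "fobj D i" "k i"] kc that Ds by (auto simp: in_hom)
    then obtain k' where k': "\<And>i. i \<in> obj J \<Longrightarrow> k' i \<in> hom C (fobj D i) r"
        "\<And>i. i \<in> obj J \<Longrightarrow> e \<cdot>\<^bsub>E\<^esub> farr L (k' i) = k i" by metis
    have "is_cocone J C D r k'"
    proof (rule coconeI[OF cc(1) r(1)])
      fix f assume f: "f \<in> arr J"
      have "e \<cdot>\<^bsub>E\<^esub> farr L (k' (tgt J f) \<cdot>\<^bsub>C\<^esub> farr D f) = k (tgt J f) \<cdot>\<^bsub>E\<^esub> farr L (farr D f)"
        using f Ls Ds k' r by (simp add: in_hom flip: k'(2))
      also have "\<dots> = k (src J f)" using kc(6)[OF f] f by simp
      also have "\<dots> = e \<cdot>\<^bsub>E\<^esub> farr L (k' (src J f))" using f by (simp add: k')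
      finally show "k' (tgt J f) \<cdot>\<^bsub>C\<^esub> farr D f = k' (src J f)"
        by (intro unique[OF r(2), of "fobj D (src J f)"] u) (use f k' Ds in \<open>simp_all add: in_hom\<close>)
    qed (rule k'(1))
    from colimitD(2)[OF col this] obtain h where h: "h \<in> hom C c r" "\<And>i. i \<in> obj J \<Longrightarrow> h \<cdot>\<^bsub>C\<^esub> l i = k' i"
      by blast
    have "e \<cdot>\<^bsub>E\<^esub> farr L h \<cdot>\<^bsub>E\<^esub> farr L (l i) = k i" if i: "i \<in> obj J" for i
      using k'(2)[OF i] Ls(6)[of "l i" h] h cc i r Ls by (simp add: in_hom)
    moreover have "e \<cdot>\<^bsub>E\<^esub> farr L h \<in> hom E (fobj L c) d" using r h Ls by (simp add: in_hom)
    ultimately show "\<exists>h. h \<in> hom E (fobj L c) d \<and> (\<forall>i\<in>obj J. h \<cdot>\<^bsub>E\<^esub> farr L (l i) = k i)" by blast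
  next
    fix u v d
    assume uv: "u \<in> hom E (fobj L c) d" "v \<in> hom E (fobj L c) d"
      and eq: "\<And>i. i \<in> obj J \<Longrightarrow> u \<cdot>\<^bsub>E\<^esub> farr L (l i) = v \<cdot>\<^bsub>E\<^esub> farr L (l i)"
    have "d \<in> obj E" using uv by (auto simp: in_hom)
    from univ[OF this] obtain r e where r: "r \<in> obj C" "e \<in> hom E (fobj L r) d"
      and un: "\<And>c g. \<lbrakk>c \<in> obj C; g \<in> hom E (fobj L c) d\<rbrakk> \<Longrightarrow> \<exists>!h. h \<in> hom C c r \<and> e \<cdot>\<^bsub>E\<^esub> farr L h = g" by blast
    obtain u' v' where u': "u' \<in> hom C c r" "e \<cdot>\<^bsub>E\<^esub> farr L u' = u" and v': "v' \<in> hom C c r" "e \<cdot>\<^bsub>E\<^esub> farr L v' = v"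
      using un[OF cc(2) uv(1)] un[OF cc(2) uv(2)] by blast
    have "u' = v'"
    proof (rule colimit_ext[OF col])
      fix i assume i: "i \<in> obj J"
      have "e \<cdot>\<^bsub>E\<^esub> farr L (u' \<cdot>\<^bsub>C\<^esub> l i) = u \<cdot>\<^bsub>E\<^esub> farr L (l i)"
        using i cc Ls r u'(1) by (simp add: in_hom flip: u'(2))
      also have "\<dots> = e \<cdot>\<^bsub>E\<^esub> farr L (v' \<cdot>\<^bsub>C\<^esub> l i)"
        using i cc Ls r v'(1) by (simp add: in_hom eq flip: v'(2))
      finally show "u' \<cdot>\<^bsub>C\<^esub> l i = v' \<cdot>\<^bsub>C\<^esub> l i"
        by (intro unique[OF r(2), of "fobj D i"] un) (use i cc Ds u'(1) v'(1) in \<open>simp_all add: in_hom\<close>)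
    qed (use u' v' in \<open>auto simp: in_hom\<close>)
    then show "u = v" using u' v' by simp
  qed
qed

text \<open>Application of an arrow of small sets to an element.\<close>

abbreviation ap :: "'u set_arr \<Rightarrow> 'u \<Rightarrow> 'u" where
  "ap k \<equiv> fst (snd k)"

lemma ap_set_arr [simp]: "x \<in> X \<Longrightarrow> ap (set_arr X h Y) x = h x"
  by (simp add: set_arr_def)

lemma set_arrE:
  assumes "k \<in> arr (set_smc :: ('u set, 'u set_arr) smc)"
  obtains h where "k = set_arr (src set_smc k) h (tgt set_smc k)" "h \<in> src set_smc k \<rightarrow> tgt set_smc k"
    "small TYPE('u) (src set_smc k)" "small TYPE('u) (tgt set_smc k)"
proof -
  have "k \<in> hom set_smc (src set_smc k) (tgt set_smc k)" using assms by (simp add: in_hom)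
  then show thesis using that unfolding set_hom_iff by blast
qed

lemma ap_in: "\<lbrakk>k \<in> arr set_smc; x \<in> src set_smc k\<rbrakk> \<Longrightarrow> ap k x \<in> tgt set_smc k"
  by (erule set_arrE) (metis ap_set_arr Pi_mem)

lemma ap_cmp:
  assumes "k \<in> arr set_smc" "k' \<in> arr set_smc" "tgt set_smc k = src set_smc k'" "x \<in> src set_smc k"
  shows "ap (k' \<cdot>\<^bsub>set_smc\<^esub> k) x = ap k' (ap k x)"
proof -
  obtain h h' where h: "k = set_arr (src set_smc k) h (tgt set_smc k)" "h \<in> src set_smc k \<rightarrow> tgt set_smc k"
    "k' = set_arr (src set_smc k') h' (tgt set_smc k')"
    using assms(1,2) by (metis set_arrE)
  have "k' \<cdot>\<^bsub>set_smc\<^esub> k = set_arr (src set_smc k) (\<lambda>x. h' (h x)) (tgt set_smc k')"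
    using h assms(3) by (metis set_arr_cmp)
  moreover have "h x \<in> src set_smc k'" using h(2) assms by auto
  ultimately show ?thesis using assms(4) h by (metis ap_set_arr)
qed

lemma set_arr_ext:
  assumes "k \<in> arr set_smc" "k' \<in> arr set_smc" "src set_smc k = src set_smc k'" "tgt set_smc k = tgt set_smc k'"
    "\<And>x. x \<in> src set_smc k \<Longrightarrow> ap k x = ap k' x"
  shows "k = k'"
proof -
  obtain h h' where h: "k = set_arr (src set_smc k) h (tgt set_smc k)"
    "k' = set_arr (src set_smc k') h' (tgt set_smc k')"
    using assms(1,2) by (metis set_arrE)
  have "h x = h' x" if "x \<in> src set_smc k" for x
    using assms(3,5) that h by (metis ap_set_arr)
  then have "set_arr (src set_smc k) h (tgt set_smc k) = set_arr (src set_smc k') h' (tgt set_smc k')"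
    using assms(3,4) by simp
  then show ?thesis by (rule trans[OF h(1) trans[OF _ h(2)[symmetric]]])
qed

text \<open>The right Kan extension of \<open>Y : G \<rightarrow> Set\<close> along \<open>f : G \<rightarrow> H\<close> sends \<open>h\<close> to the set of families
  \<open>\<phi> (g, u) \<in> Y g\<close>, indexed by the arrows \<open>u : h \<rightarrow> f g\<close>, that are natural in \<open>g\<close>.  These sets are small,
  so injections \<open>code h\<close> make them sets of elements of the universe.\<close>

locale kan_extension =
  fixes G H :: "('u, 'u) cat" and f :: "('u, 'u, 'u, 'u) func" and Y :: "'u gset"
  assumes U: "universe TYPE('u)" and G: "small_category G" and H: "small_category H"
    and f: "is_functor G H f" and Y: "is_functor G set_smc Y"
begin

sublocale G: category G using G by (simp add: small_category_def)
sublocale H: category H using H by (simp add: small_category_def)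
sublocale S: category "set_smc :: ('u set, 'u set_arr) smc" by (rule category_set)

lemmas f_simps [simp] = functor_simps[OF f]
lemmas Y_simps [simp] = functor_simps[OF Y]

definition idx :: "'u \<Rightarrow> ('u \<times> 'u) set" where
  "idx h = {(g, u). g \<in> obj G \<and> u \<in> hom H h (fobj f g)}"

definition families :: "'u \<Rightarrow> ('u \<times> 'u \<Rightarrow> 'u) set" where
  "families h = {\<phi> \<in> extensional (idx h). (\<forall>(g, u) \<in> idx h. \<phi> (g, u) \<in> fobj Y g) \<and>
     (\<forall>v \<in> arr G. \<forall>u \<in> hom H h (fobj f (src G v)).
        ap (farr Y v) (\<phi> (src G v, u)) = \<phi> (tgt G v, farr f v \<cdot>\<^bsub>H\<^esub> u))}"

lemma familiesD:
  assumes "\<phi> \<in> families h"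
  shows "\<phi> \<in> extensional (idx h)" "\<lbrakk>g \<in> obj G; u \<in> hom H h (fobj f g)\<rbrakk> \<Longrightarrow> \<phi> (g, u) \<in> fobj Y g"
    "\<lbrakk>v \<in> arr G; u \<in> hom H h (fobj f (src G v))\<rbrakk> \<Longrightarrow>
        ap (farr Y v) (\<phi> (src G v, u)) = \<phi> (tgt G v, farr f v \<cdot>\<^bsub>H\<^esub> u)"
  using assms by (auto simp: families_def idx_def)

lemma small_families: "small TYPE('u) (families h)"
proof -
  have I: "small TYPE('u) (idx h)"
    by (rule small_subset[OF small_Times[OF U, of "obj G" "arr H"]])
      (use G H in \<open>auto simp: small_category_def idx_def in_hom\<close>)
  have "small TYPE('u) (fobj Y g)" if "g \<in> obj G" for g using Y_simps(1)[OF that] by simp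
  then have "small TYPE('u) (Sigma (obj G) (fobj Y))"
    using G by (intro small_Sigma[OF U]) (auto simp: small_category_def)
  then have "small TYPE('u) (snd ` Sigma (obj G) (fobj Y))" by (rule small_image)
  from small_PiE[OF U I this] show ?thesis
  proof (rule small_subset)
    show "families h \<subseteq> idx h \<rightarrow>\<^sub>E snd ` Sigma (obj G) (fobj Y)"
      by (force simp: families_def idx_def PiE_iff)
  qed
qed

definition code :: "'u \<Rightarrow> ('u \<times> 'u \<Rightarrow> 'u) \<Rightarrow> 'u" where
  "code h = (SOME e. inj_on e (families h))"

definition decode :: "'u \<Rightarrow> 'u \<Rightarrow> 'u \<times> 'u \<Rightarrow> 'u" where
  "decode h = inv_into (families h) (code h)"

lemma inj_code: "inj_on (code h) (families h)"
  unfolding code_def using small_obtain_inj[OF small_families] by (metis someI_ex)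

lemma decode_code [simp]: "\<phi> \<in> families h \<Longrightarrow> decode h (code h \<phi>) = \<phi>"
  unfolding decode_def by (rule inv_into_f_f[OF inj_code])

definition shift :: "'u \<Rightarrow> ('u \<times> 'u \<Rightarrow> 'u) \<Rightarrow> 'u \<times> 'u \<Rightarrow> 'u" where
  "shift w \<phi> = (\<lambda>(g, u) \<in> idx (tgt H w). \<phi> (g, u \<cdot>\<^bsub>H\<^esub> w))"

lemma shift_apply [simp]:
  "\<lbrakk>g \<in> obj G; u \<in> hom H (tgt H w) (fobj f g)\<rbrakk> \<Longrightarrow> shift w \<phi> (g, u) = \<phi> (g, u \<cdot>\<^bsub>H\<^esub> w)"
  by (simp add: shift_def idx_def)

lemma shift_families:
  assumes "w \<in> arr H" "\<phi> \<in> families (src H w)"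
  shows "shift w \<phi> \<in> families (tgt H w)"
proof -
  have "shift w \<phi> (g, u) \<in> fobj Y g" if "g \<in> obj G" "u \<in> hom H (tgt H w) (fobj f g)" for g u
    using that assms by (auto simp: in_hom intro!: familiesD(2)[OF assms(2)])
  moreover have "ap (farr Y v) (shift w \<phi> (src G v, u)) = shift w \<phi> (tgt G v, farr f v \<cdot>\<^bsub>H\<^esub> u)"
    if "v \<in> arr G" "u \<in> hom H (tgt H w) (fobj f (src G v))" for v u
    using that assms familiesD(3)[OF assms(2), of v "u \<cdot>\<^bsub>H\<^esub> w"] by (simp add: in_hom)
  moreover have "shift w \<phi> \<in> extensional (idx (tgt H w))" by (simp add: shift_def)
  ultimately show ?thesis by (auto simp: families_def idx_def)
qed

lemma families_ext:
  assumes "\<phi> \<in> families h" "\<psi> \<in> families h"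
    "\<And>g u. \<lbrakk>g \<in> obj G; u \<in> hom H h (fobj f g)\<rbrakk> \<Longrightarrow> \<phi> (g, u) = \<psi> (g, u)"
  shows "\<phi> = \<psi>"
  by (rule extensionalityI[OF familiesD(1)[OF assms(1)] familiesD(1)[OF assms(2)]])
    (use assms(3) in \<open>auto simp: idx_def\<close>)

definition ran :: "'u gset" where
  "ran = \<lparr>fobj = \<lambda>h\<in>obj H. code h ` families h,
     farr = \<lambda>w\<in>arr H. set_arr (code (src H w) ` families (src H w))
       (\<lambda>x. code (tgt H w) (shift w (decode (src H w) x))) (code (tgt H w) ` families (tgt H w))\<rparr>"

lemma ran_simps [simp]:
  "h \<in> obj H \<Longrightarrow> fobj ran h = code h ` families h"
  "w \<in> arr H \<Longrightarrow> farr ran w = set_arr (code (src H w) ` families (src H w))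
       (\<lambda>x. code (tgt H w) (shift w (decode (src H w) x))) (code (tgt H w) ` families (tgt H w))"
  by (simp_all add: ran_def)

lemma small_code [simp]: "small TYPE('u) (code h ` families h)"
  by (rule small_image[OF small_families])

lemma ran_functor: "is_functor H set_smc ran"
proof (rule functorI[OF H.category_axioms S.category_axioms])
  fix h assume h: "h \<in> obj H"
  have "shift (idn H h) \<phi> = \<phi>" if "\<phi> \<in> families h" for \<phi>
    by (rule families_ext[OF _ that]) (use h that shift_families[of "idn H h" \<phi>] in \<open>auto simp: in_hom\<close>)
  then show "farr ran (idn H h) = idn set_smc (fobj ran h)" using h by auto
next
  fix w w' assume w: "w \<in> arr H" "w' \<in> arr H" "tgt H w = src H w'"
  have "shift (w' \<cdot>\<^bsub>H\<^esub> w) \<phi> = shift w' (shift w \<phi>)" if "\<phi> \<in> families (src H w)" for \<phi>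
    by (rule families_ext[where h = "tgt H w'"])
      (use w that shift_families[of "w' \<cdot>\<^bsub>H\<^esub> w" \<phi>] shift_families[of w' "shift w \<phi>"] shift_families[of w \<phi>]
        in \<open>auto simp: in_hom\<close>)
  moreover have "shift w \<phi> \<in> families (src H w')" if "\<phi> \<in> families (src H w)" for \<phi>
    using shift_families[of w \<phi>] that w by simp
  ultimately show "farr ran (w' \<cdot>\<^bsub>H\<^esub> w) = farr ran w' \<cdot>\<^bsub>set_smc\<^esub> farr ran w"
    using w by (subst (2 3) ran_simps) (auto simp: Pi_iff)
qed (auto simp: ran_def in_hom shift_families)

definition counit_at :: "'u \<Rightarrow> 'u set_arr" where
  "counit_at g = set_arr (fobj ran (fobj f g)) (\<lambda>x. decode (fobj f g) x (g, idn H (fobj f g))) (fobj Y g)"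

lemma counit_nat: "is_nat G set_smc (comp_func G ran f) Y (restrict counit_at (obj G))"
proof (rule natI[OF comp_functor[OF f ran_functor] Y])
  fix g assume g: "g \<in> obj G"
  then show "restrict counit_at (obj G) g \<in> hom set_smc (fobj (comp_func G ran f) g) (fobj Y g)"
    using Y_simps(1)[OF g] by (auto simp: counit_at_def in_hom intro!: familiesD(2))
next
  fix v assume v: "v \<in> arr G"
  let ?r = "counit_at (tgt G v) \<cdot>\<^bsub>set_smc\<^esub> farr ran (farr f v)" and ?l = "farr Y v \<cdot>\<^bsub>set_smc\<^esub> counit_at (src G v)"
  note rf = functor_simps[OF ran_functor]
  have c [simp]: "counit_at g \<in> arr set_smc" "src set_smc (counit_at g) = fobj ran (fobj f g)"
      "tgt set_smc (counit_at g) = fobj Y g" if "g \<in> obj G" for g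
    using that Y_simps(1)[OF that] by (auto simp: counit_at_def intro!: familiesD(2) simp: in_hom)
  have "?r = ?l"
  proof (rule set_arr_ext)
    fix x assume "x \<in> src set_smc ?r"
    then have "x \<in> fobj ran (fobj f (src G v))"
      using v by (simp add: rf del: ran_simps)
    then obtain \<phi> where \<phi>: "\<phi> \<in> families (fobj f (src G v))" "x = code (fobj f (src G v)) \<phi>" using v by auto
    have s: "shift (farr f v) \<phi> \<in> families (fobj f (tgt G v))"
      using shift_families[of "farr f v" \<phi>] v \<phi> by simp
    have x: "x \<in> fobj ran (fobj f (src G v))" "ap (farr ran (farr f v)) x = code (fobj f (tgt G v)) (shift (farr f v) \<phi>)"
      using v \<phi> by simp_all
    have "ap ?r x = shift (farr f v) \<phi> (tgt G v, idn H (fobj f (tgt G v)))"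
      using v x s by (subst ap_cmp) (simp_all add: rf del: ran_simps, simp add: counit_at_def)
    also have "\<dots> = \<phi> (tgt G v, farr f v \<cdot>\<^bsub>H\<^esub> idn H (fobj f (src G v)))" using v by (simp add: in_hom)
    also have "\<dots> = ap (farr Y v) (\<phi> (src G v, idn H (fobj f (src G v))))"
      using v by (intro familiesD(3)[OF \<phi>(1), symmetric]) (simp_all add: in_hom)
    also have "\<dots> = ap ?l x"
      using v x \<phi> by (subst ap_cmp) (simp_all add: rf del: ran_simps, simp add: counit_at_def)
    finally show "ap ?r x = ap ?l x" .
  qed (use v rf in \<open>simp_all del: ran_simps\<close>)
  then show "restrict counit_at (obj G) (tgt G v) \<cdot>\<^bsub>set_smc\<^esub> farr (comp_func G ran f) v
    = farr Y v \<cdot>\<^bsub>set_smc\<^esub> restrict counit_at (obj G) (src G v)"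
    using v by simp
qed simp

text \<open>The component at \<open>h\<close> of the mediating map sends \<open>x\<close> to the family \<open>(g, u) \<mapsto> t g (X u x)\<close>.  It is forced:
  the value of a family at \<open>(g, u)\<close> is obtained by moving it along \<open>u\<close> and then applying the counit.\<close>

lemma universal:
  assumes X: "is_functor H set_smc X" and t: "is_nat G set_smc (comp_func G X f) Y t"
  shows "\<exists>!s. is_nat H set_smc X ran s \<and> (\<forall>g\<in>obj G. counit_at g \<cdot>\<^bsub>set_smc\<^esub> s (fobj f g) = t g)"
proof
  note [simp] = functor_simps[OF X] nat_simps(1-3)[OF t]
  note rf = functor_simps[OF ran_functor]
  have apX: "ap (farr X w) x \<in> fobj X (tgt H w)" if "w \<in> arr H" "x \<in> fobj X (src H w)" for w x
    using ap_in[of "farr X w" x] that by simp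
  have apt: "ap (t g) x \<in> fobj Y g" if "g \<in> obj G" "x \<in> fobj X (fobj f g)" for g x
    using ap_in[of "t g" x] that by simp
  have small_X: "small TYPE('u) (fobj X h)" if "h \<in> obj H" for h using functor_simps(1)[OF X that] by simp
  define fam where "fam h x = (\<lambda>(g, u) \<in> idx h. ap (t g) (ap (farr X u) x))" for h x
  have fam_apply [simp]: "fam h x (g, u) = ap (t g) (ap (farr X u) x)"
    if "g \<in> obj G" "u \<in> hom H h (fobj f g)" for h x g u
    using that by (simp add: fam_def idx_def)
  have fam: "fam h x \<in> families h" if h: "h \<in> obj H" and x: "x \<in> fobj X h" for h x
  proof -
    have "ap (farr Y v) (ap (t (src G v)) (ap (farr X u) x)) = ap (t (tgt G v)) (ap (farr X (farr f v \<cdot>\<^bsub>H\<^esub> u)) x)"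
      if v: "v \<in> arr G" and u: "u \<in> hom H h (fobj f (src G v))" for v u
    proof -
      have ux: "u \<in> arr H" "src H u = h" "tgt H u = fobj f (src G v)" "ap (farr X u) x \<in> fobj X (fobj f (src G v))"
        using u x apX[of u x] by (auto simp: in_hom)
      have "ap (farr Y v) (ap (t (src G v)) (ap (farr X u) x)) = ap (farr Y v \<cdot>\<^bsub>set_smc\<^esub> t (src G v)) (ap (farr X u) x)"
        using v ux by (subst ap_cmp) simp_all
      also have "\<dots> = ap (t (tgt G v) \<cdot>\<^bsub>set_smc\<^esub> farr X (farr f v)) (ap (farr X u) x)"
        using nat_simps(4)[OF t v] v by simp
      also have "\<dots> = ap (t (tgt G v)) (ap (farr X (farr f v \<cdot>\<^bsub>H\<^esub> u)) x)"
        using v ux x by (simp add: ap_cmp)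
      finally show ?thesis .
    qed
    moreover have "ap (t g) (ap (farr X u) x) \<in> fobj Y g" if "g \<in> obj G" "u \<in> hom H h (fobj f g)" for g u
      using that x apX[of u x] by (intro apt) (auto simp: in_hom)
    moreover have "farr f v \<cdot>\<^bsub>H\<^esub> u \<in> hom H h (fobj f (tgt G v))"
      if "v \<in> arr G" "u \<in> hom H h (fobj f (src G v))" for v u using that by (simp add: in_hom)
    moreover have "fam h x \<in> extensional (idx h)" by (simp add: fam_def)
    ultimately show ?thesis by (auto simp: families_def idx_def)
  qed
  define s where "s = (\<lambda>h\<in>obj H. set_arr (fobj X h) (\<lambda>x. code h (fam h x)) (fobj ran h))"
  have s [simp]: "s h \<in> arr set_smc" "src set_smc (s h) = fobj X h" "tgt set_smc (s h) = fobj ran h"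
    if "h \<in> obj H" for h
    using that small_X[OF that] fam by (auto simp: s_def)
  have s_ap: "ap (s h) x = code h (fam h x)" if "h \<in> obj H" "x \<in> fobj X h" for h x
    using that by (simp add: s_def)
  have c [simp]: "counit_at g \<in> arr set_smc" "src set_smc (counit_at g) = fobj ran (fobj f g)"
      "tgt set_smc (counit_at g) = fobj Y g" if "g \<in> obj G" for g
    using that nat_simps(1-3)[OF counit_nat that] by simp_all
  have c_ap: "ap (counit_at g) (code (fobj f g) \<phi>) = \<phi> (g, idn H (fobj f g))"
    if "g \<in> obj G" "\<phi> \<in> families (fobj f g)" for g \<phi>
    using that by (simp add: counit_at_def)
  have "is_nat H set_smc X ran s"
  proof (rule natI[OF X ran_functor])
    fix w assume w: "w \<in> arr H"
    show "s (tgt H w) \<cdot>\<^bsub>set_smc\<^esub> farr X w = farr ran w \<cdot>\<^bsub>set_smc\<^esub> s (src H w)"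
    proof (rule set_arr_ext)
      fix x assume "x \<in> src set_smc (s (tgt H w) \<cdot>\<^bsub>set_smc\<^esub> farr X w)"
      then have x: "x \<in> fobj X (src H w)" using w by simp
      have "fam (tgt H w) (ap (farr X w) x) = shift w (fam (src H w) x)"
      proof (rule families_ext)
        show "fam (tgt H w) (ap (farr X w) x) \<in> families (tgt H w)"
          "shift w (fam (src H w) x) \<in> families (tgt H w)"
          using w x by (auto intro!: fam shift_families apX)
        fix g u assume "g \<in> obj G" "u \<in> hom H (tgt H w) (fobj f g)"
        then show "fam (tgt H w) (ap (farr X w) x) (g, u) = shift w (fam (src H w) x) (g, u)"
          using w x by (simp add: in_hom ap_cmp)
      qed
      then show "ap (s (tgt H w) \<cdot>\<^bsub>set_smc\<^esub> farr X w) x = ap (farr ran w \<cdot>\<^bsub>set_smc\<^esub> s (src H w)) x"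
        using w x apX[of w x] fam[of "src H w" x]
        by (simp add: ap_cmp rf s_ap del: ran_simps) simp
    qed (use w rf in \<open>simp_all del: ran_simps\<close>)
  qed (simp_all add: in_hom del: ran_simps, simp add: s_def)
  moreover have "counit_at g \<cdot>\<^bsub>set_smc\<^esub> s (fobj f g) = t g" if g: "g \<in> obj G" for g
  proof (rule set_arr_ext)
    fix x assume "x \<in> src set_smc (counit_at g \<cdot>\<^bsub>set_smc\<^esub> s (fobj f g))"
    then have x: "x \<in> fobj X (fobj f g)" using g by (simp del: ran_simps)
    have "ap (counit_at g \<cdot>\<^bsub>set_smc\<^esub> s (fobj f g)) x = fam (fobj f g) x (g, idn H (fobj f g))"
      using g x fam[of "fobj f g" x] by (simp add: ap_cmp s_ap c_ap del: ran_simps)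
    then show "ap (counit_at g \<cdot>\<^bsub>set_smc\<^esub> s (fobj f g)) x = ap (t g) x"
      using g x by (simp add: in_hom)
  qed (use g in \<open>simp_all del: ran_simps\<close>)
  ultimately show "is_nat H set_smc X ran s \<and> (\<forall>g\<in>obj G. counit_at g \<cdot>\<^bsub>set_smc\<^esub> s (fobj f g) = t g)" by blast
  fix r assume r': "is_nat H set_smc X ran r \<and> (\<forall>g\<in>obj G. counit_at g \<cdot>\<^bsub>set_smc\<^esub> r (fobj f g) = t g)"
  then have r: "is_nat H set_smc X ran r" by blast
  note rs [simp] = nat_simps(1-3)[OF r]
  have "r h = s h" if h: "h \<in> obj H" for h
  proof (rule set_arr_ext)
    fix x assume "x \<in> src set_smc (r h)"
    then have x: "x \<in> fobj X h" using h by simp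
    then have "ap (r h) x \<in> fobj ran h" using ap_in[of "r h" x] h by (simp del: ran_simps)
    then obtain \<phi> where \<phi>: "\<phi> \<in> families h" "ap (r h) x = code h \<phi>" using h by auto
    have "\<phi> = fam h x"
    proof (rule families_ext[OF \<phi>(1) fam[OF h x]])
      fix g u assume gu: "g \<in> obj G" "u \<in> hom H h (fobj f g)"
      then have u: "u \<in> arr H" "src H u = h" "tgt H u = fobj f g" by (simp_all add: in_hom)
      have "code (fobj f g) (shift u \<phi>) = ap (farr ran u) (code h \<phi>)" using u \<phi> by simp
      also have "\<dots> = ap (farr ran u \<cdot>\<^bsub>set_smc\<^esub> r h) x"
        using u h x \<phi> by (subst ap_cmp) (simp_all add: rf del: ran_simps)
      also have "\<dots> = ap (r (fobj f g) \<cdot>\<^bsub>set_smc\<^esub> farr X u) x" using nat_simps(4)[OF r, of u] u by simp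
      also have "\<dots> = ap (r (fobj f g)) (ap (farr X u) x)"
        using u gu x by (subst ap_cmp) (simp_all del: ran_simps)
      finally have "ap (counit_at g) (code (fobj f g) (shift u \<phi>)) = ap (counit_at g \<cdot>\<^bsub>set_smc\<^esub> r (fobj f g)) (ap (farr X u) x)"
        using u gu x apX[of u x] by (subst ap_cmp) (simp_all del: ran_simps)
      also have "\<dots> = fam h x (g, u)" using r' gu by simp
      finally show "\<phi> (g, u) = fam h x (g, u)"
        using c_ap[of g "shift u \<phi>"] shift_families[of u \<phi>] u \<phi> gu by (simp add: in_hom)
    qed
    then show "ap (r h) x = ap (s h) x" using \<phi> s_ap[OF h x] by simp
  qed (use h in \<open>simp_all del: ran_simps\<close>)
  then show "r = s" using natD(3)[OF r] by (intro extensionalityI[where A = "obj H"]) (auto simp: s_def)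
qed

end


subsection \<open>Restriction of group actions\<close>

lemma restriction_simps [simp]:
  "is_functor H set_smc X \<Longrightarrow> fobj (restriction G H f) X = comp_func G X f"
  "is_nat H set_smc X Y t \<Longrightarrow> farr (restriction G H f) (X, t, Y)
    = (comp_func G X f, \<lambda>g\<in>obj G. t (fobj f g), comp_func G Y f)"
  by (simp_all add: restriction_def GSet_def)

lemma whisker_nat:
  assumes f: "is_functor G H f" and t: "is_nat H C X Y t"
  shows "is_nat G C (comp_func G X f) (comp_func G Y f) (\<lambda>g\<in>obj G. t (fobj f g))"
proof -
  interpret G: category G using functor_cats[OF f] by blast
  note fs = functor_simps[OF f]
  show ?thesis
  proof (rule natI)
    fix v assume "v \<in> arr G"
    then show "(\<lambda>g\<in>obj G. t (fobj f g)) (tgt G v) \<cdot>\<^bsub>C\<^esub> farr (comp_func G X f) v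
      = farr (comp_func G Y f) v \<cdot>\<^bsub>C\<^esub> (\<lambda>g\<in>obj G. t (fobj f g)) (src G v)"
      using nat_simps(4)[OF t, of "farr f v"] fs by simp
  qed (use nat_simps(1-3)[OF t] fs natD[OF t] in \<open>auto simp: in_hom intro: comp_functor[OF f]\<close>)
qed

lemma restriction_functor:
  assumes f: "is_functor G H f"
  shows "is_functor (GSet H) (GSet G) (restriction G H f)"
  unfolding GSet_def
proof (rule functorI[OF category_Fun category_Fun])
  note fs = functor_simps[OF f]
  show "fobj (restriction G H f) \<in> extensional (obj (Fun H set_smc))"
    "farr (restriction G H f) \<in> extensional (arr (Fun H set_smc))"
    by (simp_all add: restriction_def GSet_def)
  fix X assume X: "X \<in> obj (Fun H (set_smc :: ('a set, 'a set_arr) smc))"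
  then show "fobj (restriction G H f) X \<in> obj (Fun G set_smc)" by (simp add: comp_functor[OF f])
  show "farr (restriction G H f) (idn (Fun H set_smc) X) = idn (Fun G set_smc) (fobj (restriction G H f) X)"
    using X fs by (simp add: id_nat_nat) (auto simp: id_nat_def intro!: restrict_ext)
next
  fix t assume "t \<in> arr (Fun H (set_smc :: ('a set, 'a set_arr) smc))"
  then show "farr (restriction G H f) t \<in> hom (Fun G set_smc)
      (fobj (restriction G H f) (src (Fun H set_smc) t)) (fobj (restriction G H f) (tgt (Fun H set_smc) t))"
    by (elim Fun_arrE) (simp add: natD whisker_nat[OF f])
next
  fix s t assume h: "s \<in> arr (Fun H (set_smc :: ('a set, 'a set_arr) smc))" "t \<in> arr (Fun H set_smc)"
    "tgt (Fun H set_smc) s = src (Fun H set_smc) t"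
  then obtain X s' Y t' Z where "s = (X, s', Y)" "is_nat H set_smc X Y s'" "t = (Y, t', Z)" "is_nat H set_smc Y Z t'"
    by (auto elim!: Fun_arrE)
  then show "farr (restriction G H f) (t \<cdot>\<^bsub>Fun H set_smc\<^esub> s)
    = farr (restriction G H f) t \<cdot>\<^bsub>Fun G set_smc\<^esub> farr (restriction G H f) s"
    using functor_simps(1)[OF f] by (auto simp: vcomp_nat) (auto simp: vcomp_def intro!: restrict_ext)
qed

lemma restriction_cocontinuous:
  assumes U: "universe TYPE('u)" and G: "small_category (G :: ('u, 'u) cat)" and H: "small_category H"
    and f: "is_functor G H f"
  shows "cocontinuous TYPE('u) (GSet H) (GSet G) (restriction G H f)"
proof (rule left_adjoint_cocontinuous[OF restriction_functor[OF f]])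
  fix Y assume "Y \<in> obj (GSet G)"
  then have Y: "is_functor G set_smc Y" by (simp add: GSet_def)
  interpret K: kan_extension G H f Y by unfold_locales (use assms Y in auto)
  let ?e = "(comp_func G K.ran f, restrict K.counit_at (obj G), Y)"
  have "\<exists>!h. h \<in> hom (GSet H) X K.ran \<and> ?e \<cdot>\<^bsub>GSet G\<^esub> farr (restriction G H f) h = g"
    if X: "X \<in> obj (GSet H)" and g: "g \<in> hom (GSet G) (fobj (restriction G H f) X) Y" for X g
  proof -
    have X': "is_functor H set_smc X" using X by (simp add: GSet_def)
    obtain t where t: "g = (comp_func G X f, t, Y)" "is_nat G set_smc (comp_func G X f) Y t"
      using g X' by (auto simp: GSet_def elim: Fun_homE)
    have eq: "?e \<cdot>\<^bsub>GSet G\<^esub> farr (restriction G H f) (X, s, K.ran) = g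
        \<longleftrightarrow> (\<forall>g\<in>obj G. K.counit_at g \<cdot>\<^bsub>set_smc\<^esub> s (fobj f g) = t g)"
      if "is_nat H set_smc X K.ran s" for s
    proof -
      have "?e \<cdot>\<^bsub>GSet G\<^esub> farr (restriction G H f) (X, s, K.ran) = g
        \<longleftrightarrow> (\<lambda>g\<in>obj G. K.counit_at g \<cdot>\<^bsub>set_smc\<^esub> s (fobj f g)) = t"
        using that by (simp add: GSet_def t(1) vcomp_def cong: restrict_cong)
      also have "\<dots> \<longleftrightarrow> (\<forall>g\<in>obj G. K.counit_at g \<cdot>\<^bsub>set_smc\<^esub> s (fobj f g) = t g)"
        using natD(3)[OF t(2)] by (auto intro!: restrict_eqI)
      finally show ?thesis .
    qed
    obtain s where s: "is_nat H set_smc X K.ran s" "\<forall>g\<in>obj G. K.counit_at g \<cdot>\<^bsub>set_smc\<^esub> s (fobj f g) = t g"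
      and u: "\<And>r. \<lbrakk>is_nat H set_smc X K.ran r; \<forall>g\<in>obj G. K.counit_at g \<cdot>\<^bsub>set_smc\<^esub> r (fobj f g) = t g\<rbrakk> \<Longrightarrow> r = s"
      using K.universal[OF X' t(2)] by blast
    show ?thesis
    proof (rule ex1I[of _ "(X, s, K.ran)"])
      show "(X, s, K.ran) \<in> hom (GSet H) X K.ran \<and> ?e \<cdot>\<^bsub>GSet G\<^esub> farr (restriction G H f) (X, s, K.ran) = g"
        using s eq by (simp add: GSet_def)
      fix h assume h: "h \<in> hom (GSet H) X K.ran \<and> ?e \<cdot>\<^bsub>GSet G\<^esub> farr (restriction G H f) h = g"
      then obtain r where "h = (X, r, K.ran)" "is_nat H set_smc X K.ran r"
        by (auto simp: GSet_def elim: Fun_homE)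
      with h u eq show "h = (X, s, K.ran)" by auto
    qed
  qed
  moreover have "K.ran \<in> obj (GSet H)" "?e \<in> hom (GSet G) (fobj (restriction G H f) K.ran) Y"
    using K.ran_functor K.counit_nat by (simp_all add: GSet_def)
  ultimately show "\<exists>r \<in> obj (GSet H). \<exists>e \<in> hom (GSet G) (fobj (restriction G H f) r) Y.
      \<forall>c \<in> obj (GSet H). \<forall>g \<in> hom (GSet G) (fobj (restriction G H f) c) Y.
      \<exists>!h. h \<in> hom (GSet H) c r \<and> e \<cdot>\<^bsub>GSet G\<^esub> farr (restriction G H f) h = g"
    by blast
qed


section \<open>The 2-functor of monoidal functors on group actions\<close>

lemma smfun_ext:
  fixes F G :: "('o, 'm, 'p, 'n) smfun"
  assumes F: "sm_functor R S F" and G: "sm_functor R S G"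
    and eq: "\<And>a. a \<in> obj R \<Longrightarrow> fobj F a = fobj G a" "\<And>f. f \<in> arr R \<Longrightarrow> farr F f = farr G f"
    "\<And>a b. \<lbrakk>a \<in> obj R; b \<in> obj R\<rbrakk> \<Longrightarrow> mu F (a, b) = mu G (a, b)" "eta F = eta G"
  shows "F = G"
proof -
  have "fobj F = fobj G" "farr F = farr G" "mu F = mu G"
    using functor_extensional[OF sm_functorD(1)[OF F]] functor_extensional[OF sm_functorD(1)[OF G]]
      sm_functorD(2)[OF F] sm_functorD(2)[OF G] eq
    by (auto intro: extensionalityI)
  with eq(4) show ?thesis by simp
qed

lemma Fun_structure:
  "associator (Fun G C) X Y Z = (pointwise_tensor G C (pointwise_tensor G C X Y) Z,
      \<lambda>x\<in>obj G. associator C (fobj X x) (fobj Y x) (fobj Z x),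
      pointwise_tensor G C X (pointwise_tensor G C Y Z))"
  "lunitor (Fun G C) X = (pointwise_tensor G C (constant_unit G C) X, \<lambda>x\<in>obj G. lunitor C (fobj X x), X)"
  "runitor (Fun G C) X = (pointwise_tensor G C X (constant_unit G C), \<lambda>x\<in>obj G. runitor C (fobj X x), X)"
  "braiding (Fun G C) X Y = (pointwise_tensor G C X Y, \<lambda>x\<in>obj G. braiding C (fobj X x) (fobj Y x),
      pointwise_tensor G C Y X)"
  by (simp_all add: Fun_def Let_def)

lemma pointwise_simps [simp]:
  "x \<in> obj G \<Longrightarrow> fobj (pointwise_tensor G C X Y) x = fobj X x \<odot>\<^bsub>C\<^esub> fobj Y x"
  "f \<in> arr G \<Longrightarrow> farr (pointwise_tensor G C X Y) f = farr X f \<otimes>\<^bsub>C\<^esub> farr Y f"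
  "x \<in> obj G \<Longrightarrow> fobj (constant_unit G C) x = tunit C"
  "f \<in> arr G \<Longrightarrow> farr (constant_unit G C) f = idn C (tunit C)"
  by (simp_all add: pointwise_tensor_def constant_unit_def)

lemma comp_pointwise:
  assumes "is_functor G H f"
  shows "comp_func G (pointwise_tensor H C X Y) f = pointwise_tensor G C (comp_func G X f) (comp_func G Y f)"
    "comp_func G (constant_unit H C) f = constant_unit G C"
  using functor_simps[OF assms]
  by (auto simp: comp_func_def pointwise_tensor_def constant_unit_def intro!: restrict_ext)

lemma comp_func_assoc:
  assumes "is_functor G H f"
  shows "comp_func G (comp_func H X g) f = comp_func G X (comp_func G g f)"
  using functor_simps[OF assms] by (auto simp: comp_func_def intro!: restrict_ext)

lemma comp_func_id:
  fixes X :: "('o, 'm, 'p, 'n) func"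
  assumes "is_functor G C X"
  shows "comp_func G X (id_func G) = X"
  using comp_functor[OF id_functor[OF functor_cats(1)[OF assms]] assms] assms
  by (rule functor_ext) simp_all

text \<open>The images of these arrows \<open>X \<circ> f \<Rightarrow> X \<circ> f'\<close> under a monoidal functor \<open>F\<close> are the components of the
  transformation by which the 2-cell \<open>\<alpha> : f \<Rightarrow> f'\<close> acts at \<open>F\<close>.\<close>

definition whisker ::
  "('g, 'h) cat \<Rightarrow> ('g, 'h, 'k, 'l) func \<Rightarrow> ('g, 'h, 'k, 'l) func \<Rightarrow> ('g \<Rightarrow> 'l)
    \<Rightarrow> ('k, 'l, 'o, 'm) func \<Rightarrow> ('g, 'h, 'o, 'm) fun_arr" where
  "whisker G f f' \<alpha> X = (comp_func G X f, \<lambda>g\<in>obj G. farr X (\<alpha> g), comp_func G X f')"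

lemma whisker_arr:
  assumes \<alpha>: "is_nat G H f f' \<alpha>" and X: "is_functor H C X"
  shows "is_nat G C (comp_func G X f) (comp_func G X f') (\<lambda>g\<in>obj G. farr X (\<alpha> g))"
proof -
  interpret G: category G by (rule nat_cats[OF \<alpha>])
  note as = nat_simps(1-3)[OF \<alpha>] and Xs = functor_simps[OF X]
    and fs = functor_simps[OF natD(1)[OF \<alpha>]] functor_simps[OF natD(2)[OF \<alpha>]]
  show ?thesis
  proof (rule natI)
    fix v assume v: "v \<in> arr G"
    have "farr X (\<alpha> (tgt G v)) \<cdot>\<^bsub>C\<^esub> farr X (farr f v) = farr X (\<alpha> (tgt G v) \<cdot>\<^bsub>H\<^esub> farr f v)"
      using v as fs by (simp add: Xs)
    also have "\<dots> = farr X (farr f' v) \<cdot>\<^bsub>C\<^esub> farr X (\<alpha> (src G v))"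
      unfolding nat_simps(4)[OF \<alpha> v] using v as fs by (simp add: Xs)
    finally show "(\<lambda>g\<in>obj G. farr X (\<alpha> g)) (tgt G v) \<cdot>\<^bsub>C\<^esub> farr (comp_func G X f) v
      = farr (comp_func G X f') v \<cdot>\<^bsub>C\<^esub> (\<lambda>g\<in>obj G. farr X (\<alpha> g)) (src G v)"
      using v by simp
  qed (use as Xs fs comp_functor[OF _ X] natD[OF \<alpha>] in \<open>auto simp: in_hom\<close>)
qed

text \<open>The action of the 2-functor on the 1-cell \<open>f : G \<rightarrow> H\<close>, at the object \<open>F\<close>.\<close>

abbreviation pull ::
  "('u, 'u) cat \<Rightarrow> ('u, 'u) cat \<Rightarrow> ('p, 'n) smc \<Rightarrow> ('u, 'u, 'u, 'u) func
    \<Rightarrow> ('u gset, 'u gset_arr, 'p, 'n) smfun \<Rightarrow> ('u gset, 'u gset_arr, 'p, 'n) smfun" where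
  "pull G H S f F \<equiv> comp_smfun (GSet H) S F (restriction G H f)"

text \<open>Restriction preserves the chosen structure on the nose, because it is pointwise.\<close>

lemma restriction_structure:
  fixes G H :: "('u, 'u) cat"
  assumes U: "universe TYPE('u)" and f: "is_functor G H f"
    and X: "X \<in> obj (GSet H)" "Y \<in> obj (GSet H)" "Z \<in> obj (GSet H)"
  shows "farr (restriction G H f) (associator (GSet H) X Y Z)
      = associator (GSet G) (comp_func G X f) (comp_func G Y f) (comp_func G Z f)"
    "farr (restriction G H f) (lunitor (GSet H) X) = lunitor (GSet G) (comp_func G X f)"
    "farr (restriction G H f) (runitor (GSet H) X) = runitor (GSet G) (comp_func G X f)"
    "farr (restriction G H f) (braiding (GSet H) X Y) = braiding (GSet G) (comp_func G X f) (comp_func G Y f)"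
proof -
  obtain p q dia bang where "cartesian (GSet H) p q dia bang"
    using cartesian_GSet[OF U functor_cats(2)[OF f]] .
  then interpret H: cartesian "GSet H" p q dia bang .
  have arr: "associator (GSet H) X Y Z \<in> arr (GSet H)" "lunitor (GSet H) X \<in> arr (GSet H)"
    "runitor (GSet H) X \<in> arr (GSet H)" "braiding (GSet H) X Y \<in> arr (GSet H)"
    using X by simp_all
  note fs = functor_simps[OF f]
  show "farr (restriction G H f) (associator (GSet H) X Y Z)
      = associator (GSet G) (comp_func G X f) (comp_func G Y f) (comp_func G Z f)"
    using arr(1) fs unfolding GSet_def Fun_structure Fun_simps
    by (subst restriction_simps) (auto simp: comp_pointwise[OF f] intro!: restrict_ext)
  show "farr (restriction G H f) (lunitor (GSet H) X) = lunitor (GSet G) (comp_func G X f)"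
    using arr(2) fs unfolding GSet_def Fun_structure Fun_simps
    by (subst restriction_simps) (auto simp: comp_pointwise[OF f] intro!: restrict_ext)
  show "farr (restriction G H f) (runitor (GSet H) X) = runitor (GSet G) (comp_func G X f)"
    using arr(3) fs unfolding GSet_def Fun_structure Fun_simps
    by (subst restriction_simps) (auto simp: comp_pointwise[OF f] intro!: restrict_ext)
  show "farr (restriction G H f) (braiding (GSet H) X Y) = braiding (GSet G) (comp_func G X f) (comp_func G Y f)"
    using arr(4) fs unfolding GSet_def Fun_structure Fun_simps
    by (subst restriction_simps) (auto simp: comp_pointwise[OF f] intro!: restrict_ext)
qed

lemma restriction_tensor:
  fixes G H :: "('u, 'u) cat"
  assumes U: "universe TYPE('u)" and f: "is_functor G H f" and s: "s \<in> arr (GSet H)" and t: "t \<in> arr (GSet H)"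
  shows "farr (restriction G H f) (s \<otimes>\<^bsub>GSet H\<^esub> t) = farr (restriction G H f) s \<otimes>\<^bsub>GSet G\<^esub> farr (restriction G H f) t"
proof -
  obtain p q dia bang where "cartesian (GSet H) p q dia bang"
    using cartesian_GSet[OF U functor_cats(2)[OF f]] .
  then interpret H: cartesian "GSet H" p q dia bang .
  obtain X s' X' Y t' Y' where st: "s = (X, s', X')" "is_nat H set_smc X X' s'" "t = (Y, t', Y')" "is_nat H set_smc Y Y' t'"
    using s t unfolding GSet_def by (auto elim!: Fun_arrE)
  have "s \<otimes>\<^bsub>GSet H\<^esub> t \<in> arr (GSet H)" using s t by simp
  with st functor_simps[OF f] show ?thesis
    unfolding GSet_def st Fun_simps
    by (subst restriction_simps) (auto simp: comp_pointwise[OF f] intro!: restrict_ext)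
qed

lemma GSet_simps:
  "X \<in> obj (GSet H) \<longleftrightarrow> is_functor H set_smc X"
  "X \<odot>\<^bsub>GSet H\<^esub> Y = pointwise_tensor H set_smc X Y" "tunit (GSet H) = constant_unit H set_smc"
  by (simp_all add: GSet_def)

context
  fixes G H :: "('u, 'u) cat" and S :: "('p, 'n) smc" and f :: "('u, 'u, 'u, 'u) func"
    and F :: "('u gset, 'u gset_arr, 'p, 'n) smfun"
  assumes U: "universe TYPE('u)" and f: "is_functor G H f" and F: "sm_functor (GSet G) S F"
begin

lemma pull_simps:
  "X \<in> obj (GSet H) \<Longrightarrow> fobj (pull G H S f F) X = fobj F (comp_func G X f)"
  "t \<in> arr (GSet H) \<Longrightarrow> farr (pull G H S f F) t = farr F (farr (restriction G H f) t)"
  "\<lbrakk>X \<in> obj (GSet H); Y \<in> obj (GSet H)\<rbrakk> \<Longrightarrow> mu (pull G H S f F) (X, Y) = mu F (comp_func G X f, comp_func G Y f)"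
  "eta (pull G H S f F) = eta F"
proof -
  obtain p q dia bang where "cartesian (GSet G) p q dia bang"
    using cartesian_GSet[OF U functor_cats(1)[OF f]] .
  then interpret G: cartesian "GSet G" p q dia bang .
  interpret S: category S using functor_cats[OF sm_functorD(1)[OF F]] by blast
  note Fs = functor_simps[OF sm_functorD(1)[OF F]]
  note Ks = functor_simps[OF restriction_functor[OF f]]
  show "X \<in> obj (GSet H) \<Longrightarrow> fobj (pull G H S f F) X = fobj F (comp_func G X f)"
    by (simp add: comp_smfun_def GSet_simps)
  show "t \<in> arr (GSet H) \<Longrightarrow> farr (pull G H S f F) t = farr F (farr (restriction G H f) t)"
    by (simp add: comp_smfun_def)
  show "mu (pull G H S f F) (X, Y) = mu F (comp_func G X f, comp_func G Y f)"
    if X: "X \<in> obj (GSet H)" "Y \<in> obj (GSet H)"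
  proof -
    have XY: "comp_func G X f \<in> obj (GSet G)" "comp_func G Y f \<in> obj (GSet G)"
      using X comp_functor[OF f] by (simp_all add: GSet_simps)
    have "mu (pull G H S f F) (X, Y) = farr F (idn (GSet G) (comp_func G X f \<odot>\<^bsub>GSet G\<^esub> comp_func G Y f))
        \<cdot>\<^bsub>S\<^esub> mu F (comp_func G X f, comp_func G Y f)"
      using X by (simp add: comp_smfun_def restriction_def GSet_simps)
    also have "\<dots> = mu F (comp_func G X f, comp_func G Y f)"
      using XY sm_functorD(3)[OF F XY] by (simp add: Fs(5) in_hom)
    finally show ?thesis .
  qed
  show "eta (pull G H S f F) = eta F"
    using sm_functorD(5)[OF F] Fs(5)[of "tunit (GSet G)"] by (simp add: comp_smfun_def restriction_def in_hom)
qed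

lemma pull_sm_functor: "sm_functor (GSet H) S (pull G H S f F)"
proof -
  obtain p q dia bang where "cartesian (GSet H) p q dia bang"
    using cartesian_GSet[OF U functor_cats(2)[OF f]] .
  then interpret H: cartesian "GSet H" p q dia bang .
  interpret S: category S using functor_cats[OF sm_functorD(1)[OF F]] by blast
  note Fs = functor_simps[OF sm_functorD(1)[OF F]]
  note Ks = functor_simps[OF restriction_functor[OF f]]
  let ?F = "pull G H S f F"
  have K: "fobj (restriction G H f) X = comp_func G X f" if "X \<in> obj (GSet H)" for X
    using that by (simp add: GSet_simps)
  have c [simp]: "comp_func G X f \<in> obj (GSet G)" if "X \<in> obj (GSet H)" for X
    using that comp_functor[OF f] by (simp add: GSet_simps)
  have T [simp]: "comp_func G (X \<odot>\<^bsub>GSet H\<^esub> Y) f = comp_func G X f \<odot>\<^bsub>GSet G\<^esub> comp_func G Y f" for X Y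
    by (simp add: GSet_simps comp_pointwise[OF f])
  have I [simp]: "comp_func G (tunit (GSet H)) f = tunit (GSet G)"
    by (simp add: GSet_simps comp_pointwise[OF f])
  note [simp] = pull_simps restriction_structure[OF U f]
  show ?thesis
    unfolding sm_functor_def
  proof (intro conjI ballI)
    show "is_functor (GSet H) S ?F"
    proof (rule functorI[OF H.category_axioms S.category_axioms])
      show "fobj ?F \<in> extensional (obj (GSet H))" "farr ?F \<in> extensional (arr (GSet H))"
        by (simp_all add: comp_smfun_def)
    qed (simp_all add: Fs Ks in_hom K)
    show "mu ?F \<in> extensional (obj (GSet H) \<times> obj (GSet H))" by (simp add: comp_smfun_def)
    show "eta ?F \<in> hom S (tunit S) (fobj ?F (tunit (GSet H)))" "iso_arr S (eta ?F)"
      using sm_functorD(5,6)[OF F] by simp_all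
    fix X assume [simp]: "X \<in> obj (GSet H)"
    have l: "lunitor (GSet H) X \<in> arr (GSet H)" "runitor (GSet H) X \<in> arr (GSet H)" by simp_all
    show "farr ?F (lunitor (GSet H) X) \<cdot>\<^bsub>S\<^esub> mu ?F (tunit (GSet H), X) \<cdot>\<^bsub>S\<^esub> (eta ?F \<otimes>\<^bsub>S\<^esub> idn S (fobj ?F X))
      = lunitor S (fobj ?F X)"
      using sm_functorD(9)[OF F, of "comp_func G X f"] l restriction_structure(2)[OF U f, of X X X]
      by (simp del: H.lun)
    show "farr ?F (runitor (GSet H) X) \<cdot>\<^bsub>S\<^esub> mu ?F (X, tunit (GSet H)) \<cdot>\<^bsub>S\<^esub> (idn S (fobj ?F X) \<otimes>\<^bsub>S\<^esub> eta ?F)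
      = runitor S (fobj ?F X)"
      using sm_functorD(10)[OF F, of "comp_func G X f"] l restriction_structure(3)[OF U f, of X X X]
      by (simp del: H.run)
    fix Y assume [simp]: "Y \<in> obj (GSet H)"
    show "mu ?F (X, Y) \<in> hom S (fobj ?F X \<odot>\<^bsub>S\<^esub> fobj ?F Y) (fobj ?F (X \<odot>\<^bsub>GSet H\<^esub> Y))" "iso_arr S (mu ?F (X, Y))"
      using sm_functorD(3,4)[OF F, of "comp_func G X f" "comp_func G Y f"] by simp_all
    show "farr ?F (braiding (GSet H) X Y) \<cdot>\<^bsub>S\<^esub> mu ?F (X, Y) = mu ?F (Y, X) \<cdot>\<^bsub>S\<^esub> braiding S (fobj ?F X) (fobj ?F Y)"
      using sm_functorD(11)[OF F, of "comp_func G X f" "comp_func G Y f"]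
        restriction_structure(4)[OF U f, of X Y X] by simp
    fix Z assume [simp]: "Z \<in> obj (GSet H)"
    show "farr ?F (associator (GSet H) X Y Z) \<cdot>\<^bsub>S\<^esub> mu ?F (X \<odot>\<^bsub>GSet H\<^esub> Y, Z) \<cdot>\<^bsub>S\<^esub> (mu ?F (X, Y) \<otimes>\<^bsub>S\<^esub> idn S (fobj ?F Z))
      = mu ?F (X, Y \<odot>\<^bsub>GSet H\<^esub> Z) \<cdot>\<^bsub>S\<^esub> (idn S (fobj ?F X) \<otimes>\<^bsub>S\<^esub> mu ?F (Y, Z)) \<cdot>\<^bsub>S\<^esub>
        associator S (fobj ?F X) (fobj ?F Y) (fobj ?F Z)"
      using sm_functorD(8)[OF F, of "comp_func G X f" "comp_func G Y f" "comp_func G Z f"] by (simp del: S.assoc)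
  next
    fix s t assume [simp]: "s \<in> arr (GSet H)" "t \<in> arr (GSet H)"
    show "mu ?F (tgt (GSet H) s, tgt (GSet H) t) \<cdot>\<^bsub>S\<^esub> (farr ?F s \<otimes>\<^bsub>S\<^esub> farr ?F t)
      = farr ?F (s \<otimes>\<^bsub>GSet H\<^esub> t) \<cdot>\<^bsub>S\<^esub> mu ?F (src (GSet H) s, src (GSet H) t)"
      using sm_functorD(7)[OF F, of "farr (restriction G H f) s" "farr (restriction G H f) t"]
      by (simp add: Ks K restriction_tensor[OF U f])
  qed
qed

lemma pull_cocontinuous:
  assumes "small_category G" "small_category H" "cocontinuous TYPE('u) (GSet G) S F"
  shows "cocontinuous TYPE('u) (GSet H) S (pull G H S f F)"
  by (rule cocontinuous_comp[OF restriction_cocontinuous[OF U assms(1,2) f] assms(3)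
        sm_functorD(1)[OF pull_sm_functor]]) (simp_all add: pull_simps GSet_simps)

end

lemma pull_id:
  fixes G :: "('u, 'u) cat"
  assumes "universe TYPE('u)" "category G" and F: "sm_functor (GSet G) S F"
  shows "pull G G S (id_func G) F = F"
proof (rule smfun_ext[OF pull_sm_functor[OF assms(1) id_functor[OF assms(2)] F] F])
  note ps = pull_simps[OF assms(1) id_functor[OF assms(2)] F]
  show "fobj (pull G G S (id_func G) F) X = fobj F X" if "X \<in> obj (GSet G)" for X
    using that comp_func_id[of G set_smc X] by (simp add: ps GSet_simps)
  show "farr (pull G G S (id_func G) F) t = farr F t" if t: "t \<in> arr (GSet G)" for t
  proof -
    obtain X s Y where s: "t = (X, s, Y)" "is_nat G set_smc X Y s"
      using t unfolding GSet_def by (auto elim!: Fun_arrE)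
    then have "(\<lambda>g\<in>obj G. s (fobj (id_func G) g)) = s"
      using natD(3)[OF s(2)] by (auto intro!: restrict_eqI)
    then show ?thesis using t s by (simp add: ps comp_func_id[OF natD(1)[OF s(2)]] comp_func_id[OF natD(2)[OF s(2)]])
  qed
qed (use assms in \<open>simp_all add: pull_simps id_functor GSet_simps comp_func_id[where C = set_smc]\<close>)

lemma restriction_comp:
  assumes f: "is_functor G H f" and g: "is_functor H K g" and t: "t \<in> arr (GSet K)"
  shows "farr (restriction G K (comp_func G g f)) t = farr (restriction G H f) (farr (restriction H K g) t)"
proof -
  obtain X s Y where s: "t = (X, s, Y)" "is_nat K set_smc X Y s"
    using t unfolding GSet_def by (auto elim!: Fun_arrE)
  show ?thesis
    using functor_simps[OF f] whisker_nat[OF g s(2)]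
    by (auto simp: s comp_func_assoc[OF f] intro!: restrict_ext)
qed

lemma pull_comp:
  fixes G H K :: "('u, 'u) cat"
  assumes U: "universe TYPE('u)" and f: "is_functor G H f" and g: "is_functor H K g" and F: "sm_functor (GSet G) S F"
  shows "pull G K S (comp_func G g f) F = pull H K S g (pull G H S f F)"
proof (rule smfun_ext[OF pull_sm_functor[OF U comp_functor[OF f g] F]
      pull_sm_functor[OF U g pull_sm_functor[OF U f F]]])
  note ps = pull_simps[OF U comp_functor[OF f g] F] pull_simps[OF U g pull_sm_functor[OF U f F]]
    pull_simps[OF U f F]
  have c: "comp_func H X g \<in> obj (GSet H)" if "X \<in> obj (GSet K)" for X
    using that comp_functor[OF g] by (simp add: GSet_simps)
  show "fobj (pull G K S (comp_func G g f) F) X = fobj (pull H K S g (pull G H S f F)) X"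
    if "X \<in> obj (GSet K)" for X
    using that c by (simp add: ps comp_func_assoc[OF f])
  show "mu (pull G K S (comp_func G g f) F) (X, Y) = mu (pull H K S g (pull G H S f F)) (X, Y)"
    if "X \<in> obj (GSet K)" "Y \<in> obj (GSet K)" for X Y
    using that c by (simp add: ps comp_func_assoc[OF f])
  show "farr (pull G K S (comp_func G g f) F) t = farr (pull H K S g (pull G H S f F)) t"
    if "t \<in> arr (GSet K)" for t
    using that functor_simps(2)[OF restriction_functor[OF g] that]
    by (simp add: ps restriction_comp[OF f g])
  show "eta (pull G K S (comp_func G g f) F) = eta (pull H K S g (pull G H S f F))"
    by (simp add: ps)
qed


lemma whisker_hom:
  assumes \<alpha>: "is_nat G H f f' \<alpha>" and X: "X \<in> obj (GSet H)"
  shows "whisker G f f' \<alpha> X \<in> arr (GSet G)" "src (GSet G) (whisker G f f' \<alpha> X) = comp_func G X f"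
    "tgt (GSet G) (whisker G f f' \<alpha> X) = comp_func G X f'"
  using whisker_arr[OF \<alpha>, of set_smc X] X by (simp_all add: whisker_def GSet_def)

lemma whisker_natural:
  assumes \<alpha>: "is_nat G H f f' \<alpha>" and s: "s \<in> arr (GSet H)"
  shows "whisker G f f' \<alpha> (tgt (GSet H) s) \<cdot>\<^bsub>GSet G\<^esub> farr (restriction G H f) s
    = farr (restriction G H f') s \<cdot>\<^bsub>GSet G\<^esub> whisker G f f' \<alpha> (src (GSet H) s)"
proof -
  obtain X t Y where t: "s = (X, t, Y)" "is_nat H set_smc X Y t"
    using s unfolding GSet_def by (auto elim!: Fun_arrE)
  show ?thesis
    using nat_simps[OF \<alpha>] nat_simps(4)[OF t(2)]
    by (auto simp: t whisker_def GSet_def vcomp_def intro!: restrict_ext) (metis nat_simps(1-3)[OF \<alpha>])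
qed

lemma whisker_tensor:
  assumes \<alpha>: "is_nat G H f f' \<alpha>"
  shows "whisker G f f' \<alpha> (X \<odot>\<^bsub>GSet H\<^esub> Y) = whisker G f f' \<alpha> X \<otimes>\<^bsub>GSet G\<^esub> whisker G f f' \<alpha> Y"
  using nat_simps(1-3)[OF \<alpha>] natD(1,2)[OF \<alpha>]
  by (auto simp: whisker_def GSet_def comp_pointwise intro!: restrict_ext)

lemma whisker_unit:
  assumes \<alpha>: "is_nat G H f f' \<alpha>"
  shows "whisker G f f' \<alpha> (tunit (GSet H)) = idn (GSet G) (tunit (GSet G))"
  using nat_simps(1-3)[OF \<alpha>] natD(1,2)[OF \<alpha>]
  by (auto simp: whisker_def GSet_def comp_pointwise id_nat_def intro!: restrict_ext)

lemma whisker_id: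
  assumes f: "is_functor G H f" and X: "X \<in> obj (GSet H)"
  shows "whisker G f f (id_nat G H f) X = idn (GSet G) (comp_func G X f)"
  using functor_simps[OF f] functor_simps[of H set_smc X] X
  by (auto simp: whisker_def GSet_def id_nat_def intro!: restrict_ext)

lemma whisker_vcomp:
  assumes \<alpha>: "is_nat G H f f' \<alpha>" and \<beta>: "is_nat G H f' f'' \<beta>" and X: "X \<in> obj (GSet H)"
  shows "whisker G f f'' (vcomp G H \<beta> \<alpha>) X = whisker G f' f'' \<beta> X \<cdot>\<^bsub>GSet G\<^esub> whisker G f f' \<alpha> X"
  using nat_simps(1-3)[OF \<alpha>] nat_simps(1-3)[OF \<beta>] functor_simps(6)[of H set_smc X] X
  by (auto simp: whisker_def GSet_def vcomp_def intro!: restrict_ext)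

lemma whisker_hcomp:
  assumes \<alpha>: "is_nat G H f f' \<alpha>" and \<beta>: "is_nat H K g g' \<beta>" and X: "X \<in> obj (GSet K)"
  shows "whisker G (comp_func G g f) (comp_func G g' f') (hcomp G K g f' \<beta> \<alpha>) X
    = farr (restriction G H f') (whisker H g g' \<beta> X) \<cdot>\<^bsub>GSet G\<^esub> whisker G f f' \<alpha> (comp_func H X g)"
proof -
  have X': "is_functor K set_smc X" using X by (simp add: GSet_simps)
  show ?thesis
    using nat_simps(1-3)[OF \<alpha>] nat_simps(1-3)[OF \<beta>] functor_simps(6)[OF X'] functor_simps[OF natD(1)[OF \<alpha>]]
      functor_simps[OF natD(2)[OF \<alpha>]] functor_simps[OF natD(1)[OF \<beta>]] whisker_arr[OF \<beta> X']
    by (auto simp: whisker_def GSet_def vcomp_def hcomp_def comp_func_assoc[OF natD(1)[OF \<alpha>]]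
        comp_func_assoc[OF natD(2)[OF \<alpha>]] intro!: restrict_ext)
qed

lemma pi1_simps [simp]:
  "on0 (pi1 S) G = com2ring_hom TYPE('u) (GSet (G :: ('u, 'u) cat)) S"
  "on1 (pi1 S) G H f = precompose TYPE('u) (GSet H) (GSet (G :: ('u, 'u) cat)) S (restriction G H f)"
  by (simp_all add: pi1_def)

lemma pi1_on2:
  fixes G :: "('u, 'u) cat"
  assumes "F \<in> obj (com2ring_hom TYPE('u) (GSet G) S)"
  shows "on2 (pi1 S) G H f f' \<alpha> F = (pull G H S f F, \<lambda>X\<in>obj (GSet H). farr F (whisker G f f' \<alpha> X), pull G H S f' F)"
  using assms by (simp add: pi1_def whisker_def)

context tensor_category
begin

lemma on1_obj:
  assumes "F \<in> obj (com2ring_hom U (GSet G) S)"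
  shows "fobj (precompose U (GSet H) (GSet G) S (restriction G H f)) F = pull G H S f F"
  using assms by (simp add: precompose_def)

lemma on1_arr:
  assumes "(F, t, F') \<in> arr (com2ring_hom U (GSet G) S)"
  shows "farr (precompose U (GSet H) (GSet G) S (restriction G H f)) (F, t, F')
    = (pull G H S f F, \<lambda>X\<in>obj (GSet H). t (comp_func G X f), pull G H S f F')"
  using assms by (auto simp: precompose_def GSet_simps simp del: com2ring_simps intro!: restrict_ext)

lemma on1_functor:
  fixes G H :: "('u, 'u) cat"
  assumes U: "universe TYPE('u)" and f: "is_functor G H f" and G: "small_category G" and H: "small_category H"
  shows "is_functor (com2ring_hom TYPE('u) (GSet G) S) (com2ring_hom TYPE('u) (GSet H) S)
    (precompose TYPE('u) (GSet H) (GSet G) S (restriction G H f))"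
    (is "is_functor ?P ?Q ?R")
proof -
  obtain p q dia bang where "cartesian (GSet G) p q dia bang"
    using cartesian_GSet[OF U functor_cats(1)[OF f]] .
  then interpret GG: cartesian "GSet G" p q dia bang .
  obtain p' q' dia' bang' where "cartesian (GSet H) p' q' dia' bang'"
    using cartesian_GSet[OF U functor_cats(2)[OF f]] .
  then interpret HH: cartesian "GSet H" p' q' dia' bang' .
  note cP = category_com2ring[OF GG.cartesian_axioms, of "TYPE('u)"]
  note cQ = category_com2ring[OF HH.cartesian_axioms, of "TYPE('u)"]
  have c [simp]: "comp_func G X f \<in> obj (GSet G)" if "X \<in> obj (GSet H)" for X
    using that comp_functor[OF f] by (simp add: GSet_simps)
  have T: "comp_func G (X \<odot>\<^bsub>GSet H\<^esub> Y) f = comp_func G X f \<odot>\<^bsub>GSet G\<^esub> comp_func G Y f" for X Y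
    by (simp add: GSet_simps comp_pointwise[OF f])
  have I: "comp_func G (tunit (GSet H)) f = tunit (GSet G)"
    by (simp add: GSet_simps comp_pointwise[OF f])
  have pull_obj: "pull G H S f F \<in> obj ?Q" if "F \<in> obj ?P" for F
    using that pull_sm_functor[OF U f, of S F] pull_cocontinuous[OF U f, of S F] G H by simp
  note ps = pull_simps[OF U f]
  show ?thesis
  proof (rule functorI[OF cP cQ])
    fix F assume F: "F \<in> obj ?P"
    show "fobj ?R F \<in> obj ?Q" using pull_obj[OF F] on1_obj[OF F] by simp
    show "farr ?R (idn ?P F) = idn ?Q (fobj ?R F)"
      using category.idn_simps(1)[OF cP F] F
      by (auto simp: on1_obj on1_arr id_nat_def ps intro!: restrict_ext)
  next
    fix t assume t: "t \<in> arr ?P"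
    then obtain F t' F' where t': "t = (F, t', F')" and F: "sm_functor (GSet G) S F" "F \<in> obj ?P"
      and F': "sm_functor (GSet G) S F'" "F' \<in> obj ?P" and m: "is_monoidal_nat (GSet G) S F F' t'"
      by (auto elim: com2ring_arrE)
    note n = monoidal_natD(1)[OF m]
    let ?t = "\<lambda>X\<in>obj (GSet H). t' (comp_func G X f)"
    have "is_monoidal_nat (GSet H) S (pull G H S f F) (pull G H S f F') ?t"
      unfolding is_monoidal_nat_def
    proof (intro conjI ballI)
      show "is_nat (GSet H) S (pull G H S f F) (pull G H S f F') ?t"
      proof (rule natI[OF sm_functorD(1)[OF pull_sm_functor[OF U f F(1)]] sm_functorD(1)[OF pull_sm_functor[OF U f F'(1)]]])
        fix s assume s: "s \<in> arr (GSet H)"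
        note Ks = functor_simps(2-4)[OF restriction_functor[OF f] s]
        have K: "fobj (restriction G H f) X = comp_func G X f" if "X \<in> obj (GSet H)" for X
          using that by (simp add: GSet_simps)
        show "?t (tgt (GSet H) s) \<cdot> farr (pull G H S f F) s = farr (pull G H S f F') s \<cdot> ?t (src (GSet H) s)"
          using nat_simps(4)[OF n Ks(1)] s by (simp add: ps F F' Ks K)
      qed (use nat_simps(1-3)[OF n] in \<open>auto simp: ps F F' in_hom\<close>)
      show "?t (tunit (GSet H)) \<cdot> eta (pull G H S f F) = eta (pull G H S f F')"
        using monoidal_natD(3)[OF m] by (simp add: ps F F' I)
      fix X Y assume "X \<in> obj (GSet H)" "Y \<in> obj (GSet H)"
      then show "?t (X \<odot>\<^bsub>GSet H\<^esub> Y) \<cdot> mu (pull G H S f F) (X, Y) = mu (pull G H S f F') (X, Y) \<cdot> (?t X \<otimes> ?t Y)"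
        using monoidal_natD(2)[OF m, of "comp_func G X f" "comp_func G Y f"] by (simp add: ps F F' T)
    qed
    then show "farr ?R t \<in> hom ?Q (fobj ?R (src ?P t)) (fobj ?R (tgt ?P t))"
      using t pull_obj[OF F(2)] pull_obj[OF F'(2)] F(2) F'(2)
      by (simp add: t' on1_arr on1_obj in_hom del: com2ring_simps(1))
  next
    fix s t assume st: "s \<in> arr ?P" "t \<in> arr ?P" "tgt ?P s = src ?P t"
    then have ts: "t \<cdot>\<^bsub>?P\<^esub> s \<in> arr ?P" using category.cmp_simps(1)[OF cP] by blast
    from st obtain F s' F' t' F'' where "s = (F, s', F')" "t = (F', t', F'')"
      by (auto elim!: com2ring_arrE)
    with st ts show "farr ?R (t \<cdot>\<^bsub>?P\<^esub> s) = farr ?R t \<cdot>\<^bsub>?Q\<^esub> farr ?R s"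
      by (auto simp: on1_arr vcomp_def simp del: com2ring_simps(1,4) intro!: restrict_ext)
  qed (simp_all add: precompose_def)
qed

lemma on2_monoidal_nat:
  fixes G H :: "('u, 'u) cat"
  assumes U: "universe TYPE('u)" and \<alpha>: "is_nat G H f f' \<alpha>" and F: "sm_functor (GSet G) S F"
  shows "is_monoidal_nat (GSet H) S (pull G H S f F) (pull G H S f' F)
    (\<lambda>X\<in>obj (GSet H). farr F (whisker G f f' \<alpha> X))"
    (is "is_monoidal_nat _ _ ?F ?F' ?t")
  unfolding is_monoidal_nat_def
proof (intro conjI ballI)
  note f = natD(1)[OF \<alpha>] and f' = natD(2)[OF \<alpha>]
  obtain p q dia bang where "cartesian (GSet G) p q dia bang"
    using cartesian_GSet[OF U functor_cats(1)[OF f]] .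
  then interpret GG: cartesian "GSet G" p q dia bang .
  obtain p' q' dia' bang' where "cartesian (GSet H) p' q' dia' bang'"
    using cartesian_GSet[OF U functor_cats(2)[OF f]] .
  then interpret HH: cartesian "GSet H" p' q' dia' bang' .
  note ps = pull_simps[OF U f F] pull_simps[OF U f' F]
  note Fs = functor_simps[OF sm_functorD(1)[OF F]]
  note wh = whisker_hom[OF \<alpha>]
  show "is_nat (GSet H) S ?F ?F' ?t"
  proof (rule natI[OF sm_functorD(1)[OF pull_sm_functor[OF U f F]] sm_functorD(1)[OF pull_sm_functor[OF U f' F]]])
    fix s assume s: "s \<in> arr (GSet H)"
    have K: "fobj (restriction G H f) X = comp_func G X f" "fobj (restriction G H f') X = comp_func G X f'"
      if "X \<in> obj (GSet H)" for X
      using that by (simp_all add: GSet_simps)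
    note Ks = functor_simps(2-4)[OF restriction_functor[OF f] s] functor_simps(2-4)[OF restriction_functor[OF f'] s]
    have "farr F (whisker G f f' \<alpha> (tgt (GSet H) s)) \<cdot> farr F (farr (restriction G H f) s)
      = farr F (whisker G f f' \<alpha> (tgt (GSet H) s) \<cdot>\<^bsub>GSet G\<^esub> farr (restriction G H f) s)"
      using s by (intro Fs(6)[symmetric]) (simp_all add: wh Ks K)
    also have "\<dots> = farr F (farr (restriction G H f') s) \<cdot> farr F (whisker G f f' \<alpha> (src (GSet H) s))"
      unfolding whisker_natural[OF \<alpha> s] using s by (intro Fs(6)) (simp_all add: wh Ks K)
    finally show "?t (tgt (GSet H) s) \<cdot> farr ?F s = farr ?F' s \<cdot> ?t (src (GSet H) s)"
      using s by (simp add: ps)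
  qed (simp_all add: ps in_hom Fs wh)
  show "?t (tunit (GSet H)) \<cdot> eta ?F = eta ?F'"
    using sm_functor_eta[OF F] by (simp add: ps whisker_unit[OF \<alpha>] Fs)
  fix X Y assume X: "X \<in> obj (GSet H)" and Y: "Y \<in> obj (GSet H)"
  then show "?t (X \<odot>\<^bsub>GSet H\<^esub> Y) \<cdot> mu ?F (X, Y) = mu ?F' (X, Y) \<cdot> (?t X \<otimes> ?t Y)"
    using sm_functorD(7)[OF F wh(1)[OF X] wh(1)[OF Y]] by (simp add: ps whisker_tensor[OF \<alpha>] wh)
qed

text \<open>Each axiom about 2-cells is an equation between whiskered arrows to which \<open>F\<close> is applied; each axiom
  about 1-cells holds because restriction is strictly functorial.\<close>

lemma two_functor_pi1:
  fixes \<G> :: "('u, 'u) cat set"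
  assumes U: "universe TYPE('u)" and \<G>: "\<G> \<subseteq> small_groupoids"
  shows "is_two_functor \<G> (pi1 S)"
proof -
  let ?P = "\<lambda>G :: ('u, 'u) cat. com2ring_hom TYPE('u) (GSet G) S"
  let ?R = "\<lambda>(G :: ('u, 'u) cat) H f. precompose TYPE('u) (GSet H) (GSet G) S (restriction G H f)"
  have small: "small_category G" "category G" if "G \<in> \<G>" for G :: "('u, 'u) cat"
    using that \<G> by (auto simp: small_groupoids_def small_category_def)
  have cP: "category (?P G)" if G: "G \<in> \<G>" for G
  proof -
    obtain p q dia bang where "cartesian (GSet G) p q dia bang"
      using cartesian_GSet[OF U small(2)[OF G]] .
    then show ?thesis by (rule category_com2ring)
  qed
  have R: "is_functor (?P G) (?P H) (?R G H f)"
    if "G \<in> \<G>" "H \<in> \<G>" "is_functor G H f" for G H f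
    by (rule on1_functor[OF U that(3) small(1)[OF that(1)] small(1)[OF that(2)]])
  have pull_obj: "pull G H S f F \<in> obj (?P H)"
    if "G \<in> \<G>" "H \<in> \<G>" "is_functor G H f" "F \<in> obj (?P G)" for G H f F
    using functor_simps(1)[OF R[OF that(1-3)] that(4)] on1_obj[OF that(4)] by simp
  have on2_arr: "(pull G H S f F, \<lambda>X\<in>obj (GSet H). farr F (whisker G f f' \<alpha> X), pull G H S f' F) \<in> arr (?P H)"
    if "G \<in> \<G>" "H \<in> \<G>" "is_nat G H f f' \<alpha>" "F \<in> obj (?P G)" for G H f f' \<alpha> F
    using pull_obj[OF that(1,2) natD(1)[OF that(3)] that(4)] pull_obj[OF that(1,2) natD(2)[OF that(3)] that(4)]
      on2_monoidal_nat[OF U that(3), of F] that(4) by simp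
  have c: "comp_func G X f \<in> obj (GSet G)" if "is_functor G H f" "X \<in> obj (GSet H)" for G H f X
    using that comp_functor by (auto simp: GSet_simps)
  show ?thesis
    unfolding is_two_functor_def pi1_simps
  proof (intro conjI ballI allI impI)
    fix G :: "('u, 'u) cat" assume G: "G \<in> \<G>"
    show "category (?P G)" by (rule cP[OF G])
    show "?R G G (id_func G) = id_func (?P G)"
    proof (rule functor_ext[OF R[OF G G id_functor[OF small(2)[OF G]]] id_functor[OF cP[OF G]]])
      fix F assume "F \<in> obj (?P G)"
      then show "fobj (?R G G (id_func G)) F = fobj (id_func (?P G)) F"
        using pull_id[OF U small(2)[OF G], of S F] by (simp add: on1_obj)
    next
      fix t assume t: "t \<in> arr (?P G)"
      then obtain F t' F' where t': "t = (F, t', F')" and F: "sm_functor (GSet G) S F"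
        and F': "sm_functor (GSet G) S F'" and m: "is_monoidal_nat (GSet G) S F F' t'"
        by (auto elim: com2ring_arrE)
      have "(\<lambda>X\<in>obj (GSet G). t' (comp_func G X (id_func G))) = t'"
        using natD(3)[OF monoidal_natD(1)[OF m]]
        by (auto simp: GSet_simps comp_func_id[where C = set_smc] intro!: restrict_eqI)
      then show "farr (?R G G (id_func G)) t = farr (id_func (?P G)) t"
        using t pull_id[OF U small(2)[OF G] F] pull_id[OF U small(2)[OF G] F'] by (simp add: t' on1_arr del: com2ring_simps)
    qed
  next
    fix G H :: "('u, 'u) cat" and f :: "('u, 'u, 'u, 'u) func"
    assume h: "G \<in> \<G>" "H \<in> \<G>" and f: "is_functor G H f"
    show "is_functor (?P G) (?P H) (?R G H f)" by (rule R[OF h f])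
    show "on2 (pi1 S) G H f f (id_nat G H f) = id_nat (?P G) (?P H) (?R G H f)"
    proof (rule extensionalityI[where A = "obj (?P G)"])
      fix F assume F: "F \<in> obj (?P G)"
      then have Fs: "sm_functor (GSet G) S F" by simp
      have "(\<lambda>X\<in>obj (GSet H). farr F (whisker G f f (id_nat G H f) X)) = id_nat (GSet H) S (pull G H S f F)"
        using functor_simps(5)[OF sm_functorD(1)[OF Fs] c[OF f]]
        by (auto simp: id_nat_def[of "GSet H" S] whisker_id[OF f] pull_simps[OF U f Fs] intro!: restrict_ext)
      then show "on2 (pi1 S) G H f f (id_nat G H f) F = id_nat (?P G) (?P H) (?R G H f) F"
        using F by (simp add: pi1_on2 id_nat_def[of "?P G"] on1_obj del: com2ring_simps(1))
    qed (simp_all add: pi1_def id_nat_def)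
  next
    fix G H K :: "('u, 'u) cat" and f g :: "('u, 'u, 'u, 'u) func"
    assume h: "G \<in> \<G>" "H \<in> \<G>" "K \<in> \<G>"
      and "is_functor G H f \<and> is_functor H K g"
    then have f: "is_functor G H f" and g: "is_functor H K g" by auto
    show "?R G K (comp_func G g f) = comp_func (?P G) (?R H K g) (?R G H f)"
    proof (rule functor_ext[OF R[OF h(1,3) comp_functor[OF f g]] comp_functor[OF R[OF h(1,2) f] R[OF h(2,3) g]]])
      fix F assume F: "F \<in> obj (?P G)"
      then show "fobj (?R G K (comp_func G g f)) F = fobj (comp_func (?P G) (?R H K g) (?R G H f)) F"
        using pull_comp[OF U f g, of S F] pull_obj[OF h(1,2) f F] by (simp add: on1_obj)
    next
      fix t assume t: "t \<in> arr (?P G)"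
      then obtain F t' F' where t': "t = (F, t', F')" and F: "sm_functor (GSet G) S F"
        and F': "sm_functor (GSet G) S F'" by (auto elim: com2ring_arrE)
      have "(pull G H S f F, \<lambda>X\<in>obj (GSet H). t' (comp_func G X f), pull G H S f F') \<in> arr (?P H)"
        using functor_simps(2)[OF R[OF h(1,2) f] t] t by (simp add: t' on1_arr del: com2ring_simps)
      then show "farr (?R G K (comp_func G g f)) t = farr (comp_func (?P G) (?R H K g) (?R G H f)) t"
        using t c[OF g]
        by (auto simp: t' on1_arr pull_comp[OF U f g] F F' comp_func_assoc[OF f] simp del: com2ring_simps
            intro!: restrict_ext)
    qed
  next
    fix G H :: "('u, 'u) cat" and f f' :: "('u, 'u, 'u, 'u) func" and \<alpha>
    assume h: "G \<in> \<G>" "H \<in> \<G>" and \<alpha>: "is_nat G H f f' \<alpha>"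
    note f = natD(1)[OF \<alpha>] and f' = natD(2)[OF \<alpha>]
    show "is_nat (?P G) (?P H) (?R G H f) (?R G H f') (on2 (pi1 S) G H f f' \<alpha>)"
    proof (rule natI[OF R[OF h f] R[OF h f']])
      fix F assume F: "F \<in> obj (?P G)"
      show "on2 (pi1 S) G H f f' \<alpha> F \<in> hom (?P H) (fobj (?R G H f) F) (fobj (?R G H f') F)"
        using on2_arr[OF h \<alpha> F] F by (simp add: pi1_on2 on1_obj in_hom del: com2ring_simps(1,4))
    next
      fix t assume t: "t \<in> arr (?P G)"
      then obtain F t' F' where t': "t = (F, t', F')" and F: "F \<in> obj (?P G)"
        and F': "F' \<in> obj (?P G)" and m: "is_monoidal_nat (GSet G) S F F' t'" by (auto elim: com2ring_arrE)
      note n = nat_simps(4)[OF monoidal_natD(1)[OF m]]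
      show "on2 (pi1 S) G H f f' \<alpha> (tgt (?P G) t) \<cdot>\<^bsub>?P H\<^esub> farr (?R G H f) t
        = farr (?R G H f') t \<cdot>\<^bsub>?P H\<^esub> on2 (pi1 S) G H f f' \<alpha> (src (?P G) t)"
        using t F F' n[OF whisker_hom(1)[OF \<alpha>]] whisker_hom(2,3)[OF \<alpha>]
        by (auto simp: t' pi1_on2 on1_arr vcomp_def simp del: com2ring_simps(1,4) intro!: restrict_ext)
    qed (simp add: pi1_def)
  next
    fix G H :: "('u, 'u) cat" and f f' f'' :: "('u, 'u, 'u, 'u) func" and \<alpha> \<beta>
    assume h: "G \<in> \<G>" "H \<in> \<G>" and "is_nat G H f f' \<alpha> \<and> is_nat G H f' f'' \<beta>"
    then have \<alpha>: "is_nat G H f f' \<alpha>" and \<beta>: "is_nat G H f' f'' \<beta>" by auto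
    show "on2 (pi1 S) G H f f'' (vcomp G H \<beta> \<alpha>)
      = vcomp (?P G) (?P H) (on2 (pi1 S) G H f' f'' \<beta>) (on2 (pi1 S) G H f f' \<alpha>)"
    proof (rule extensionalityI[where A = "obj (?P G)"])
      fix F assume F: "F \<in> obj (?P G)"
      then have Fs: "sm_functor (GSet G) S F" by simp
      have "farr F (whisker G f f'' (vcomp G H \<beta> \<alpha>) X)
        = farr F (whisker G f' f'' \<beta> X) \<cdot> farr F (whisker G f f' \<alpha> X)" if X: "X \<in> obj (GSet H)" for X
        unfolding whisker_vcomp[OF \<alpha> \<beta> X]
        by (rule functor_simps(6)[OF sm_functorD(1)[OF Fs]]) (simp_all add: whisker_hom[OF \<alpha> X] whisker_hom[OF \<beta> X])
      then show "on2 (pi1 S) G H f f'' (vcomp G H \<beta> \<alpha>) F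
        = vcomp (?P G) (?P H) (on2 (pi1 S) G H f' f'' \<beta>) (on2 (pi1 S) G H f f' \<alpha>) F"
        using F by (auto simp: pi1_on2 vcomp_def simp del: com2ring_simps(1) intro!: restrict_ext)
    qed (simp_all add: pi1_def vcomp_def)
  next
    fix G H K :: "('u, 'u) cat" and f f' g g' :: "('u, 'u, 'u, 'u) func" and \<alpha> \<beta>
    assume h: "G \<in> \<G>" "H \<in> \<G>" "K \<in> \<G>"
      and "is_nat G H f f' \<alpha> \<and> is_nat H K g g' \<beta>"
    then have \<alpha>: "is_nat G H f f' \<alpha>" and \<beta>: "is_nat H K g g' \<beta>" by auto
    note f = natD(1)[OF \<alpha>] and f' = natD(2)[OF \<alpha>] and g = natD(1)[OF \<beta>] and g' = natD(2)[OF \<beta>]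
    show "on2 (pi1 S) G K (comp_func G g f) (comp_func G g' f') (hcomp G K g f' \<beta> \<alpha>)
      = hcomp (?P G) (?P K) (?R H K g) (?R G H f') (on2 (pi1 S) H K g g' \<beta>) (on2 (pi1 S) G H f f' \<alpha>)"
    proof (rule extensionalityI[where A = "obj (?P G)"])
      fix F assume F: "F \<in> obj (?P G)"
      then have Fs: "sm_functor (GSet G) S F" by simp
      have "farr F (whisker G (comp_func G g f) (comp_func G g' f') (hcomp G K g f' \<beta> \<alpha>) X)
        = farr (pull G H S f' F) (whisker H g g' \<beta> X) \<cdot> farr F (whisker G f f' \<alpha> (comp_func H X g))"
        if X: "X \<in> obj (GSet K)" for X
      proof -
        note wb = whisker_hom[OF \<beta> X] and wa = whisker_hom[OF \<alpha> c[OF g X]]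
        have "fobj (restriction G H f') (comp_func H X g) = comp_func G (comp_func H X g) f'"
          using c[OF g X] by (simp add: GSet_simps)
        then show ?thesis
          unfolding whisker_hcomp[OF \<alpha> \<beta> X] pull_simps(2)[OF U f' Fs wb(1)]
          using functor_simps(2-4)[OF restriction_functor[OF f'] wb(1)]
          by (intro functor_simps(6)[OF sm_functorD(1)[OF Fs]]) (simp_all add: wa wb)
      qed
      then have "(\<lambda>X\<in>obj (GSet K). farr F (whisker G (comp_func G g f) (comp_func G g' f') (hcomp G K g f' \<beta> \<alpha>) X))
        = vcomp (GSet K) S (\<lambda>X\<in>obj (GSet K). farr (pull G H S f' F) (whisker H g g' \<beta> X))
            (\<lambda>X\<in>obj (GSet K). (\<lambda>Y\<in>obj (GSet H). farr F (whisker G f f' \<alpha> Y)) (comp_func H X g))"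
        using c[OF g] by (auto simp: vcomp_def intro!: restrict_ext)
      then show "on2 (pi1 S) G K (comp_func G g f) (comp_func G g' f') (hcomp G K g f' \<beta> \<alpha>) F
        = hcomp (?P G) (?P K) (?R H K g) (?R G H f') (on2 (pi1 S) H K g g' \<beta>) (on2 (pi1 S) G H f f' \<alpha>) F"
        using F pull_obj[OF h(1,2) f' F] on1_arr[OF on2_arr[OF h(1,2) \<alpha> F]]
        by (simp add: hcomp_def[of "?P G"] pi1_on2 on1_obj pull_comp[OF U f g Fs] pull_comp[OF U f' g' Fs]
            del: com2ring_simps(1))
    qed (simp_all add: pi1_def hcomp_def)
  qed
qed

end


section \<open>Strict isomorphisms of 2-functors\<close>

lemma two_functorD:
  fixes P :: "('u, 'o, 'm) two_functor" and f f' g :: "('u, 'u, 'u, 'u) func"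
  assumes "is_two_functor \<G> P"
  shows "G \<in> \<G> \<Longrightarrow> category (on0 P G)"
    "\<lbrakk>G \<in> \<G>; H \<in> \<G>; is_functor G H f\<rbrakk> \<Longrightarrow> is_functor (on0 P G) (on0 P H) (on1 P G H f)"
    "G \<in> \<G> \<Longrightarrow> on1 P G G (id_func G) = id_func (on0 P G)"
    "\<lbrakk>G \<in> \<G>; H \<in> \<G>; K \<in> \<G>; is_functor G H f; is_functor H K g\<rbrakk> \<Longrightarrow>
      on1 P G K (comp_func G g f) = comp_func (on0 P G) (on1 P H K g) (on1 P G H f)"
    "\<lbrakk>G \<in> \<G>; H \<in> \<G>; is_nat G H f f' \<alpha>\<rbrakk> \<Longrightarrow>
      is_nat (on0 P G) (on0 P H) (on1 P G H f) (on1 P G H f') (on2 P G H f f' \<alpha>)"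
  using assms unfolding is_two_functor_def by simp_all

text \<open>A family of functors that commutes strictly with 1-cells and 2-cells is pseudonatural with
  identity components.\<close>

lemma strict_pseudonat:
  fixes P :: "('u, 'o, 'm) two_functor" and Q :: "('u, 'p, 'n) two_functor"
  assumes P: "is_two_functor \<G> P" and Q: "is_two_functor \<G> Q"
    and t: "\<And>G. G \<in> \<G> \<Longrightarrow> is_functor (on0 P G) (on0 Q G) (at0 t G)"
    and at1: "\<And>G H f. at1 t G H f = id_nat (on0 P G) (on0 Q H) (comp_func (on0 P G) (on1 Q G H f) (at0 t G))"
    and t1: "\<And>G H (f :: ('u, 'u, 'u, 'u) func). \<lbrakk>G \<in> \<G>; H \<in> \<G>; is_functor G H f\<rbrakk> \<Longrightarrow>
      comp_func (on0 P G) (on1 Q G H f) (at0 t G) = comp_func (on0 P G) (at0 t H) (on1 P G H f)"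
    and t2: "\<And>G H (f :: ('u, 'u, 'u, 'u) func) (f' :: ('u, 'u, 'u, 'u) func) \<alpha> x. \<lbrakk>G \<in> \<G>; H \<in> \<G>; is_nat G H f f' \<alpha>; x \<in> obj (on0 P G)\<rbrakk> \<Longrightarrow>
      on2 Q G H f f' \<alpha> (fobj (at0 t G) x) = farr (at0 t H) (on2 P G H f f' \<alpha> x)"
  shows "is_pseudonat \<G> P Q t"
proof -
  have t1_obj: "fobj (at0 t H) (fobj (on1 P G H f) x) = fobj (on1 Q G H f) (fobj (at0 t G) x)"
    if "G \<in> \<G>" "H \<in> \<G>" "is_functor G H f" "x \<in> obj (on0 P G)"
    for G H x and f :: "('u, 'u, 'u, 'u) func"
    using arg_cong[OF t1[OF that(1-3)], of "\<lambda>F. fobj F x"] that(4) by simp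
  have at1_x: "at1 t G H f x = idn (on0 Q H) (fobj (on1 Q G H f) (fobj (at0 t G) x))"
    if "x \<in> obj (on0 P G)"
    for G H x and f :: "('u, 'u, 'u, 'u) func"
    using that by (simp add: at1 id_nat_def)
  note objs = functor_simps(1)[OF t] functor_simps(1)[OF two_functorD(2)[OF Q]]
    functor_simps(1)[OF two_functorD(2)[OF P]]
  show ?thesis
    unfolding is_pseudonat_def
  proof (intro conjI ballI allI impI)
    fix G assume G: "G \<in> \<G>"
    show "is_functor (on0 P G) (on0 Q G) (at0 t G)" by (rule t[OF G])
    fix x assume x: "x \<in> obj (on0 P G)"
    then show "at1 t G G (id_func G) x = idn (on0 Q G) (fobj (at0 t G) x)"
      using two_functorD(3)[OF Q G] objs(1)[OF G x] by (simp add: at1_x)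
  next
    fix G H and f :: "('u, 'u, 'u, 'u) func" assume h: "G \<in> \<G>" "H \<in> \<G>" "is_functor G H f"
    show "is_nat (on0 P G) (on0 Q H) (comp_func (on0 P G) (on1 Q G H f) (at0 t G))
      (comp_func (on0 P G) (at0 t H) (on1 P G H f)) (at1 t G H f)"
      unfolding at1 t1[OF h, symmetric]
      by (rule id_nat_nat[OF comp_functor[OF t[OF h(1)] two_functorD(2)[OF Q h]]])
    fix x assume x: "x \<in> obj (on0 P G)"
    show "iso_arr (on0 Q H) (at1 t G H f x)"
      using category.iso_idn[OF two_functorD(1)[OF Q h(2)]] objs(2)[OF h objs(1)[OF h(1) x]]
      by (simp add: at1_x x)
  next
    fix G H and f f' :: "('u, 'u, 'u, 'u) func" and \<alpha> x assume h: "G \<in> \<G>" "H \<in> \<G>" "is_nat G H f f' \<alpha>" and x: "x \<in> obj (on0 P G)"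
    interpret QH: category "on0 Q H" by (rule two_functorD(1)[OF Q h(2)])
    note n = two_functorD(5)[OF Q h]
    show "at1 t G H f' x \<cdot>\<^bsub>on0 Q H\<^esub> on2 Q G H f f' \<alpha> (fobj (at0 t G) x)
      = farr (at0 t H) (on2 P G H f f' \<alpha> x) \<cdot>\<^bsub>on0 Q H\<^esub> at1 t G H f x"
      using nat_simps(1-3)[OF n objs(1)[OF h(1) x]] by (simp add: at1_x x flip: t2[OF h x])
  next
    fix G H K and f g :: "('u, 'u, 'u, 'u) func" and x
    assume h: "G \<in> \<G>" "H \<in> \<G>" "K \<in> \<G>" "is_functor G H f \<and> is_functor H K g" and x: "x \<in> obj (on0 P G)"
    then have f: "is_functor G H f" and g: "is_functor H K g" by auto
    interpret QK: category "on0 Q K" by (rule two_functorD(1)[OF Q h(3)])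
    note tx = objs(1)[OF h(1) x]
    note qx = objs(2)[OF h(1,2) f tx]
    show "at1 t G K (comp_func G g f) x
      = at1 t H K g (fobj (on1 P G H f) x) \<cdot>\<^bsub>on0 Q K\<^esub> farr (on1 Q H K g) (at1 t G H f x)"
      using two_functorD(4)[OF Q h(1-3) f g] objs(3)[OF h(1,2) f x] tx qx objs(2)[OF h(2,3) g qx]
        functor_simps(5)[OF two_functorD(2)[OF Q h(2,3) g] qx]
      by (simp add: at1_x x t1_obj[OF h(1,2) f x])
  qed
qed

text \<open>The composite of two strict transformations is strict, so if its functors are identities then it is
  the identity transformation, and identity components form the modification.\<close>

lemma strict_inverse_modification:
  fixes P :: "('u, 'o, 'm) two_functor" and Q :: "('u, 'p, 'n) two_functor"
  assumes P: "is_two_functor \<G> P" and Q: "is_two_functor \<G> Q"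
    and t: "\<And>G. G \<in> \<G> \<Longrightarrow> is_functor (on0 P G) (on0 Q G) (at0 t G)"
    and s: "\<And>G. G \<in> \<G> \<Longrightarrow> is_functor (on0 Q G) (on0 P G) (at0 s G)"
    and st: "\<And>G. G \<in> \<G> \<Longrightarrow> comp_func (on0 P G) (at0 s G) (at0 t G) = id_func (on0 P G)"
    and at1_t: "\<And>G H f. at1 t G H f = id_nat (on0 P G) (on0 Q H) (comp_func (on0 P G) (on1 Q G H f) (at0 t G))"
    and at1_s: "\<And>G H f. at1 s G H f = id_nat (on0 Q G) (on0 P H) (comp_func (on0 Q G) (on1 P G H f) (at0 s G))"
    and t1: "\<And>G H (f :: ('u, 'u, 'u, 'u) func). \<lbrakk>G \<in> \<G>; H \<in> \<G>; is_functor G H f\<rbrakk> \<Longrightarrow>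
      comp_func (on0 P G) (on1 Q G H f) (at0 t G) = comp_func (on0 P G) (at0 t H) (on1 P G H f)"
  shows "is_invertible_modification \<G> P P (comp_pseudonat P P s t) (id_pseudonat P)
    (\<lambda>G. id_nat (on0 P G) (on0 P G) (id_func (on0 P G)))"
  unfolding is_invertible_modification_def
proof (intro conjI ballI allI impI)
  fix G assume G: "G \<in> \<G>"
  show "is_nat (on0 P G) (on0 P G) (at0 (comp_pseudonat P P s t) G) (at0 (id_pseudonat P) G)
    (id_nat (on0 P G) (on0 P G) (id_func (on0 P G)))"
    by (simp add: comp_pseudonat_def id_pseudonat_def st[OF G] id_nat_nat id_functor two_functorD(1)[OF P G])
  fix x assume "x \<in> obj (on0 P G)"
  then show "iso_arr (on0 P G) (id_nat (on0 P G) (on0 P G) (id_func (on0 P G)) x)"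
    by (simp add: id_nat_def category.iso_idn[OF two_functorD(1)[OF P G]])
next
  fix G H and f :: "('u, 'u, 'u, 'u) func" and x
  assume h: "G \<in> \<G>" "H \<in> \<G>" "is_functor G H f" and x: "x \<in> obj (on0 P G)"
  interpret PH: category "on0 P H" by (rule two_functorD(1)[OF P h(2)])
  note p = two_functorD(2)[OF P h]
  note px = functor_simps(1)[OF p x] and tx = functor_simps(1)[OF t[OF h(1)] x]
  have st_x: "fobj (at0 s G) (fobj (at0 t G) x) = x" if "G \<in> \<G>" "x \<in> obj (on0 P G)" for G x
    using arg_cong[OF st[OF that(1)], of "\<lambda>F. fobj F x"] that(2) by simp
  have t1_x: "fobj (on1 Q G H f) (fobj (at0 t G) x) = fobj (at0 t H) (fobj (on1 P G H f) x)"
    using arg_cong[OF t1[OF h], of "\<lambda>F. fobj F x"] x by simp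
  have "at1 (comp_pseudonat P P s t) G H f x = idn (on0 P H) (fobj (on1 P G H f) x)"
    using x tx px st_x[OF h(1) x] st_x[OF h(2) px] functor_simps(1)[OF t[OF h(2)] px]
      functor_simps(5)[OF s[OF h(2)], of "fobj (at0 t H) (fobj (on1 P G H f) x)"]
    by (simp add: comp_pseudonat_def at1_s at1_t id_nat_def t1_x)
  then show "at1 (id_pseudonat P) G H f x \<cdot>\<^bsub>on0 P H\<^esub>
      farr (on1 P G H f) (id_nat (on0 P G) (on0 P G) (id_func (on0 P G)) x)
    = id_nat (on0 P H) (on0 P H) (id_func (on0 P H)) (fobj (on1 P G H f) x) \<cdot>\<^bsub>on0 P H\<^esub>
      at1 (comp_pseudonat P P s t) G H f x"
    using x px functor_simps(5)[OF p x] by (simp add: id_pseudonat_def id_nat_def)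
qed

text \<open>If the components of a strict transformation are isomorphisms of categories, then their
  inverses again form a strict transformation, and both composites are identities.\<close>

lemma strict_equivalence:
  fixes P :: "('u, 'o, 'm) two_functor" and Q :: "('u, 'p, 'n) two_functor"
    and v :: "('u, 'u) cat \<Rightarrow> ('p, 'n, 'o, 'm) func"
  assumes P: "is_two_functor \<G> P" and Q: "is_two_functor \<G> Q"
    and t: "\<And>G. G \<in> \<G> \<Longrightarrow> is_functor (on0 P G) (on0 Q G) (at0 t G)"
    and at1: "\<And>G H f. at1 t G H f = id_nat (on0 P G) (on0 Q H) (comp_func (on0 P G) (on1 Q G H f) (at0 t G))"
    and t1: "\<And>G H (f :: ('u, 'u, 'u, 'u) func). \<lbrakk>G \<in> \<G>; H \<in> \<G>; is_functor G H f\<rbrakk> \<Longrightarrow>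
      comp_func (on0 P G) (on1 Q G H f) (at0 t G) = comp_func (on0 P G) (at0 t H) (on1 P G H f)"
    and t2: "\<And>G H (f :: ('u, 'u, 'u, 'u) func) (f' :: ('u, 'u, 'u, 'u) func) \<alpha> x. \<lbrakk>G \<in> \<G>; H \<in> \<G>; is_nat G H f f' \<alpha>; x \<in> obj (on0 P G)\<rbrakk> \<Longrightarrow>
      on2 Q G H f f' \<alpha> (fobj (at0 t G) x) = farr (at0 t H) (on2 P G H f f' \<alpha> x)"
    and v: "\<And>G. G \<in> \<G> \<Longrightarrow> is_functor (on0 Q G) (on0 P G) (v G)"
    and vt: "\<And>G. G \<in> \<G> \<Longrightarrow> comp_func (on0 P G) (v G) (at0 t G) = id_func (on0 P G)"
    and tv: "\<And>G. G \<in> \<G> \<Longrightarrow> comp_func (on0 Q G) (at0 t G) (v G) = id_func (on0 Q G)"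
  shows "is_equivalence \<G> P Q t"
proof -
  define s where "s = \<lparr>at0 = v,
    at1 = \<lambda>G H f. id_nat (on0 Q G) (on0 P H) (comp_func (on0 Q G) (on1 P G H f) (v G))\<rparr>"
  have s: "at0 s G = v G" "at1 s G H f = id_nat (on0 Q G) (on0 P H) (comp_func (on0 Q G) (on1 P G H f) (v G))"
    for G H f by (simp_all add: s_def)
  have vt_x: "fobj (v G) (fobj (at0 t G) x) = x" if "G \<in> \<G>" "x \<in> obj (on0 P G)" for G x
    using arg_cong[OF vt[OF that(1)], of "\<lambda>F. fobj F x"] that(2) by simp
  have vt_f: "farr (v G) (farr (at0 t G) x) = x" if "G \<in> \<G>" "x \<in> arr (on0 P G)" for G x
    using arg_cong[OF vt[OF that(1)], of "\<lambda>F. farr F x"] that(2) by simp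
  have tv_x: "fobj (at0 t G) (fobj (v G) x) = x" if "G \<in> \<G>" "x \<in> obj (on0 Q G)" for G x
    using arg_cong[OF tv[OF that(1)], of "\<lambda>F. fobj F x"] that(2) by simp
  have tv_f: "farr (at0 t G) (farr (v G) x) = x" if "G \<in> \<G>" "x \<in> arr (on0 Q G)" for G x
    using arg_cong[OF tv[OF that(1)], of "\<lambda>F. farr F x"] that(2) by simp
  have t1_x: "fobj (on1 Q G H f) (fobj (at0 t G) x) = fobj (at0 t H) (fobj (on1 P G H f) x)"
    if "G \<in> \<G>" "H \<in> \<G>" "is_functor G H f" "x \<in> obj (on0 P G)"
    for G H x and f :: "('u, 'u, 'u, 'u) func"
    using arg_cong[OF t1[OF that(1-3)], of "\<lambda>F. fobj F x"] that(4) by simp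
  have t1_f: "farr (on1 Q G H f) (farr (at0 t G) x) = farr (at0 t H) (farr (on1 P G H f) x)"
    if "G \<in> \<G>" "H \<in> \<G>" "is_functor G H f" "x \<in> arr (on0 P G)"
    for G H x and f :: "('u, 'u, 'u, 'u) func"
    using arg_cong[OF t1[OF that(1-3)], of "\<lambda>F. farr F x"] that(4) by simp
  have s1: "comp_func (on0 Q G) (on1 P G H f) (at0 s G) = comp_func (on0 Q G) (at0 s H) (on1 Q G H f)"
    if h: "G \<in> \<G>" "H \<in> \<G>" "is_functor G H f" for G H and f :: "('u, 'u, 'u, 'u) func"
    unfolding s(1)
  proof -
    note p = two_functorD(2)[OF P h] and q = two_functorD(2)[OF Q h]
    show "comp_func (on0 Q G) (on1 P G H f) (v G) = comp_func (on0 Q G) (v H) (on1 Q G H f)"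
    proof (rule functor_ext[OF comp_functor[OF v[OF h(1)] p] comp_functor[OF q v[OF h(2)]]])
      fix x assume x: "x \<in> obj (on0 Q G)"
      note vx = functor_simps(1)[OF v[OF h(1)] x]
      show "fobj (comp_func (on0 Q G) (on1 P G H f) (v G)) x = fobj (comp_func (on0 Q G) (v H) (on1 Q G H f)) x"
        using t1_x[OF h vx] vt_x[OF h(2) functor_simps(1)[OF p vx]] by (simp add: x tv_x[OF h(1) x])
    next
      fix x assume x: "x \<in> arr (on0 Q G)"
      note vx = functor_simps(2)[OF v[OF h(1)] x]
      show "farr (comp_func (on0 Q G) (on1 P G H f) (v G)) x = farr (comp_func (on0 Q G) (v H) (on1 Q G H f)) x"
        using t1_f[OF h vx] vt_f[OF h(2) functor_simps(2)[OF p vx]] by (simp add: x tv_f[OF h(1) x])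
    qed
  qed
  have "is_pseudonat \<G> Q P s"
  proof (rule strict_pseudonat[OF Q P _ s(2)[folded s(1)] s1])
    fix G H and f f' :: "('u, 'u, 'u, 'u) func" and \<alpha> x
    assume h: "G \<in> \<G>" "H \<in> \<G>" "is_nat G H f f' \<alpha>" and x: "x \<in> obj (on0 Q G)"
    note vx = functor_simps(1)[OF v[OF h(1)] x]
    show "on2 P G H f f' \<alpha> (fobj (at0 s G) x) = farr (at0 s H) (on2 Q G H f f' \<alpha> x)"
      using t2[OF h vx] vt_f[OF h(2) nat_simps(1)[OF two_functorD(5)[OF P h] vx]] by (simp add: s tv_x[OF h(1) x])
  qed (simp_all add: s v)
  moreover note strict_pseudonat[OF P Q t at1 t1 t2]
    strict_inverse_modification[OF P Q t v[folded s(1)] vt[folded s(1)] at1 s(2)[folded s(1)] t1]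
    strict_inverse_modification[OF Q P v[folded s(1)] t tv[folded s(1)] s(2)[folded s(1)] at1 s1]
  ultimately show ?thesis unfolding is_equivalence_def using P Q by blast
qed


section \<open>The equivalence of fundamental groupoids\<close>

lemma finite_subset_small_groupoids:
  assumes "universe TYPE('u)"
  shows "(finite_groupoids :: ('u, 'u) cat set) \<subseteq> small_groupoids"
  using finite_small[OF assms]
  by (auto simp: finite_groupoids_def small_groupoids_def small_category_def groupoid_def)

text \<open>For each \<open>G\<close> the forgetful functor induces an isomorphism of categories, and these isomorphisms
  commute strictly with restriction, since both sides evaluate \<open>F\<close> on restricted actions and then
  forget.\<close>

lemma pi1_forgetful_equivalence:
  fixes A :: "('o, 'm) smc" and \<G> :: "('u, 'u) cat set"
  assumes U: "universe TYPE('u)" and A: "smc A" and cocomp: "cocomplete TYPE('u) A"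
    and \<G>: "\<G> \<subseteq> small_groupoids"
  shows "is_equivalence \<G> (pi1 (Cog A)) (pi1 A) (pi1_forgetful A)"
proof -
  interpret A: smc A by (rule A)
  interpret C: tensor_category "Cog A" by (rule A.tensor_category_Cog)
  interpret AT: tensor_category A by (rule A.is_tensor_category)
  let ?S = "set_smc :: ('u set, 'u set_arr) smc"
  define p where "p G = Fun_p G ?S set_p" for G :: "('u, 'u) cat"
  define q where "q G = Fun_q G ?S set_q" for G :: "('u, 'u) cat"
  define dia where "dia G = Fun_dia G ?S set_dia" for G :: "('u, 'u) cat"
  define bang where "bang G = Fun_bang G ?S set_bang" for G :: "('u, 'u) cat"
  have cart: "cartesian (GSet G) (p G) (q G) (dia G) (bang G)" if "category G" for G :: "('u, 'u) cat"
    unfolding GSet_def p_def q_def dia_def bang_def by (rule cartesian_Fun[OF cartesian_set[OF U] that])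
  have comparison: "coalgebra_comparison (GSet G) (p G) (q G) (dia G) (bang G) A TYPE('u)"
    if "category G" for G :: "('u, 'u) cat"
    using cart[OF that] A cocomp by (simp add: coalgebra_comparison_def coalgebra_comparison_axioms_def)
  have valued: "coalgebra_valued (GSet G) (p G) (q G) (dia G) (bang G) A F"
    if "category G" "sm_functor (GSet G) (Cog A) F" for G :: "('u, 'u) cat" and F
    using cart[OF that(1)] A that(2) by (simp add: coalgebra_valued_def coalgebra_valued_axioms_def)
  have cat: "category G" "small_category G" if "G \<in> \<G>" for G
    using that \<G> by (auto simp: small_groupoids_def small_category_def)
  let ?U = "\<lambda>(G :: ('u, 'u) cat) F. comp_smfun (GSet G) A (forgetful A) F"
  have U_pull: "?U H (pull G H (Cog A) f F) = pull G H A f (?U G F)"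
    if f: "is_functor G H f" and F: "sm_functor (GSet G) (Cog A) F" for G H :: "('u, 'u) cat" and f F
  proof -
    note cG = functor_cats(1)[OF f] and cH = functor_cats(2)[OF f]
    interpret F: coalgebra_valued "GSet G" "p G" "q G" "dia G" "bang G" A F by (rule valued[OF cG F])
    interpret PF: coalgebra_valued "GSet H" "p H" "q H" "dia H" "bang H" A "pull G H (Cog A) f F"
      by (rule valued[OF cH pull_sm_functor[OF U f F]])
    have c: "comp_func G X f \<in> obj (GSet G)" if "X \<in> obj (GSet H)" for X
      using that comp_functor[OF f] by (simp add: GSet_simps)
    show ?thesis
      by (rule smfun_ext[OF PF.UH_sm_functor pull_sm_functor[OF U f F.UH_sm_functor]])
        (simp_all add: pull_simps[OF U f F] pull_simps[OF U f F.UH_sm_functor] c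
          functor_simps(2)[OF restriction_functor[OF f]])
  qed
  show ?thesis
  proof (rule strict_equivalence[where v = "\<lambda>G. lift_hom TYPE('u) (GSet G) (dia G) (bang G) A"])
    show "is_two_functor \<G> (pi1 (Cog A))" by (rule C.two_functor_pi1[OF U \<G>])
    show "is_two_functor \<G> (pi1 A)" by (rule AT.two_functor_pi1[OF U \<G>])
  next
    fix G assume "G \<in> \<G>"
    then interpret X: coalgebra_comparison "GSet G" "p G" "q G" "dia G" "bang G" A "TYPE('u)"
      by (intro comparison cat)
    show "is_functor (on0 (pi1 (Cog A)) G) (on0 (pi1 A) G) (at0 (pi1_forgetful A) G)"
      using X.T_functor by (simp add: pi1_forgetful_def)
    show "is_functor (on0 (pi1 A) G) (on0 (pi1 (Cog A)) G) (lift_hom TYPE('u) (GSet G) (dia G) (bang G) A)"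
      using X.V_functor by simp
    show "comp_func (on0 (pi1 (Cog A)) G) (lift_hom TYPE('u) (GSet G) (dia G) (bang G) A) (at0 (pi1_forgetful A) G)
      = id_func (on0 (pi1 (Cog A)) G)"
      using X.V_T by (simp add: pi1_forgetful_def)
    show "comp_func (on0 (pi1 A) G) (at0 (pi1_forgetful A) G) (lift_hom TYPE('u) (GSet G) (dia G) (bang G) A)
      = id_func (on0 (pi1 A) G)"
      using X.T_V by (simp add: pi1_forgetful_def)
  next
    fix G H and f :: "('u, 'u, 'u, 'u) func"
    assume h: "G \<in> \<G>" "H \<in> \<G>" and f: "is_functor G H f"
    interpret XG: coalgebra_comparison "GSet G" "p G" "q G" "dia G" "bang G" A "TYPE('u)"
      by (intro comparison cat h)
    interpret XH: coalgebra_comparison "GSet H" "p H" "q H" "dia H" "bang H" A "TYPE('u)"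
      by (intro comparison cat h)
    note RC = C.on1_functor[OF U f cat(2)[OF h(1)] cat(2)[OF h(2)]]
    note RA = AT.on1_functor[OF U f cat(2)[OF h(1)] cat(2)[OF h(2)]]
    let ?RC = "precompose TYPE('u) (GSet H) (GSet G) (Cog A) (restriction G H f)"
    let ?RA = "precompose TYPE('u) (GSet H) (GSet G) A (restriction G H f)"
    have "comp_func XG.P ?RA XG.T = comp_func XG.P XH.T ?RC"
    proof (rule functor_ext[OF comp_functor[OF XG.T_functor RA] comp_functor[OF RC XH.T_functor]])
      fix F assume F: "F \<in> obj XG.P"
      note TF = functor_simps(1)[OF XG.T_functor F] and RF = functor_simps(1)[OF RC F]
      have "fobj ?RA (fobj XG.T F) = pull G H A f (?U G F)"
        using AT.on1_obj[OF TF] by (simp only: XG.T_obj[OF F])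
      also have "\<dots> = fobj XH.T (fobj ?RC F)"
        using XH.T_obj[OF RF] U_pull[OF f, of F] F by (simp add: C.on1_obj[OF F])
      finally show "fobj (comp_func XG.P ?RA XG.T) F = fobj (comp_func XG.P XH.T ?RC) F"
        by (simp only: comp_func_simps(1)[OF F])
    next
      fix t assume t: "t \<in> arr XG.P"
      then obtain F s F' where s: "t = (F, s, F')" and F: "sm_functor (GSet G) (Cog A) F"
        and F': "sm_functor (GSet G) (Cog A) F'"
        by (auto elim: com2ring_arrE)
      note TF = functor_simps(2)[OF XG.T_functor t] and RF = functor_simps(2)[OF RC t]
      have c: "comp_func G X f \<in> obj (GSet G)" if "X \<in> obj (GSet H)" for X
        using that comp_functor[OF f] by (simp add: GSet_simps)
      have "farr ?RA (farr XG.T t) = (pull G H A f (?U G F),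
          \<lambda>X\<in>obj (GSet H). und (s (comp_func G X f)), pull G H A f (?U G F'))"
        using AT.on1_arr[OF TF[unfolded s XG.T_arr[OF t[unfolded s]]], of H f] c
        by (auto simp: s XG.T_arr[OF t[unfolded s]] intro!: restrict_ext)
      also have "\<dots> = farr XH.T (farr ?RC t)"
        using XH.T_arr[OF RF[unfolded s C.on1_arr[OF t[unfolded s]]]] c
        by (auto simp: s C.on1_arr[OF t[unfolded s]] U_pull[OF f F] U_pull[OF f F'] intro!: restrict_ext)
      finally show "farr (comp_func XG.P ?RA XG.T) t = farr (comp_func XG.P XH.T ?RC) t"
        by (simp only: comp_func_simps(2)[OF t])
    qed
    then show "comp_func (on0 (pi1 (Cog A)) G) (on1 (pi1 A) G H f) (at0 (pi1_forgetful A) G)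
      = comp_func (on0 (pi1 (Cog A)) G) (at0 (pi1_forgetful A) H) (on1 (pi1 (Cog A)) G H f)"
      by (simp add: pi1_forgetful_def)
  next
    fix G H and f f' :: "('u, 'u, 'u, 'u) func" and \<alpha> F
    assume h: "G \<in> \<G>" "H \<in> \<G>" and \<alpha>: "is_nat G H f f' \<alpha>" and "F \<in> obj (on0 (pi1 (Cog A)) G)"
    then have F: "F \<in> obj (com2ring_hom TYPE('u) (GSet G) (Cog A))" and Fs: "sm_functor (GSet G) (Cog A) F" by auto
    interpret XG: coalgebra_comparison "GSet G" "p G" "q G" "dia G" "bang G" A "TYPE('u)"
      by (intro comparison cat h)
    interpret XH: coalgebra_comparison "GSet H" "p H" "q H" "dia H" "bang H" A "TYPE('u)"
      by (intro comparison cat h)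
    interpret F: coalgebra_valued "GSet G" "p G" "q G" "dia G" "bang G" A F by (rule valued[OF cat(1)[OF h(1)] Fs])
    note f = natD(1)[OF \<alpha>] and f' = natD(2)[OF \<alpha>]
    have arr: "(pull G H (Cog A) f F, \<lambda>X\<in>obj (GSet H). farr F (whisker G f f' \<alpha> X), pull G H (Cog A) f' F) \<in> arr XH.P"
      using C.on2_monoidal_nat[OF U \<alpha> Fs] F pull_sm_functor[OF U f Fs] pull_sm_functor[OF U f' Fs]
        pull_cocontinuous[OF U f Fs] pull_cocontinuous[OF U f' Fs] cat(2)[OF h(1)] cat(2)[OF h(2)] by simp
    have TF: "fobj XG.T F \<in> obj XG.Q" by (rule functor_simps(1)[OF XG.T_functor F])
    have "on2 (pi1 A) G H f f' \<alpha> (fobj XG.T F) = (pull G H A f (?U G F),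
        \<lambda>X\<in>obj (GSet H). und (farr F (whisker G f f' \<alpha> X)), pull G H A f' (?U G F))"
      using pi1_on2[OF TF] whisker_hom(1)[OF \<alpha>] by (auto simp: XG.T_obj[OF F] intro!: restrict_ext)
    also have "\<dots> = farr XH.T (on2 (pi1 (Cog A)) G H f f' \<alpha> F)"
      using XH.T_arr[OF arr] by (auto simp: pi1_on2[OF F] U_pull[OF f Fs] U_pull[OF f' Fs] intro!: restrict_ext)
    finally show "on2 (pi1 A) G H f f' \<alpha> (fobj (at0 (pi1_forgetful A) G) F)
      = farr (at0 (pi1_forgetful A) H) (on2 (pi1 (Cog A)) G H f f' \<alpha> F)"
      by (simp add: pi1_forgetful_def)
  qed (simp add: pi1_forgetful_def)
qed

theorem corollary3p3p6:
  fixes A :: "('o, 'm) smc"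
  assumes "universe TYPE('u)"
    and "commutative_2_ring TYPE('u) A"
  shows "is_equivalence (small_groupoids :: ('u, 'u) cat set) (pi1 (Cog A)) (pi1 A) (pi1_forgetful A) \<and>
    is_equivalence (finite_groupoids :: ('u, 'u) cat set) (pi1 (Cog A)) (pi1 A) (pi1_forgetful A)"
proof -
  have "smc A" "cocomplete TYPE('u) A"
    using assms(2) by (auto simp: commutative_2_ring_def presentable_def smc_def)
  then show ?thesis
    using pi1_forgetful_equivalence[OF assms(1)] finite_subset_small_groupoids[OF assms(1)] by blast
qed

end
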